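(* For Lebesgue-almost every $\vec\ell=(\ell_1,\ell_2,\ell_3)\in\mathbb{R}_+^3$, the 3-interval exchange transformation $T$ of $[0,|\vec\ell|)$, $|\vec\ell|=\ell_1+\ell_2+\ell_3$, with length vector $\vec\ell$ and permutation $\begin{pmatrix}1&2&3\\3&2&1\end{pmatrix}$ satisfies Möbius disjointness: for every $x\in[0,|\vec\ell|)$ and every continuous $f:[0,|\vec\ell|]\to\mathbb{R}$, $$\lim_{N\to\infty}\frac1N\sum_{n=0}^{N-1}f(T^nx)\mu(n)=0.$$
   Context: $\mu$ is the Möbius function: $\mu(n)=0$ if $n$ is not square-free, and for square-free $n$, $\mu(n)=1$ or $-1$ according to whether $n$ has an even or odd number of prime factors; set $\mu(0)=0$. The interval exchange transformation with lengths $\ell_1,\dots,\ell_d$ and permutation $\pi$ acts on $[0,\sum_i\ell_i)$, divided into consecutive half-open intervals $I_1,\dots,I_d$ of lengths $\ell_1,\dots,\ell_d$, by $T(x)=x-\sum_{k<j}\ell_k+\sum_{\pi(k)<\pi(j)}\ell_k$ for $x\in I_j$. *)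

theory Defs
  imports "HOL-Analysis.Analysis" "HOL-Computational_Algebra.Squarefree"
begin

(* There is no separate case for 0, which is not squarefree. *)
definition moebius_mu :: "nat \<Rightarrow> int" where
  "moebius_mu n = (if squarefree n then (- 1) ^ card (prime_factors n) else 0)"

definition iet_interval :: "(nat \<Rightarrow> real) \<Rightarrow> nat \<Rightarrow> real set" where
  "iet_interval l j = {(\<Sum>k\<in>{1..<j}. l k)..<(\<Sum>k\<in>{1..j}. l k)}"

(* Lengths and permutation are functions on nat of which only the values on {1..d} matter.
   For nonnegative lengths the index j exists and is unique exactly when x lies in
   [0, l 1 + ... + l d); if p permutes {1..d}, this interval is mapped to itself. Values of iet
   outside this interval are meaningless. *)
definition iet :: "nat \<Rightarrow> (nat \<Rightarrow> real) \<Rightarrow> (nat \<Rightarrow> nat) \<Rightarrow> real \<Rightarrow> real" where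
  "iet d l p x =
     (let j = (THE j. j \<in> {1..d} \<and> x \<in> iet_interval l j)
      in x - (\<Sum>k\<in>{1..<j}. l k) + (\<Sum>k | k \<in> {1..d} \<and> p k < p j. l k))"

end

theory Submission
  imports
    Defs
    "HOL-Analysis.Kronecker_Approximation_Theorem"
    "HOL-Complex_Analysis.Complex_Analysis"
    "HOL-Library.Diagonal_Subsequence"
    "HOL-Real_Asymp.Real_Asymp"
begin

text \<open>
  Up to scaling, the exchange of three intervals is the map that the rotation by \<open>a\<close> of the circle of length
  \<open>1\<close> induces on an arc of length \<open>b\<close>. By Katai's criterion it suffices that for \<open>0 < r < s\<close> and \<open>f\<close> of mean \<open>0\<close>
  the averages of \<open>f (T^(r n) x) f (T^(s n) x)\<close> tend to \<open>0\<close>; constants are handled by the prime number theorem in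
  the form that \<open>\<mu>\<close> has mean \<open>0\<close>, which follows from the non-vanishing of \<open>\<zeta>\<close> on the line \<open>Re s = 1\<close> by a
  Tauberian argument with the Fejer kernel.

  For almost all length vectors there are infinitely many \<open>q\<close> such that \<open>\<delta> = q (q a - P)\<close> is small and positive while
  the fractional part \<open>\<theta>\<close> of \<open>q b\<close> is in the middle of the unit interval. A block of \<open>q\<close> rotation steps then moves
  points by \<open>\<delta> / q\<close>, and for most points it visits the arc \<open>k\<close> or \<open>k + 1\<close> times, where \<open>k = \<lfloor>q b\<rfloor>\<close>.
  Hence on functions of mean \<open>0\<close> the power \<open>T^(m k)\<close> is weakly close to \<open>(1 - \<theta> - m \<delta>) + (\<theta> - m \<delta>) T^(-m)\<close>. Let \<open>A i\<close> be a limit of the averages of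
  \<open>f (T^(r (n + i)) x) f (T^(s n) x)\<close> along a subsequence. Shifting \<open>i\<close> by \<open>n k\<close> can be read as \<open>T^(r n k)\<close> acting on the
  first factor or as \<open>T^(-s n k)\<close> acting on the second one, and the difference of the two weak limits is
  \<open>(s - r) n \<delta> (A i + A (i - n))\<close>. So \<open>A i + A (i - n)\<close> tends to \<open>0\<close> for \<open>n\<close> and for \<open>n + 1\<close>, which makes \<open>A\<close>
  constant and therefore zero.
\<close>

section \<open>Katai's orthogonality criterion\<close>

text \<open>The two weights of the weak limit add up to only \<open>1 - 2 * m * \<delta>\<close>.
  The missing mass belongs to points whose position relative to the cells of width
  \<open>1 / q\<close> crosses a boundary during the \<open>m\<close> blocks. From one block
  translate to the next the power of \<open>T\<close> acting on such points shifts by one, so a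
  function of mean \<open>0\<close> averages out there by the ergodic theorem. This loss drives the
  argument: an exact period would give the same limit for both readings. Since \<open>n\<close> is
  of order \<open>1 / \<delta>\<close>, the total drift \<open>n * \<delta>\<close> stays near a
  fixed \<tau> while \<delta> tends to 0, so the two readings differ by a fixed multiple. Keeping
  \<theta> between 1/3 and 2/3 leaves room for both arcs once the crossing points are removed. A
  weak limit says nothing about a single orbit. The bridge is a bound in mean square for the
  functional that sends \<open>v\<close> to the limit of its weighted averages along the orbit of
  \<open>x\<close>; such a functional tends to 0 along weakly null families. All means are orbit
  averages uniform in the starting point, which is why no exceptional \<open>x\<close>
  arises.\<close>

abbreviation mu :: "nat \<Rightarrow> real" where "mu n \<equiv> real_of_int (moebius_mu n)"

lemma abs_mu_le: "\<bar>mu n\<bar> \<le> 1"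
  by (simp add: moebius_mu_def power_abs)

lemma mu_0 [simp]: "mu 0 = 0" and mu_1 [simp]: "mu (Suc 0) = 1"
  by (simp_all add: moebius_mu_def)

lemma mu_prime_mult:
  assumes p: "prime p" shows "mu (p * m) = (if p dvd m then 0 else - mu m)"
proof (cases "p dvd m")
  case True
  then have "p\<^sup>2 dvd p * m" by (simp add: power2_eq_square)
  moreover have "\<not> p dvd 1" using p by (simp add: prime_nat_iff)
  ultimately have "\<not> squarefree (p * m)" unfolding squarefree_def by blast
  then show ?thesis using True by (simp add: moebius_mu_def)
next
  case False
  then have m: "m \<noteq> 0" by (metis dvd_0_right)
  have co: "coprime p m" using False p by (simp add: prime_imp_coprime)
  have sq: "squarefree (p * m) \<longleftrightarrow> squarefree m"
    using squarefree_mult_coprime[OF co] squarefree_prime[OF p] squarefree_multD(2) by blast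
  have "prime_factors (p * m) = insert p (prime_factors m)"
    using p m by (subst prime_factors_product) (auto simp: prime_factorization_prime prime_gt_0_nat)
  moreover have "p \<notin> prime_factors m" using False by (simp add: in_prime_factors_iff)
  ultimately have "card (prime_factors (p * m)) = Suc (card (prime_factors m))" by simp
  then show ?thesis using False sq by (simp add: moebius_mu_def)
qed

lemma card_multiples:
  assumes "0 < d"
  shows "\<bar>real (card {n. n < N \<and> d dvd n}) - real N / real d\<bar> \<le> 1"
proof -
  have "{n. n < N \<and> d dvd n} = (\<lambda>k. d * k) ` {..<(N + d - 1) div d}"
  proof (intro set_eqI iffI)
    fix n assume "n \<in> {n. n < N \<and> d dvd n}"
    then obtain k where k: "n = d * k" "d * k < N" by auto
    have "k < (N + d - 1) div d"
    proof -
      have "d * (k + 1) \<le> N + d - 1" using k(2) by simp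
      then have "k + 1 \<le> (N + d - 1) div d" using assms by (simp add: less_eq_div_iff_mult_less_eq mult.commute)
      then show ?thesis by simp
    qed
    then show "n \<in> (\<lambda>k. d * k) ` {..<(N + d - 1) div d}" using k by auto
  next
    fix n assume "n \<in> (\<lambda>k. d * k) ` {..<(N + d - 1) div d}"
    then obtain k where k: "n = d * k" "k < (N + d - 1) div d" by blast
    then have k: "n = d * k" "k + 1 \<le> (N + d - 1) div d" by simp_all
    have "d * (k + 1) \<le> N + d - 1" using k(2) assms by (simp add: less_eq_div_iff_mult_less_eq mult.commute)
    then show "n \<in> {n. n < N \<and> d dvd n}" using k assms by simp
  qed
  then have c: "card {n. n < N \<and> d dvd n} = (N + d - 1) div d"
    using assms by (simp add: card_image inj_on_def)
  define K where "K = (N + d - 1) div d"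
  have "K * d \<le> N + d - 1" "N + d - 1 < (K + 1) * d"
    using assms dividend_less_div_times[of d "N + d - 1"] by (simp_all add: K_def algebra_simps)
  then have "K * d \<le> N + d" "N \<le> K * d" using assms by (simp_all add: algebra_simps)
  then have 1: "real K * real d \<le> real N + real d" "real N \<le> real K * real d"
    by (simp_all flip: of_nat_mult of_nat_add)
  have 2: "(real N / real d + 1) * real d = real N + real d" "real N / real d * real d = real N"
    using assms by (simp_all add: distrib_right)
  have d: "0 < real d" using assms by simp
  have "real K * real d \<le> (real N / real d + 1) * real d" "real N / real d * real d \<le> real K * real d"
    unfolding 2 by (rule 1)+
  then have "real K \<le> real N / real d + 1" "real N / real d \<le> real K"
    using d by (simp_all only: mult_le_cancel_right_pos)
  then show ?thesis unfolding c K_def[symmetric] by linarith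
qed

lemma average_bound:
  fixes h :: "nat \<Rightarrow> real"
  assumes "(\<lambda>K. h K / real K) \<longlonglongrightarrow> 0" "e > 0"
  obtains C where "C \<ge> 0" "\<And>K. \<bar>h K\<bar> \<le> e * real K + C"
proof -
  have "\<forall>\<^sub>F K in sequentially. \<bar>h K / real K\<bar> < e"
    using assms unfolding tendsto_iff dist_real_def by simp
  then obtain K0 where K0: "\<And>K. K \<ge> K0 \<Longrightarrow> \<bar>h K / real K\<bar> < e" by (auto simp: eventually_sequentially)
  define C where "C = (\<Sum>k\<le>K0. \<bar>h k\<bar>)"
  have C0: "C \<ge> 0" by (simp add: C_def sum_nonneg)
  show thesis
  proof (rule that[OF C0])
    fix K
    show "\<bar>h K\<bar> \<le> e * real K + C"
    proof (cases "K \<le> K0")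
      case True
      then have "\<bar>h K\<bar> \<le> C" unfolding C_def by (intro member_le_sum) auto
      moreover have "0 \<le> e * real K" using assms by simp
      ultimately show ?thesis by linarith
    next
      case False
      then have "\<bar>h K\<bar> < e * real K" using K0[of K] by (simp add: abs_divide pos_divide_less_eq)
      then show ?thesis using C0 by linarith
    qed
  qed
qed

definition omega_in :: "nat set \<Rightarrow> nat \<Rightarrow> real" where
  "omega_in S n = (\<Sum>p\<in>S. of_bool (p dvd n))"

lemma sum_of_bool_multiples:
  fixes N d :: nat shows "(\<Sum>n<N. of_bool (d dvd n)) = real (card {n. n < N \<and> d dvd n})"
  by (subst sum_of_bool_eq) (auto intro!: arg_cong[where f = card])

text \<open>Variance bound by expanding the square. Divisibility by two distinct primes of
  \<open>S\<close> is independent up to an error of 1 per pair, so the terms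
  \<open>N * A * A\<close> cancel and only the diagonal, of size \<open>N * A\<close>, and errors
  free of \<open>N\<close> remain. Thus \<open>omega_in S n\<close> is close to \<open>A\<close> for
  most \<open>n\<close>.\<close>

lemma turan_kubilius:
  fixes S :: "nat set"
  assumes S: "finite S" "\<And>p. p \<in> S \<Longrightarrow> prime p"
  defines "A \<equiv> \<Sum>p\<in>S. 1 / real p"
  shows "(\<Sum>n<N. (omega_in S n - A)\<^sup>2) \<le> real N * A + (real (card S))\<^sup>2 + 2 * A * real (card S)"
proof -
  have p0: "0 < p" if "p \<in> S" for p using S(2)[OF that] prime_gt_0_nat by blast
  have A0: "A \<ge> 0" by (simp add: A_def sum_nonneg)
  have lin: "(\<Sum>n<N. omega_in S n) \<ge> real N * A - real (card S)"
  proof -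
    have "(\<Sum>n<N. omega_in S n) = (\<Sum>p\<in>S. real (card {n. n < N \<and> p dvd n}))"
      unfolding omega_in_def by (subst sum.swap) (simp add: sum_of_bool_multiples)
    also have "\<dots> \<ge> (\<Sum>p\<in>S. real N / real p - 1)"
    proof (rule sum_mono)
      fix p assume "p \<in> S"
      then show "real N / real p - 1 \<le> real (card {n. n < N \<and> p dvd n})" using card_multiples[OF p0, of p N] by linarith
    qed
    also have "(\<Sum>p\<in>S. real N / real p - 1) = real N * A - real (card S)"
      by (simp add: sum_subtractf A_def sum_distrib_left)
    finally show ?thesis .
  qed
  have pair: "(\<Sum>n<N. of_bool (p dvd n) * of_bool (q dvd n)) \<le> real N * (1 / real p) * (1 / real q) + 1 + of_bool (p = q) * (real N / real p)"
    if pq: "p \<in> S" "q \<in> S" for p q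
  proof (cases "p = q")
    case True
    have "(\<Sum>n<N. of_bool (p dvd n) * of_bool (q dvd n)) = (\<Sum>n<N. of_bool (p dvd n) :: real)"
      using True by (intro sum.cong) auto
    also have "\<dots> \<le> real N / real p + 1" using card_multiples[OF p0[OF pq(1)], of N] by (simp add: sum_of_bool_multiples)
    also have "\<dots> \<le> real N * (1 / real p) * (1 / real q) + 1 + real N / real p" by simp
    finally show ?thesis using True by simp
  next
    case False
    have co: "coprime p q" using primes_coprime[OF S(2)[OF pq(1)] S(2)[OF pq(2)] False] .
    have "(\<Sum>n<N. of_bool (p dvd n) * of_bool (q dvd n)) = (\<Sum>n<N. of_bool (p * q dvd n) :: real)"
    proof (intro sum.cong refl)
      fix n
      have iff: "p * q dvd n \<longleftrightarrow> p dvd n \<and> q dvd n" using divides_mult[OF _ _ co, of n] dvd_mult_left[of p q n] dvd_mult_right[of p q n] by (intro iffI conjI) simp_all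
      show "of_bool (p dvd n) * of_bool (q dvd n) = (of_bool (p * q dvd n) :: real)" unfolding iff of_bool_conj ..
    qed
    also have "\<dots> \<le> real N / real (p * q) + 1" using card_multiples[of "p * q" N] p0 pq by (simp add: sum_of_bool_multiples)
    finally show ?thesis using False by simp
  qed
  have "(\<Sum>n<N. (omega_in S n)\<^sup>2) = (\<Sum>n<N. \<Sum>p\<in>S. \<Sum>q\<in>S. of_bool (p dvd n) * of_bool (q dvd n))"
    unfolding omega_in_def power2_eq_square sum_product ..
  also have "\<dots> = (\<Sum>p\<in>S. \<Sum>q\<in>S. \<Sum>n<N. of_bool (p dvd n) * of_bool (q dvd n))"
    by (rule trans[OF sum.swap]) (intro sum.cong refl sum.swap)
  also have "\<dots> \<le> (\<Sum>p\<in>S. \<Sum>q\<in>S. real N * (1 / real p) * (1 / real q) + 1 + of_bool (p = q) * (real N / real p))"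
    by (intro sum_mono pair)
  also have "\<dots> = (\<Sum>p\<in>S. \<Sum>q\<in>S. real N * (1 / real p) * (1 / real q)) + (real (card S))\<^sup>2 + (\<Sum>p\<in>S. \<Sum>q\<in>S. of_bool (p = q) * (real N / real p))"
    by (simp add: sum.distrib power2_eq_square)
  also have "(\<Sum>p\<in>S. \<Sum>q\<in>S. real N * (1 / real p) * (1 / real q)) = real N * A * A"
  proof -
    have "(\<Sum>p\<in>S. \<Sum>q\<in>S. real N * (1 / real p) * (1 / real q)) = (\<Sum>p\<in>S. real N * (1 / real p)) * (\<Sum>q\<in>S. 1 / real q)"
      by (rule sum_product[symmetric])
    then show ?thesis by (simp only: A_def sum_distrib_left[symmetric])
  qed
  also have "(\<Sum>p\<in>S. \<Sum>q\<in>S. of_bool (p = q) * (real N / real p)) = (\<Sum>p\<in>S. real N / real p)"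
  proof (intro sum.cong refl)
    fix p assume p: "p \<in> S"
    have "(\<Sum>q\<in>S. of_bool (p = q) * (real N / real p)) = (\<Sum>q\<in>S. if p = q then real N / real p else 0)"
      by (intro sum.cong) auto
    then show "(\<Sum>q\<in>S. of_bool (p = q) * (real N / real p)) = real N / real p" using p S(1) by simp
  qed
  also have "(\<Sum>p\<in>S. real N / real p) = real N * A" by (simp add: A_def sum_distrib_left)
  finally have sq: "(\<Sum>n<N. (omega_in S n)\<^sup>2) \<le> real N * A * A + (real (card S))\<^sup>2 + real N * A" .
  have "(\<Sum>n<N. (omega_in S n - A)\<^sup>2) = (\<Sum>n<N. (omega_in S n)\<^sup>2) - 2 * A * (\<Sum>n<N. omega_in S n) + real N * A * A"
  proof -
    have "(omega_in S n - A)\<^sup>2 = (omega_in S n)\<^sup>2 - 2 * A * omega_in S n + A * A" for n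
      by (simp add: power2_eq_square algebra_simps)
    then show ?thesis by (simp add: sum.distrib sum_subtractf mult.assoc flip: sum_distrib_left)
  qed
  moreover have "2 * A * (\<Sum>n<N. omega_in S n) \<ge> 2 * A * (real N * A - real (card S))"
    using lin A0 by (intro mult_left_mono) auto
  moreover have "2 * A * (real N * A - real (card S)) = 2 * (real N * A * A) - 2 * A * real (card S)" by (simp add: algebra_simps)
  ultimately show ?thesis using sq by linarith
qed

text \<open>The index range on the right stays \<open>{..<N}\<close> for every \<open>p\<close>,
  with the cut-off in the indicator, so that sums over \<open>p\<close> and over \<open>m\<close>
  can be interchanged.\<close>

lemma sum_multiples:
  fixes h :: "nat \<Rightarrow> real" and N p :: nat
  assumes "0 < p"
  shows "(\<Sum>n<N. of_bool (p dvd n) * h n) = (\<Sum>m<N. of_bool (p * m < N) * h (p * m))"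
proof -
  have "(\<Sum>m<N. of_bool (p * m < N) * h (p * m)) = (\<Sum>m\<in>{m. m < N \<and> p * m < N}. h (p * m))"
    by (rule sum.mono_neutral_cong_right) auto
  also have "\<dots> = (\<Sum>n\<in>(\<lambda>m. p * m) ` {m. m < N \<and> p * m < N}. h n)"
    using assms by (subst sum.reindex) (auto simp: inj_on_def o_def)
  also have "(\<lambda>m. p * m) ` {m. m < N \<and> p * m < N} = {n. n < N \<and> p dvd n}"
  proof (intro set_eqI iffI)
    fix n assume "n \<in> {n. n < N \<and> p dvd n}"
    then obtain m where m: "n = p * m" "p * m < N" by auto
    have "1 * m \<le> p * m" using assms by (intro mult_right_mono) auto
    then have "m < N" using m(2) by linarith
    then show "n \<in> (\<lambda>m. p * m) ` {m. m < N \<and> p * m < N}" using m by blast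
  qed auto
  also have "(\<Sum>n\<in>{n. n < N \<and> p dvd n}. h n) = (\<Sum>n<N. of_bool (p dvd n) * h n)"
    by (rule sum.mono_neutral_cong_left) auto
  finally show ?thesis by simp
qed

text \<open>Turns a sum cut off by an indicator back into an initial segment, the form in which the
  correlation hypothesis bounds it.\<close>

lemma sum_initial_segment:
  fixes g :: "nat \<Rightarrow> real" and N r :: nat
  assumes "0 < r"
  obtains K where "K \<le> N" "(\<Sum>m<N. of_bool (r * m < N) * g m) = (\<Sum>m<K. g m)"
proof -
  define K where "K = (LEAST k. N \<le> r * k)"
  have rN: "N \<le> r * N" using mult_right_mono[of 1 r N] assms by simp
  then have KN: "K \<le> N" unfolding K_def by (rule Least_le)
  have K1: "N \<le> r * K" unfolding K_def using rN by (rule LeastI)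
  have iff: "r * m < N \<longleftrightarrow> m < K" for m
  proof
    assume "r * m < N"
    then have "r * m < r * K" using K1 by linarith
    then show "m < K" by simp
  next
    assume "m < K"
    then have "\<not> N \<le> r * m" unfolding K_def by (rule not_less_Least)
    then show "r * m < N" by simp
  qed
  have "(\<Sum>m<N. of_bool (r * m < N) * g m) = (\<Sum>m<K. g m)"
    using KN by (intro sum.mono_neutral_cong_right) (auto simp: iff)
  then show thesis using that KN by blast
qed

lemma sum_abs_le_sqrt:
  fixes g :: "nat \<Rightarrow> real"
  assumes "(\<Sum>n<N. (g n)\<^sup>2) \<le> real N * B" "0 \<le> B"
  shows "(\<Sum>n<N. \<bar>g n\<bar>) \<le> real N * sqrt B"
proof -
  have "(\<Sum>n<N. \<bar>g n\<bar> * 1)\<^sup>2 \<le> (\<Sum>n<N. \<bar>g n\<bar>\<^sup>2) * (\<Sum>n<N. 1\<^sup>2)"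
    by (rule Cauchy_Schwarz_ineq_sum)
  also have "\<dots> \<le> (real N * B) * real N" using assms by (simp add: mult_right_mono)
  also have "\<dots> = (real N * sqrt B)\<^sup>2" using assms(2) by (simp add: power_mult_distrib power2_eq_square)
  finally have "(\<Sum>n<N. \<bar>g n\<bar>)\<^sup>2 \<le> (real N * sqrt B)\<^sup>2" by simp
  then show ?thesis by (rule power2_le_imp_le) (use assms(2) in simp)
qed

text \<open>The factor \<open>A\<close> is replaced by \<open>omega_in S n\<close> at the cost of
  the variance bound. Then \<open>n = p * m\<close> and \<open>mu (p * m) = - mu m\<close> unless
  \<open>p\<close> divides \<open>m\<close>, so for each \<open>m\<close> the sum over
  \<open>p\<close> separates from \<open>mu m\<close>. Cauchy-Schwarz discards \<open>mu m\<close>,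
  and the square produces the correlations for distinct primes and a diagonal of size
  \<open>N * A\<close>. The outcome is of order \<open>sqrt A\<close> against the factor
  \<open>A\<close> on the left.\<close>

lemma katai_finite:
  fixes F :: "nat \<Rightarrow> real"
  assumes F: "\<And>n. \<bar>F n\<bar> \<le> 1"
    and corr: "\<And>p q. prime p \<Longrightarrow> prime q \<Longrightarrow> p \<noteq> q \<Longrightarrow> (\<lambda>N. (\<Sum>n<N. F (p * n) * F (q * n)) / real N) \<longlonglongrightarrow> 0"
    and S: "finite S" "\<And>p. p \<in> S \<Longrightarrow> prime p"
  defines "A \<equiv> \<Sum>p\<in>S. 1 / real p" and "Z \<equiv> \<Sum>n. 1 / (real (Suc n))\<^sup>2"
  shows "\<forall>\<^sub>F N in sequentially. A * \<bar>\<Sum>n<N. F n * mu n\<bar> \<le> real N * (2 * sqrt (A + 1) + Z + 1)"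
proof -
  have p0: "0 < p" if "p \<in> S" for p using S(2)[OF that] prime_gt_0_nat by blast
  have A0: "A \<ge> 0" by (simp add: A_def sum_nonneg)
  define k where "k = real (card S)"
  have k0: "k \<ge> 0" by (simp add: k_def)
  \<comment> \<open>The at most \<open>k\<^sup>2\<close> ordered pairs of distinct primes then
    contribute at most \<open>N / 2\<close> in total; the other half of \<open>N\<close> is left for
    the errors that do not grow with \<open>N\<close>.\<close>
  define e where "e = 1 / (2 * (k\<^sup>2 + 1))"
  have e: "e > 0" by (simp add: e_def add_nonneg_pos)
  have "\<forall>p q. \<exists>C. p \<in> S \<longrightarrow> q \<in> S \<longrightarrow> p \<noteq> q \<longrightarrow> C \<ge> 0 \<and> (\<forall>K. \<bar>\<Sum>n<K. F (p * n) * F (q * n)\<bar> \<le> e * real K + C)"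
    using average_bound[OF corr e] S(2) by metis
  then obtain C where C: "\<And>p q. p \<in> S \<Longrightarrow> q \<in> S \<Longrightarrow> p \<noteq> q \<Longrightarrow> C p q \<ge> 0"
    "\<And>p q K. p \<in> S \<Longrightarrow> q \<in> S \<Longrightarrow> p \<noteq> q \<Longrightarrow> \<bar>\<Sum>n<K. F (p * n) * F (q * n)\<bar> \<le> e * real K + C p q"
    by metis
  define C' where "C' = (\<Sum>p\<in>S. \<Sum>q\<in>S. if p = q then 0 else C p q)"
  have C'0: "C' \<ge> 0" using C(1) by (auto simp: C'_def intro!: sum_nonneg)
  \<comment> \<open>Beyond \<open>N0\<close> the terms that do not grow with \<open>N\<close> are
    absorbed: those of the variance bound by one \<open>N\<close>, \<open>k + C'\<close> by
    \<open>N / 2\<close>, and the \<open>k\<close> from \<open>R\<close> by one more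
    \<open>N\<close>.\<close>
  define N0 where "N0 = nat \<lceil>k\<^sup>2 + 2 * A * k + 2 * (k + C') + k\<rceil>"
  show ?thesis unfolding eventually_sequentially
  proof (intro exI[of _ N0] allI impI)
    fix N assume N: "N \<ge> N0"
    have Nr: "k\<^sup>2 + 2 * A * k + 2 * (k + C') + k \<le> real N" using N unfolding N0_def by linarith
    have nn: "0 \<le> k\<^sup>2" "0 \<le> 2 * A * k" using k0 A0 by auto
    let ?w = "omega_in S"
    have T1: "\<bar>\<Sum>n<N. F n * mu n * (A - ?w n)\<bar> \<le> real N * sqrt (A + 1)"
    proof -
      have "(\<Sum>n<N. (?w n - A)\<^sup>2) \<le> real N * A + k\<^sup>2 + 2 * A * k"
        unfolding A_def k_def by (rule turan_kubilius[OF S])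
      also have "\<dots> \<le> real N * (A + 1)" using Nr nn k0 C'0 by (simp add: distrib_left)
      finally have "(\<Sum>n<N. \<bar>?w n - A\<bar>) \<le> real N * sqrt (A + 1)" using A0 by (intro sum_abs_le_sqrt) auto
      moreover have "\<bar>F n * mu n * (A - ?w n)\<bar> \<le> \<bar>?w n - A\<bar>" for n
      proof -
        have "\<bar>F n\<bar> * \<bar>mu n\<bar> \<le> 1 * 1" by (intro mult_mono F abs_mu_le) auto
        then have "(\<bar>F n\<bar> * \<bar>mu n\<bar>) * \<bar>A - ?w n\<bar> \<le> 1 * \<bar>A - ?w n\<bar>" by (intro mult_right_mono) auto
        then show ?thesis by (simp only: abs_mult mult_1 abs_minus_commute)
      qed
      then have "\<bar>\<Sum>n<N. F n * mu n * (A - ?w n)\<bar> \<le> (\<Sum>n<N. \<bar>?w n - A\<bar>)"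
        by (intro order_trans[OF sum_abs sum_mono])
      ultimately show ?thesis by linarith
    qed
    define G where "G m = (\<Sum>p\<in>S. of_bool (p * m < N) * F (p * m))" for m
    \<comment> \<open>\<open>R\<close> corrects the rule \<open>mu (p * m) = - mu m\<close> at the
      multiples \<open>m\<close> of \<open>p\<close>. There \<open>p * m\<close> is a multiple of
      \<open>p\<^sup>2\<close>, which is rare enough for a total of
      \<open>N * Z + k\<close>.\<close>
    define R where "R = (\<Sum>p\<in>S. \<Sum>m<N. of_bool (p * m < N) * (F (p * m) * (of_bool (p dvd m) * mu m)))"
    have "(\<Sum>n<N. F n * mu n * ?w n) = (\<Sum>p\<in>S. \<Sum>n<N. of_bool (p dvd n) * (F n * mu n))"
      unfolding omega_in_def sum_distrib_left by (subst sum.swap) (simp add: mult_ac)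
    also have "\<dots> = (\<Sum>p\<in>S. \<Sum>m<N. of_bool (p * m < N) * (F (p * m) * mu (p * m)))"
      by (intro sum.cong refl sum_multiples p0)
    also have "\<dots> = (\<Sum>p\<in>S. \<Sum>m<N. of_bool (p * m < N) * (F (p * m) * (of_bool (p dvd m) * mu m)) - mu m * (of_bool (p * m < N) * F (p * m)))"
    proof (intro sum.cong refl)
      fix p m assume "p \<in> S"
      then have mu_pm: "mu (p * m) = (if p dvd m then 0 else - mu m)" using mu_prime_mult[OF S(2)] by blast
      show "of_bool (p * m < N) * (F (p * m) * mu (p * m)) =
        of_bool (p * m < N) * (F (p * m) * (of_bool (p dvd m) * mu m)) - mu m * (of_bool (p * m < N) * F (p * m))"
        unfolding mu_pm by simp
    qed
    also have "\<dots> = R - (\<Sum>p\<in>S. \<Sum>m<N. mu m * (of_bool (p * m < N) * F (p * m)))"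
      by (simp add: R_def sum_subtractf)
    also have "(\<Sum>p\<in>S. \<Sum>m<N. mu m * (of_bool (p * m < N) * F (p * m))) = (\<Sum>m<N. mu m * G m)"
      unfolding G_def sum_distrib_left by (rule sum.swap)
    finally have split: "(\<Sum>n<N. F n * mu n * ?w n) = R - (\<Sum>m<N. mu m * G m)" .
    have R: "\<bar>R\<bar> \<le> real N * Z + k"
    proof -
      have one: "\<bar>\<Sum>m<N. of_bool (p * m < N) * (F (p * m) * (of_bool (p dvd m) * mu m))\<bar> \<le> real N * (1 / (real p)\<^sup>2) + 1" if p: "p \<in> S" for p
      proof -
        have "\<bar>of_bool (p * m < N) * (F (p * m) * (of_bool (p dvd m) * mu m))\<bar> \<le> of_bool (p * m < N) * of_bool (p * p dvd p * m)" for m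
        proof -
          have "\<bar>F (p * m)\<bar> * \<bar>mu m\<bar> \<le> 1 * 1" by (intro mult_mono F abs_mu_le) auto
          then show ?thesis using p0[OF p] by (auto simp: abs_mult)
        qed
        then have "\<bar>\<Sum>m<N. of_bool (p * m < N) * (F (p * m) * (of_bool (p dvd m) * mu m))\<bar> \<le> (\<Sum>m<N. of_bool (p * m < N) * of_bool (p * p dvd p * m))"
          by (intro order_trans[OF sum_abs sum_mono])
        also have "\<dots> = (\<Sum>n<N. of_bool (p dvd n) * of_bool (p * p dvd n))"
          by (rule sum_multiples[symmetric]) (rule p0[OF p])
        also have "\<dots> = (\<Sum>n<N. of_bool (p * p dvd n))" by (intro sum.cong) (auto intro: dvd_mult_left)
        also have "\<dots> \<le> real N / real (p * p) + 1"
          using card_multiples[of "p * p" N] p0[OF p] unfolding sum_of_bool_multiples by simp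
        finally show ?thesis by (simp add: power2_eq_square)
      qed
      have "\<bar>R\<bar> \<le> (\<Sum>p\<in>S. real N * (1 / (real p)\<^sup>2) + 1)"
        unfolding R_def using one by (intro order_trans[OF sum_abs sum_mono])
      also have "\<dots> = real N * (\<Sum>p\<in>S. 1 / (real p)\<^sup>2) + k" by (simp add: sum.distrib sum_distrib_left k_def)
      also have "(\<Sum>p\<in>S. 1 / (real p)\<^sup>2) \<le> Z"
      proof -
        have sm: "summable (\<lambda>n. 1 / (real (Suc n))\<^sup>2)"
          using inverse_squares_sums sums_summable by (simp add: add.commute)
        have "(\<Sum>p\<in>S. 1 / (real p)\<^sup>2) = (\<Sum>n\<in>(\<lambda>p. p - 1) ` S. 1 / (real (Suc n))\<^sup>2)"
        proof (subst sum.reindex)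
          show "inj_on (\<lambda>p. p - 1) S" using p0 by (auto simp: inj_on_def) (metis One_nat_def Suc_pred)
          show "(\<Sum>p\<in>S. 1 / (real p)\<^sup>2) = sum ((\<lambda>n. 1 / (real (Suc n))\<^sup>2) \<circ> (\<lambda>p. p - 1)) S"
          proof (intro sum.cong refl)
            fix p assume "p \<in> S"
            then have "Suc (p - 1) = p" using p0 by simp
            then show "1 / (real p)\<^sup>2 = ((\<lambda>n. 1 / (real (Suc n))\<^sup>2) \<circ> (\<lambda>p. p - 1)) p" by (simp only: o_apply)
          qed
        qed
        also have "\<dots> \<le> Z" unfolding Z_def using S(1) by (intro sum_le_suminf sm) auto
        finally show ?thesis .
      qed
      finally show ?thesis by (simp add: mult_left_mono)
    qed
    have T3: "\<bar>\<Sum>m<N. mu m * G m\<bar> \<le> real N * sqrt (A + 1)"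
    proof -
      have pairs: "(\<Sum>m<N. of_bool (p * m < N) * F (p * m) * (of_bool (q * m < N) * F (q * m)))
         \<le> (if p = q then real N * (1 / real p) + 1 else 0) + (e * real N + (if p = q then 0 else C p q))" if pq: "p \<in> S" "q \<in> S" for p q
      proof (cases "p = q")
        case True
        have FF: "F n * F n \<le> 1" for n
        proof -
          have "\<bar>F n\<bar> * \<bar>F n\<bar> \<le> 1 * 1" by (intro mult_mono F) auto
          then show ?thesis by simp
        qed
        have "(\<Sum>m<N. of_bool (p * m < N) * F (p * m) * (of_bool (q * m < N) * F (q * m))) \<le> (\<Sum>m<N. of_bool (p * m < N) * 1)"
          using True FF by (intro sum_mono) auto
        also have "\<dots> = (\<Sum>n<N. of_bool (p dvd n) * 1)" by (rule sum_multiples[symmetric]) (rule p0[OF pq(1)])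
        also have "\<dots> \<le> real N / real p + 1" using card_multiples[OF p0[OF pq(1)], of N] by (simp add: sum_of_bool_multiples)
        finally have "(\<Sum>m<N. of_bool (p * m < N) * F (p * m) * (of_bool (q * m < N) * F (q * m))) \<le> real N / real p + 1" .
        moreover have "0 \<le> e * real N" using e by simp
        ultimately show ?thesis using True by simp
      next
        case False
        have mx: "p * m < N \<and> q * m < N \<longleftrightarrow> max p q * m < N" for m
          by (simp add: max_def) (metis le_less_trans mult_le_mono1 nat_le_linear)
        have mx0: "0 < max p q" using p0[OF pq(1)] by simp
        obtain K where K: "K \<le> N" "(\<Sum>m<N. of_bool (max p q * m < N) * (F (p * m) * F (q * m))) = (\<Sum>m<K. F (p * m) * F (q * m))"
          using sum_initial_segment[OF mx0, where g = "\<lambda>m. F (p * m) * F (q * m)" and N = N] by blast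
        have "(\<Sum>m<N. of_bool (p * m < N) * F (p * m) * (of_bool (q * m < N) * F (q * m))) = (\<Sum>m<N. of_bool (max p q * m < N) * (F (p * m) * F (q * m)))"
          unfolding mx[symmetric] by (intro sum.cong) auto
        also have "\<dots> \<le> e * real K + C p q" unfolding K(2) using C(2)[OF pq False, of K] by linarith
        also have "\<dots> \<le> e * real N + C p q" using K(1) e by simp
        finally show ?thesis using False by simp
      qed
      have "(\<Sum>m<N. (G m)\<^sup>2) = (\<Sum>m<N. \<Sum>p\<in>S. \<Sum>q\<in>S. of_bool (p * m < N) * F (p * m) * (of_bool (q * m < N) * F (q * m)))"
        unfolding G_def power2_eq_square sum_product ..
      also have "\<dots> = (\<Sum>p\<in>S. \<Sum>q\<in>S. \<Sum>m<N. of_bool (p * m < N) * F (p * m) * (of_bool (q * m < N) * F (q * m)))"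
        by (rule trans[OF sum.swap]) (intro sum.cong refl sum.swap)
      also have "\<dots> \<le> (\<Sum>p\<in>S. \<Sum>q\<in>S. (if p = q then real N * (1 / real p) + 1 else 0) + (e * real N + (if p = q then 0 else C p q)))"
        by (intro sum_mono pairs)
      also have "\<dots> = (\<Sum>p\<in>S. \<Sum>q\<in>S. if p = q then real N * (1 / real p) + 1 else 0) + (k * (k * (e * real N)) + C')"
        by (simp only: sum.distrib C'_def sum_constant k_def)
      also have "(\<Sum>p\<in>S. \<Sum>q\<in>S. if p = q then real N * (1 / real p) + 1 else 0) = (\<Sum>p\<in>S. real N * (1 / real p) + 1)"
        using S(1) by (intro sum.cong refl) simp
      also have "\<dots> = real N * A + k" by (simp only: sum.distrib A_def sum_distrib_left sum_constant k_def mult_1_right)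
      also have "real N * A + k + (k * (k * (e * real N)) + C') \<le> real N * (A + 1)"
      proof -
        have "k\<^sup>2 * e \<le> 1/2" by (simp add: e_def divide_le_eq add_nonneg_pos)
        then have "(k\<^sup>2 * e) * real N \<le> (1/2) * real N" by (intro mult_right_mono) auto
        moreover have "k * (k * (e * real N)) = (k\<^sup>2 * e) * real N" by (simp add: power2_eq_square)
        moreover have "z \<le> n / 2" if "x + y + 2 * z + k \<le> n" "0 \<le> x" "0 \<le> y" for x y z n :: real
          using that k0 by linarith
        from this[OF Nr nn] have "k + C' \<le> real N / 2" .
        moreover have "real N * (A + 1) = real N * A + real N" by (simp add: distrib_left)
        ultimately show ?thesis by linarith
      qed
      finally have "(\<Sum>m<N. \<bar>G m\<bar>) \<le> real N * sqrt (A + 1)" using A0 by (intro sum_abs_le_sqrt) auto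
      moreover have "\<bar>mu m * G m\<bar> \<le> \<bar>G m\<bar>" for m
        using mult_right_mono[OF abs_mu_le[of m], of "\<bar>G m\<bar>"] by (simp add: abs_mult)
      then have "\<bar>\<Sum>m<N. mu m * G m\<bar> \<le> (\<Sum>m<N. \<bar>G m\<bar>)" by (intro order_trans[OF sum_abs sum_mono])
      ultimately show ?thesis by linarith
    qed
    have "A * (\<Sum>n<N. F n * mu n) = (\<Sum>n<N. F n * mu n * ?w n) + (\<Sum>n<N. F n * mu n * (A - ?w n))"
      by (simp add: sum_distrib_left algebra_simps flip: sum.distrib)
    then have "\<bar>A * (\<Sum>n<N. F n * mu n)\<bar> \<le> real N * Z + k + real N * sqrt (A + 1) + real N * sqrt (A + 1)"
      using T1 T3 R split by linarith
    moreover have "l \<le> n" if "x + y + 2 * z + l \<le> n" "0 \<le> x" "0 \<le> y" "0 \<le> z" for l x y z n :: real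
      using that by linarith
    from this[OF Nr nn add_nonneg_nonneg[OF k0 C'0]] have "k \<le> real N" .
    moreover have "real N * (2 * sqrt (A + 1) + Z + 1) = real N * sqrt (A + 1) + real N * sqrt (A + 1) + real N * Z + real N"
      by (simp add: algebra_simps)
    ultimately have "\<bar>A * (\<Sum>n<N. F n * mu n)\<bar> \<le> real N * (2 * sqrt (A + 1) + Z + 1)" by linarith
    then show "A * \<bar>\<Sum>n<N. F n * mu n\<bar> \<le> real N * (2 * sqrt (A + 1) + Z + 1)" using A0 by (simp add: abs_mult)
  qed
qed

theorem katai:
  fixes F :: "nat \<Rightarrow> real"
  assumes F: "\<And>n. \<bar>F n\<bar> \<le> 1"
    and corr: "\<And>p q. prime p \<Longrightarrow> prime q \<Longrightarrow> p \<noteq> q \<Longrightarrow> (\<lambda>N. (\<Sum>n<N. F (p * n) * F (q * n)) / real N) \<longlonglongrightarrow> 0"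
    and recip: "\<And>B. \<exists>S. finite S \<and> (\<forall>p\<in>S. prime p) \<and> B \<le> (\<Sum>p\<in>S. 1 / real p)"
  shows "(\<lambda>N. (\<Sum>n<N. F n * mu n) / real N) \<longlonglongrightarrow> 0"
proof (rule tendstoI)
  fix \<epsilon> :: real assume \<epsilon>: "\<epsilon> > 0"
  define Z where "Z = (\<Sum>n. 1 / (real (Suc n))\<^sup>2)"
  have "((\<lambda>A. (2 * sqrt (A + 1) + Z + 1) / A) \<longlongrightarrow> 0) at_top" by real_asymp
  then have "\<forall>\<^sub>F A in at_top. (2 * sqrt (A + 1) + Z + 1) / A < \<epsilon>" using \<epsilon> by (rule order_tendstoD(2))
  then obtain B where B: "\<And>A. A \<ge> B \<Longrightarrow> (2 * sqrt (A + 1) + Z + 1) / A < \<epsilon>" unfolding eventually_at_top_linorder by blast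
  obtain S where S: "finite S" "\<And>p. p \<in> S \<Longrightarrow> prime p" and SB: "max B 1 \<le> (\<Sum>p\<in>S. 1 / real p)" using recip[of "max B 1"] by blast
  define A where "A = (\<Sum>p\<in>S. 1 / real p)"
  have A: "A > 0" "(2 * sqrt (A + 1) + Z + 1) / A < \<epsilon>" using SB B[of A] by (auto simp: A_def)
  have "\<forall>\<^sub>F N in sequentially. A * \<bar>\<Sum>n<N. F n * mu n\<bar> \<le> real N * (2 * sqrt (A + 1) + Z + 1)"
    unfolding A_def Z_def by (rule katai_finite[OF F corr S])
  then show "\<forall>\<^sub>F N in sequentially. dist ((\<Sum>n<N. F n * mu n) / real N) 0 < \<epsilon>"
    using eventually_gt_at_top[of 0]
  proof eventually_elim
    case (elim N)
    have "\<bar>\<Sum>n<N. F n * mu n\<bar> \<le> real N * ((2 * sqrt (A + 1) + Z + 1) / A)"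
      using elim(1) A(1) by (simp add: pos_le_divide_eq mult.commute)
    then have "\<bar>\<Sum>n<N. F n * mu n\<bar> / real N \<le> (2 * sqrt (A + 1) + Z + 1) / A"
      using elim(2) by (simp add: pos_divide_le_eq mult.commute)
    then show ?case using A(2) by (simp add: dist_real_def abs_divide)
  qed
qed

section \<open>The zeta function on the line of real part one\<close>

text \<open>The Dirichlet term, \<open>n\<close> to the power \<open>- s\<close>. As
  \<open>0 powr\<close> anything is 0, the series can run over all natural numbers without excluding
  0.\<close>

definition np :: "complex \<Rightarrow> nat \<Rightarrow> complex" where "np s n = of_nat n powr (- s)"

lemma norm_np: "norm (np s n) = real n powr (- Re s)"
  unfolding np_def by (subst norm_powr_real_powr) auto

lemma np_0 [simp]: "np s 0 = 0" and np_1 [simp]: "np s (Suc 0) = 1"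
  by (simp_all add: np_def)

lemma np_mult: "np s (m * n) = np s m * np s n"
  unfolding np_def of_nat_mult by (rule powr_times_real) auto

lemma norm_np_summable:
  assumes "1 < Re s" shows "(\<lambda>n. norm (np s n)) summable_on A"
proof -
  have "summable (\<lambda>n. real n powr (- Re s))" using assms by (subst summable_real_powr_iff) simp
  then have "(\<lambda>n. real n powr (- Re s)) summable_on UNIV"
    by (intro norm_summable_imp_summable_on) simp
  then show ?thesis unfolding norm_np by (rule summable_on_subset_banach) simp
qed

lemma np_summable: "1 < Re s \<Longrightarrow> np s summable_on A"
  using norm_np_summable abs_summable_summable by blast

definition tail :: "complex \<Rightarrow> nat \<Rightarrow> real" where
  "tail s y = (\<Sum>\<^sub>\<infinity>n\<in>{y<..}. norm (np s n))"

lemma tail_tendsto: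
  assumes s: "1 < Re s" shows "tail s \<longlonglongrightarrow> 0"
proof -
  let ?f = "\<lambda>n. norm (np s n)" and ?T = "\<Sum>\<^sub>\<infinity>n. norm (np s n)"
  have "(?f has_sum ?T) UNIV" using norm_np_summable[OF s] by (rule has_sum_infsum)
  then have "?f sums ?T" by (rule has_sum_imp_sums)
  then have "(\<lambda>y. \<Sum>n\<le>y. ?f n) \<longlonglongrightarrow> ?T" by (simp add: sums_def_le)
  then have "(\<lambda>y. ?T - (\<Sum>n\<le>y. ?f n)) \<longlonglongrightarrow> ?T - ?T" by (intro tendsto_diff tendsto_const)
  moreover have eq: "tail s y = ?T - (\<Sum>n\<le>y. ?f n)" for y
  proof -
    have "?T = (\<Sum>\<^sub>\<infinity>n\<in>{..y} \<union> {y<..}. ?f n)" by (rule arg_cong[where f = "infsum ?f"]) auto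
    also have "\<dots> = (\<Sum>\<^sub>\<infinity>n\<in>{..y}. ?f n) + tail s y"
      unfolding tail_def by (rule infsum_Un_disjoint) (auto intro: norm_np_summable[OF s])
    finally show ?thesis by simp
  qed
  moreover have "tail s = (\<lambda>y. ?T - (\<Sum>n\<le>y. ?f n))" using eq by (rule ext)
  ultimately show ?thesis by (simp only: diff_self)
qed

lemma norm_infsum_le_tail:
  fixes g :: "nat \<Rightarrow> complex"
  assumes s: "1 < Re s" and g: "\<And>n. n \<in> A \<Longrightarrow> norm (g n) \<le> norm (np s n)" "\<And>n. n \<in> A \<Longrightarrow> n \<le> y \<Longrightarrow> g n = 0"
  shows "norm (\<Sum>\<^sub>\<infinity>n\<in>A. g n) \<le> tail s y"
proof -
  have "norm (\<Sum>\<^sub>\<infinity>n\<in>A. g n) = norm (\<Sum>\<^sub>\<infinity>n\<in>A \<inter> {y<..}. g n)"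
    by (intro arg_cong[where f = norm] infsum_cong_neutral) (auto simp: g(2))
  also have "\<dots> \<le> (\<Sum>\<^sub>\<infinity>n\<in>A \<inter> {y<..}. norm (np s n))"
  proof (rule norm_infsum_le)
    have sm: "(\<lambda>n. norm (np s n)) summable_on A \<inter> {y<..}" by (rule norm_np_summable[OF s])
    have "g summable_on A \<inter> {y<..}"
      by (rule abs_summable_summable, rule summable_on_comparison_test[OF sm]) (use g(1) in auto)
    then show "(g has_sum (\<Sum>\<^sub>\<infinity>n\<in>A \<inter> {y<..}. g n)) (A \<inter> {y<..})" by (rule has_sum_infsum)
    show "((\<lambda>n. norm (np s n)) has_sum (\<Sum>\<^sub>\<infinity>n\<in>A \<inter> {y<..}. norm (np s n))) (A \<inter> {y<..})"
      using sm by (rule has_sum_infsum)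
    show "norm (g n) \<le> norm (np s n)" if "n \<in> A \<inter> {y<..}" for n using g(1) that by simp
  qed
  also have "\<dots> \<le> tail s y" unfolding tail_def
    by (intro infsum_mono2 norm_np_summable[OF s]) auto
  finally show ?thesis .
qed

section \<open>Sieving by primes and the Euler product\<close>

definition sifted :: "nat set \<Rightarrow> complex \<Rightarrow> complex" where
  "sifted S s = (\<Sum>\<^sub>\<infinity>n\<in>{n. \<forall>p\<in>S. \<not> p dvd n}. np s n)"

definition zeta_sum :: "complex \<Rightarrow> complex" where "zeta_sum s = (\<Sum>\<^sub>\<infinity>n. np s n)"

text \<open>Among the numbers free of primes in \<open>S\<close>, the multiples of \<open>p\<close>
  are exactly \<open>p\<close> times the members of the same set, because \<open>p\<close> differs
  from every prime in \<open>S\<close>. Removing them takes away the fraction \<open>np s p\<close>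
  of the sum.\<close>

lemma sifted_insert:
  assumes s: "1 < Re s" and S: "\<And>q. q \<in> S \<Longrightarrow> prime q" and p: "prime p" "p \<notin> S"
  shows "sifted (insert p S) s = (1 - np s p) * sifted S s"
proof -
  let ?A = "{n. \<forall>q\<in>S. \<not> q dvd n}" and ?A' = "{n. \<forall>q\<in>insert p S. \<not> q dvd n}"
  have p0: "p > 0" using p prime_gt_0_nat by blast
  have "q dvd p * m \<longleftrightarrow> q dvd m" if "q \<in> S" for q m
    using S[OF that] p that by (metis dvd_mult prime_dvd_mult_nat primes_dvd_imp_eq)
  then have dv: "\<And>m. p * m \<in> ?A \<longleftrightarrow> m \<in> ?A" by auto
  have eq: "?A = ?A' \<union> (\<lambda>m. p * m) ` ?A"
  proof (intro set_eqI iffI)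
    fix n assume n: "n \<in> ?A"
    show "n \<in> ?A' \<union> (\<lambda>m. p * m) ` ?A"
    proof (cases "p dvd n")
      case True
      then obtain m where "n = p * m" by blast
      then show ?thesis using n dv by blast
    qed (use n in auto)
  next
    fix n assume "n \<in> ?A' \<union> (\<lambda>m. p * m) ` ?A"
    then show "n \<in> ?A" using dv by blast
  qed
  have "sifted S s = (\<Sum>\<^sub>\<infinity>n\<in>?A' \<union> (\<lambda>m. p * m) ` ?A. np s n)" unfolding sifted_def by (subst eq) (rule refl)
  also have "\<dots> = sifted (insert p S) s + (\<Sum>\<^sub>\<infinity>n\<in>(\<lambda>m. p * m) ` ?A. np s n)"
    unfolding sifted_def by (rule infsum_Un_disjoint) (auto intro: np_summable[OF s])
  also have "(\<Sum>\<^sub>\<infinity>n\<in>(\<lambda>m. p * m) ` ?A. np s n) = (\<Sum>\<^sub>\<infinity>m\<in>?A. np s p * np s m)"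
    using p0 by (subst infsum_reindex) (auto simp: inj_on_def o_def np_mult)
  also have "\<dots> = np s p * sifted S s" unfolding sifted_def by (rule infsum_cmult_right')
  finally show ?thesis by (simp add: algebra_simps)
qed

lemma sifted_eq_prod:
  assumes s: "1 < Re s" and S: "finite S" "\<And>q. q \<in> S \<Longrightarrow> prime q"
  shows "sifted S s = zeta_sum s * (\<Prod>p\<in>S. 1 - np s p)"
  using S
proof (induction S)
  case empty show ?case by (simp add: sifted_def zeta_sum_def)
next
  case (insert p S)
  then show ?case by (simp add: sifted_insert[OF s] mult_ac)
qed

definition primes_upto :: "nat \<Rightarrow> nat set" where "primes_upto y = {p. prime p \<and> p \<le> y}"

lemma primes_upto: "finite (primes_upto y)" "p \<in> primes_upto y \<Longrightarrow> prime p"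
  by (auto simp: primes_upto_def)

text \<open>Every \<open>n\<close> with \<open>1 < n \<le> y\<close> has a prime factor at most
  \<open>y\<close>, so apart from 1, and from 0 whose term vanishes, only numbers above
  \<open>y\<close> survive the sieve.\<close>

lemma sifted_tendsto:
  assumes s: "1 < Re s" shows "(\<lambda>y. sifted (primes_upto y) s) \<longlonglongrightarrow> 1"
proof -
  have "norm (sifted (primes_upto y) s - 1) \<le> tail s y" if y: "2 \<le> y" for y
  proof -
    let ?A = "{n. \<forall>p\<in>primes_upto y. \<not> p dvd n}"
    have 1: "1 \<in> ?A" by (auto dest: primes_upto(2))
    have "sifted (primes_upto y) s = (\<Sum>\<^sub>\<infinity>n\<in>{1} \<union> (?A - {1}). np s n)"
      unfolding sifted_def using 1 by (intro arg_cong[where f = "infsum (np s)"]) auto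
    also have "\<dots> = np s 1 + (\<Sum>\<^sub>\<infinity>n\<in>?A - {1}. np s n)"
      by (subst infsum_Un_disjoint) (auto intro: np_summable[OF s])
    finally have "sifted (primes_upto y) s - 1 = (\<Sum>\<^sub>\<infinity>n\<in>?A - {1}. np s n)" by simp
    moreover have "norm (\<Sum>\<^sub>\<infinity>n\<in>?A - {1}. np s n) \<le> tail s y"
    proof (rule norm_infsum_le_tail[OF s])
      fix n assume n: "n \<in> ?A - {1}" "n \<le> y"
      have "n = 0"
      proof (rule ccontr)
        assume "n \<noteq> 0"
        then obtain q where q: "prime q" "q dvd n" using n prime_factor_nat by blast
        then have "q \<le> n" using \<open>n \<noteq> 0\<close> by (simp add: dvd_imp_le)
        then show False using n q by (auto simp: primes_upto_def)
      qed
      then show "np s n = 0" by simp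
    qed simp
    ultimately show ?thesis by simp
  qed
  then have "\<forall>\<^sub>F y in sequentially. norm (sifted (primes_upto y) s - 1) \<le> tail s y"
    by (auto simp: eventually_sequentially)
  then have "(\<lambda>y. sifted (primes_upto y) s - 1) \<longlonglongrightarrow> 0"
    by (rule Lim_null_comparison[OF _ tail_tendsto[OF s]])
  then show ?thesis by (simp add: LIM_zero_iff)
qed

definition sqfree_over :: "nat set \<Rightarrow> nat set" where
  "sqfree_over S = {d. squarefree d \<and> prime_factors d \<subseteq> S}"

lemma squarefree_nonzero: "squarefree (n :: nat) \<Longrightarrow> n \<noteq> 0"
  by (metis not_squarefree_0)

lemma sqfree_over_nonzero: "d \<in> sqfree_over S \<Longrightarrow> d \<noteq> 0"
  unfolding sqfree_over_def using squarefree_nonzero by blast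

lemma sqfree_over_insert:
  assumes p: "prime p" "p \<notin> S"
  shows "sqfree_over (insert p S) = sqfree_over S \<union> (\<lambda>m. p * m) ` sqfree_over S"
    and "sqfree_over S \<inter> (\<lambda>m. p * m) ` sqfree_over S = {}"
proof -
  have p0: "p > 0" using p prime_gt_0_nat by blast
  have nd: "\<not> p dvd m" if "m \<in> sqfree_over S" for m
  proof
    assume "p dvd m"
    moreover have "m \<noteq> 0" using that by (rule sqfree_over_nonzero)
    ultimately have "p \<in> prime_factors m" using p by (simp add: in_prime_factors_iff)
    then show False using that p(2) by (auto simp: sqfree_over_def)
  qed
  show "sqfree_over S \<inter> (\<lambda>m. p * m) ` sqfree_over S = {}" using nd by fastforce
  have pf: "prime_factors (p * m) = insert p (prime_factors m)" if "m \<noteq> 0" for m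
    using p that p0 by (subst prime_factors_product) (auto simp: prime_factorization_prime)
  show "sqfree_over (insert p S) = sqfree_over S \<union> (\<lambda>m. p * m) ` sqfree_over S"
  proof (intro set_eqI iffI)
    fix d assume d: "d \<in> sqfree_over (insert p S)"
    show "d \<in> sqfree_over S \<union> (\<lambda>m. p * m) ` sqfree_over S"
    proof (cases "p dvd d")
      case True
      then obtain m where m: "d = p * m" by blast
      have sq: "squarefree (p * m)" using d by (simp add: sqfree_over_def m)
      then have m0: "m \<noteq> 0" using squarefree_nonzero[of "p * m"] by auto
      have "\<not> p dvd m"
      proof
        assume "p dvd m"
        then have "p\<^sup>2 dvd p * m" by (simp add: power2_eq_square)
        then show False using sq p by (auto dest!: squarefreeD)
      qed
      then have "p \<notin> prime_factors m" by (simp add: in_prime_factors_iff)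
      then have "m \<in> sqfree_over S"
        using d pf[OF m0] sq squarefree_multD(2)[OF sq] by (auto simp: sqfree_over_def m)
      then show ?thesis using m by blast
    next
      case False
      then have "p \<notin> prime_factors d" by (simp add: in_prime_factors_iff)
      then show ?thesis using d by (auto simp: sqfree_over_def)
    qed
  next
    fix d assume "d \<in> sqfree_over S \<union> (\<lambda>m. p * m) ` sqfree_over S"
    then show "d \<in> sqfree_over (insert p S)"
    proof
      assume "d \<in> (\<lambda>m. p * m) ` sqfree_over S"
      then obtain m where m: "d = p * m" "m \<in> sqfree_over S" by blast
      have m0: "m \<noteq> 0" using m(2) by (rule sqfree_over_nonzero)
      have "coprime p m" using nd[OF m(2)] p by (simp add: prime_imp_coprime)
      then have "squarefree d" unfolding m(1) using m(2) squarefree_prime[OF p(1)]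
        by (simp add: squarefree_mult_coprime sqfree_over_def)
      then show ?thesis using pf[OF m0] m by (auto simp: sqfree_over_def)
    qed (auto simp: sqfree_over_def)
  qed
qed

text \<open>Multiplying out: a new prime \<open>p\<close> adds the squarefree numbers
  \<open>p * m\<close>, each with the sign opposite to that of \<open>m\<close>.\<close>

lemma prod_eq_mu_sum:
  assumes "finite S" "\<And>q. q \<in> S \<Longrightarrow> prime q"
  shows "finite (sqfree_over S) \<and> (\<Prod>p\<in>S. 1 - np s p) = (\<Sum>d\<in>sqfree_over S. of_real (mu d) * np s d)"
  using assms
proof (induction S)
  case empty
  have "sqfree_over {} = {1}"
    by (auto simp: sqfree_over_def prime_factorization_empty_iff)
  then show ?case by simp
next
  case (insert p S)
  have p: "prime p" using insert by simp
  have IH: "finite (sqfree_over S)" "(\<Prod>p\<in>S. 1 - np s p) = (\<Sum>d\<in>sqfree_over S. of_real (mu d) * np s d)"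
    using insert by auto
  have p0: "p > 0" using p prime_gt_0_nat by blast
  have nd: "\<not> p dvd m" if m: "m \<in> sqfree_over S" for m
    using m insert(2) p sqfree_over_nonzero[OF m] by (auto simp: sqfree_over_def in_prime_factors_iff)
  have "(\<Sum>d\<in>sqfree_over (insert p S). of_real (mu d) * np s d) =
     (\<Sum>d\<in>sqfree_over S. of_real (mu d) * np s d) + (\<Sum>d\<in>(\<lambda>m. p * m) ` sqfree_over S. of_real (mu d) * np s d)"
    unfolding sqfree_over_insert(1)[OF p insert(2)] by (rule sum.union_disjoint) (use IH sqfree_over_insert(2)[OF p insert(2)] in auto)
  also have "(\<Sum>d\<in>(\<lambda>m. p * m) ` sqfree_over S. of_real (mu d) * np s d) = (\<Sum>m\<in>sqfree_over S. of_real (mu (p * m)) * np s (p * m))"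
    using p0 by (subst sum.reindex) (auto simp: inj_on_def)
  also have "\<dots> = (\<Sum>m\<in>sqfree_over S. - np s p * (of_real (mu m) * np s m))"
  proof (intro sum.cong refl)
    fix m assume "m \<in> sqfree_over S"
    then have "mu (p * m) = - mu m" using mu_prime_mult[OF p, of m] nd by simp
    then show "of_real (mu (p * m)) * np s (p * m) = - np s p * (of_real (mu m) * np s m)" by (simp add: np_mult)
  qed
  also have "\<dots> = - np s p * (\<Prod>p\<in>S. 1 - np s p)" unfolding IH(2) sum_distrib_left ..
  finally have "(\<Sum>d\<in>sqfree_over (insert p S). of_real (mu d) * np s d) = (1 - np s p) * (\<Prod>p\<in>S. 1 - np s p)"
    unfolding IH(2)[symmetric] by (simp add: algebra_simps)
  moreover have "finite (sqfree_over (insert p S))" unfolding sqfree_over_insert(1)[OF p insert(2)] using IH(1) by simp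
  ultimately show ?case using insert(1,2) by simp
qed

definition mu_sum :: "complex \<Rightarrow> complex" where "mu_sum s = (\<Sum>\<^sub>\<infinity>n. of_real (mu n) * np s n)"

lemma norm_mu_np: "norm (of_real (mu n) * np s n) \<le> norm (np s n)"
  using mult_right_mono[OF abs_mu_le[of n], of "norm (np s n)"] by (simp add: norm_mult)

lemma mu_np_summable:
  assumes "1 < Re s" shows "(\<lambda>n. of_real (mu n) * np s n) summable_on A"
  by (rule abs_summable_summable, rule summable_on_comparison_test[OF norm_np_summable[OF assms]])
    (use norm_mu_np in auto)

lemma prod_tendsto_mu_sum:
  assumes s: "1 < Re s" shows "(\<lambda>y. \<Prod>p\<in>primes_upto y. 1 - np s p) \<longlonglongrightarrow> mu_sum s"
proof -
  let ?g = "\<lambda>n. of_real (mu n) * np s n"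
  have "norm ((\<Prod>p\<in>primes_upto y. 1 - np s p) - mu_sum s) \<le> tail s y" for y
  proof -
    let ?D = "sqfree_over (primes_upto y)"
    have D: "finite ?D" "(\<Prod>p\<in>primes_upto y. 1 - np s p) = (\<Sum>d\<in>?D. ?g d)"
      using prod_eq_mu_sum[OF primes_upto, where s = s] by auto
    have "mu_sum s = (\<Sum>\<^sub>\<infinity>n\<in>?D \<union> - ?D. ?g n)" unfolding mu_sum_def by simp
    also have "\<dots> = (\<Sum>d\<in>?D. ?g d) + (\<Sum>\<^sub>\<infinity>n\<in>- ?D. ?g n)"
      using D(1) by (subst infsum_Un_disjoint[OF mu_np_summable[OF s] mu_np_summable[OF s]]) auto
    finally have "norm ((\<Prod>p\<in>primes_upto y. 1 - np s p) - mu_sum s) = norm (\<Sum>\<^sub>\<infinity>n\<in>- ?D. ?g n)"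
      unfolding D(2) by (simp add: norm_minus_commute)
    also have "\<dots> \<le> tail s y"
    proof (rule norm_infsum_le_tail[OF s norm_mu_np])
      fix n assume n: "n \<in> - ?D" "n \<le> y"
      have "\<not> squarefree n"
      proof
        assume sq: "squarefree n"
        then have "n \<noteq> 0" by (rule squarefree_nonzero)
        have "prime_factors n \<subseteq> primes_upto y"
        proof
          fix p assume "p \<in> prime_factors n"
          then have "prime p" "p dvd n" by (auto simp: in_prime_factors_iff)
          moreover have "p \<le> y" using \<open>p dvd n\<close> \<open>n \<noteq> 0\<close> n(2) dvd_imp_le[of p n] by linarith
          ultimately show "p \<in> primes_upto y" by (simp add: primes_upto_def)
        qed
        then show False using n sq by (simp add: sqfree_over_def)
      qed
      then show "?g n = 0" by (simp add: moebius_mu_def)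
    qed
    finally show ?thesis .
  qed
  then have "(\<lambda>y. (\<Prod>p\<in>primes_upto y. 1 - np s p) - mu_sum s) \<longlonglongrightarrow> 0"
    by (intro Lim_null_comparison[OF _ tail_tendsto[OF s]]) auto
  then show ?thesis by (simp add: LIM_zero_iff)
qed

text \<open>Two limits of the same finite sieves: the sifted sum is \<open>zeta_sum s\<close> times
  a finite product that tends to \<open>mu_sum s\<close>, and it tends to 1 as the sieve takes in
  all primes. No infinite product has to be formed.\<close>

theorem zeta_mult_mu_sum:
  assumes s: "1 < Re s" shows "zeta_sum s * mu_sum s = 1"
proof (rule LIMSEQ_unique)
  show "(\<lambda>y. sifted (primes_upto y) s) \<longlonglongrightarrow> zeta_sum s * mu_sum s"
  proof -
    have "sifted (primes_upto y) s = zeta_sum s * (\<Prod>p\<in>primes_upto y. 1 - np s p)" for y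
      by (rule sifted_eq_prod[OF s primes_upto])
    then show ?thesis using tendsto_mult_left[OF prod_tendsto_mu_sum[OF s]] by simp
  qed
qed (rule sifted_tendsto[OF s])

section \<open>The 3-4-1 inequality and the divergence of the sum of prime reciprocals\<close>

lemma ln_norm_one_minus_sums:
  fixes z :: complex
  assumes "norm z < 1"
  shows "(\<lambda>n. - Re (z ^ n) / real n) sums ln (norm (1 - z))"
proof -
  \<comment> \<open>The term \<open>n = 0\<close> is 0 in both series, by division by zero.\<close>
  have "(\<lambda>n. (- 1) ^ Suc n / of_nat n * (- z) ^ n) sums ln (1 + - z)"
    using assms by (intro Ln_series) simp
  then have "(\<lambda>n. Re ((- 1) ^ Suc n / of_nat n * (- z) ^ n)) sums Re (ln (1 + - z))" by (rule sums_Re)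
  moreover have "1 - z \<noteq> 0" using assms by auto
  then have "Re (ln (1 + - z)) = ln (norm (1 - z))" by (simp add: Re_Ln)
  moreover have "Re ((- 1) ^ Suc n / of_nat n * (- z) ^ n) = - Re (z ^ n) / real n" for n
  proof -
    have "(- 1) ^ Suc n * (- z) ^ n = - (z ^ n)" by (simp add: power_mult_distrib[symmetric] flip: mult_minus_left)
    then have eq: "(- 1) ^ Suc n / of_nat n * (- z) ^ n = - (z ^ n) / of_nat n"
      by (simp only: times_divide_eq_left)
    show ?thesis unfolding eq by simp
  qed
  ultimately show ?thesis by (simp only:)
qed

text \<open>After taking logarithms the coefficient of \<open>r ^ n / n\<close> is
  \<open>- (3 + 4 * c + (2 * c\<^sup>2 - 1)) = - 2 * (1 + c)\<^sup>2\<close> with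
  \<open>c = Re (w ^ n)\<close>, which is never positive.\<close>

lemma three_four_one_local:
  fixes w :: complex
  assumes r: "0 \<le> r" "r < 1" and w: "norm w = 1"
  shows "norm (1 - of_real r :: complex) ^ 3 * norm (1 - of_real r * w) ^ 4 * norm (1 - of_real r * w\<^sup>2) \<le> 1"
proof -
  have n: "norm (of_real r :: complex) < 1" "norm (of_real r * w) < 1" "norm (of_real r * w\<^sup>2) < 1"
    using r w by (auto simp: norm_mult norm_power)
  have pos: "0 < norm (1 - of_real r :: complex)" "0 < norm (1 - of_real r * w)" "0 < norm (1 - of_real r * w\<^sup>2)"
    using n by auto
  let ?L = "3 * ln (norm (1 - of_real r :: complex)) + 4 * ln (norm (1 - of_real r * w)) + ln (norm (1 - of_real r * w\<^sup>2))"
  have "(\<lambda>n. 3 * (- Re (of_real r ^ n :: complex) / real n) + 4 * (- Re ((of_real r * w) ^ n) / real n) + (- Re ((of_real r * w\<^sup>2) ^ n) / real n)) sums ?L"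
    by (intro sums_add sums_mult ln_norm_one_minus_sums n)
  then have "?L \<le> 0"
  proof (rule sums_le[rotated, OF _ sums_zero])
    fix n
    define c where "c = Re (w ^ n)"
    have "norm (w ^ n) = 1" using w by (simp add: norm_power)
    then have "(Re (w ^ n))\<^sup>2 + (Im (w ^ n))\<^sup>2 = 1" by (simp add: cmod_def)
    then have c2: "Re ((w ^ n)\<^sup>2) = 2 * c\<^sup>2 - 1" by (simp add: c_def power2_eq_square)
    have e: "Re (of_real r ^ n :: complex) = r ^ n" "Re ((of_real r * w) ^ n) = r ^ n * c" "Re ((of_real r * w\<^sup>2) ^ n) = r ^ n * (2 * c\<^sup>2 - 1)"
    proof -
      show "Re (of_real r ^ n :: complex) = r ^ n" by (simp flip: of_real_power)
      show "Re ((of_real r * w) ^ n) = r ^ n * c" by (simp add: power_mult_distrib c_def flip: of_real_power)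
      have "(of_real r * w\<^sup>2) ^ n = of_real (r ^ n) * (w ^ n)\<^sup>2" by (simp add: power_mult_distrib power_mult[symmetric] mult.commute)
      then show "Re ((of_real r * w\<^sup>2) ^ n) = r ^ n * (2 * c\<^sup>2 - 1)" using c2 by simp
    qed
    have "3 * (- Re (of_real r ^ n :: complex) / real n) + 4 * (- Re ((of_real r * w) ^ n) / real n) + (- Re ((of_real r * w\<^sup>2) ^ n) / real n)
      = - (r ^ n * (2 * (1 + c)\<^sup>2)) / real n"
      unfolding e by (simp add: field_simps power2_eq_square add_divide_distrib[symmetric] diff_divide_distrib[symmetric])
    also have "\<dots> \<le> 0" using r by simp
    finally show "3 * (- Re (of_real r ^ n :: complex) / real n) + 4 * (- Re ((of_real r * w) ^ n) / real n) + (- Re ((of_real r * w\<^sup>2) ^ n) / real n) \<le> 0" .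
  qed
  moreover have "ln (norm (1 - of_real r :: complex) ^ 3 * norm (1 - of_real r * w) ^ 4 * norm (1 - of_real r * w\<^sup>2)) = ?L"
    using pos by (simp add: ln_mult ln_realpow)
  ultimately show ?thesis using pos by (metis ln_le_zero_iff mult_pos_pos zero_less_power)
qed

lemma np_vertical:
  assumes "0 < p"
  shows "np (Complex \<sigma> t) p = of_real (real p powr (- \<sigma>)) * np (Complex 0 t) p" "norm (np (Complex 0 t) p) = 1"
    "np (Complex 0 (2 * t)) p = (np (Complex 0 t) p)\<^sup>2"
proof -
  have p0: "(of_nat p :: complex) \<noteq> 0" using assms by simp
  have "- Complex \<sigma> t = of_real (- \<sigma>) + - Complex 0 t" by (simp add: complex_eq_iff)
  then have "np (Complex \<sigma> t) p = of_nat p powr (of_real (- \<sigma>)) * np (Complex 0 t) p"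
    unfolding np_def by (simp only: powr_add)
  moreover have "(of_nat p :: complex) powr (of_real (- \<sigma>)) = of_real (real p powr (- \<sigma>))"
    using powr_of_real[of "real p" "- \<sigma>"] by simp
  ultimately show "np (Complex \<sigma> t) p = of_real (real p powr (- \<sigma>)) * np (Complex 0 t) p" by simp
  show "norm (np (Complex 0 t) p) = 1" using assms by (simp add: norm_np)
  have "- Complex 0 (2 * t) = - Complex 0 t + - Complex 0 t" by (simp add: complex_eq_iff)
  then show "np (Complex 0 (2 * t)) p = (np (Complex 0 t) p)\<^sup>2"
    unfolding np_def power2_eq_square by (simp only: powr_add)
qed

lemma np_zero: "0 < n \<Longrightarrow> np (Complex 0 0) n = 1"
proof -
  have "Complex 0 0 = 0" by (simp add: complex_eq_iff)
  then show "0 < n \<Longrightarrow> np (Complex 0 0) n = 1" by (simp add: np_def)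
qed

text \<open>The local inequality is multiplied over the primes up to \<open>y\<close>. Since the
  sifted sums tend to 1, an upper bound for the finite products becomes a lower bound for the zeta
  values.\<close>

lemma three_four_one:
  assumes "1 < \<sigma>"
  shows "1 \<le> norm (zeta_sum (Complex \<sigma> 0)) ^ 3 * norm (zeta_sum (Complex \<sigma> t)) ^ 4 * norm (zeta_sum (Complex \<sigma> (2 * t)))"
proof -
  let ?P = "\<lambda>y s. \<Prod>p\<in>primes_upto y. 1 - np s p"
  let ?Z = "\<lambda>f. norm (f (Complex \<sigma> 0)) ^ 3 * norm (f (Complex \<sigma> t)) ^ 4 * norm (f (Complex \<sigma> (2 * t)))"
  have s: "1 < Re (Complex \<sigma> u)" for u using assms by simp
  have eq: "sifted (primes_upto y) (Complex \<sigma> u) = zeta_sum (Complex \<sigma> u) * ?P y (Complex \<sigma> u)" for y u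
    by (rule sifted_eq_prod[OF s primes_upto])
  have P: "?Z (?P y) \<le> 1" for y
  proof -
    have "?Z (?P y) = (\<Prod>p\<in>primes_upto y. ?Z (\<lambda>s. 1 - np s p))"
      by (simp add: prod_norm[symmetric] prod_power_distrib prod.distrib)
    also have "\<dots> \<le> 1"
    proof (rule prod_le_1)
      fix p assume "p \<in> primes_upto y"
      then have p: "1 < p" using primes_upto(2) prime_gt_1_nat by blast
      then have p0: "0 < p" by simp
      have r: "0 \<le> real p powr (- \<sigma>)" "real p powr (- \<sigma>) < 1"
        using p assms powr_less_mono[of "- \<sigma>" 0 "real p"] by auto
      have "np (Complex 0 0) p = 1" using p0 by (rule np_zero)
      then have e1: "np (Complex \<sigma> 0) p = of_real (real p powr (- \<sigma>))"
        using np_vertical(1)[OF p0, of \<sigma> 0] by simp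
      have e2: "np (Complex \<sigma> t) p = of_real (real p powr (- \<sigma>)) * np (Complex 0 t) p"
        by (rule np_vertical(1)[OF p0])
      have e3: "np (Complex \<sigma> (2 * t)) p = of_real (real p powr (- \<sigma>)) * (np (Complex 0 t) p)\<^sup>2"
        unfolding np_vertical(3)[OF p0, symmetric] by (rule np_vertical(1)[OF p0])
      have "?Z (\<lambda>s. 1 - np s p) \<le> 1"
        unfolding e1 e2 e3 by (rule three_four_one_local[OF r np_vertical(2)[OF p0, of t]])
      then show "0 \<le> ?Z (\<lambda>s. 1 - np s p) \<and> ?Z (\<lambda>s. 1 - np s p) \<le> 1" by simp
    qed
    finally show ?thesis .
  qed
  have "?Z (sifted (primes_upto y)) \<le> ?Z zeta_sum" for y
  proof -
    have "?Z (sifted (primes_upto y)) = ?Z zeta_sum * ?Z (?P y)"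
      unfolding eq by (simp add: norm_mult power_mult_distrib)
    also have "\<dots> \<le> ?Z zeta_sum * 1" using P by (intro mult_left_mono) auto
    finally show ?thesis by simp
  qed
  moreover have "(\<lambda>y. ?Z (sifted (primes_upto y))) \<longlonglongrightarrow> norm (1::complex) ^ 3 * norm (1::complex) ^ 4 * norm (1::complex)"
    by (intro tendsto_intros sifted_tendsto s)
  ultimately have "norm (1::complex) ^ 3 * norm (1::complex) ^ 4 * norm (1::complex) \<le> ?Z zeta_sum"
    by (intro LIMSEQ_le_const2) auto
  then show ?thesis by simp
qed

lemma one_minus_ge_exp:
  fixes x :: real assumes "0 \<le> x" "x \<le> 1/2" shows "exp (- 2 * x) \<le> 1 - x"
proof -
  have "1 \<le> (1 - x) * (1 + 2 * x)" using assms mult_left_mono[of "2 * x" 1 x] by (simp add: algebra_simps)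
  also have "\<dots> \<le> (1 - x) * exp (2 * x)" using assms by (intro mult_left_mono exp_ge_add_one_self) auto
  finally have "exp (- 2 * x) * 1 \<le> exp (- 2 * x) * ((1 - x) * exp (2 * x))" by (intro mult_left_mono) auto
  also have "\<dots> = 1 - x" by (simp add: exp_minus field_simps)
  finally show ?thesis by simp
qed

text \<open>If all sums stayed below \<open>B\<close>, the Euler factors, at least
  \<open>1 - 1 / p \<ge> exp (- 2 / p)\<close>, would bound zeta by \<open>exp (2 * B)\<close> for
  every real \<sigma> > 1, and letting \<sigma> tend to 1 would bound the harmonic numbers.\<close>

theorem sum_prime_reciprocals_unbounded:
  "\<exists>S. finite S \<and> (\<forall>p\<in>S. prime p) \<and> B \<le> (\<Sum>p\<in>S. 1 / real p)"
proof (rule ccontr)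
  assume no: "\<nexists>S. finite S \<and> (\<forall>p\<in>S. prime p) \<and> B \<le> (\<Sum>p\<in>S. 1 / real p)"
  have bd: "(\<Sum>p\<in>primes_upto y. 1 / real p) \<le> B" for y
    using no primes_upto by (meson linear)
  have zeta_le: "norm (zeta_sum (Complex \<sigma> 0)) \<le> exp (2 * B)" if \<sigma>: "1 < \<sigma>" for \<sigma>
  proof -
    have s: "1 < Re (Complex \<sigma> 0)" using \<sigma> by simp
    have prod: "exp (- 2 * B) \<le> norm (\<Prod>p\<in>primes_upto y. 1 - np (Complex \<sigma> 0) p)" for y
    proof -
      have "exp (- 2 * B) \<le> exp (\<Sum>p\<in>primes_upto y. - 2 * (1 / real p))"
        using bd[of y] by (simp only: sum_distrib_left[symmetric] exp_le_cancel_iff)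
      also have "\<dots> = (\<Prod>p\<in>primes_upto y. exp (- 2 * (1 / real p)))" by (rule exp_sum) (rule primes_upto)
      also have "\<dots> \<le> (\<Prod>p\<in>primes_upto y. norm (1 - np (Complex \<sigma> 0) p))"
      proof (rule prod_mono)
        fix p assume "p \<in> primes_upto y"
        then have p: "2 \<le> p" using primes_upto(2) prime_ge_2_nat by blast
        have "np (Complex 0 0) p = 1" using p by (intro np_zero) simp
        then have np_eq: "np (Complex \<sigma> 0) p = of_real (real p powr (- \<sigma>))" using np_vertical(1)[of p \<sigma> 0] p by simp
        have "real p powr (- \<sigma>) \<le> real p powr (- 1)" using \<sigma> p by (intro powr_mono) auto
        then have le: "real p powr (- \<sigma>) \<le> 1 / real p" using p by (simp add: powr_minus_divide)
        have "exp (- 2 * (1 / real p)) \<le> 1 - 1 / real p" using p by (intro one_minus_ge_exp) auto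
        also have "\<dots> \<le> 1 - real p powr (- \<sigma>)" using le by simp
        also have "\<dots> = Re (1 - np (Complex \<sigma> 0) p)" unfolding np_eq by simp
        also have "\<dots> \<le> norm (1 - np (Complex \<sigma> 0) p)" by (rule complex_Re_le_cmod)
        finally show "0 \<le> exp (- 2 * (1 / real p)) \<and> exp (- 2 * (1 / real p)) \<le> norm (1 - np (Complex \<sigma> 0) p)" by simp
      qed
      finally show ?thesis by (simp add: prod_norm)
    qed
    have "norm (zeta_sum (Complex \<sigma> 0)) * exp (- 2 * B) \<le> norm (1::complex)"
    proof (rule LIMSEQ_le_const)
      show "(\<lambda>y. norm (sifted (primes_upto y) (Complex \<sigma> 0))) \<longlonglongrightarrow> norm (1::complex)"
        by (intro tendsto_norm sifted_tendsto s)
      have "norm (zeta_sum (Complex \<sigma> 0)) * exp (- 2 * B) \<le> norm (sifted (primes_upto y) (Complex \<sigma> 0))" for y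
      proof -
        have eq: "sifted (primes_upto y) (Complex \<sigma> 0) = zeta_sum (Complex \<sigma> 0) * (\<Prod>p\<in>primes_upto y. 1 - np (Complex \<sigma> 0) p)"
          by (rule sifted_eq_prod[OF s primes_upto])
        show ?thesis unfolding eq norm_mult by (intro mult_left_mono prod) auto
      qed
      then show "\<exists>N. \<forall>y\<ge>N. norm (zeta_sum (Complex \<sigma> 0)) * exp (- 2 * B) \<le> norm (sifted (primes_upto y) (Complex \<sigma> 0))" by blast
    qed
    then show ?thesis by (simp add: exp_minus field_simps)
  qed
  have "(\<Sum>n\<in>{1..N}. real n powr (- 1)) \<le> exp (2 * B)" for N
  proof -
    have part: "(\<Sum>n\<in>{1..N}. real n powr (- \<sigma>)) \<le> exp (2 * B)" if \<sigma>: "1 < \<sigma>" for \<sigma>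
    proof -
      have s: "1 < Re (Complex \<sigma> 0)" using \<sigma> by simp
      have np_eq: "Re (np (Complex \<sigma> 0) n) = real n powr (- \<sigma>)" for n
      proof (cases "n = 0")
        case False
        then have "np (Complex 0 0) n = 1" by (intro np_zero) simp
        then show ?thesis using np_vertical(1)[of n \<sigma> 0] False by simp
      qed simp
      have sm: "(np (Complex \<sigma> 0) has_sum zeta_sum (Complex \<sigma> 0)) UNIV"
        unfolding zeta_sum_def using np_summable[OF s] by (rule has_sum_infsum)
      have "((\<lambda>n. real n powr (- \<sigma>)) has_sum Re (zeta_sum (Complex \<sigma> 0))) UNIV"
        using has_sum_Re[OF sm] unfolding np_eq .
      then have "(\<Sum>n\<in>{1..N}. real n powr (- \<sigma>)) \<le> Re (zeta_sum (Complex \<sigma> 0))"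
        by (rule finite_sum_le_has_sum) auto
      also have "\<dots> \<le> norm (zeta_sum (Complex \<sigma> 0))" by (rule complex_Re_le_cmod)
      also have "\<dots> \<le> exp (2 * B)" by (rule zeta_le[OF \<sigma>])
      finally show ?thesis .
    qed
    have "((\<lambda>\<sigma>. \<Sum>n\<in>{1..N}. real n powr (- \<sigma>)) \<longlongrightarrow> (\<Sum>n\<in>{1..N}. real n powr (- 1))) (at_right 1)"
      by (intro tendsto_intros) auto
    then show ?thesis
    proof (rule tendsto_upperbound)
      have "\<forall>\<^sub>F \<sigma> in at_right (1::real). 1 < \<sigma>" by (rule eventually_at_right_less)
      then show "\<forall>\<^sub>F \<sigma> in at_right 1. (\<Sum>n\<in>{1..N}. real n powr (- \<sigma>)) \<le> exp (2 * B)"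
        by (rule eventually_mono) (rule part)
    qed simp
  qed
  then have "(\<Sum>k=1..n. inverse (real k)) \<le> exp (2 * B)" for n
    by (simp add: powr_minus)
  then have "harm n \<le> exp (2 * B)" for n unfolding harm_def by simp
  moreover have "filterlim (harm :: nat \<Rightarrow> real) at_top sequentially" by (rule harm_at_top)
  then have "\<forall>\<^sub>F n in sequentially. exp (2 * B) < (harm n :: real)" by (simp add: filterlim_at_top_dense)
  ultimately show False using eventually_happens[of "\<lambda>n. exp (2 * B) < (harm n :: real)" sequentially] by (auto simp: not_less[symmetric])
qed

text \<open>The summands of \<open>\<zeta>(s) - 1 / (s - 1)\<close>; the junk value at \<open>s = 1\<close> is never used.\<close>

definition zterm :: "complex \<Rightarrow> nat \<Rightarrow> complex" where
  "zterm s n = np s (Suc n) - (of_nat (Suc (Suc n)) powr (1 - s) - of_nat (Suc n) powr (1 - s)) / (1 - s)"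

definition zreg :: "complex \<Rightarrow> complex" where "zreg s = (\<Sum>n. zterm s n)"

text \<open>\<open>zterm s n\<close> is the integral of \<open>np s N - x powr (- s)\<close> over
  \<open>[N, N + 1]\<close> with \<open>N = Suc n\<close>. The mean value inequality is used twice,
  for the integrand and for its antiderivative, and the bound gains one power of \<open>N\<close>
  over the size of \<open>np s N\<close>.\<close>

lemma norm_zterm_le:
  assumes s: "0 < Re s" "s \<noteq> 1"
  shows "norm (zterm s n) \<le> norm s * real (Suc n) powr (- Re s - 1)"
proof -
  define N where "N = Suc n"
  have N0: "real N > 0" by (simp add: N_def)
  let ?S = "closed_segment (of_nat N) (of_nat (Suc N)) :: complex set"
  have S: "z \<notin> \<real>\<^sub>\<le>\<^sub>0" "z \<in> \<real>" "real N \<le> Re z" "norm (z - of_nat N) \<le> 1" if "z \<in> ?S" for z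
  proof -
    from that obtain u where u: "0 \<le> u" "u \<le> 1" "z = (1 - u) *\<^sub>R of_nat N + u *\<^sub>R of_nat (Suc N)"
      by (auto simp: closed_segment_def)
    then have z: "z = of_real (real N + u)" by (simp add: scaleR_conv_of_real algebra_simps)
    show "z \<notin> \<real>\<^sub>\<le>\<^sub>0" using u(1) N0 unfolding z by (simp add: complex_nonpos_Reals_iff)
    show "z \<in> \<real>" unfolding z by simp
    show "real N \<le> Re z" using u(1) unfolding z by simp
    have "z - of_nat N = of_real u" unfolding z by simp
    then show "norm (z - of_nat N) \<le> 1" using u(1,2) by simp
  qed
  have NS: "of_nat N \<in> ?S" "of_nat (Suc N) \<in> ?S" by auto
  let ?B = "norm s * real N powr (- Re s - 1)"
  have inner: "norm (np s N - z powr (- s)) \<le> ?B" if z: "z \<in> ?S" for z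
  proof -
    have "norm (np s N - z powr (- s)) \<le> ?B * norm (of_nat N - z)" unfolding np_def
    proof (rule field_differentiable_bound[OF convex_closed_segment _ _ NS(1) z])
      fix w assume w: "w \<in> ?S"
      show "((\<lambda>z. z powr (- s)) has_field_derivative - s * w powr (- s - 1)) (at w within ?S)"
        using S(1)[OF w] by (auto intro!: derivative_eq_intros)
      have "norm (w powr (- s - 1)) = Re w powr (- Re s - 1)"
        using S(2,3)[OF w] N0 by (subst norm_powr_real_powr) auto
      also have "\<dots> \<le> real N powr (- Re s - 1)" using S(3)[OF w] N0 s by (intro powr_mono2') auto
      finally show "norm (- s * w powr (- s - 1)) \<le> ?B" by (simp add: norm_mult mult_left_mono)
    qed
    also have "\<dots> \<le> ?B * 1" using S(4)[OF z] by (intro mult_left_mono) (auto simp: norm_minus_commute)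
    finally show ?thesis by simp
  qed
  \<comment> \<open>An antiderivative in \<open>z\<close> of \<open>np s N - z powr (- s)\<close>;
    its increment from \<open>N\<close> to \<open>Suc N\<close> is \<open>zterm s n\<close>.\<close>
  let ?D = "\<lambda>z. np s N * z - z powr (1 - s) / (1 - s)"
  have "norm (?D (of_nat (Suc N)) - ?D (of_nat N)) \<le> ?B * norm (of_nat (Suc N) - of_nat N :: complex)"
  proof (rule field_differentiable_bound[OF convex_closed_segment _ inner NS(2,1)])
    fix w assume w: "w \<in> ?S"
    have "((\<lambda>z. np s N * z - z powr (1 - s) / (1 - s)) has_field_derivative np s N * 1 - ((1 - s) * w powr (1 - s - 1)) / (1 - s)) (at w within ?S)"
      using S(1)[OF w] s by (auto intro!: derivative_eq_intros)
    moreover have "np s N * 1 - ((1 - s) * w powr (1 - s - 1)) / (1 - s) = np s N - w powr (- s)" using s by simp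
    ultimately show "(?D has_field_derivative np s N - w powr (- s)) (at w within ?S)" by (simp only:)
  qed
  moreover have "?D (of_nat (Suc N)) - ?D (of_nat N) = zterm s n"
    by (simp add: zterm_def N_def diff_divide_distrib algebra_simps)
  ultimately show ?thesis by (simp add: N_def)
qed

lemma zterm_summable:
  assumes s: "0 < Re s" "s \<noteq> 1" shows "summable (zterm s)"
proof (rule summable_comparison_test')
  have "summable (\<lambda>n. real n powr (- Re s - 1))" using s by (subst summable_real_powr_iff) simp
  then have "summable (\<lambda>n. real (Suc n) powr (- Re s - 1))" by (subst summable_Suc_iff)
  then show "summable (\<lambda>n. norm s * real (Suc n) powr (- Re s - 1))" by (rule summable_mult)
  show "norm (zterm s n) \<le> norm s * real (Suc n) powr (- Re s - 1)" if "n \<ge> 0" for n by (rule norm_zterm_le[OF s])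
qed

text \<open>The subtracted terms telescope, and the power \<open>of_nat (Suc K) powr (1 - s)\<close>
  that remains tends to 0.\<close>

lemma zeta_sum_eq_zreg:
  assumes s: "1 < Re s" shows "zeta_sum s = zreg s + 1 / (s - 1)"
proof -
  have s1: "0 < Re s" "s \<noteq> 1" using s by auto
  have "(np s has_sum zeta_sum s) UNIV" unfolding zeta_sum_def using np_summable[OF s] by (rule has_sum_infsum)
  then have "np s sums zeta_sum s" by (rule has_sum_imp_sums)
  then have "(\<lambda>n. np s (Suc n)) sums zeta_sum s" by (subst sums_Suc_iff) simp
  then have 1: "(\<lambda>K. \<Sum>n<K. np s (Suc n)) \<longlonglongrightarrow> zeta_sum s" by (simp add: sums_def)
  have part: "(\<Sum>n<K. zterm s n) = (\<Sum>n<K. np s (Suc n)) - (of_nat (Suc K) powr (1 - s) - 1) / (1 - s)" for K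
    by (induction K) (simp_all add: zterm_def diff_divide_distrib)
  have "(\<lambda>K. of_nat (Suc K) powr (1 - s) :: complex) \<longlonglongrightarrow> 0"
  proof (rule Lim_null_comparison)
    show "\<forall>\<^sub>F K in sequentially. norm (of_nat (Suc K) powr (1 - s) :: complex) \<le> real (Suc K) powr (1 - Re s)"
      by (rule always_eventually, rule allI, subst norm_powr_real_powr) auto
    show "(\<lambda>K. real (Suc K) powr (1 - Re s)) \<longlonglongrightarrow> 0"
    proof (rule LIMSEQ_Suc)
      show "(\<lambda>K. real K powr (1 - Re s)) \<longlonglongrightarrow> 0"
        using s by (intro tendsto_neg_powr filterlim_real_sequentially) simp
    qed
  qed
  then have "(\<lambda>K. \<Sum>n<K. zterm s n) \<longlonglongrightarrow> zeta_sum s - (0 - 1) / (1 - s)"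
    unfolding part using s1 by (intro tendsto_intros 1) auto
  moreover have "(\<lambda>K. \<Sum>n<K. zterm s n) \<longlonglongrightarrow> zreg s"
    unfolding zreg_def by (rule summable_LIMSEQ[OF zterm_summable[OF s1]])
  ultimately have "zeta_sum s - (0 - 1) / (1 - s) = zreg s" by (rule LIMSEQ_unique)
  moreover have "(0 - 1) / (1 - s) = 1 / (s - 1)" using s1 by (simp add: divide_simps)
  ultimately show ?thesis by (simp only:) (metis diff_add_cancel)
qed

text \<open>The distance 1/2 from the line \<open>Re s = 0\<close> gives a uniform majorant with
  exponent \<open>- 3 / 2\<close>; the point 1 is left out because \<open>zterm\<close> divides by
  \<open>1 - s\<close>.\<close>

definition half :: "complex set" where "half = {s. 1/2 < Re s} - {1}"

lemma open_half: "open half"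
  unfolding half_def by (intro open_Diff open_halfspace_Re_gt) auto

lemma zreg_holomorphic: "zreg holomorphic_on half"
proof (rule holomorphic_uniform_sequence[OF open_half])
  show "(\<lambda>s. \<Sum>n<K. zterm s n) holomorphic_on half" for K
    unfolding zterm_def np_def half_def by (intro holomorphic_intros) auto
  fix s assume "s \<in> half"
  then obtain d where d: "0 < d" "cball s d \<subseteq> half" using open_half open_contains_cball by blast
  define C where "C = norm s + d"
  have "uniform_limit (cball s d) (\<lambda>K z. \<Sum>n<K. zterm z n) (\<lambda>z. \<Sum>n. zterm z n) sequentially"
  proof (rule Weierstrass_m_test)
    fix n z assume z: "z \<in> cball s d"
    then have "z \<in> half" using d by blast
    then have z': "0 < Re z" "z \<noteq> 1" "1/2 \<le> Re z" by (auto simp: half_def)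
    have "norm (z - s) \<le> d" using z by (simp add: dist_norm norm_minus_commute)
    then have "norm z \<le> C" unfolding C_def using norm_triangle_sub[of z s] by linarith
    moreover have "real (Suc n) powr (- Re z - 1) \<le> real (Suc n) powr (- 3 / 2)" using z' by (intro powr_mono) auto
    ultimately have "norm z * real (Suc n) powr (- Re z - 1) \<le> C * real (Suc n) powr (- 3 / 2)"
      by (intro mult_mono) (auto intro: order_trans[OF norm_ge_zero])
    then show "norm (zterm z n) \<le> C * real (Suc n) powr (- 3 / 2)" using norm_zterm_le[OF z'(1,2), of n] by linarith
  next
    have "summable (\<lambda>n. real n powr (- 3 / 2))" by (subst summable_real_powr_iff) simp
    then have "summable (\<lambda>n. real (Suc n) powr (- 3 / 2))" by (subst summable_Suc_iff)
    then show "summable (\<lambda>n. C * real (Suc n) powr (- 3 / 2))" by (rule summable_mult)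
  qed
  then show "\<exists>d>0. cball s d \<subseteq> half \<and> uniform_limit (cball s d) (\<lambda>K z. \<Sum>n<K. zterm z n) zreg sequentially"
    unfolding zreg_def[abs_def] using d by blast
qed

definition zeta_ext :: "complex \<Rightarrow> complex" where "zeta_ext s = zreg s + 1 / (s - 1)"

lemma zeta_ext_holomorphic: "zeta_ext holomorphic_on half"
  unfolding zeta_ext_def by (intro holomorphic_intros zreg_holomorphic) (auto simp: half_def)

text \<open>Boundedness near 1 takes the place of holomorphy there: it makes
  \<open>(s - 1) * zreg s\<close> tend to 0 at the pole of zeta without assigning
  \<open>zreg\<close> its correct value at 1.\<close>

lemma zreg_bounded:
  obtains C where "\<And>s. 1 \<le> Re s \<Longrightarrow> s \<noteq> 1 \<Longrightarrow> norm s \<le> 2 \<Longrightarrow> norm (zreg s) \<le> C"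
proof -
  have "summable (\<lambda>n. real n powr (- 2))" by (subst summable_real_powr_iff) simp
  then have "summable (\<lambda>n. real (Suc n) powr (- 2))" by (subst summable_Suc_iff)
  then have sm: "summable (\<lambda>n. 2 * real (Suc n) powr (- 2))" by (rule summable_mult)
  show thesis
  proof (rule that)
    fix s :: complex assume s: "1 \<le> Re s" "s \<noteq> 1" "norm s \<le> 2"
    show "norm (zreg s) \<le> (\<Sum>n. 2 * real (Suc n) powr (- 2))"
      unfolding zreg_def
    proof (rule norm_suminf_le[OF _ sm])
      fix n
      have "norm (zterm s n) \<le> norm s * real (Suc n) powr (- Re s - 1)" using s by (intro norm_zterm_le) auto
      also have "\<dots> \<le> 2 * real (Suc n) powr (- 2)" using s by (intro mult_mono powr_mono) auto
      finally show "norm (zterm s n) \<le> 2 * real (Suc n) powr (- 2)" .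
    qed
  qed
qed

lemma continuous_zeta_ext: "s \<in> half \<Longrightarrow> isCont zeta_ext s"
  using zeta_ext_holomorphic holomorphic_on_imp_continuous_on open_half continuous_on_eq_continuous_at by blast

lemma Complex_vertical_tendsto: "((\<lambda>\<sigma>. Complex \<sigma> t) \<longlongrightarrow> Complex 1 t) (at_right 1)"
  by (intro tendsto_Complex tendsto_const tendsto_ident_at)

text \<open>The 3-4-1 inequality: a zero at \<open>1 + i t\<close> would make the product tend to \<open>0\<close> as \<open>\<sigma>\<close> tends to \<open>1\<close>,
  since four factors vanish there against a pole of order three.\<close>

lemma zeta_ext_nonzero_line:
  assumes t: "t \<noteq> 0" shows "zeta_ext (Complex 1 t) \<noteq> 0"
proof
  assume zero: "zeta_ext (Complex 1 t) = 0"
  let ?F = "at_right (1::real)"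
  have s0: "Complex 1 t \<in> half" "Complex 1 (2 * t) \<in> half" using t by (auto simp: half_def complex_eq_iff)
  have ev1: "\<forall>\<^sub>F \<sigma> in ?F. 1 < \<sigma>" by (rule eventually_at_right_less)
  have ev2: "\<forall>\<^sub>F \<sigma> in ?F. \<sigma> < 2" by (rule order_tendstoD(2)[OF tendsto_ident_at]) simp
  obtain C where C: "\<And>s. 1 \<le> Re s \<Longrightarrow> s \<noteq> 1 \<Longrightarrow> norm s \<le> 2 \<Longrightarrow> norm (zreg s) \<le> C" using zreg_bounded by blast
  have 1: "((\<lambda>\<sigma>. norm (of_real (\<sigma> - 1) * zeta_ext (Complex \<sigma> 0))) \<longlongrightarrow> norm (1::complex)) ?F"
  proof (rule tendsto_norm)
    have "((\<lambda>\<sigma>. of_real (\<sigma> - 1) * zreg (Complex \<sigma> 0)) \<longlongrightarrow> 0) ?F"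
    proof (rule Lim_null_comparison)
      show "\<forall>\<^sub>F \<sigma> in ?F. norm (of_real (\<sigma> - 1) * zreg (Complex \<sigma> 0)) \<le> (\<sigma> - 1) * C"
        using ev1 ev2
      proof eventually_elim
        case (elim \<sigma>)
        have "norm (Complex \<sigma> 0) = \<sigma>" using elim by (simp add: cmod_def)
        then have "norm (zreg (Complex \<sigma> 0)) \<le> C" using elim by (intro C) (auto simp: complex_eq_iff)
        moreover have "norm (of_real (\<sigma> - 1) :: complex) = \<sigma> - 1" using elim by (subst norm_of_real) simp
        ultimately show ?case using elim unfolding norm_mult by (simp only: mult_left_mono)
      qed
      show "((\<lambda>\<sigma>. (\<sigma> - 1) * C) \<longlongrightarrow> 0) ?F" by (auto intro!: tendsto_eq_intros)
    qed
    then have tl: "((\<lambda>\<sigma>. of_real (\<sigma> - 1) * zreg (Complex \<sigma> 0) + 1) \<longlongrightarrow> 0 + 1) ?F" by (intro tendsto_add tendsto_const)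
    have ev: "\<forall>\<^sub>F \<sigma> in ?F. of_real (\<sigma> - 1) * zreg (Complex \<sigma> 0) + 1 = of_real (\<sigma> - 1) * zeta_ext (Complex \<sigma> 0)"
      using ev1
    proof eventually_elim
      case (elim \<sigma>)
      have e: "Complex \<sigma> 0 - 1 = of_real (\<sigma> - 1)" by (simp add: complex_eq_iff)
      have "k * z + 1 = k * (z + 1 / k)" if "k \<noteq> 0" for k z :: complex using that by (simp add: field_simps)
      moreover have "of_real (\<sigma> - 1) \<noteq> (0::complex)" using elim by simp
      ultimately show ?case unfolding zeta_ext_def e .
    qed
    from tendsto_cong[OF ev, THEN iffD1, OF tl]
    show "((\<lambda>\<sigma>. of_real (\<sigma> - 1) * zeta_ext (Complex \<sigma> 0)) \<longlongrightarrow> 1) ?F" by (simp only: add_0)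
  qed
  obtain D where D: "(zeta_ext has_field_derivative D) (at (Complex 1 t))"
    using zeta_ext_holomorphic s0(1) open_half holomorphic_on_imp_differentiable_at field_differentiable_def by blast
  have 2: "((\<lambda>\<sigma>. norm (zeta_ext (Complex \<sigma> t) / of_real (\<sigma> - 1))) \<longlongrightarrow> norm D) ?F"
  proof (rule tendsto_norm)
    have "((\<lambda>s. (zeta_ext s - zeta_ext (Complex 1 t)) / (s - Complex 1 t)) \<longlongrightarrow> D) (at (Complex 1 t))"
      using D by (simp add: has_field_derivative_iff)
    moreover have "filterlim (\<lambda>\<sigma>. Complex \<sigma> t) (at (Complex 1 t)) ?F"
      unfolding filterlim_at using Complex_vertical_tendsto ev1 by (auto elim!: eventually_mono)
    ultimately have "((\<lambda>\<sigma>. (zeta_ext (Complex \<sigma> t) - zeta_ext (Complex 1 t)) / (Complex \<sigma> t - Complex 1 t)) \<longlongrightarrow> D) ?F"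
      by (rule filterlim_compose)
    moreover have "Complex \<sigma> t - Complex 1 t = of_real (\<sigma> - 1)" for \<sigma> by (simp add: complex_eq_iff)
    ultimately show "((\<lambda>\<sigma>. zeta_ext (Complex \<sigma> t) / of_real (\<sigma> - 1)) \<longlongrightarrow> D) ?F" by (simp only: zero diff_0_right)
  qed
  have 3: "((\<lambda>\<sigma>. norm (zeta_ext (Complex \<sigma> (2 * t)))) \<longlongrightarrow> norm (zeta_ext (Complex 1 (2 * t)))) ?F"
    by (intro tendsto_norm isCont_tendsto_compose[OF continuous_zeta_ext[OF s0(2)]] Complex_vertical_tendsto)
  have 4: "((\<lambda>\<sigma>. \<sigma> - 1) \<longlongrightarrow> 0) ?F" by (auto intro!: tendsto_eq_intros)
  let ?P = "\<lambda>\<sigma>. norm (of_real (\<sigma> - 1) * zeta_ext (Complex \<sigma> 0)) ^ 3 * norm (zeta_ext (Complex \<sigma> t) / of_real (\<sigma> - 1)) ^ 4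
      * norm (zeta_ext (Complex \<sigma> (2 * t))) * (\<sigma> - 1)"
  have "(?P \<longlongrightarrow> norm (1::complex) ^ 3 * norm D ^ 4 * norm (zeta_ext (Complex 1 (2 * t))) * 0) ?F"
    by (intro tendsto_intros 1 2 3 4)
  then have "(?P \<longlongrightarrow> 0) ?F" by simp
  moreover have "\<forall>\<^sub>F \<sigma> in ?F. 1 \<le> ?P \<sigma>"
    using ev1
  proof eventually_elim
    case (elim \<sigma>)
    have z: "zeta_sum (Complex \<sigma> u) = zeta_ext (Complex \<sigma> u)" for u
      unfolding zeta_ext_def using elim by (intro zeta_sum_eq_zreg) simp
    have alg: "(k * x) ^ 3 * (y / k) ^ 4 * z * k = x ^ 3 * y ^ 4 * z" if "k \<noteq> 0" for k x y z :: real
      using that by (simp add: power_mult_distrib power_divide eval_nat_numeral)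
    have k: "norm (of_real (\<sigma> - 1) :: complex) = \<sigma> - 1" using elim by (subst norm_of_real) simp
    have P_eq: "?P \<sigma> = norm (zeta_ext (Complex \<sigma> 0)) ^ 3 * norm (zeta_ext (Complex \<sigma> t)) ^ 4 * norm (zeta_ext (Complex \<sigma> (2 * t)))"
      unfolding norm_mult norm_divide k using elim by (intro alg) simp
    show ?case unfolding P_eq using three_four_one[OF elim, of t] unfolding z .
  qed
  ultimately have "1 \<le> (0::real)" by (rule tendsto_lowerbound) simp
  then show False by simp
qed

text \<open>The reciprocal of \<open>zeta_ext\<close>, with numerator and denominator multiplied by
  \<open>s - 1\<close>. At \<open>s = 1\<close> it is 0, as the pole demands, whatever value
  \<open>zreg\<close> has there.\<close>

definition inv_zeta :: "complex \<Rightarrow> complex" where "inv_zeta s = (s - 1) / (1 + (s - 1) * zreg s)"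

lemma inv_zeta_denominator:
  assumes s: "1 \<le> Re s" "s \<noteq> 1" shows "1 + (s - 1) * zreg s \<noteq> 0"
proof -
  have eq: "1 + (s - 1) * zreg s = (s - 1) * zeta_ext s" using s by (simp add: zeta_ext_def field_simps)
  have "zeta_ext s \<noteq> 0"
  proof (cases "Re s = 1")
    case True
    then have "s = Complex 1 (Im s)" "Im s \<noteq> 0" using s by (auto simp: complex_eq_iff)
    then show ?thesis using zeta_ext_nonzero_line by metis
  next
    case False
    then have "1 < Re s" using s by simp
    then show ?thesis using zeta_mult_mu_sum[of s] zeta_sum_eq_zreg[of s] by (auto simp: zeta_ext_def)
  qed
  then show ?thesis using eq s by simp
qed

lemma mu_sum_eq_inv_zeta:
  assumes s: "1 < Re s" shows "mu_sum s = inv_zeta s"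
proof -
  have s1: "s \<noteq> 1" using s by auto
  have "zeta_sum s * (s - 1) = 1 + (s - 1) * zreg s"
    using s1 by (simp add: zeta_sum_eq_zreg[OF s] field_simps)
  moreover have "zeta_sum s * mu_sum s = 1" by (rule zeta_mult_mu_sum[OF s])
  ultimately have "mu_sum s * (1 + (s - 1) * zreg s) = s - 1" by (metis mult.commute mult.left_commute mult_1_right)
  then show ?thesis using inv_zeta_denominator[of s] s s1 by (simp add: inv_zeta_def eq_divide_eq)
qed

lemma inv_zeta_continuous: "continuous_on {s. 1 \<le> Re s} inv_zeta"
  unfolding continuous_on_eq_continuous_within
proof
  fix s assume "s \<in> {s. 1 \<le> Re s}"
  then have s: "1 \<le> Re s" by simp
  show "continuous (at s within {s. 1 \<le> Re s}) inv_zeta"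
  proof (cases "s = 1")
    case False
    then have "s \<in> half" using s by (simp add: half_def)
    then have "isCont zreg s" using zreg_holomorphic holomorphic_on_imp_continuous_on open_half continuous_on_eq_continuous_at by blast
    then have "isCont inv_zeta s" unfolding inv_zeta_def using inv_zeta_denominator[OF s False] by (intro continuous_intros) auto
    then show ?thesis by (rule continuous_at_imp_continuous_at_within)
  next
    case True
    obtain C where C: "\<And>s. 1 \<le> Re s \<Longrightarrow> s \<noteq> 1 \<Longrightarrow> norm s \<le> 2 \<Longrightarrow> norm (zreg s) \<le> C" using zreg_bounded by blast
    let ?F = "at 1 within {s. 1 \<le> Re s}"
    have near: "\<forall>\<^sub>F s in ?F. 1 \<le> Re s \<and> s \<noteq> 1 \<and> norm s \<le> 2"
    proof -
      have "\<forall>\<^sub>F s in ?F. norm (s - 1) < 1"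
        using tendsto_ident_at[of "1::complex" "{s. 1 \<le> Re s}"] unfolding tendsto_iff dist_norm by simp
      moreover have "\<forall>\<^sub>F s in ?F. s \<in> {s. 1 \<le> Re s} \<and> s \<noteq> 1" by (simp add: eventually_at_filter)
      ultimately show ?thesis
      proof eventually_elim
        case (elim s)
        have "norm s \<le> norm (s - 1) + norm (1::complex)" using norm_triangle_ineq[of "s - 1" 1] by simp
        then show ?case using elim by simp
      qed
    qed
    have s1: "((\<lambda>s. s - 1) \<longlongrightarrow> 1 - 1) ?F" by (intro tendsto_intros)
    have "((\<lambda>s. (s - 1) * zreg s) \<longlongrightarrow> 0) ?F"
    proof (rule Lim_null_comparison)
      show "\<forall>\<^sub>F s in ?F. norm ((s - 1) * zreg s) \<le> norm (s - 1) * C"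
        using near by eventually_elim (auto simp: norm_mult intro!: mult_left_mono C)
      show "((\<lambda>s. norm (s - 1) * C) \<longlongrightarrow> 0) ?F" using tendsto_mult_left_zero[OF tendsto_norm_zero[OF s1[simplified]]] .
    qed
    then have "(inv_zeta \<longlongrightarrow> (1 - 1) / (1 + 0)) ?F"
      unfolding inv_zeta_def by (intro tendsto_intros s1) auto
    then show ?thesis unfolding True continuous_within by (simp add: inv_zeta_def)
  qed
qed

section \<open>The mean of the Moebius function\<close>

definition fejer_weight :: "real \<Rightarrow> real \<Rightarrow> real" where "fejer_weight R y = max 0 (1 - \<bar>y\<bar> / R)"

text \<open>The Fourier transform of \<open>fejer_weight R\<close>: for \<open>w \<noteq> 0\<close>
  it is \<open>R\<close> times the square of \<open>sin (R * w / 2) / (R * w / 2)\<close>.\<close>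

definition fejer_kernel :: "real \<Rightarrow> real \<Rightarrow> real" where
  "fejer_kernel R w = (if w = 0 then R else (2 - 2 * cos (R * w)) / (R * w\<^sup>2))"

lemma fejer_weight:
  assumes "0 < R"
  shows "0 \<le> fejer_weight R y" "fejer_weight R y \<le> 1" "continuous_on A (fejer_weight R)"
    "y \<notin> {-R..R} \<Longrightarrow> fejer_weight R y = 0"
proof -
  show "0 \<le> fejer_weight R y" "fejer_weight R y \<le> 1" using assms by (auto simp: fejer_weight_def)
  show "continuous_on A (fejer_weight R)" unfolding fejer_weight_def using assms by (intro continuous_intros) auto
  assume "y \<notin> {-R..R}"
  then have "R < \<bar>y\<bar>" by auto
  then show "fejer_weight R y = 0" using assms by (simp add: fejer_weight_def field_simps)
qed

lemma fejer_kernel_integral: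
  assumes R: "0 < R"
  shows "((\<lambda>y. of_real (fejer_weight R y) * exp (\<i> * of_real (w * y))) has_integral of_real (fejer_kernel R w)) {-R..R}"
proof -
  let ?f = "\<lambda>y. of_real (fejer_weight R y) * exp (\<i> * of_real (w * y))"
  have pos: "fejer_weight R y = 1 - y / R" if "y \<in> {0..R}" for y using that R by (simp add: fejer_weight_def)
  have neg: "fejer_weight R y = 1 + y / R" if "y \<in> {-R..0}" for y using that R by (simp add: fejer_weight_def field_simps)
  show ?thesis
  proof (cases "w = 0")
    case True
    define A where "A s y = of_real y + s * (of_real y)\<^sup>2 / (2 * of_real R)" for s :: complex and y
    have 1: "(?f has_integral (A (-1) R - A (-1) 0)) {0..R}"
      unfolding A_def using R by (intro fundamental_theorem_of_calculus)
        (auto simp: True pos field_simps intro!: has_vector_derivative_real_field derivative_eq_intros)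
    have 2: "(?f has_integral (A 1 0 - A 1 (-R))) {-R..0}"
      unfolding A_def using R by (intro fundamental_theorem_of_calculus)
        (auto simp: True neg field_simps intro!: has_vector_derivative_real_field derivative_eq_intros)
    have "of_real (fejer_kernel R w) = (A 1 0 - A 1 (-R)) + (A (-1) R - A (-1) 0)"
      using R True by (simp add: A_def fejer_kernel_def power2_eq_square field_simps)
    then show ?thesis using has_integral_combine[OF _ _ 2 1] R by simp
  next
    case w: False
    define c where "c = \<i> * of_real w"
    have c: "c \<noteq> 0" "c\<^sup>2 = - of_real (w\<^sup>2)" using w by (simp_all add: c_def power_mult_distrib)
    have e: "exp (\<i> * of_real (w * y)) = exp (c * of_real y)" for y by (simp add: c_def mult.assoc)
    \<comment> \<open>\<open>A\<close> and \<open>B\<close> come from partial integration on the two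
      halves. The weight vanishes at both ends and the terms \<open>1 / c\<close> at 0 cancel, so
      only the terms with \<open>c\<^sup>2\<close> in the denominator survive.\<close>
    define A where "A = (\<lambda>y. (1 - of_real y / of_real R) * exp (c * of_real y) / c + exp (c * of_real y) / (of_real R * c\<^sup>2))"
    define B where "B = (\<lambda>y. (1 + of_real y / of_real R) * exp (c * of_real y) / c - exp (c * of_real y) / (of_real R * c\<^sup>2))"
    have 1: "(?f has_integral (A R - A 0)) {0..R}"
      unfolding A_def e using R c(1) by (intro fundamental_theorem_of_calculus)
        (auto simp: pos power2_eq_square field_simps intro!: has_vector_derivative_real_field derivative_eq_intros)
    have 2: "(?f has_integral (B 0 - B (-R))) {-R..0}"
      unfolding B_def e using R c(1) by (intro fundamental_theorem_of_calculus)
        (auto simp: neg power2_eq_square field_simps intro!: has_vector_derivative_real_field derivative_eq_intros)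
    have "exp (c * of_real R) + exp (c * of_real (- R)) = 2 * cos (of_real (R * w))"
      unfolding cos_exp_eq by (simp add: c_def mult_ac)
    moreover have "cos (of_real (R * w)) = (of_real (cos (R * w)) :: complex)" by (rule cos_of_real)
    ultimately have ee: "exp (c * of_real R) + exp (c * of_real (- R)) = 2 * of_real (cos (R * w))" by simp
    have "(B 0 - B (-R)) + (A R - A 0) = (exp (c * of_real R) + exp (c * of_real (- R)) - 2) / (of_real R * c\<^sup>2)"
      using R by (simp add: A_def B_def diff_divide_distrib add_divide_distrib)
    also have "\<dots> = of_real (fejer_kernel R w)"
      unfolding ee c(2) using R w by (simp add: fejer_kernel_def field_simps)
    finally show ?thesis using has_integral_combine[OF _ _ 2 1] R by simp
  qed
qed

lemma fejer_kernel_nonneg: "0 < R \<Longrightarrow> 0 \<le> fejer_kernel R w"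
  by (auto simp: fejer_kernel_def intro!: divide_nonneg_nonneg)

lemma fejer_kernel_le:
  assumes "0 < R" "w \<noteq> 0" shows "fejer_kernel R w \<le> 4 / (R * w\<^sup>2)"
proof -
  have "2 - 2 * cos (R * w) \<le> 4" using cos_ge_minus_one[of "R * w"] by linarith
  then show ?thesis using assms by (simp add: fejer_kernel_def divide_right_mono)
qed

lemma fejer_kernel_ge:
  assumes R: "0 < R" and w: "\<bar>R * w\<bar> \<le> 1" shows "R / 2 \<le> fejer_kernel R w"
proof (cases "w = 0")
  case False
  \<comment> \<open>With \<open>t\<close> half the argument, \<open>2 - 2 * cos (R * w)\<close> is
    \<open>4 * (sin t)\<^sup>2\<close>. The mean value theorem gives
    \<open>sin t \<ge> 7/8 * t\<close> for \<open>t \<le> 1/2\<close>, and the square of 7/8 exceeds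
    1/2.\<close>
  define t where "t = \<bar>R * w\<bar> / 2"
  have t: "0 < t" "t \<le> 1/2" using R w False by (auto simp: t_def)
  obtain z where z: "0 < z" "z < t" "sin t - sin 0 = (t - 0) * cos z"
    using MVT2[of 0 t sin cos] t DERIV_sin by blast
  have "cos z = 1 - 2 * (sin (z / 2))\<^sup>2" using cos_double_sin[of "z / 2"] by simp
  moreover have "\<bar>sin (z / 2)\<bar> \<le> 1/4" using abs_sin_x_le_abs_x[of "z / 2"] z t by simp
  then have "(sin (z / 2))\<^sup>2 \<le> (1/4)\<^sup>2" by (intro abs_le_square_iff[THEN iffD1]) simp
  ultimately have "7/8 \<le> cos z" by (simp add: power2_eq_square)
  then have "t * (7/8) \<le> sin t" using z(3) t by simp
  then have "(t * (7/8))\<^sup>2 \<le> (sin t)\<^sup>2" using t by (intro power_mono) auto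
  then have "t\<^sup>2 * (49/64) \<le> (sin t)\<^sup>2" unfolding power_mult_distrib by (simp add: power_divide)
  then have "t\<^sup>2 / 2 \<le> (sin t)\<^sup>2" using zero_le_power2[of t] by linarith
  moreover have "cos (R * w) = 1 - 2 * (sin t)\<^sup>2"
    using cos_double_sin[of t] unfolding t_def by simp
  moreover have "t\<^sup>2 = R\<^sup>2 * w\<^sup>2 / 4" by (simp add: t_def power_divide power_mult_distrib)
  ultimately have "R\<^sup>2 * w\<^sup>2 / 2 \<le> 2 - 2 * cos (R * w)" by simp
  moreover have "0 < R * w\<^sup>2" using R False by simp
  ultimately show ?thesis using False by (simp add: fejer_kernel_def le_divide_eq power2_eq_square)
qed (use R in \<open>simp add: fejer_kernel_def\<close>)

text \<open>The sum telescopes against the arc tangent.\<close>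

lemma sum_log_cauchy_le:
  assumes A: "A \<subseteq> {1..}" "finite A"
  shows "(\<Sum>n\<in>A. 1 / real n * (1 / (1 + (ln (real n) - v)\<^sup>2))) \<le> 1 + 3 * pi"
proof -
  let ?g = "\<lambda>n. 1 / real n * (1 / (1 + (ln (real n) - v)\<^sup>2))" and ?h = "\<lambda>n. arctan (ln (real n) - v)"
  have g0: "0 \<le> ?g n" for n by (intro mult_nonneg_nonneg divide_nonneg_nonneg) auto
  have le1: "1 / (1 + x\<^sup>2) \<le> 1" for x :: real by (subst divide_le_eq_1_pos) (auto intro: add_pos_nonneg)
  have step: "?g (Suc n) \<le> 3 * (?h (Suc n) - ?h n)" if "1 \<le> n" for n
  proof -
    have ln_less: "ln (real n) < ln (real (Suc n))" using that by simp
    obtain z where z: "ln (real n) - v < z" "z < ln (real (Suc n)) - v"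
      "?h (Suc n) - ?h n = (ln (real (Suc n)) - v - (ln (real n) - v)) * inverse (1 + z\<^sup>2)"
      using MVT2[of "ln (real n) - v" "ln (real (Suc n)) - v" arctan "\<lambda>z. inverse (1 + z\<^sup>2)"] ln_less DERIV_arctan by auto
    have n0: "0 < real n" using that by simp
    have "ln (real n / real (Suc n)) \<le> real n / real (Suc n) - 1" using n0 by (intro ln_le_minus_one) simp
    then have d1: "1 / real (Suc n) \<le> ln (real (Suc n)) - ln (real n)"
      using n0 by (simp add: ln_div field_simps)
    have "ln (real (Suc n) / real n) \<le> real (Suc n) / real n - 1" using n0 by (intro ln_le_minus_one) simp
    then have "ln (real (Suc n)) - ln (real n) \<le> 1 / real n" using n0 by (simp add: ln_div field_simps)
    also have "\<dots> \<le> 1" using that by simp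
    finally have d2: "ln (real (Suc n)) - ln (real n) \<le> 1" .
    define b where "b = ln (real (Suc n)) - v"
    have "\<bar>z - b\<bar> \<le> 1" using z(1,2) d2 by (simp add: b_def)
    then have "(z - b)\<^sup>2 \<le> 1" by (simp add: abs_square_le_1)
    \<comment> \<open>\<open>1 + z\<^sup>2 \<le> 3 * (1 + b\<^sup>2)\<close> written with squares:
      the intermediate point of the mean value theorem is replaced by the endpoint \<open>b\<close>,
      at distance at most 1, at the price of the factor 3.\<close>
    then have "0 \<le> (2 * b - z)\<^sup>2 + 2 * (1 - (z - b)\<^sup>2) + b\<^sup>2"
      by (intro add_nonneg_nonneg mult_nonneg_nonneg) auto
    also have "\<dots> = 3 * (1 + b\<^sup>2) - (1 + z\<^sup>2)" by (simp add: power2_eq_square algebra_simps)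
    finally have "0 \<le> 3 * (1 + b\<^sup>2) - (1 + z\<^sup>2)" .
    then have "1 + z\<^sup>2 \<le> 3 * (1 + b\<^sup>2)" by simp
    then have "1 / (1 + b\<^sup>2) \<le> 3 * inverse (1 + z\<^sup>2)"
      by (simp add: field_simps add_pos_nonneg)
    then have "1 / real (Suc n) * (1 / (1 + b\<^sup>2)) \<le> (ln (real (Suc n)) - ln (real n)) * (3 * inverse (1 + z\<^sup>2))"
      using d1 ln_less by (intro mult_mono) auto
    then show ?thesis using z(3) by (simp add: b_def)
  qed
  have upto: "(\<Sum>n=1..Suc N. ?g n) \<le> 1 + 3 * (?h (Suc N) - ?h 1)" for N
  proof (induction N)
    case 0 then show ?case using le1[of "v"] by simp
  next
    case (Suc N) then show ?case using step[of "Suc N"] by (subst sum.nat_ivl_Suc') (auto simp del: of_nat_Suc)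
  qed
  define N where "N = Max (insert 0 A)"
  have "A \<subseteq> {1..Suc N}" using A by (auto simp: N_def le_SucI)
  then have "(\<Sum>n\<in>A. ?g n) \<le> (\<Sum>n=1..Suc N. ?g n)" using g0 by (intro sum_mono2) auto
  also have "\<dots> \<le> 1 + 3 * (?h (Suc N) - ?h 1)" by (rule upto)
  also have "\<dots> \<le> 1 + 3 * pi"
    using arctan_bounded[of "ln (real (Suc N)) - v"] arctan_bounded[of "ln (real 1) - v"] by simp
  finally show ?thesis .
qed

text \<open>Translating the integrand by \<open>h = pi / v\<close> changes the sign of the
  exponential. So twice the integral equals the integral of \<open>F y - F (y + h)\<close> against
  the exponential, and this is at most \<open>D h\<close>, a modulus of continuity in the mean,
  which tends to 0 with \<open>h\<close>.\<close>

lemma riemann_lebesgue: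
  fixes F :: "real \<Rightarrow> complex"
  assumes F: "continuous_on UNIV F" "\<And>y. y \<notin> {-R..R} \<Longrightarrow> F y = 0"
  shows "((\<lambda>v. integral {-R..R} (\<lambda>y. F y * exp (\<i> * of_real (v * y)))) \<longlongrightarrow> 0) at_top"
proof -
  let ?I = "{-R-1..R+1}"
  define D where "D h = integral ?I (\<lambda>y. norm (F y - F (y + h)))" for h
  have Fc: "continuous_on A (\<lambda>x. F (g x))" if "continuous_on A g" for A :: "'b::topological_space set" and g
    using continuous_on_compose2[OF F(1) that] by simp
  have "continuous_on UNIV (\<lambda>h. integral (cbox (-R-1) (R+1)) (\<lambda>y. norm (F y - F (y + h))))"
    by (rule integral_continuous_on_param) (auto intro!: continuous_intros Fc simp: split_beta)
  then have Dc: "isCont D 0" by (simp add: D_def [abs_def] continuous_on_eq_continuous_at)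
  have h0: "((\<lambda>v. pi / v) \<longlongrightarrow> 0) at_top" by real_asymp
  have "D 0 = 0" by (simp add: D_def)
  then have Dlim: "((\<lambda>v. D (pi / v)) \<longlongrightarrow> 0) at_top"
    using isCont_tendsto_compose[OF Dc h0] by simp
  show ?thesis
  proof (rule Lim_null_comparison[OF _ Dlim])
    show "\<forall>\<^sub>F v in at_top. norm (integral {-R..R} (\<lambda>y. F y * exp (\<i> * of_real (v * y)))) \<le> D (pi / v)"
      using eventually_ge_at_top[of pi]
    proof eventually_elim
      case (elim v)
      define h where "h = pi / v"
      have v: "0 < v" using elim pi_gt_zero by linarith
      have h: "0 \<le> h" "h \<le> 1" using elim v by (auto simp: h_def)
      define G where "G y = F y * exp (\<i> * of_real (v * y))" for y
      have Gc: "continuous_on UNIV G" unfolding G_def using F(1) by (intro continuous_intros)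
      have G0: "G y = 0" if "y \<notin> {-R..R}" for y using F(2)[OF that] by (simp add: G_def)
      have G: "(G has_integral integral {-R..R} G) {-R..R}"
        using Gc continuous_on_subset by (intro integrable_integral integrable_continuous_interval) blast
      have G1: "(G has_integral integral {-R..R} G) ?I"
        by (rule has_integral_on_superset[OF G G0]) auto
      have "(G has_integral integral {-R..R} G) {-R-1+h..R+1+h}"
        by (rule has_integral_on_superset[OF G G0]) (use h in auto)
      then have G2: "((\<lambda>y. G (h + y)) has_integral integral {-R..R} G) ?I"
        using has_integral_shift_Icc_real[of G h "integral {-R..R} G" "-R-1" "R+1"] by (simp add: o_def)
      have shift: "exp (\<i> * of_real (v * (h + y))) = - exp (\<i> * of_real (v * y))" for y
      proof -
        have "\<i> * of_real (v * (h + y)) = \<i> * of_real (v * y) + of_real pi * \<i>"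
          using v by (simp add: h_def algebra_simps)
        then show ?thesis by (simp only: exp_add exp_pi_i mult_minus_right mult_1_right)
      qed
      have "G y + G (h + y) = (F y - F (y + h)) * exp (\<i> * of_real (v * y))" for y
        unfolding G_def shift by (simp add: algebra_simps)
      then have G3: "((\<lambda>y. (F y - F (y + h)) * exp (\<i> * of_real (v * y))) has_integral (2 * integral {-R..R} G)) ?I"
        using has_integral_add[OF G1 G2] by simp
      have "norm (integral ?I (\<lambda>y. (F y - F (y + h)) * exp (\<i> * of_real (v * y)))) \<le> D h"
        unfolding D_def
        by (intro integral_norm_bound_integral integrable_continuous_interval continuous_intros Fc)
          (auto simp: norm_mult)
      then have "norm (2 * integral {-R..R} G) \<le> D h" using integral_unique[OF G3] by simp
      then have "norm (integral {-R..R} G) \<le> D h" by (simp add: norm_mult) (smt (verit) norm_ge_zero)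
      then show ?case unfolding G_def [abs_def] h_def .
    qed
  qed
qed

text \<open>A Tauberian setting in the manner of Wiener and Ikehara: bounded coefficients and a
  Dirichlet series with continuous boundary values. It is applied to \<open>mertens n / n\<close>
  and to its negative.\<close>

locale boundary_series =
  fixes a :: "nat \<Rightarrow> real" and H :: "complex \<Rightarrow> complex"
  assumes bound: "\<bar>a n\<bar> \<le> 1"
    and H_cont: "continuous_on {s. 1 \<le> Re s} H"
    and H_sums: "1 < Re s \<Longrightarrow> (\<lambda>n. of_real (a n) * np s n) sums H s"
begin

text \<open>A smoothing of the values of \<open>H\<close> on the line at distance \<open>x\<close>
  from the boundary. For \<open>x > 0\<close>, integration term by term turns it into the sum of the
  \<open>a n\<close> weighted by \<open>n powr (- 1 - x)\<close> and by the Fejer kernel at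
  \<open>v - ln n\<close>, so it measures \<open>a\<close> near \<open>exp v\<close>.\<close>

definition Psi :: "real \<Rightarrow> real \<Rightarrow> real \<Rightarrow> complex" where
  "Psi R v x = integral {-R..R} (\<lambda>y. of_real (fejer_weight R y) * H (Complex (1 + x) y) * exp (\<i> * of_real (v * y)))"

lemma H_continuous_compose:
  assumes "continuous_on A g" "\<And>x. x \<in> A \<Longrightarrow> 1 \<le> Re (g x)" shows "continuous_on A (\<lambda>x. H (g x))"
  using continuous_on_compose2[OF H_cont assms(1)] assms(2) by auto

lemma Psi_sums:
  assumes R: "0 < R" and x: "0 < x"
  shows "(\<lambda>n. of_real (a n * (real n powr (- 1 - x) * fejer_kernel R (v - ln (real n))))) sums Psi R v x"
proof -
  let ?t = "\<lambda>n y. of_real (a n) * np (Complex (1 + x) y) n"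
  let ?k = "\<lambda>y. of_real (fejer_weight R y) * exp (\<i> * of_real (v * y))"
  have int: "((\<lambda>y. ?k y * ?t n y) has_integral of_real (a n * (real n powr (- 1 - x) * fejer_kernel R (v - ln (real n))))) {-R..R}" for n
  proof (cases "n = 0")
    case False
    have np: "np (Complex (1 + x) y) n = of_real (real n powr (- 1 - x)) * exp (- (\<i> * of_real (ln (real n) * y)))" for y
    proof -
      have "np (Complex 0 y) n = exp (- (\<i> * of_real (ln (real n) * y)))"
        using False by (simp add: np_def powr_def Complex_eq mult_ac)
      then show ?thesis using np_vertical(1)[of n "1 + x" y] False by simp
    qed
    have "((\<lambda>y. of_real (a n * real n powr (- 1 - x)) * (of_real (fejer_weight R y) * exp (\<i> * of_real ((v - ln (real n)) * y))))
        has_integral of_real (a n * real n powr (- 1 - x)) * of_real (fejer_kernel R (v - ln (real n)))) {-R..R}"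
      by (intro has_integral_mult_right fejer_kernel_integral R)
    moreover have "?k y * ?t n y =
        of_real (a n * real n powr (- 1 - x)) * (of_real (fejer_weight R y) * exp (\<i> * of_real ((v - ln (real n)) * y)))" for y
    proof -
      have "exp (\<i> * of_real ((v - ln (real n)) * y)) = exp (\<i> * of_real (v * y)) * exp (- (\<i> * of_real (ln (real n) * y)))"
        unfolding exp_add[symmetric] by (rule arg_cong[where f = exp]) (simp add: algebra_simps)
      then show ?thesis unfolding np by simp
    qed
    ultimately show ?thesis by (simp only: of_real_mult mult.assoc)
  qed simp
  have k1: "norm (?k y) \<le> 1" for y using fejer_weight(1,2)[OF R, of y] by (simp add: norm_mult)
  have "uniform_limit {-R..R} (\<lambda>N y. \<Sum>n<N. ?k y * ?t n y) (\<lambda>y. \<Sum>n. ?k y * ?t n y) sequentially"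
  proof (rule Weierstrass_m_test)
    show "summable (\<lambda>n. real n powr (- (1 + x)))" using x by (subst summable_real_powr_iff) simp
    fix n y
    have "norm (?t n y) \<le> real n powr (- (1 + x))"
      using mult_right_mono[OF bound[of n], of "real n powr (- (1 + x))"] by (simp add: norm_mult norm_np)
    then show "norm (?k y * ?t n y) \<le> real n powr (- (1 + x))"
      unfolding norm_mult[of "?k y"] using mult_mono[OF k1[of y], of "norm (?t n y)" "real n powr (- (1 + x))"] by simp
  qed
  moreover have "(\<Sum>n. ?k y * ?t n y) = of_real (fejer_weight R y) * H (Complex (1 + x) y) * exp (\<i> * of_real (v * y))" for y
    using sums_unique[OF sums_mult[OF H_sums[of "Complex (1 + x) y"], of "?k y"], symmetric] x by (simp add: mult_ac)
  ultimately have unif: "uniform_limit (cbox (-R) R) (\<lambda>N y. \<Sum>n<N. ?k y * ?t n y)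
      (\<lambda>y. of_real (fejer_weight R y) * H (Complex (1 + x) y) * exp (\<i> * of_real (v * y))) sequentially"
    by simp
  have np_cont: "continuous_on A (\<lambda>y. np (Complex (1 + x) y) n)" for A n
    unfolding np_def by (cases "n = 0") (auto intro!: continuous_intros)
  have "continuous_on (cbox (-R) R) (\<lambda>y. \<Sum>n<N. ?k y * ?t n y)" for N
    by (intro continuous_intros np_cont fejer_weight(3)[OF R])
  then obtain I :: "nat \<Rightarrow> complex" and J :: complex where IJ: "\<And>N. ((\<lambda>y. \<Sum>n<N. ?k y * ?t n y) has_integral I N) (cbox (-R) R)"
    "((\<lambda>y. of_real (fejer_weight R y) * H (Complex (1 + x) y) * exp (\<i> * of_real (v * y))) has_integral J) (cbox (-R) R)"
    "I \<longlonglongrightarrow> J"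
    by (rule uniform_limit_integral_cbox[OF unif]) auto
  have I: "I = (\<lambda>N. \<Sum>n<N. of_real (a n * (real n powr (- 1 - x) * fejer_kernel R (v - ln (real n)))))"
    by (rule ext, rule has_integral_unique[OF IJ(1)]) (unfold cbox_interval, intro has_integral_sum int finite_lessThan)
  have J: "Psi R v x = J" using integral_unique[OF IJ(2)] by (simp add: Psi_def)
  show ?thesis using IJ(3) unfolding sums_def I J .
qed

lemma Psi_tendsto: assumes R: "0 < R" shows "(Psi R v \<longlongrightarrow> Psi R v 0) (at_right 0)"
proof -
  have "continuous_on {0..1} (\<lambda>x. integral (cbox (-R) R)
      (\<lambda>y. of_real (fejer_weight R y) * H (Complex (1 + x) y) * exp (\<i> * of_real (v * y))))"
  proof (rule integral_continuous_on_param)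
    have "continuous_on ({0..1} \<times> cbox (-R) R) (\<lambda>z. of_real (fejer_weight R (snd z)) * H (Complex (1 + fst z) (snd z)) * exp (\<i> * of_real (v * snd z)))"
      by (intro continuous_intros H_continuous_compose continuous_on_compose2[OF fejer_weight(3)[OF R, of UNIV]]) auto
    then show "continuous_on ({0..1} \<times> cbox (-R) R) (\<lambda>(x, y). of_real (fejer_weight R y) * H (Complex (1 + x) y) * exp (\<i> * of_real (v * y)))"
      by (simp add: split_beta)
  qed
  then have "continuous_on {0..1} (Psi R v)" by (simp add: Psi_def [abs_def])
  then have "(Psi R v \<longlongrightarrow> Psi R v 0) (at 0 within {0..1})" by (simp add: continuous_on_def)
  then show ?thesis using at_within_Icc_at_right[of 0 "1::real"] by simp
qed

text \<open>At \<open>x = 0\<close> the series is no longer at hand, but \<open>Psi\<close> is the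
  Fourier integral of a continuous function with compact support.\<close>

lemma Psi_vanish: assumes R: "0 < R" shows "((\<lambda>v. Psi R v 0) \<longlongrightarrow> 0) at_top"
  unfolding Psi_def
proof (rule riemann_lebesgue)
  show "continuous_on UNIV (\<lambda>y. of_real (fejer_weight R y) * H (Complex (1 + 0) y))"
    by (intro continuous_intros H_continuous_compose fejer_weight(3)[OF R]) auto
  show "of_real (fejer_weight R y) * H (Complex (1 + 0) y) = 0" if "y \<notin> {-R..R}" for y
    using fejer_weight(4)[OF R that] by simp
qed

text \<open>Inside \<open>W\<close> the coefficients are at least \<eta>. Outside,
  \<open>\<bar>a n\<bar> \<le> 1\<close> and the kernel is at most a multiple of
  \<open>1 / (R * (1 + w\<^sup>2))\<close> with \<open>w = ln n - v\<close>, which has a bounded sum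
  against \<open>1 / n\<close>. The series is available for \<open>x > 0\<close> only, so the
  estimate is made there with a constant free of \<open>x\<close> and then carried to
  \<open>x = 0\<close>.\<close>

lemma Psi_lower:
  assumes R: "0 < R" and \<kappa>: "0 < \<kappa>" and \<eta>: "0 \<le> \<eta>"
    and W: "finite W" "W \<subseteq> {1..}" "\<And>n. n \<in> W \<Longrightarrow> \<eta> \<le> a n" "\<And>n. 1 \<le> n \<Longrightarrow> n \<notin> W \<Longrightarrow> \<kappa> \<le> \<bar>ln (real n) - v\<bar>"
  shows "\<eta> * (\<Sum>n\<in>W. 1 / real n * fejer_kernel R (v - ln (real n))) - 4 / R * (1 + 1 / \<kappa>\<^sup>2) * (1 + 3 * pi) \<le> Re (Psi R v 0)"
proof -
  define C where "C = 4 / R * (1 + 1 / \<kappa>\<^sup>2) * (1 + 3 * pi)"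
  let ?K = "\<lambda>n. fejer_kernel R (v - ln (real n))"
  have far: "?K n \<le> 4 / R * (1 + 1 / \<kappa>\<^sup>2) * (1 / (1 + (ln (real n) - v)\<^sup>2))" if "1 \<le> n" "n \<notin> W" for n
  proof -
    define w where "w = ln (real n) - v"
    have w: "\<kappa> \<le> \<bar>w\<bar>" using W(4)[OF that] by (simp add: w_def)
    then have w2: "\<kappa>\<^sup>2 \<le> w\<^sup>2" using power_mono[OF w, of 2] \<kappa> by simp
    have w0: "0 < w\<^sup>2" using w2 \<kappa> by (smt (verit) zero_less_power)
    have "1 + w\<^sup>2 \<le> w\<^sup>2 * (1 + 1 / \<kappa>\<^sup>2)" using w2 \<kappa> by (simp add: field_simps)
    then have "1 / w\<^sup>2 \<le> (1 + 1 / \<kappa>\<^sup>2) * (1 / (1 + w\<^sup>2))" using w0 by (simp add: field_simps add_pos_pos)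
    then have "4 / R * (1 / w\<^sup>2) \<le> 4 / R * ((1 + 1 / \<kappa>\<^sup>2) * (1 / (1 + w\<^sup>2)))" using R by (intro mult_left_mono) auto
    moreover have "v - ln (real n) \<noteq> 0" "(v - ln (real n))\<^sup>2 = w\<^sup>2" using w \<kappa> by (auto simp: w_def power2_commute)
    then have "?K n \<le> 4 / R * (1 / w\<^sup>2)" using fejer_kernel_le[OF R, of "v - ln (real n)"] by simp
    ultimately show ?thesis by (simp add: w_def mult.assoc)
  qed
  have powr_le: "real n powr (- 1 - x) \<le> 1 / real n" if "1 \<le> n" "0 < x" for n x
  proof -
    have "real n powr (- 1 - x) \<le> real n powr (- 1)" using that by (intro powr_mono) auto
    then show ?thesis using that by (simp add: powr_minus_divide)
  qed
  have pos: "\<eta> * (\<Sum>n\<in>W. real n powr (- 1 - x) * ?K n) - C \<le> Re (Psi R v x)" if x: "0 < x" for x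
  proof -
    let ?t = "\<lambda>n. a n * (real n powr (- 1 - x) * ?K n)"
    have K0: "0 \<le> real n powr (- 1 - x) * ?K n" for n using fejer_kernel_nonneg[OF R] by simp
    have "(\<lambda>n. complex_of_real (?t n)) sums Psi R v x" by (rule Psi_sums[OF R x])
    then have "?t sums Re (Psi R v x)" using sums_Re by fastforce
    then have lim: "(\<lambda>N. \<Sum>n<N. ?t n) \<longlonglongrightarrow> Re (Psi R v x)" by (simp add: sums_def)
    obtain N0 where N0: "W \<subseteq> {..<N0}" using finite_nat_iff_bounded W(1) by blast
    have "\<eta> * (\<Sum>n\<in>W. real n powr (- 1 - x) * ?K n) - C \<le> (\<Sum>n<N. ?t n)" if N: "N0 \<le> N" for N
    proof -
      have WN: "W \<subseteq> {..<N}" using N0 N by auto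
      let ?V = "{..<N} - W - {0}"
      have "(\<Sum>n<N. ?t n) = (\<Sum>n\<in>{..<N} - W. ?t n) + (\<Sum>n\<in>W. ?t n)"
        by (rule sum.subset_diff[OF WN]) simp
      moreover have "(\<Sum>n\<in>{..<N} - W. ?t n) = (\<Sum>n\<in>?V. ?t n)"
        by (rule sum.mono_neutral_right) auto
      moreover have "\<eta> * (\<Sum>n\<in>W. real n powr (- 1 - x) * ?K n) \<le> (\<Sum>n\<in>W. ?t n)"
        unfolding sum_distrib_left by (intro sum_mono mult_right_mono W K0)
      moreover have "- C \<le> (\<Sum>n\<in>?V. ?t n)"
      proof -
        let ?c = "4 / R * (1 + 1 / \<kappa>\<^sup>2)"
        have t: "- (?c * (1 / real n * (1 / (1 + (ln (real n) - v)\<^sup>2)))) \<le> ?t n" if n: "n \<in> ?V" for n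
        proof -
          have n1: "1 \<le> n" "n \<notin> W" using n by auto
          have "\<bar>?t n\<bar> \<le> real n powr (- 1 - x) * ?K n"
            using mult_right_mono[OF bound[of n] K0[of n]] K0[of n] by (simp add: abs_mult[of "a n"])
          also have "\<dots> \<le> 1 / real n * (?c * (1 / (1 + (ln (real n) - v)\<^sup>2)))"
            using powr_le[OF n1(1) x] far[OF n1] fejer_kernel_nonneg[OF R] by (intro mult_mono) auto
          finally show ?thesis by (simp add: mult_ac)
        qed
        have "?c * (\<Sum>n\<in>?V. 1 / real n * (1 / (1 + (ln (real n) - v)\<^sup>2))) \<le> ?c * (1 + 3 * pi)"
          using R by (intro mult_left_mono sum_log_cauchy_le) auto
        then have "- C \<le> - (?c * (\<Sum>n\<in>?V. 1 / real n * (1 / (1 + (ln (real n) - v)\<^sup>2))))" by (simp add: C_def)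
        also have "\<dots> = (\<Sum>n\<in>?V. - (?c * (1 / real n * (1 / (1 + (ln (real n) - v)\<^sup>2)))))"
          by (simp only: sum_distrib_left sum_negf)
        also have "\<dots> \<le> (\<Sum>n\<in>?V. ?t n)" by (intro sum_mono t)
        finally show ?thesis .
      qed
      ultimately show ?thesis by linarith
    qed
    then show ?thesis by (intro LIMSEQ_le_const[OF lim]) blast
  qed
  have "((\<lambda>x. \<eta> * (\<Sum>n\<in>W. real n powr (- 1 - x) * ?K n) - C) \<longlongrightarrow> \<eta> * (\<Sum>n\<in>W. real n powr (- 1 - 0) * ?K n) - C) (at_right 0)"
    using W(2) by (intro tendsto_intros) auto
  moreover have "((\<lambda>x. Re (Psi R v x)) \<longlongrightarrow> Re (Psi R v 0)) (at_right 0)"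
    by (intro tendsto_Re Psi_tendsto R)
  moreover have "\<forall>\<^sub>F x in at_right 0. \<eta> * (\<Sum>n\<in>W. real n powr (- 1 - x) * ?K n) - C \<le> Re (Psi R v x)"
    using eventually_at_right_less[of "0::real"] by eventually_elim (rule pos)
  ultimately have "\<eta> * (\<Sum>n\<in>W. real n powr (- 1 - 0) * ?K n) - C \<le> Re (Psi R v 0)"
    by (intro tendsto_le[of "at_right (0::real)"]) simp_all
  moreover have "(\<Sum>n\<in>W. real n powr (- 1 - 0) * ?K n) = (\<Sum>n\<in>W. 1 / real n * ?K n)"
    using W(2) by (intro sum.cong refl) (auto simp: powr_minus_divide)
  ultimately show ?thesis by (simp add: C_def)
qed

text \<open>Only the \<open>n\<close> with \<open>\<bar>ln n - v\<bar> \<le> 1 / R\<close> are kept.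
  There are about \<open>B - A\<close> of them, each of weight at least
  \<open>1 / B * (R / 2)\<close>; as \<open>1 - A / B \<ge> 1 / R\<close>, they give 1/2 up to a
  rounding loss of at most \<open>R * exp (- v) / 2\<close>.\<close>

lemma window_weight:
  assumes R: "2 \<le> R" "1 / R \<le> \<kappa>" and v: "0 \<le> v" "R * exp (- v) \<le> 1/2"
    and W: "finite W" "W \<subseteq> {1..}" "\<And>n. 1 \<le> n \<Longrightarrow> n \<notin> W \<Longrightarrow> \<kappa> < \<bar>ln (real n) - v\<bar>"
  shows "1/4 \<le> (\<Sum>n\<in>W. 1 / real n * fejer_kernel R (v - ln (real n)))"
proof -
  define A B where "A = exp (v - 1 / R)" and "B = exp (v + 1 / R)"
  have AB: "0 < A" "A \<le> B" "1 \<le> B" using R v by (auto simp: A_def B_def)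
  let ?V = "{nat \<lceil>A\<rceil>..nat \<lfloor>B\<rfloor>}"
  have V: "1 \<le> n" "\<bar>ln (real n) - v\<bar> \<le> 1 / R" "real n \<le> B" if n: "n \<in> ?V" for n
  proof -
    have n': "A \<le> real n" "real n \<le> B" using n AB by (auto simp: nat_le_iff le_nat_iff ceiling_le_iff le_floor_iff)
    then show "1 \<le> n" "real n \<le> B" using AB by (auto simp: Suc_le_eq)
    have "0 < n" using n'(1) AB(1) by (cases n) auto
    then have "v - 1 / R \<le> ln (real n)" using n'(1) ln_ge_iff[of "real n" "v - 1 / R"] by (simp add: A_def)
    moreover have "ln (real n) \<le> v + 1 / R" using n' AB by (simp add: B_def) (metis exp_gt_zero ln_exp ln_mono order.strict_trans2 AB(1))
    ultimately show "\<bar>ln (real n) - v\<bar> \<le> 1 / R" by linarith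
  qed
  have VW: "?V \<subseteq> W"
  proof
    fix n assume n: "n \<in> ?V"
    show "n \<in> W" using W(3)[of n] V(1,2)[OF n] R(2) by (rule_tac ccontr) simp
  qed
  have low: "1 / B * (R / 2) \<le> 1 / real n * fejer_kernel R (v - ln (real n))" if n: "n \<in> ?V" for n
  proof (rule mult_mono)
    show "1 / B \<le> 1 / real n" using V(1,3)[OF n] by (intro divide_left_mono) auto
    have "R * \<bar>v - ln (real n)\<bar> \<le> R * (1 / R)" using V(2)[OF n] R by (intro mult_left_mono) auto
    then show "R / 2 \<le> fejer_kernel R (v - ln (real n))" using R by (intro fejer_kernel_ge) (auto simp: abs_mult)
  qed (use R in auto)
  have "B - A - 1 \<le> real (card ?V)" using AB by simp linarith
  then have "(B - A - 1) * (1 / B * (R / 2)) \<le> real (card ?V) * (1 / B * (R / 2))"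
    using AB R by (intro mult_right_mono) auto
  also have "\<dots> \<le> (\<Sum>n\<in>?V. 1 / real n * fejer_kernel R (v - ln (real n)))"
    using sum_mono[of ?V "\<lambda>_. 1 / B * (R / 2)", OF low] by simp
  also have "\<dots> \<le> (\<Sum>n\<in>W. 1 / real n * fejer_kernel R (v - ln (real n)))"
    using VW W(1) R fejer_kernel_nonneg[of R] by (intro sum_mono2) auto
  finally have 1: "(B - A - 1) * (1 / B * (R / 2)) \<le> (\<Sum>n\<in>W. 1 / real n * fejer_kernel R (v - ln (real n)))" .
  have "(B - A - 1) * (1 / B * (R / 2)) = R / 2 * (1 - A / B - 1 / B)" using AB by (simp add: field_simps)
  moreover have "A / B = exp (- (2 / R))" by (simp add: A_def B_def exp_diff[symmetric])
  moreover have "exp (- (2 / R)) \<le> 1 - 1 / R"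
  proof -
    have "1 + 2 / R \<le> exp (2 / R)" by (rule exp_ge_add_one_self)
    then have "exp (- (2 / R)) \<le> 1 / (1 + 2 / R)"
      using R by (simp add: exp_minus divide_simps mult.commute)
    also have "\<dots> \<le> 1 - 1 / R" using R by (simp add: field_simps)
    finally show ?thesis .
  qed
  moreover have "1 / B \<le> exp (- v)" using R by (simp add: B_def exp_minus[symmetric] inverse_eq_divide[symmetric])
  ultimately have "R / 2 * (1 / R - exp (- v)) \<le> (B - A - 1) * (1 / B * (R / 2))" using R by (simp only:) (intro mult_left_mono, auto)
  moreover have "R / 2 * (1 / R - exp (- v)) = 1/2 - R * exp (- v) / 2" using R by (simp add: field_simps)
  ultimately show ?thesis using 1 v(2) by linarith
qed

text \<open>If \<open>a n \<ge> \<eta>\<close>, then \<open>a\<close> stays above \<open>\<eta> / 2\<close> on a logarithmic window, on which the Fejer kernel has a fixed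
  mass independent of \<open>R\<close>, while its mass outside is of order \<open>1 / R\<close>.\<close>

theorem slowly_varying_upper:
  assumes slow: "\<And>\<eta>. 0 < \<eta> \<Longrightarrow> \<exists>\<kappa>>0. \<forall>n\<ge>1. \<eta> \<le> a n \<longrightarrow>
      (\<forall>m\<ge>1. ln (real n) \<le> ln (real m) \<longrightarrow> ln (real m) \<le> ln (real n) + 2 * \<kappa> \<longrightarrow> \<eta> / 2 \<le> a m)"
    and \<eta>: "0 < \<eta>"
  shows "\<forall>\<^sub>F n in sequentially. a n < \<eta>"
proof -
  obtain \<kappa> where \<kappa>: "0 < \<kappa>" and slow': "\<And>n m. 1 \<le> n \<Longrightarrow> \<eta> \<le> a n \<Longrightarrow> 1 \<le> m \<Longrightarrow> ln (real n) \<le> ln (real m) \<Longrightarrow>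
      ln (real m) \<le> ln (real n) + 2 * \<kappa> \<Longrightarrow> \<eta> / 2 \<le> a m"
    using slow[OF \<eta>] by blast
  define C where "C = 4 * (1 + 1 / \<kappa>\<^sup>2) * (1 + 3 * pi)"
  \<comment> \<open>Then \<open>C / R\<close>, the mass outside the window, is at most
    \<open>\<eta> / 16\<close>. The value of \<open>Psi\<close> will be strictly below
    \<open>\<eta> / 16\<close>, whereas the window contributes at least
    \<open>\<eta> / 8\<close>.\<close>
  define R where "R = max (max 2 (1 / \<kappa>)) (16 * C / \<eta>)"
  have R: "2 \<le> R" "1 / \<kappa> \<le> R" "16 * C / \<eta> \<le> R" by (auto simp: R_def)
  then have R': "1 / R \<le> \<kappa>" "C / R \<le> \<eta> / 16" using \<kappa> \<eta> by (simp_all add: field_simps)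
  have "\<forall>\<^sub>F v in at_top. norm (Psi R v 0) < \<eta> / 16"
    using tendstoD[OF Psi_vanish[of R], of "\<eta> / 16"] R(1) \<eta> by simp
  moreover have "((\<lambda>v. R * exp (- v)) \<longlongrightarrow> 0) at_top" by real_asymp
  then have "\<forall>\<^sub>F v in at_top. R * exp (- v) < 1/2" by (rule order_tendstoD) simp
  ultimately have "\<forall>\<^sub>F v in at_top. norm (Psi R v 0) < \<eta> / 16 \<and> R * exp (- v) < 1/2 \<and> 0 \<le> v"
    using eventually_ge_at_top[of "0::real"] by eventually_elim simp
  moreover have "filterlim (\<lambda>n. ln (real n) + \<kappa>) at_top sequentially" by real_asymp
  ultimately have "\<forall>\<^sub>F n in sequentially. norm (Psi R (ln (real n) + \<kappa>) 0) < \<eta> / 16 \<and>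
      R * exp (- (ln (real n) + \<kappa>)) < 1/2 \<and> 0 \<le> ln (real n) + \<kappa>"
    by (rule eventually_compose_filterlim)
  then show ?thesis using eventually_ge_at_top[of 1]
  proof eventually_elim
    case (elim n)
    show ?case
    proof (rule ccontr)
      assume "\<not> a n < \<eta>"
      then have an: "\<eta> \<le> a n" by simp
      \<comment> \<open>The centre of the window \<open>[ln n, ln n + 2 * \<kappa>]\<close>, which
        extends to the right of \<open>ln n\<close> only because \<open>slow\<close> controls larger
        \<open>m\<close> only.\<close>
      define v where "v = ln (real n) + \<kappa>"
      define W where "W = {m. 1 \<le> m \<and> \<bar>ln (real m) - v\<bar> \<le> \<kappa>}"
      have "m \<le> nat \<lceil>exp (v + \<kappa>)\<rceil>" if "m \<in> W" for m
      proof -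
        have "ln (real m) \<le> v + \<kappa>" "0 < real m" using that by (auto simp: W_def)
        then have "real m \<le> exp (v + \<kappa>)" by (metis exp_le_cancel_iff exp_ln)
        then show ?thesis by linarith
      qed
      then have fin: "finite W" using finite_nat_set_iff_bounded_le by blast
      have W1: "W \<subseteq> {1..}" by (auto simp: W_def)
      have "\<eta> / 2 * (\<Sum>n\<in>W. 1 / real n * fejer_kernel R (v - ln (real n))) - 4 / R * (1 + 1 / \<kappa>\<^sup>2) * (1 + 3 * pi) \<le> Re (Psi R v 0)"
      proof (rule Psi_lower[OF _ \<kappa> _ fin W1])
        show "\<eta> / 2 \<le> a m" if "m \<in> W" for m
          using that elim(2) by (intro slow'[OF _ an]) (auto simp: W_def v_def abs_le_iff)
      qed (use R \<eta> in \<open>auto simp: W_def\<close>)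
      moreover have "1/4 \<le> (\<Sum>n\<in>W. 1 / real n * fejer_kernel R (v - ln (real n)))"
        by (rule window_weight[OF R(1) R'(1) _ _ fin W1]) (use elim in \<open>auto simp: W_def v_def\<close>)
      then have "\<eta> / 2 * (1/4) \<le> \<eta> / 2 * (\<Sum>n\<in>W. 1 / real n * fejer_kernel R (v - ln (real n)))"
        using \<eta> by (intro mult_left_mono) auto
      moreover have "4 / R * (1 + 1 / \<kappa>\<^sup>2) * (1 + 3 * pi) = C / R" by (simp add: C_def)
      moreover have "Re (Psi R v 0) < \<eta> / 16" using elim(1) complex_Re_le_cmod[of "Psi R v 0"] by (simp add: v_def)
      ultimately show False using R'(2) by linarith
    qed
  qed
qed

end

section \<open>The summatory function of mu and its Dirichlet series\<close>

definition mertens :: "nat \<Rightarrow> real" where "mertens n = (\<Sum>k\<le>n. mu k)"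

lemma mertens_0 [simp]: "mertens 0 = 0" and mertens_Suc: "mertens (Suc n) = mertens n + mu (Suc n)"
  by (simp_all add: mertens_def)

lemma abs_mertens_diff: "m \<le> n \<Longrightarrow> \<bar>mertens n - mertens m\<bar> \<le> real n - real m"
proof (induction n rule: dec_induct)
  case (step n) then show ?case using abs_mu_le[of "Suc n"] by (simp add: mertens_Suc abs_if split: if_splits)
qed simp

lemma abs_mertens_le: "\<bar>mertens n\<bar> \<le> real n"
  using abs_mertens_diff[of 0 n] by simp

text \<open>Partial summation of the series of \<open>mu\<close> produces
  \<open>(np s (Suc n) - np s (Suc (Suc n))) / s\<close>, while the series of
  \<open>mertens n / n\<close> needs \<open>np (s + 1) (Suc n)\<close>. The difference is
  \<open>zterm (s + 1) n\<close>, small enough for absolute convergence on the closed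
  half-plane.\<close>

definition zeta_correction :: "complex \<Rightarrow> complex" where
  "zeta_correction s = (\<Sum>n. of_real (mertens (Suc n)) * zterm (s + 1) n)"

lemma norm_zeta_correction_term:
  assumes s: "1 \<le> Re s"
  shows "norm (of_real (mertens (Suc n)) * zterm (s + 1) n) \<le> norm (s + 1) * real (Suc n) powr (-2)"
proof -
  have s1: "0 < Re (s + 1)" "s + 1 \<noteq> 1" using s by (auto simp: complex_eq_iff)
  have "norm (of_real (mertens (Suc n)) * zterm (s + 1) n) \<le> real (Suc n) * (norm (s + 1) * real (Suc n) powr (- Re (s + 1) - 1))"
    unfolding norm_mult using abs_mertens_le[of "Suc n"] norm_zterm_le[OF s1, of n] by (intro mult_mono) auto
  also have "\<dots> = norm (s + 1) * (real (Suc n) powr 1 * real (Suc n) powr (- Re (s + 1) - 1))" by (simp add: mult_ac)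
  also have "\<dots> = norm (s + 1) * real (Suc n) powr (- Re s - 1)" 
    unfolding powr_add[symmetric] by (rule arg_cong[where f = "\<lambda>e. norm (s + 1) * real (Suc n) powr e"]) simp
  also have "\<dots> \<le> norm (s + 1) * real (Suc n) powr (-2)" using s by (intro mult_left_mono powr_mono) auto
  finally show ?thesis .
qed

lemma summable_Suc_powr_minus2: "summable (\<lambda>n. c * real (Suc n) powr (-2))"
proof -
  have "summable (\<lambda>n. real n powr (-2))" by (subst summable_real_powr_iff) simp
  then have "summable (\<lambda>n. real (Suc n) powr (-2))" by (subst summable_Suc_iff)
  then show ?thesis by (rule summable_mult)
qed

lemma zeta_correction_sums:
  assumes "1 \<le> Re s" shows "(\<lambda>n. of_real (mertens (Suc n)) * zterm (s + 1) n) sums zeta_correction s"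
  unfolding zeta_correction_def
  by (rule summable_sums, rule summable_comparison_test'[OF summable_Suc_powr_minus2]) (rule norm_zeta_correction_term[OF assms])

lemma zeta_correction_continuous: "continuous_on {s. 1 \<le> Re s} zeta_correction"
proof -
  have bdd: "continuous_on ({s. 1 \<le> Re s} \<inter> ball 0 B) zeta_correction" for B
  proof (rule uniform_limit_theorem[where F = sequentially])
    let ?S = "{s. 1 \<le> Re s} \<inter> ball 0 B"
    have "continuous_on ?S (\<lambda>s. zterm (s + 1) n)" for n
      unfolding zterm_def np_def by (intro continuous_intros) (auto simp: complex_eq_iff)
    then show "\<forall>\<^sub>F N in sequentially. continuous_on ?S (\<lambda>s. \<Sum>n<N. of_real (mertens (Suc n)) * zterm (s + 1) n)"
      by (intro always_eventually allI continuous_intros)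
    show "uniform_limit ?S (\<lambda>N s. \<Sum>n<N. of_real (mertens (Suc n)) * zterm (s + 1) n) zeta_correction sequentially"
      unfolding zeta_correction_def [abs_def]
    proof (rule Weierstrass_m_test[OF _ summable_Suc_powr_minus2])
      fix n s assume s: "s \<in> ?S"
      then have "norm (s + 1) \<le> B + 1" using norm_triangle_ineq[of s 1] by simp
      then have "norm (s + 1) * real (Suc n) powr (-2) \<le> (B + 1) * real (Suc n) powr (-2)" by (rule mult_right_mono) simp
      then show "norm (of_real (mertens (Suc n)) * zterm (s + 1) n) \<le> (B + 1) * real (Suc n) powr (-2)"
        using norm_zeta_correction_term[of s n] s by (auto intro: order_trans)
    qed
  qed simp
  show ?thesis
    unfolding continuous_on_eq_continuous_within
  proof
    fix s :: complex assume s: "s \<in> {s. 1 \<le> Re s}"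
    let ?B = "ball 0 (norm s + 1) :: complex set"
    have sB: "s \<in> {s. 1 \<le> Re s} \<inter> ?B" using s by simp
    have "continuous (at s within {s. 1 \<le> Re s} \<inter> ?B) zeta_correction"
      using bdd[of "norm s + 1"] sB by (simp only: continuous_on_eq_continuous_within)
    moreover have "at s within {s. 1 \<le> Re s} \<inter> ?B = at s within {s. 1 \<le> Re s}"
      by (rule at_within_nhd[of s ?B]) auto
    ultimately show "continuous (at s within {s. 1 \<le> Re s}) zeta_correction" by simp
  qed
qed

definition mertens_series :: "complex \<Rightarrow> complex" where
  "mertens_series s = inv_zeta s / s + zeta_correction s"

lemma mertens_series_continuous: "continuous_on {s. 1 \<le> Re s} mertens_series"
  unfolding mertens_series_def by (intro continuous_intros inv_zeta_continuous zeta_correction_continuous) auto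

lemma mertens_series_sums:
  assumes s: "1 < Re s" shows "(\<lambda>n. of_real (mertens n / real n) * np s n) sums mertens_series s"
proof -
  have s0: "s \<noteq> 0" using s by auto
  let ?d = "\<lambda>n. of_real (mertens (Suc n)) * (np s (Suc n) - np s (Suc (Suc n)))"
  have abel: "(\<Sum>n<N. ?d n) = (\<Sum>n<Suc N. of_real (mu n) * np s n) - of_real (mertens N) * np s (Suc N)" for N
    by (induction N) (simp_all add: mertens_Suc algebra_simps)
  have "(\<lambda>n. of_real (mu n) * np s n) sums mu_sum s"
    unfolding mu_sum_def by (rule has_sum_imp_sums, rule has_sum_infsum, rule mu_np_summable[OF s])
  then have 1: "(\<lambda>N. \<Sum>n<Suc N. of_real (mu n) * np s n) \<longlonglongrightarrow> mu_sum s"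
    unfolding sums_def by (rule LIMSEQ_Suc)
  have "(\<lambda>N. of_real (mertens N) * np s (Suc N)) \<longlonglongrightarrow> 0"
  proof (rule Lim_null_comparison)
    show "\<forall>\<^sub>F N in sequentially. norm (of_real (mertens N) * np s (Suc N)) \<le> real (Suc N) powr (1 - Re s)"
    proof (intro always_eventually allI)
      fix N
      have "\<bar>mertens N\<bar> \<le> real (Suc N)" using abs_mertens_le[of N] by simp
      then have "norm (of_real (mertens N) * np s (Suc N)) \<le> real (Suc N) powr 1 * real (Suc N) powr (- Re s)"
        unfolding norm_mult norm_np by (intro mult_mono) auto
      then show "norm (of_real (mertens N) * np s (Suc N)) \<le> real (Suc N) powr (1 - Re s)"
        unfolding powr_add[symmetric] by simp
    qed
    have "(\<lambda>N. real N powr (1 - Re s)) \<longlonglongrightarrow> 0"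
      using s by (intro tendsto_neg_powr filterlim_real_sequentially) simp
    then show "(\<lambda>N. real (Suc N) powr (1 - Re s)) \<longlonglongrightarrow> 0" by (rule LIMSEQ_Suc)
  qed
  from tendsto_diff[OF 1 this] have "?d sums mu_sum s" unfolding sums_def abel diff_0_right .
  then have "(\<lambda>n. ?d n / s) sums (mu_sum s / s)" by (rule sums_divide)
  then have "(\<lambda>n. ?d n / s + of_real (mertens (Suc n)) * zterm (s + 1) n) sums mertens_series s"
    unfolding mertens_series_def mu_sum_eq_inv_zeta[OF s, symmetric] using s by (intro sums_add zeta_correction_sums) auto
  moreover have "?d n / s + of_real (mertens (Suc n)) * zterm (s + 1) n = of_real (mertens (Suc n) / real (Suc n)) * np s (Suc n)" for n
  proof -
    have "np (s + 1) (Suc n) = np s (Suc n) / of_nat (Suc n)"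
      by (simp add: np_def powr_diff del: of_nat_Suc)
    moreover have "zterm (s + 1) n = np (s + 1) (Suc n) + (np s (Suc (Suc n)) - np s (Suc n)) / s"
      by (simp add: zterm_def np_def del: of_nat_Suc)
    moreover have "M * (p - q) / s + M * (p / N + (q - p) / s) = M / N * p" if "N \<noteq> 0" for M N p q :: complex
      using that s0 by (simp add: field_simps)
    ultimately show ?thesis by (simp del: of_nat_Suc)
  qed
  ultimately have "(\<lambda>n. of_real (mertens (Suc n) / real (Suc n)) * np s (Suc n)) sums mertens_series s" by simp
  then show ?thesis by (subst (asm) sums_Suc_iff) simp
qed

text \<open>Between \<open>n\<close> and \<open>m\<close> the function \<open>mertens\<close> moves
  by at most \<open>m - n\<close>, so \<open>c * mertens m \<ge> n * (1 + \<eta>) - m\<close>. This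
  is at least \<open>\<eta> / 2 * m\<close> exactly as long as \<open>m / n \<le> q\<close>. The
  sign \<open>c\<close> serves for upper and lower bounds at once.\<close>

lemma mertens_slowly_varying:
  fixes c :: real
  assumes c: "\<bar>c\<bar> = 1" and \<eta>: "0 < \<eta>"
  shows "\<exists>\<kappa>>0. \<forall>n\<ge>1. \<eta> \<le> c * (mertens n / real n) \<longrightarrow>
      (\<forall>m\<ge>1. ln (real n) \<le> ln (real m) \<longrightarrow> ln (real m) \<le> ln (real n) + 2 * \<kappa> \<longrightarrow> \<eta> / 2 \<le> c * (mertens m / real m))"
proof (intro exI conjI allI impI)
  define q where "q = (1 + \<eta>) / (1 + \<eta> / 2)"
  have q: "1 < q" using \<eta> by (simp add: q_def)
  then show "0 < ln q / 2" by simp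
  fix n m :: nat
  assume n: "1 \<le> n" and an: "\<eta> \<le> c * (mertens n / real n)" and m: "1 \<le> m"
    and nm: "ln (real n) \<le> ln (real m)" and mn: "ln (real m) \<le> ln (real n) + 2 * (ln q / 2)"
  have "n \<le> m" using nm n m by simp
  then have "\<bar>c\<bar> * \<bar>mertens m - mertens n\<bar> \<le> real m - real n" using abs_mertens_diff[of n m] c by simp
  then have "\<bar>c * mertens m - c * mertens n\<bar> \<le> real m - real n" unfolding abs_mult[symmetric] right_diff_distrib .
  moreover have "\<eta> * real n \<le> c * mertens n" using an n by (simp add: field_simps)
  ultimately have 1: "real n * (1 + \<eta>) - real m \<le> c * mertens m" by (simp add: algebra_simps)
  have "ln (real m) \<le> ln (real n * q)" using mn n q by (simp add: ln_mult)
  then have "real m \<le> real n * q" using n m q by simp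
  then have "real m * (1 + \<eta> / 2) \<le> real n * (1 + \<eta>)" using \<eta> by (simp add: q_def field_simps)
  then have "\<eta> / 2 * real m \<le> c * mertens m" using 1 by (simp add: algebra_simps)
  then show "\<eta> / 2 \<le> c * (mertens m / real m)" using m by (simp add: field_simps)
qed

lemma mertens_upper:
  assumes c: "\<bar>c\<bar> = 1" and e: "0 < e" shows "\<forall>\<^sub>F n in sequentially. c * (mertens n / real n) < e"
proof -
  interpret boundary_series "\<lambda>n. c * (mertens n / real n)" "\<lambda>s. of_real c * mertens_series s"
  proof
    have "\<bar>mertens n / real n\<bar> \<le> 1" for n using abs_mertens_le[of n] by (cases "n = 0") (simp_all add: divide_le_eq)
    then show "\<bar>c * (mertens n / real n)\<bar> \<le> 1" for n using c by (simp only: abs_mult mult_1_left)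
    show "continuous_on {s. 1 \<le> Re s} (\<lambda>s. of_real c * mertens_series s)"
      by (intro continuous_intros mertens_series_continuous)
    show "(\<lambda>n. of_real (c * (mertens n / real n)) * np s n) sums (of_real c * mertens_series s)" if "1 < Re s" for s
      using sums_mult[OF mertens_series_sums[OF that], of "of_real c"] by (simp add: mult.assoc)
  qed
  show ?thesis by (rule slowly_varying_upper[OF mertens_slowly_varying[OF c] e])
qed

theorem mean_mu_tendsto: "(\<lambda>N. (\<Sum>n<N. mu n) / real N) \<longlonglongrightarrow> 0"
proof -
  have "(\<lambda>n. mertens n / real n) \<longlonglongrightarrow> 0"
  proof (rule tendstoI)
    fix e :: real assume e: "0 < e"
    show "\<forall>\<^sub>F n in sequentially. dist (mertens n / real n) 0 < e"
      using mertens_upper[OF abs_one e] mertens_upper[of "-1", OF _ e, simplified]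
      by eventually_elim (simp add: abs_less_iff)
  qed
  then have "(\<lambda>n. mertens n / real n - mu n / real n) \<longlonglongrightarrow> 0 - 0"
  proof (rule tendsto_diff)
    have "norm (mu n / real n) \<le> 1 / real n" for n using abs_mu_le[of n] by (simp add: divide_right_mono)
    then show "(\<lambda>n. mu n / real n) \<longlonglongrightarrow> 0"
      by (intro Lim_null_comparison[OF _ lim_1_over_n]) simp
  qed
  moreover have diff: "mertens n / real n - mu n / real n = (\<Sum>k<n. mu k) / real n" for n
  proof -
    have "mertens n = (\<Sum>k<n. mu k) + mu n" unfolding mertens_def lessThan_Suc_atMost[symmetric] by simp
    then show ?thesis by (simp add: add_divide_distrib)
  qed
  ultimately show ?thesis unfolding diff diff_0_right by simp
qed

section \<open>Length vectors with good approximations\<close>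

lemma emeasure_ball_real: "0 \<le> r \<Longrightarrow> emeasure lebesgue (ball (x::real) r) = ennreal (2 * r)"
  by (simp add: ball_eq_greaterThanLessThan)

text \<open>Vitali's theorem covers a porous set by disjoint balls each of which loses a fixed proportion
  to its hole, so the infimum of the measures of the covers of the set is multiplied by a factor below \<open>1\<close>.\<close>

lemma bounded_porous_negligible:
  fixes S :: "real set"
  assumes \<kappa>: "0 < \<kappa>" "\<kappa> < 1" and bdd: "bounded S"
    and hole: "\<And>x r. x \<in> S \<Longrightarrow> 0 < r \<Longrightarrow> \<exists>d y. 0 < d \<and> d < r \<and> ball y (\<kappa> * d) \<subseteq> ball x d \<and> ball y (\<kappa> * d) \<inter> S = {}"
  shows "negligible S"
proof -
  let ?\<mu> = "measure lebesgue"
  let ?M = "{?\<mu> U | U. U \<in> lmeasurable \<and> S \<subseteq> U}"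
  define m where "m = Inf ?M"
  obtain B where B: "S \<subseteq> ball 0 B" using bdd bounded_subset_ballD by blast
  have ne: "?M \<noteq> {}" using B lmeasurable_ball by blast
  have bdd_M: "bdd_below ?M" by (rule bdd_belowI[of _ 0]) auto
  have m_le: "m \<le> ?\<mu> U" if "U \<in> lmeasurable" "S \<subseteq> U" for U
    unfolding m_def using that by (intro cInf_lower bdd_M) blast
  have m0: "0 \<le> m" unfolding m_def using ne by (intro cInf_greatest) auto
  have step: "m \<le> (1 - \<kappa>) * ?\<mu> U" if U: "open U" "U \<in> lmeasurable" "S \<subseteq> U" for U
  proof -
    \<comment> \<open>An index is a triple: the centre and the radius of a ball, and the centre of
      the hole in it.\<close>
    let ?B = "\<lambda>i. ball (fst i) (fst (snd i)) :: real set" and ?H = "\<lambda>i. ball (snd (snd i)) (\<kappa> * fst (snd i)) :: real set"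
    define K where "K = {i. fst i \<in> S \<and> 0 < fst (snd i) \<and> ?B i \<subseteq> U \<and> ?H i \<subseteq> ?B i \<and> ?H i \<inter> S = {}}"
    have "\<exists>i. i \<in> K \<and> x \<in> ?B i \<and> fst (snd i) < d" if x: "x \<in> S" "0 < d" for x d
    proof -
      have "x \<in> U" using x U(3) by blast
      then obtain e where e: "0 < e" "ball x e \<subseteq> U" by (rule openE[OF U(1)])
      obtain d' y where d': "0 < d'" "d' < min d e" "ball y (\<kappa> * d') \<subseteq> ball x d'" "ball y (\<kappa> * d') \<inter> S = {}"
        using hole[of x "min d e"] x e by auto
      moreover have "ball x d' \<subseteq> U" using e(2) d'(2) by auto
      ultimately show ?thesis using x by (intro exI[of _ "(x, d', y)"]) (auto simp: K_def)
    qed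
    then obtain C where C: "countable C" "C \<subseteq> K" and disj: "pairwise (\<lambda>i j. disjnt (?B i) (?B j)) C"
      and neg: "negligible (S - (\<Union>i\<in>C. ?B i))"
      by (rule Vitali_covering_theorem_balls[of S K fst "\<lambda>i. fst (snd i)"]) blast+
    let ?BB = "\<Union>i\<in>C. ?B i" and ?HH = "\<Union>i\<in>C. ?H i"
    have HB: "?H i \<subseteq> ?B i" "?H i \<inter> S = {}" "?B i \<subseteq> U" "0 < fst (snd i)" if "i \<in> C" for i
      using that C(2) unfolding K_def by blast+
    have disjB: "disjoint_family_on ?B C" using disj by (auto simp: disjoint_family_on_def pairwise_def disjnt_def)
    have disjH: "disjoint_family_on ?H C"
      unfolding disjoint_family_on_def
    proof (intro ballI impI)
      fix i j assume ij: "i \<in> C" "j \<in> C" "i \<noteq> j"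
      have "?B i \<inter> ?B j = {}" using disjB ij unfolding disjoint_family_on_def by blast
      then show "?H i \<inter> ?H j = {}" using HB(1)[OF ij(1)] HB(1)[OF ij(2)] by blast
    qed
    have "emeasure lebesgue ?HH = (\<integral>\<^sup>+i. emeasure lebesgue (?H i) \<partial>count_space C)"
      by (intro emeasure_UN_countable disjH C) auto
    also have "\<dots> = (\<integral>\<^sup>+i. ennreal \<kappa> * emeasure lebesgue (?B i) \<partial>count_space C)"
    proof (rule nn_integral_cong)
      fix i assume "i \<in> space (count_space C)"
      then have "0 < fst (snd i)" using HB by simp
      then show "emeasure lebesgue (?H i) = ennreal \<kappa> * emeasure lebesgue (?B i)"
        using \<kappa> by (subst (1 2) emeasure_ball_real) (auto simp: ennreal_mult[symmetric] mult_ac)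
    qed
    also have "\<dots> = ennreal \<kappa> * (\<integral>\<^sup>+i. emeasure lebesgue (?B i) \<partial>count_space C)" by (rule nn_integral_cmult) simp
    also have "(\<integral>\<^sup>+i. emeasure lebesgue (?B i) \<partial>count_space C) = emeasure lebesgue ?BB"
      by (intro emeasure_UN_countable[symmetric] disjB C) auto
    finally have HH: "emeasure lebesgue ?HH = ennreal \<kappa> * emeasure lebesgue ?BB" .
    have BBU: "?BB \<subseteq> U" using HB(3) by blast
    have BBm: "?BB \<in> lmeasurable"
      by (rule fmeasurableI2[OF U(2) BBU]) (intro sets_completionI_sets, simp add: borel_open open_UN)
    have HHB: "?HH \<subseteq> ?BB" using HB(1) by blast
    have HHm: "?HH \<in> lmeasurable"
      by (rule fmeasurableI2[OF BBm HHB]) (intro sets_completionI_sets, simp add: borel_open open_UN)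
    have "?\<mu> ?HH = \<kappa> * ?\<mu> ?BB" using HH \<kappa> by (simp add: measure_def enn2real_mult)
    moreover have "?\<mu> (?BB - ?HH) = ?\<mu> ?BB - ?\<mu> ?HH" by (rule measurable_measure_Diff[OF BBm _ HHB]) (use HHm in auto)
    ultimately have "?\<mu> (?BB - ?HH) = (1 - \<kappa>) * ?\<mu> ?BB" by (simp add: algebra_simps)
    also have "\<dots> \<le> (1 - \<kappa>) * ?\<mu> U" using \<kappa> by (intro mult_left_mono measure_mono_fmeasurable BBU U) (use BBm in auto)
    finally have le: "?\<mu> (?BB - ?HH) \<le> (1 - \<kappa>) * ?\<mu> U" .
    \<comment> \<open>The part of \<open>S\<close> covered by the balls avoids the holes and the
      rest is negligible, so this set still contains \<open>S\<close>, and its measure is at most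
      \<open>1 - \<kappa>\<close> times that of \<open>U\<close>.\<close>
    let ?V = "(S - ?BB) \<union> (?BB - ?HH)"
    have Nm: "S - ?BB \<in> lmeasurable" using neg by (rule negligible_imp_measurable)
    have Dm: "?BB - ?HH \<in> lmeasurable" by (rule fmeasurable.Diff[OF BBm HHm])
    have "S \<subseteq> ?V" using HB(2) by blast
    then have "m \<le> ?\<mu> ?V" by (intro m_le fmeasurable.Un Nm Dm)
    also have "\<dots> \<le> ?\<mu> (S - ?BB) + ?\<mu> (?BB - ?HH)" by (rule measure_Un_le) (use Nm Dm in auto)
    also have "?\<mu> (S - ?BB) = 0" using neg by (rule negligible_imp_measure0)
    finally show ?thesis using le by simp
  qed
  have approx: "m \<le> (1 - \<kappa>) * (m + e)" if e: "0 < e" for e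
  proof -
    have "\<exists>x\<in>?M. x < m + e / 2" using cInf_lessD[OF ne, of "m + e / 2"] e unfolding m_def by auto
    then obtain U where U: "U \<in> lmeasurable" "S \<subseteq> U" "?\<mu> U < m + e / 2" by blast
    obtain V where V: "open V" "U \<subseteq> V" "V - U \<in> lmeasurable" "emeasure lebesgue (V - U) < ennreal (e / 2)"
      using sets_lebesgue_outer_open[of U "e / 2"] U(1) e by auto
    have V': "V = U \<union> (V - U)" using V(2) by blast
    have Vm: "V \<in> lmeasurable" by (subst V') (intro fmeasurable.Un U V)
    have "?\<mu> V \<le> ?\<mu> U + ?\<mu> (V - U)"
      by (subst V') (rule measure_Un_le, use U V in auto)
    moreover have "?\<mu> (V - U) < e / 2"
      using V(3,4) e by (simp add: emeasure_eq_measure2 ennreal_less_iff)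
    ultimately have "?\<mu> V \<le> m + e" using U(3) by linarith
    then have "(1 - \<kappa>) * ?\<mu> V \<le> (1 - \<kappa>) * (m + e)" using \<kappa> by (intro mult_left_mono) auto
    then show ?thesis using step[OF V(1) Vm] subset_trans[OF U(2) V(2)] by linarith
  qed
  have "m \<le> 0"
  proof (rule ccontr)
    assume "\<not> m \<le> 0"
    \<comment> \<open>For this choice of \<open>e\<close> the factor
      \<open>(1 - \<kappa>) * (1 + \<kappa> / 2)\<close> is below 1, which a positive
      \<open>m\<close> contradicts.\<close>
    then have "m \<le> (1 - \<kappa>) * (m + \<kappa> * m / 2)" using approx[of "\<kappa> * m / 2"] \<kappa> by simp
    then have "0 \<le> - (m * \<kappa> * (1 + \<kappa>)) / 2" by (simp add: algebra_simps)
    moreover have "0 < m * \<kappa> * (1 + \<kappa>)" using \<open>\<not> m \<le> 0\<close> \<kappa> by simp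
    ultimately show False by simp
  qed
  show ?thesis
    unfolding negligible_outer
  proof (intro allI impI)
    fix e :: real assume "0 < e"
    then have "\<exists>x\<in>?M. x < e" using cInf_lessD[OF ne, of e] \<open>m \<le> 0\<close> unfolding m_def by auto
    then show "\<exists>T. S \<subseteq> T \<and> T \<in> lmeasurable \<and> ?\<mu> T < e" by blast
  qed
qed

lemma porous_negligible:
  fixes S :: "real set"
  assumes \<kappa>: "0 < \<kappa>" "\<kappa> < 1"
    and hole: "\<And>x r. x \<in> S \<Longrightarrow> 0 < r \<Longrightarrow> \<exists>d y. 0 < d \<and> d < r \<and> ball y (\<kappa> * d) \<subseteq> ball x d \<and> ball y (\<kappa> * d) \<inter> S = {}"
  shows "negligible S"
proof -
  have "negligible (S \<inter> ball 0 (real n))" for n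
  proof (rule bounded_porous_negligible[OF \<kappa>])
    show "bounded (S \<inter> ball 0 (real n))" by (rule bounded_subset[OF bounded_ball]) blast
    show "\<exists>d y. 0 < d \<and> d < r \<and> ball y (\<kappa> * d) \<subseteq> ball x d \<and> ball y (\<kappa> * d) \<inter> (S \<inter> ball 0 (real n)) = {}"
      if "x \<in> S \<inter> ball 0 (real n)" "0 < r" for x r
      using hole[of x r] that by blast
  qed
  then have "negligible (\<Union>n. S \<inter> ball 0 (real n))" by (intro negligible_countable_Union) auto
  moreover have "S \<subseteq> (\<Union>n. S \<inter> ball 0 (real n))" using reals_Archimedean2 by auto
  ultimately show ?thesis by (rule negligible_subset)
qed

text \<open>Fubini for the indicator of \<open>N\<close> at \<open>x + s *\<^sub>R v\<close>,
  integrated over all \<open>x\<close> and over \<open>s\<close> in an interval of length 1.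
  Integrated along the lines it gives 0; for fixed \<open>s\<close>, translation invariance gives
  the measure of \<open>N\<close>.\<close>

lemma negligible_if_lines_negligible:
  fixes v :: "'a::euclidean_space"
  assumes N: "N \<in> sets borel" and lines: "\<And>x. negligible {s. x + s *\<^sub>R v \<in> N}"
  shows "negligible N"
proof -
  let ?f = "\<lambda>(x :: 'a, s :: real). indicator {0..1} s * indicator N (x + s *\<^sub>R v) :: ennreal"
  have add: "(\<lambda>z. fst z + snd z *\<^sub>R v) \<in> borel_measurable (lborel \<Otimes>\<^sub>M lborel)" by measurable
  have "(\<lambda>z. indicator N (fst z + snd z *\<^sub>R v) :: ennreal) \<in> borel_measurable (lborel \<Otimes>\<^sub>M lborel)"
    using measurable_compose[OF add borel_measurable_indicator[OF N]] by simp
  then have f: "?f \<in> borel_measurable (lborel \<Otimes>\<^sub>M lborel)" unfolding split_beta by measurable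
  have "(\<integral>\<^sup>+x. (\<integral>\<^sup>+s. ?f (x, s) \<partial>lborel) \<partial>lborel) = 0"
  proof -
    have "(\<integral>\<^sup>+s. ?f (x, s) \<partial>lborel) = 0" for x
    proof -
      have "{s. x + s *\<^sub>R v \<in> N} \<in> sets borel"
        using measurable_sets_borel[of "\<lambda>s. x + s *\<^sub>R v" borel N] N by (simp add: vimage_def)
      then have "{s. x + s *\<^sub>R v \<in> N} \<in> null_sets lborel"
        using lines[of x] by (simp add: negligible_iff_null_sets null_sets_completion_iff)
      then have "AE s in lborel. \<not> x + s *\<^sub>R v \<in> N" using AE_not_in by fastforce
      then have "AE s in lborel. ?f (x, s) = 0" by eventually_elim simp
      then have "(\<integral>\<^sup>+s. ?f (x, s) \<partial>lborel) = (\<integral>\<^sup>+(s::real). 0 \<partial>lborel)" by (rule nn_integral_cong_AE)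
      then show ?thesis by simp
    qed
    then show ?thesis by simp
  qed
  then have "0 = (\<integral>\<^sup>+s. (\<integral>\<^sup>+x. ?f (x, s) \<partial>lborel) \<partial>lborel)" using lborel_pair.Fubini[OF f] by simp
  also have "\<dots> = (\<integral>\<^sup>+(s::real). emeasure lborel N * indicator {0..1} s \<partial>lborel)"
  proof (rule nn_integral_cong)
    fix s :: real
    have "(\<integral>\<^sup>+x. indicator N (x + s *\<^sub>R v) \<partial>lborel) = (\<integral>\<^sup>+x. indicator N x \<partial>distr lborel borel ((+) (s *\<^sub>R v)))"
      using N by (subst nn_integral_distr) (auto simp: add.commute)
    also have "\<dots> = emeasure lborel N" unfolding lborel_distr_plus using N by simp
    finally show "(\<integral>\<^sup>+x. ?f (x, s) \<partial>lborel) = emeasure lborel N * indicator {0..1} s"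
      by (cases "s \<in> {0..1}") (simp_all add: mult.commute)
  qed
  also have "\<dots> = emeasure lborel N" by (subst nn_integral_cmult) auto
  finally have "emeasure lborel N = 0" by simp
  then have "N \<in> null_sets lborel" using N by (auto simp: null_sets_def)
  then show ?thesis using N by (simp add: negligible_iff_null_sets null_sets_completion_iff)
qed

text \<open>Both conditions are open in the lengths: \<open>tight\<close> allows a window of length of order \<open>1 / q\<^sup>2\<close> for the angle and
  \<open>central\<close> one of order \<open>1 / q\<close> for the base, so they are treated on lines along which only one of the two varies.\<close>

definition tight :: "nat \<Rightarrow> nat \<Rightarrow> int \<Rightarrow> real \<Rightarrow> bool" where
  "tight j q P a \<longleftrightarrow> 0 < q \<and> coprime P (int q) \<and>
    1 / (2 * real j) < real q * (real q * a - of_int P) \<and> real q * (real q * a - of_int P) < 1 / real j"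

definition central :: "nat \<Rightarrow> real \<Rightarrow> bool" where
  "central q b \<longleftrightarrow> (\<exists>k::int. 1/3 < real q * b - of_int k \<and> real q * b - of_int k < 2/3)"

lemma frac_of_central:
  assumes "central q b" shows "1/3 < frac (real q * b)" "frac (real q * b) < 2/3"
proof -
  obtain k :: int where k: "1/3 < real q * b - of_int k" "real q * b - of_int k < 2/3" using assms by (auto simp: central_def)
  then have "\<lfloor>real q * b\<rfloor> = k" by (simp add: floor_eq_iff)
  then show "1/3 < frac (real q * b)" "frac (real q * b) < 2/3" using k by (simp_all add: frac_def)
qed

text \<open>Every irrational number has infinitely many coprime approximations within
  \<open>1 / q\<^sup>2\<close>. Near each of them lies an interval of length of order
  \<open>1 / (j * q\<^sup>2)\<close> on which \<open>tight\<close> holds, so the exceptional set is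
  porous with a ratio that depends on \<open>j\<close> alone.\<close>

lemma negligible_not_tight:
  assumes j: "1 \<le> j" shows "negligible {a. \<not> (\<exists>q P. Q \<le> q \<and> tight j q P a)}"
proof -
  let ?S = "{a. a \<notin> \<rat> \<and> \<not> (\<exists>q P. Q \<le> q \<and> tight j q P a)}"
  have "negligible ?S"
  proof (rule porous_negligible[of "1 / (8 * real j)"])
    show "0 < 1 / (8 * real j)" "1 / (8 * real j) < 1" using j by auto
    fix x r :: real
    assume x: "x \<in> ?S" and r: "0 < r"
    have inf: "infinite (approx_set x)" using x rational_iff_finite_approx_set by blast
    obtain P k :: int where Pk: "(P, k) \<in> approx_set x" "max (int Q) \<lceil>2 / r\<rceil> < k"
      using infinite_approx_set[OF inf] by blast
    define q where "q = nat k"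
    have "0 < k" using Pk(2) by simp
    then have kq: "k = int q" "0 < q" by (simp_all add: q_def)
    have qQ: "Q \<le> q" using Pk(2) kq by simp
    have "2 / r < real q" using Pk(2) kq(1) by linarith
    then have qr: "2 < r * real q" using r by (simp add: field_simps)
    have cop: "coprime P (int q)" and app: "\<bar>x - of_int P / real q\<bar> < 1 / (real q)\<^sup>2"
      using Pk(1) kq by (auto simp: approx_set_def)
    define d where "d = 2 / (real q)\<^sup>2"
    \<comment> \<open>At \<open>y\<close> the quantity \<open>q * (q * y - P)\<close> is
      \<open>3 / (4 * j)\<close>, midway between the two bounds of \<open>tight\<close>; the hole of
      radius \<open>1 / (4 * j * q\<^sup>2)\<close> fills the window.\<close>
    define y where "y = of_int P / real q + 3 / (4 * real j * (real q)\<^sup>2)"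
    have d0: "0 < d" using kq by (simp add: d_def)
    have "r * real q \<le> r * (real q)\<^sup>2" using kq r by (simp add: power2_eq_square)
    then have dr: "d < r" using qr kq by (simp add: d_def divide_less_eq)
    have rad: "1 / (8 * real j) * d = 1 / (4 * real j * (real q)\<^sup>2)" by (simp add: d_def)
    have near: "\<bar>z - of_int P / real q\<bar> < 1 / (real q)\<^sup>2" "tight j q P z" if z: "z \<in> ball y (1 / (8 * real j) * d)" for z
    proof -
      have zy: "\<bar>z - y\<bar> < 1 / (4 * real j * (real q)\<^sup>2)" using z unfolding rad by (simp add: dist_real_def abs_minus_commute)
      define t where "t = real q * (real q * z - of_int P)"
      have zt: "z = of_int P / real q + t / (real q)\<^sup>2" using kq by (simp add: t_def power2_eq_square field_simps)
      have "z - y = (t - 3 / (4 * real j)) / (real q)\<^sup>2" 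
        by (subst zt) (simp add: y_def diff_divide_distrib)
      moreover have "1 / (4 * real j * (real q)\<^sup>2) = 1 / (4 * real j) / (real q)\<^sup>2" by simp
      ultimately have "\<bar>t - 3 / (4 * real j)\<bar> / (real q)\<^sup>2 < 1 / (4 * real j) / (real q)\<^sup>2"
        using zy by (simp only: abs_divide abs_power2)
      then have "\<bar>t - 3 / (4 * real j)\<bar> < 1 / (4 * real j)" using kq(2) divide_less_cancel[of _ "(real q)\<^sup>2"] by (simp del: divide_divide_eq_left)
      then have t: "1 / (2 * real j) < t" "t < 1 / real j" using j by (auto simp: abs_less_iff field_simps)
      then show "tight j q P z" using kq cop by (simp add: tight_def t_def)
      have "0 < t" "t < 1" using t j by (auto intro: less_trans[of 0] less_le_trans[of t "1 / real j"])
      then show "\<bar>z - of_int P / real q\<bar> < 1 / (real q)\<^sup>2" using kq unfolding zt by (simp add: divide_strict_right_mono)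
    qed
    have "ball y (1 / (8 * real j) * d) \<subseteq> ball x d"
    proof
      fix z assume "z \<in> ball y (1 / (8 * real j) * d)"
      from near(1)[OF this] app have "\<bar>x - z\<bar> < 2 / (real q)\<^sup>2" by (simp add: abs_less_iff)
      then show "z \<in> ball x d" by (simp add: dist_real_def d_def)
    qed
    moreover have "ball y (1 / (8 * real j) * d) \<inter> ?S = {}" using near(2) qQ by blast
    ultimately show "\<exists>d y. 0 < d \<and> d < r \<and> ball y (1 / (8 * real j) * d) \<subseteq> ball x d \<and> ball y (1 / (8 * real j) * d) \<inter> ?S = {}"
      using d0 dr by blast
  qed
  moreover have "negligible (\<rat> :: real set)" 
    unfolding negligible_iff_null_sets by (intro null_sets_completionI countable_imp_null_set_lborel countable_rat)
  ultimately have "negligible (?S \<union> \<rat>)" by (rule negligible_Un)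
  then show ?thesis by (rule negligible_subset) blast
qed

text \<open>The middle third of every cell \<open>[k / q, (k + 1) / q)\<close> consists of points
  with \<open>central q\<close>, and \<open>q\<close> is unbounded in \<open>A\<close>, so the
  exceptional set has holes at arbitrarily small scales around each of its points.\<close>

lemma negligible_not_central:
  assumes inf: "\<And>Q. \<exists>q\<ge>Q. q \<in> A" shows "negligible {b. \<not> (\<exists>q\<in>A. central q b)}" (is "negligible ?S")
proof (rule porous_negligible[of "1/6"])
  fix x r :: real
  assume x: "x \<in> ?S" and r: "0 < r"
  obtain q where q: "q \<in> A" "Suc (nat \<lceil>1 / r\<rceil>) \<le> q" using inf by blast
  then have q0: "0 < q" and "1 / r < real q" by linarith+
  then have qr: "1 / real q < r" using r by (simp add: field_simps)
  define y where "y = (of_int \<lfloor>real q * x\<rfloor> + 1/2) / real q"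
  have near: "\<bar>real q * z - of_int \<lfloor>real q * x\<rfloor> - 1/2\<bar> < 1/6" if z: "z \<in> ball y (1/6 * (1 / real q))" for z
  proof -
    have "\<bar>z - y\<bar> < 1/6 * (1 / real q)" using z by (simp add: dist_real_def abs_minus_commute)
    then have "real q * \<bar>z - y\<bar> < real q * (1/6 * (1 / real q))" using q0 by (intro mult_strict_left_mono) auto
    moreover have "real q * \<bar>z - y\<bar> = \<bar>real q * (z - y)\<bar>" by (simp add: abs_mult)
    moreover have "real q * (z - y) = real q * z - of_int \<lfloor>real q * x\<rfloor> - 1/2" using q0 by (simp add: y_def field_simps)
    ultimately show ?thesis using q0 by simp
  qed
  have "ball y (1/6 * (1 / real q)) \<subseteq> ball x (1 / real q)"
  proof
    fix z assume z: "z \<in> ball y (1/6 * (1 / real q))"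
    have "\<bar>real q * x - real q * z\<bar> < 1"
      using near[OF z] of_int_floor_le[of "real q * x"] floor_correct[of "real q * x"] by linarith
    then have "real q * \<bar>x - z\<bar> < 1" by (simp add: abs_mult flip: right_diff_distrib)
    then show "z \<in> ball x (1 / real q)" using q0 by (simp add: dist_real_def field_simps)
  qed
  moreover have "central q z" if "z \<in> ball y (1/6 * (1 / real q))" for z
    unfolding central_def by (rule exI[of _ "\<lfloor>real q * x\<rfloor>"]) (use near[OF that] in linarith)
  then have "ball y (1/6 * (1 / real q)) \<inter> ?S = {}" using q(1) by blast
  ultimately show "\<exists>d y. 0 < d \<and> d < r \<and> ball y (1/6 * d) \<subseteq> ball x d \<and> ball y (1/6 * d) \<inter> ?S = {}"
    using q0 qr by (intro exI[of _ "1 / real q"] exI[of _ y]) auto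
qed auto

lemma negligible_affine_vimage:
  fixes S :: "real set"
  assumes "negligible S" "c \<noteq> 0" shows "negligible {s. \<alpha> + s / c \<in> S}"
proof -
  have "negligible ((\<lambda>t. c * t) ` ((+) (- \<alpha>) ` S))"
    using negligible_translation[OF assms(1), of "- \<alpha>"]
    by (rule negligible_differentiable_image_negligible[OF order.refl]) (intro derivative_intros)
  moreover have "{s. \<alpha> + s / c \<in> S} \<subseteq> (\<lambda>t. c * t) ` ((+) (- \<alpha>) ` S)"
  proof
    fix s assume "s \<in> {s. \<alpha> + s / c \<in> S}"
    moreover have "s = c * (- \<alpha> + (\<alpha> + s / c))" using assms(2) by simp
    ultimately show "s \<in> (\<lambda>t. c * t) ` ((+) (- \<alpha>) ` S)" by blast
  qed
  ultimately show ?thesis by (rule negligible_subset)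
qed

text \<open>Attaching an interval of length \<open>l $ 2\<close> gives a circle whose rotation by \<open>l $ 2 + l $ 3\<close> induces the
  exchange of the intervals; \<open>angle\<close> and \<open>base\<close> are the rotation and the arc after normalising the circle.\<close>

definition circumference :: "real ^ 3 \<Rightarrow> real" where "circumference l = l $ 1 + 2 * l $ 2 + l $ 3"
definition angle :: "real ^ 3 \<Rightarrow> real" where "angle l = (l $ 2 + l $ 3) / circumference l"
definition base :: "real ^ 3 \<Rightarrow> real" where "base l = (l $ 1 + l $ 2 + l $ 3) / circumference l"

lemma measurable_circumference [measurable]: "circumference \<in> borel_measurable borel"
  and measurable_angle [measurable]: "angle \<in> borel_measurable borel"
  and measurable_base [measurable]: "base \<in> borel_measurable borel"
  unfolding circumference_def [abs_def] angle_def [abs_def] base_def [abs_def]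
  by (measurable; simp add: borel_measurable_continuous_onI continuous_intros)+

text \<open>Two directions that keep the circumference. Along \<open>angle_flow\<close> the angle
  moves at constant speed; along \<open>base_flow\<close> the angle stays fixed and the base
  moves.\<close>

definition angle_flow :: "real ^ 3" where "angle_flow = vector [-1, 0, 1]"
definition base_flow :: "real ^ 3" where "base_flow = vector [1, -1, 1]"

lemma circumference_flow [simp]:
  "circumference (l + s *\<^sub>R angle_flow) = circumference l" "circumference (l + s *\<^sub>R base_flow) = circumference l"
  by (simp_all add: circumference_def angle_flow_def base_flow_def vector_3)

lemma angle_base_flow:
  "angle (l + s *\<^sub>R angle_flow) = angle l + s / circumference l"
  "angle (l + s *\<^sub>R base_flow) = angle l"
  "base (l + s *\<^sub>R base_flow) = base l + s / circumference l"
  unfolding angle_def base_def circumference_flow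
  by (simp_all add: angle_flow_def base_flow_def vector_3 flip: add_divide_distrib)

lemma negligible_not_tight_angle:
  assumes j: "1 \<le> j"
  shows "negligible {l. 0 < circumference l \<and> \<not> (\<exists>q P. Q \<le> q \<and> tight j q P (angle l))}" (is "negligible ?N")
proof (rule negligible_if_lines_negligible)
  show "?N \<in> sets borel" unfolding tight_def by measurable
  fix l
  show "negligible {s. l + s *\<^sub>R angle_flow \<in> ?N}"
  proof (cases "0 < circumference l")
    case True
    then show ?thesis
      using negligible_affine_vimage[OF negligible_not_tight[OF j, of Q], of "circumference l" "angle l"]
      by (simp add: angle_base_flow)
  qed (simp add: angle_base_flow)
qed

text \<open>The admissible \<open>q\<close> depend on the angle only and are therefore the same all
  along a line in direction \<open>base_flow\<close>; the one-dimensional statement applies with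
  this fixed infinite set.\<close>

lemma negligible_not_central_base:
  "negligible {l. 0 < circumference l \<and> (\<forall>Q. \<exists>q\<ge>Q. \<exists>P. tight j q P (angle l)) \<and>
     \<not> (\<exists>q P. Q0 \<le> q \<and> tight j q P (angle l) \<and> central q (base l))}" (is "negligible ?N")
proof (rule negligible_if_lines_negligible)
  show "?N \<in> sets borel" unfolding tight_def central_def by measurable
  fix l
  let ?A = "{q. Q0 \<le> q \<and> (\<exists>P. tight j q P (angle l))}"
  show "negligible {s. l + s *\<^sub>R base_flow \<in> ?N}"
  proof (cases "0 < circumference l \<and> (\<forall>Q. \<exists>q\<ge>Q. \<exists>P. tight j q P (angle l))")
    case True
    then have "\<exists>q\<ge>Q. q \<in> ?A" for Q
      by (metis (mono_tags, lifting) max.bounded_iff mem_Collect_eq)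
    from negligible_affine_vimage[OF negligible_not_central[OF this], of "circumference l" "base l"] True
    show ?thesis by (rule_tac negligible_subset[rotated]) (auto simp: angle_base_flow)
  next
    case False
    then have "{s. l + s *\<^sub>R base_flow \<in> ?N} = {}" unfolding mem_Collect_eq circumference_flow angle_base_flow by blast
    then show ?thesis by (simp only: negligible_empty)
  qed
qed

lemma AE_good_scales:
  "AE l in lebesgue. 0 < circumference l \<longrightarrow>
    (\<forall>j\<ge>1. \<forall>Q0. \<exists>q P. Q0 \<le> q \<and> tight j q P (angle l) \<and> central q (base l))"
proof -
  have "AE l in lebesgue. \<forall>j Q0. 1 \<le> j \<longrightarrow> 0 < circumference l \<longrightarrow> (\<exists>q P. Q0 \<le> q \<and> tight j q P (angle l))"
    unfolding AE_all_countable
  proof (intro allI)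
    fix j Q0 :: nat
    show "AE l in lebesgue. 1 \<le> j \<longrightarrow> 0 < circumference l \<longrightarrow> (\<exists>q P. Q0 \<le> q \<and> tight j q P (angle l))"
    proof (cases "1 \<le> j")
      case True
      from AE_not_in[OF negligible_not_tight_angle[OF True, of Q0, unfolded negligible_iff_null_sets]]
      show ?thesis by eventually_elim blast
    qed simp
  qed
  moreover have "AE l in lebesgue. \<forall>j Q0. \<not> (0 < circumference l \<and> (\<forall>Q. \<exists>q\<ge>Q. \<exists>P. tight j q P (angle l)) \<and>
     \<not> (\<exists>q P. Q0 \<le> q \<and> tight j q P (angle l) \<and> central q (base l)))"
    unfolding AE_all_countable
  proof (intro allI)
    fix j Q0 :: nat
    from AE_not_in[OF negligible_not_central_base[of j Q0, unfolded negligible_iff_null_sets]]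
    show "AE l in lebesgue. \<not> (0 < circumference l \<and> (\<forall>Q. \<exists>q\<ge>Q. \<exists>P. tight j q P (angle l)) \<and>
       \<not> (\<exists>q P. Q0 \<le> q \<and> tight j q P (angle l) \<and> central q (base l)))" by eventually_elim blast
  qed
  ultimately show ?thesis by eventually_elim meson
qed

section \<open>Means along a rotation\<close>

definition good_approx :: "real \<Rightarrow> nat \<Rightarrow> int \<Rightarrow> bool" where
  "good_approx a q P \<longleftrightarrow> 0 < q \<and> coprime P (int q) \<and> \<bar>a - real_of_int P / real q\<bar> \<le> 1 / (real q)\<^sup>2"

lemma bij_betw_affine_mod:
  fixes P k :: int and q :: nat
  assumes q: "0 < q" and co: "coprime P (int q)"
  shows "bij_betw (\<lambda>i. nat ((k + int i * P) mod int q)) {..<q} {..<q}"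
proof -
  have inj: "inj_on (\<lambda>i. nat ((k + int i * P) mod int q)) {..<q}"
  proof (rule inj_onI)
    fix i j assume ij: "i \<in> {..<q}" "j \<in> {..<q}"
      and e: "nat ((k + int i * P) mod int q) = nat ((k + int j * P) mod int q)"
    then have "(k + int i * P) mod int q = (k + int j * P) mod int q"
      using q by (simp add: eq_nat_nat_iff)
    then have "int q dvd (k + int i * P) - (k + int j * P)"
      by (simp add: mod_eq_dvd_iff)
    then have "int q dvd (int i - int j) * P"
      by (simp add: algebra_simps)
    then have "int q dvd int i - int j"
      using co by (simp add: coprime_commute coprime_dvd_mult_left_iff)
    then have "int i - int j \<noteq> 0 \<Longrightarrow> int q \<le> \<bar>int i - int j\<bar>"
      using dvd_imp_le_int[of "int i - int j" "int q"] by simp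
    then show "i = j"
      using ij by (cases "i = j") (auto simp: abs_if split: if_splits)
  qed
  moreover have "(\<lambda>i. nat ((k + int i * P) mod int q)) ` {..<q} \<subseteq> {..<q}"
    using q by (auto simp: nat_less_iff)
  ultimately show ?thesis
    by (simp add: bij_betw_def endo_inj_surj)
qed

text \<open>During \<open>q\<close> steps \<open>i * a\<close> stays within \<open>1 / q\<close> of
  \<open>i * P / q\<close>, and multiplication by \<open>P\<close> permutes the residues modulo
  \<open>q\<close>. The other \<open>1 / q\<close> comes from rounding \<open>y - y'\<close> to the
  lattice, so a lattice with any offset \<open>y'\<close> can stand for the orbit.\<close>

lemma orbit_near_lattice:
  assumes g: "good_approx a q P"
  obtains p :: "nat \<Rightarrow> nat" and n :: "nat \<Rightarrow> int"
  where "bij_betw p {..<q} {..<q}"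
    "\<And>i. i < q \<Longrightarrow> \<bar>y + real i * a - (y' + real (p i) / real q + of_int (n i))\<bar> \<le> 2 / real q"
proof
  define k where "k = \<lfloor>real q * (y - y')\<rfloor>"
  let ?p = "\<lambda>i. nat ((k + int i * P) mod int q)" and ?n = "\<lambda>i. (k + int i * P) div int q"
  have q: "0 < q" and co: "coprime P (int q)" and ap: "\<bar>a - real_of_int P / real q\<bar> \<le> 1 / (real q)\<^sup>2"
    using g by (auto simp: good_approx_def)
  show "bij_betw ?p {..<q} {..<q}" by (rule bij_betw_affine_mod[OF q co])
  fix i assume i: "i < q"
  have "real_of_int (k + int i * P) = real_of_int ((k + int i * P) mod int q) + real q * real_of_int (?n i)"
    by (metis add.commute mult_div_mod_eq of_int_add of_int_mult of_int_of_nat_eq)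
  then have 1: "real (?p i) / real q + of_int (?n i) = (real_of_int k + real i * real_of_int P) / real q"
    using q by (simp add: field_simps pos_mod_sign)
  have "\<bar>real i * (a - P / q)\<bar> \<le> real i * (1 / (real q)\<^sup>2)"
    using mult_left_mono[OF ap, of "real i"] by (simp add: abs_mult)
  also have "\<dots> \<le> real q * (1 / (real q)\<^sup>2)"
    using i by (intro mult_right_mono) auto
  also have "\<dots> = 1 / real q" using q by (simp add: power2_eq_square)
  finally have 2: "\<bar>real i * (a - P / q)\<bar> \<le> 1 / real q" .
  have "real_of_int k \<le> real q * (y - y')" "real q * (y - y') \<le> real_of_int k + 1"
    unfolding k_def by linarith+
  then have "0 \<le> (real q * (y - y') - real_of_int k) / real q" "(real q * (y - y') - real_of_int k) / real q \<le> 1 / real q"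
    using q by (auto intro!: divide_right_mono divide_nonneg_nonneg)
  moreover have "(real q * (y - y') - real_of_int k) / real q = y - y' - real_of_int k / real q"
    using q by (simp add: field_simps)
  ultimately have 3: "\<bar>y - y' - real_of_int k / real q\<bar> \<le> 1 / real q" by linarith
  have "y + real i * a - (y' + real (?p i) / real q + of_int (?n i))
      = (y - y' - real_of_int k / real q) + real i * (a - P / q)"
    using 1 q by (simp add: field_simps)
  then show "\<bar>y + real i * a - (y' + real (?p i) / real q + of_int (?n i))\<bar> \<le> 2 / real q"
    using 2 3 by (simp add: field_simps)
qed

text \<open>A neighbourhood of \<open>E\<close> on the circle. The circle appears throughout as the
  real line with periodic functions and sets.\<close>

definition near_pts :: "real set \<Rightarrow> real \<Rightarrow> real set" where
  "near_pts E r = {y. \<exists>e\<in>E. \<exists>n::int. \<bar>y - e - of_int n\<bar> < r}"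

lemma card_ints_in_interval:
  fixes c r :: real assumes "0 \<le> r"
  shows "finite {m::int. \<bar>of_int m - c\<bar> < r}" "real (card {m::int. \<bar>of_int m - c\<bar> < r}) \<le> 2 * r + 1"
proof -
  have sub: "{m::int. \<bar>of_int m - c\<bar> < r} \<subseteq> {\<lfloor>c - r\<rfloor> + 1..\<lceil>c + r\<rceil> - 1}"
  proof
    fix m assume "m \<in> {m::int. \<bar>of_int m - c\<bar> < r}"
    then have "c - r < of_int m" "of_int m < c + r" by auto
    then show "m \<in> {\<lfloor>c - r\<rfloor> + 1..\<lceil>c + r\<rceil> - 1}"
      using floor_less_iff[of "c - r" m] less_ceiling_iff[of m "c + r"] by simp
  qed
  then show "finite {m::int. \<bar>of_int m - c\<bar> < r}" by (rule finite_subset) auto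
  have "card {m::int. \<bar>of_int m - c\<bar> < r} \<le> card {\<lfloor>c - r\<rfloor> + 1..\<lceil>c + r\<rceil> - 1}"
    by (rule card_mono[OF _ sub]) auto
  also have "\<dots> = nat (\<lceil>c + r\<rceil> - 1 - \<lfloor>c - r\<rfloor>)" by simp
  finally have "real (card {m::int. \<bar>of_int m - c\<bar> < r}) \<le> real (nat (\<lceil>c + r\<rceil> - 1 - \<lfloor>c - r\<rfloor>))" by simp
  moreover have le: "real_of_int (\<lceil>c + r\<rceil> - 1 - \<lfloor>c - r\<rfloor>) \<le> 2 * r + 1" by linarith
  have "real (nat k) \<le> 2 * r + 1" if "k = \<lceil>c + r\<rceil> - 1 - \<lfloor>c - r\<rfloor>" for k
    using assms le unfolding that[symmetric] by (cases "0 \<le> k") simp_all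
  from this[OF refl] have "real (nat (\<lceil>c + r\<rceil> - 1 - \<lfloor>c - r\<rfloor>)) \<le> 2 * r + 1" .
  ultimately show "real (card {m::int. \<bar>of_int m - c\<bar> < r}) \<le> 2 * r + 1"
    by linarith
qed

lemma card_lattice_near_point:
  fixes y e r :: real assumes "0 < q" "0 \<le> r"
  shows "real (card {j. j < q \<and> y + real j / real q \<in> near_pts {e} r}) \<le> 2 * r * real q + 1"
proof -
  let ?A = "{j. j < q \<and> y + real j / real q \<in> near_pts {e} r}"
  let ?B = "{m::int. \<bar>of_int m - real q * (e - y)\<bar> < r * real q}"
  have "\<forall>j\<in>?A. \<exists>n::int. \<bar>y + real j / real q - e - of_int n\<bar> < r"
    by (auto simp: near_pts_def)
  from bchoice[OF this] obtain n :: "nat \<Rightarrow> int"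
    where n: "\<And>j. j \<in> ?A \<Longrightarrow> \<bar>y + real j / real q - e - of_int (n j)\<bar> < r"
    by blast
  let ?f = "\<lambda>j. int j - n j * int q"
  have "inj_on ?f ?A"
  proof (rule inj_onI)
    fix i j assume "i \<in> ?A" "j \<in> ?A" "?f i = ?f j"
    then have "(int i - n i * int q) mod int q = (int j - n j * int q) mod int q" "i < q" "j < q" 
      by (simp_all only: mem_Collect_eq)
    then have "int i mod int q = int j mod int q"
      using mod_mult_self1[of "int i" "- n i" "int q"] mod_mult_self1[of "int j" "- n j" "int q"] by simp
    with \<open>i < q\<close> \<open>j < q\<close> show "i = j" by simp
  qed
  moreover have "?f ` ?A \<subseteq> ?B"
  proof safe
    fix j assume "j < q" "y + real j / real q \<in> near_pts {e} r"
    then have "real q * \<bar>y + real j / real q - e - of_int (n j)\<bar> < real q * r"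
      using n[of j] assms(1) by (intro mult_strict_left_mono) auto
    moreover have "real q * \<bar>y + real j / real q - e - of_int (n j)\<bar> = \<bar>real q * (y + real j / real q - e - of_int (n j))\<bar>"
      by (simp add: abs_mult)
    moreover have "real q * (y + real j / real q - e - of_int (n j)) = of_int (?f j) - real q * (e - y)"
      using assms by (simp add: field_simps)
    ultimately show "\<bar>of_int (?f j) - real q * (e - y)\<bar> < r * real q" by (simp only: mult.commute)
  qed
  ultimately have "card ?A \<le> card ?B"
    using card_ints_in_interval(1)[of "r * real q"] assms by (intro card_inj_on_le) auto
  then have "real (card ?A) \<le> real (card ?B)" by simp
  then show ?thesis
    using card_ints_in_interval(2)[of "r * real q" "real q * (e - y)"] assms by simp
qed

lemma near_pts_UN: "near_pts E r = (\<Union>e\<in>E. near_pts {e} r)"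
  by (auto simp: near_pts_def)

lemma card_lattice_near:
  fixes y r :: real assumes "0 < q" "0 \<le> r" "finite E"
  shows "real (card {j. j < q \<and> y + real j / real q \<in> near_pts E r}) \<le> real (card E) * (2 * r * real q + 1)"
proof -
  let ?A = "\<lambda>e. {j. j < q \<and> y + real j / real q \<in> near_pts {e} r}"
  have "{j. j < q \<and> y + real j / real q \<in> near_pts E r} = (\<Union>e\<in>E. ?A e)"
    by (subst near_pts_UN) auto
  then have "card {j. j < q \<and> y + real j / real q \<in> near_pts E r} \<le> (\<Sum>e\<in>E. card (?A e))"
    by (simp add: card_UN_le assms)
  then have "real (card {j. j < q \<and> y + real j / real q \<in> near_pts E r}) \<le> (\<Sum>e\<in>E. real (card (?A e)))"
    by (simp only: of_nat_le_iff flip: of_nat_sum)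
  also have "\<dots> \<le> (\<Sum>e\<in>E. 2 * r * real q + 1)"
    by (intro sum_mono card_lattice_near_point assms)
  finally show ?thesis by simp
qed

text \<open>A class of functions on the circle that contains the indicators of arcs and is closed under products, translations
  and composition with the induced map.\<close>

definition pcont :: "(real \<Rightarrow> real) \<Rightarrow> bool" where
  "pcont F \<longleftrightarrow> (\<forall>y. F (y + 1) = F y) \<and> (\<exists>M. \<forall>y. \<bar>F y\<bar> \<le> M) \<and>
     (\<exists>E. finite E \<and> (\<forall>\<epsilon>>0. \<forall>\<rho>>0. \<exists>\<eta>>0. \<forall>y z. \<bar>y - z\<bar> < \<eta> \<and> y \<notin> near_pts E \<rho> \<longrightarrow> \<bar>F y - F z\<bar> < \<epsilon>))"

lemma pcont_periodic_int:
  assumes "pcont F" shows "F (y + of_int n) = F y"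
proof -
  have nat: "F (z + real k) = F z" for z k
  proof (induction k)
    case (Suc k)
    have "F (z + real (Suc k)) = F ((z + real k) + 1)" by (simp add: algebra_simps)
    then show ?case using Suc assms by (simp add: pcont_def)
  qed simp
  show ?thesis
  proof (cases "0 \<le> n")
    case True then show ?thesis using nat[of y "nat n"] by simp
  next
    case False then show ?thesis using nat[of "y + of_int n" "nat (-n)"] by simp
  qed
qed

definition orbit_avg :: "real \<Rightarrow> (real \<Rightarrow> real) \<Rightarrow> nat \<Rightarrow> real \<Rightarrow> real" where
  "orbit_avg a F N y = (\<Sum>i<N. F (y + real i * a)) / real N"

text \<open>Away from finitely many bad points the function is uniformly continuous, and few lattice
  points come near the bad ones. As \<open>Q0\<close> depends neither on \<open>y\<close> nor on
  \<open>y'\<close>, the average over \<open>q\<close> steps is almost independent of the starting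
  point.\<close>

lemma orbit_avg_near_lattice_avg:
  assumes F: "pcont F" and "0 < \<epsilon>"
  obtains Q0 where "\<And>a q P y y'. \<lbrakk>q \<ge> Q0; good_approx a q P\<rbrakk> \<Longrightarrow>
      \<bar>orbit_avg a F q y - (\<Sum>j<q. F (y' + real j / real q)) / real q\<bar> < \<epsilon>"
proof -
  from F obtain M E where M: "\<And>y. \<bar>F y\<bar> \<le> M" and E: "finite E"
    and osc: "\<And>\<epsilon> \<rho>. \<epsilon> > 0 \<Longrightarrow> \<rho> > 0 \<Longrightarrow> \<exists>\<eta>>0. \<forall>y z. \<bar>y - z\<bar> < \<eta> \<and> y \<notin> near_pts E \<rho> \<longrightarrow> \<bar>F y - F z\<bar> < \<epsilon>"
    unfolding pcont_def by metis
  have M0: "0 \<le> M" using M[of 0] by linarith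
  \<comment> \<open>The lattice points near \<open>E\<close> cost at most
    \<open>K * (2 * \<rho> * q + 1) = q * \<epsilon> / 4 + K\<close>, and \<open>Q0\<close> will
    ensure \<open>K < q * \<epsilon> / 4\<close>.\<close>
  define K where "K = 2 * M * real (card E) + 1"
  have K: "K > 0" "2 * M * real (card E) \<le> K" using M0 by (auto simp: K_def add_nonneg_pos)
  define \<rho> where "\<rho> = \<epsilon> / (8 * K)"
  have \<rho>: "\<rho> > 0" using K \<open>0 < \<epsilon>\<close> by (simp add: \<rho>_def)
  obtain \<eta> where \<eta>: "\<eta> > 0" and osc': "\<And>y z. \<bar>y - z\<bar> < \<eta> \<Longrightarrow> y \<notin> near_pts E \<rho> \<Longrightarrow> \<bar>F y - F z\<bar> < \<epsilon>/4"
    using osc[of "\<epsilon>/4" \<rho>] \<rho> \<open>0 < \<epsilon>\<close> by auto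
  define Q0 where "Q0 = nat \<lceil>max (4/\<eta>) (4 * K / \<epsilon>)\<rceil> + 1"
  show thesis
  proof (rule that)
    fix a q P y y' assume qQ: "q \<ge> Q0" and g: "good_approx a q P"
    have q: "0 < q" using g by (simp add: good_approx_def)
    have "real q \<ge> real Q0" using qQ by simp
    then have "real q > max (4/\<eta>) (4 * K / \<epsilon>)"
      unfolding Q0_def by linarith
    then have q\<eta>: "2 / real q < \<eta>" and qK: "4 * K < \<epsilon> * real q"
      using q \<eta> \<open>0 < \<epsilon>\<close> by (auto simp: field_simps)
    obtain p and n :: "nat \<Rightarrow> int" where p: "bij_betw p {..<q} {..<q}"
      and pn: "\<And>i. i < q \<Longrightarrow> \<bar>y + real i * a - (y' + real (p i) / real q + of_int (n i))\<bar> \<le> 2 / real q"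
      using orbit_near_lattice[OF g] by blast
    let ?z = "\<lambda>j. y' + real j / real q"
    let ?X = "{j. j < q \<and> ?z j \<in> near_pts E \<rho>}"
    have diff: "\<bar>F (y + real i * a) - F (?z (p i))\<bar> \<le> \<epsilon>/4 + 2 * M * of_bool (p i \<in> ?X)" if "i < q" for i
    proof (cases "p i \<in> ?X")
      case True
      then show ?thesis using M[of "y + real i * a"] M[of "?z (p i)"] \<open>0 < \<epsilon>\<close> by auto
    next
      case False
      have "p i < q" using p that by (auto simp: bij_betw_def)
      with False have "?z (p i) \<notin> near_pts E \<rho>" by auto
      moreover have "\<bar>?z (p i) - (y + real i * a - of_int (n i))\<bar> < \<eta>"
        using pn[OF that] q\<eta> by linarith
      ultimately have "\<bar>F (?z (p i)) - F (y + real i * a - of_int (n i))\<bar> < \<epsilon>/4" by (intro osc')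
      moreover have "F (y + real i * a - of_int (n i)) = F (y + real i * a)"
        using pcont_periodic_int[OF F, of _ "- n i"] by simp
      ultimately have "\<bar>F (y + real i * a) - F (?z (p i))\<bar> < \<epsilon>/4"
        by (simp only: abs_minus_commute)
      moreover have "2 * M * of_bool (p i \<in> ?X) = 0"
        using False by (simp only: of_bool_eq mult_zero_right)
      ultimately show ?thesis by linarith
    qed
    have "(\<Sum>j<q. F (?z j)) = (\<Sum>i<q. F (?z (p i)))"
      by (rule sum.reindex_bij_betw[OF p, of "\<lambda>j. F (?z j)", symmetric])
    then have "\<bar>(\<Sum>i<q. F (y + real i * a)) - (\<Sum>j<q. F (?z j))\<bar> \<le> (\<Sum>i<q. \<bar>F (y + real i * a) - F (?z (p i))\<bar>)"
      by (simp only: sum_subtractf[symmetric] sum_abs)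
    also have "\<dots> \<le> (\<Sum>i<q. \<epsilon>/4 + 2 * M * of_bool (p i \<in> ?X))"
      by (intro sum_mono diff) auto
    also have "\<dots> = real q * (\<epsilon>/4) + 2 * M * (\<Sum>i<q. of_bool (p i \<in> ?X))"
      by (simp add: sum.distrib sum_distrib_left)
    also have "(\<Sum>i<q. of_bool (p i \<in> ?X)) = (\<Sum>j<q. of_bool (j \<in> ?X) :: real)"
      by (rule sum.reindex_bij_betw[OF p, of "\<lambda>j. of_bool (j \<in> ?X)"])
    also have "\<dots> = real (card ?X)"
      by (subst sum_of_bool_eq) (auto intro!: arg_cong[where f = card])
    also have "real q * (\<epsilon>/4) + 2 * M * real (card ?X) \<le> real q * (\<epsilon>/4) + 2 * M * (real (card E) * (2 * \<rho> * real q + 1))"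
      using card_lattice_near[OF q _ E, of \<rho> y'] \<rho> M0
      by (intro add_left_mono mult_left_mono) auto
    also have "\<dots> = real q * (\<epsilon>/4) + (2 * M * real (card E)) * (2 * \<rho> * real q + 1)" by simp
    also have "\<dots> \<le> real q * (\<epsilon>/4) + K * (2 * \<rho> * real q + 1)"
      using K \<rho> by (intro add_left_mono mult_right_mono) auto
    also have "\<dots> = real q * (\<epsilon>/2) + K" using K by (simp add: \<rho>_def field_simps)
    also have "\<dots> < real q * \<epsilon>"
      using qK K q \<open>0 < \<epsilon>\<close> by (simp add: field_simps)
    finally have "\<bar>(\<Sum>i<q. F (y + real i * a)) - (\<Sum>j<q. F (?z j))\<bar> < real q * \<epsilon>" .
    moreover have "orbit_avg a F q y - (\<Sum>j<q. F (?z j)) / real q = ((\<Sum>i<q. F (y + real i * a)) - (\<Sum>j<q. F (?z j))) / real q"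
      by (simp add: orbit_avg_def diff_divide_distrib)
    ultimately show "\<bar>orbit_avg a F q y - (\<Sum>j<q. F (?z j)) / real q\<bar> < \<epsilon>"
      using q by (simp only: abs_divide) (simp add: pos_divide_less_eq mult.commute)
  qed
qed

lemma pcontI:
  assumes "\<And>y. F (y + 1) = F y" "\<And>y. \<bar>F y\<bar> \<le> M" "finite E"
    "\<And>\<epsilon> \<rho>. \<epsilon> > 0 \<Longrightarrow> \<rho> > 0 \<Longrightarrow> \<exists>\<eta>>0. \<forall>y z. \<bar>y - z\<bar> < \<eta> \<and> y \<notin> near_pts E \<rho> \<longrightarrow> \<bar>F y - F z\<bar> < \<epsilon>"
  shows "pcont F"
  unfolding pcont_def using assms by blast

lemma pcont_period: "pcont F \<Longrightarrow> F (y + 1) = F y"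
  by (simp add: pcont_def)

lemma pcont_bounded:
  assumes "pcont F"
  obtains M where "M > 0" "\<And>y. \<bar>F y\<bar> \<le> M"
proof -
  from assms obtain M where M: "\<And>y. \<bar>F y\<bar> \<le> M" unfolding pcont_def by blast
  show thesis
  proof (rule that[of "max M 1"])
    show "\<bar>F y\<bar> \<le> max M 1" for y using M[of y] by simp
  qed simp
qed

lemma pcont_osc:
  assumes "pcont F"
  obtains E where "finite E" "\<And>\<epsilon> \<rho>. \<epsilon> > 0 \<Longrightarrow> \<rho> > 0 \<Longrightarrow>
    \<exists>\<eta>>0. \<forall>y z. \<bar>y - z\<bar> < \<eta> \<and> y \<notin> near_pts E \<rho> \<longrightarrow> \<bar>F y - F z\<bar> < \<epsilon>"
  using assms unfolding pcont_def by blast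

lemma near_pts_mono: "E \<subseteq> E' \<Longrightarrow> r \<le> r' \<Longrightarrow> near_pts E r \<subseteq> near_pts E' r'"
  unfolding near_pts_def by (blast intro: less_le_trans)

lemma pcont_osc2:
  assumes "pcont F" "pcont G"
  obtains E where "finite E" "\<And>\<epsilon> \<rho>. \<epsilon> > 0 \<Longrightarrow> \<rho> > 0 \<Longrightarrow>
    \<exists>\<eta>>0. \<forall>y z. \<bar>y - z\<bar> < \<eta> \<and> y \<notin> near_pts E \<rho> \<longrightarrow> \<bar>F y - F z\<bar> < \<epsilon> \<and> \<bar>G y - G z\<bar> < \<epsilon>"
proof -
  from pcont_osc[OF assms(1)] obtain E1 where E1: "finite E1" "\<And>\<epsilon> \<rho>. \<epsilon> > 0 \<Longrightarrow> \<rho> > 0 \<Longrightarrow>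
    \<exists>\<eta>>0. \<forall>y z. \<bar>y - z\<bar> < \<eta> \<and> y \<notin> near_pts E1 \<rho> \<longrightarrow> \<bar>F y - F z\<bar> < \<epsilon>" by blast
  from pcont_osc[OF assms(2)] obtain E2 where E2: "finite E2" "\<And>\<epsilon> \<rho>. \<epsilon> > 0 \<Longrightarrow> \<rho> > 0 \<Longrightarrow>
    \<exists>\<eta>>0. \<forall>y z. \<bar>y - z\<bar> < \<eta> \<and> y \<notin> near_pts E2 \<rho> \<longrightarrow> \<bar>G y - G z\<bar> < \<epsilon>" by blast
  show thesis
  proof (rule that[of "E1 \<union> E2"])
    show "finite (E1 \<union> E2)" using E1 E2 by simp
    fix \<epsilon> \<rho> :: real assume e: "\<epsilon> > 0" "\<rho> > 0"
    obtain \<eta>1 where 1: "\<eta>1 > 0" "\<And>y z. \<bar>y - z\<bar> < \<eta>1 \<Longrightarrow> y \<notin> near_pts E1 \<rho> \<Longrightarrow> \<bar>F y - F z\<bar> < \<epsilon>"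
      using E1(2)[OF e] by blast
    obtain \<eta>2 where 2: "\<eta>2 > 0" "\<And>y z. \<bar>y - z\<bar> < \<eta>2 \<Longrightarrow> y \<notin> near_pts E2 \<rho> \<Longrightarrow> \<bar>G y - G z\<bar> < \<epsilon>"
      using E2(2)[OF e] by blast
    have sub: "near_pts E1 \<rho> \<subseteq> near_pts (E1 \<union> E2) \<rho>" "near_pts E2 \<rho> \<subseteq> near_pts (E1 \<union> E2) \<rho>"
      by (intro near_pts_mono; simp)+
    show "\<exists>\<eta>>0. \<forall>y z. \<bar>y - z\<bar> < \<eta> \<and> y \<notin> near_pts (E1 \<union> E2) \<rho> \<longrightarrow> \<bar>F y - F z\<bar> < \<epsilon> \<and> \<bar>G y - G z\<bar> < \<epsilon>"
    proof (intro exI[of _ "min \<eta>1 \<eta>2"] conjI allI impI)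
      show "0 < min \<eta>1 \<eta>2" using 1 2 by simp
    next
      fix y z assume "\<bar>y - z\<bar> < min \<eta>1 \<eta>2 \<and> y \<notin> near_pts (E1 \<union> E2) \<rho>"
      then have "\<bar>y - z\<bar> < \<eta>1" "y \<notin> near_pts E1 \<rho>" using sub by auto
      then show "\<bar>F y - F z\<bar> < \<epsilon>" by (rule 1)
    next
      fix y z assume "\<bar>y - z\<bar> < min \<eta>1 \<eta>2 \<and> y \<notin> near_pts (E1 \<union> E2) \<rho>"
      then have "\<bar>y - z\<bar> < \<eta>2" "y \<notin> near_pts E2 \<rho>" using sub by auto
      then show "\<bar>G y - G z\<bar> < \<epsilon>" by (rule 2)
    qed
  qed
qed

lemma pcont_const [simp, intro]: "pcont (\<lambda>_. c)"
  by (rule pcontI[of _ "\<bar>c\<bar>" "{}"]) (auto intro: exI[of _ 1])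

lemma pcont_add [intro]:
  assumes "pcont F" "pcont G" shows "pcont (\<lambda>y. F y + G y)"
proof -
  obtain M1 where M1: "\<And>y. \<bar>F y\<bar> \<le> M1" using pcont_bounded[OF assms(1)] by blast
  obtain M2 where M2: "\<And>y. \<bar>G y\<bar> \<le> M2" using pcont_bounded[OF assms(2)] by blast
  obtain E where E: "finite E" "\<And>\<epsilon> \<rho>. \<epsilon> > 0 \<Longrightarrow> \<rho> > 0 \<Longrightarrow>
    \<exists>\<eta>>0. \<forall>y z. \<bar>y - z\<bar> < \<eta> \<and> y \<notin> near_pts E \<rho> \<longrightarrow> \<bar>F y - F z\<bar> < \<epsilon> \<and> \<bar>G y - G z\<bar> < \<epsilon>"
    using pcont_osc2[OF assms] by blast
  show ?thesis
  proof (rule pcontI[OF _ _ E(1)])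
    show "F (y + 1) + G (y + 1) = F y + G y" for y using assms by (simp add: pcont_period)
    show "\<bar>F y + G y\<bar> \<le> M1 + M2" for y using M1[of y] M2[of y] by linarith
    fix \<epsilon> \<rho> :: real assume "\<epsilon> > 0" "\<rho> > 0"
    then obtain \<eta> where \<eta>: "\<eta> > 0" "\<And>y z. \<bar>y - z\<bar> < \<eta> \<Longrightarrow> y \<notin> near_pts E \<rho> \<Longrightarrow> \<bar>F y - F z\<bar> < \<epsilon>/2 \<and> \<bar>G y - G z\<bar> < \<epsilon>/2"
      using E(2)[of "\<epsilon>/2" \<rho>] by auto
    show "\<exists>\<eta>>0. \<forall>y z. \<bar>y - z\<bar> < \<eta> \<and> y \<notin> near_pts E \<rho> \<longrightarrow> \<bar>F y + G y - (F z + G z)\<bar> < \<epsilon>"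
    proof (intro exI[of _ \<eta>] conjI allI impI \<eta>(1))
      fix y z assume "\<bar>y - z\<bar> < \<eta> \<and> y \<notin> near_pts E \<rho>"
      then show "\<bar>F y + G y - (F z + G z)\<bar> < \<epsilon>" using \<eta>(2)[of y z] by linarith
    qed
  qed
qed

lemma pcont_mult [intro]:
  assumes "pcont F" "pcont G" shows "pcont (\<lambda>y. F y * G y)"
proof -
  obtain M1 where M1: "M1 > 0" "\<And>y. \<bar>F y\<bar> \<le> M1" using pcont_bounded[OF assms(1)] by blast
  obtain M2 where M2: "M2 > 0" "\<And>y. \<bar>G y\<bar> \<le> M2" using pcont_bounded[OF assms(2)] by blast
  obtain E where E: "finite E" "\<And>\<epsilon> \<rho>. \<epsilon> > 0 \<Longrightarrow> \<rho> > 0 \<Longrightarrow>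
    \<exists>\<eta>>0. \<forall>y z. \<bar>y - z\<bar> < \<eta> \<and> y \<notin> near_pts E \<rho> \<longrightarrow> \<bar>F y - F z\<bar> < \<epsilon> \<and> \<bar>G y - G z\<bar> < \<epsilon>"
    using pcont_osc2[OF assms] by blast
  show ?thesis
  proof (rule pcontI[OF _ _ E(1)])
    show "F (y + 1) * G (y + 1) = F y * G y" for y using assms by (simp add: pcont_period)
    show "\<bar>F y * G y\<bar> \<le> M1 * M2" for y unfolding abs_mult using M1(1) by (intro mult_mono M1(2) M2(2)) auto
    fix \<epsilon> \<rho> :: real assume e: "\<epsilon> > 0" "\<rho> > 0"
    define \<epsilon>' where "\<epsilon>' = \<epsilon> / (M1 + M2)"
    have "\<epsilon>' > 0" using e M1(1) M2(1) by (simp add: \<epsilon>'_def)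
    then obtain \<eta> where \<eta>: "\<eta> > 0" "\<And>y z. \<bar>y - z\<bar> < \<eta> \<Longrightarrow> y \<notin> near_pts E \<rho> \<Longrightarrow> \<bar>F y - F z\<bar> < \<epsilon>' \<and> \<bar>G y - G z\<bar> < \<epsilon>'"
      using E(2)[OF _ e(2), of \<epsilon>'] by auto
    show "\<exists>\<eta>>0. \<forall>y z. \<bar>y - z\<bar> < \<eta> \<and> y \<notin> near_pts E \<rho> \<longrightarrow> \<bar>F y * G y - F z * G z\<bar> < \<epsilon>"
    proof (intro exI[of _ \<eta>] conjI allI impI \<eta>(1))
      fix y z assume "\<bar>y - z\<bar> < \<eta> \<and> y \<notin> near_pts E \<rho>"
      then have d: "\<bar>F y - F z\<bar> < \<epsilon>'" "\<bar>G y - G z\<bar> < \<epsilon>'" using \<eta>(2)[of y z] by auto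
      have "F y * G y - F z * G z = F y * (G y - G z) + (F y - F z) * G z" by (simp add: algebra_simps)
      then have "\<bar>F y * G y - F z * G z\<bar> \<le> \<bar>F y\<bar> * \<bar>G y - G z\<bar> + \<bar>F y - F z\<bar> * \<bar>G z\<bar>"
        by (metis abs_mult abs_triangle_ineq)
      also have "\<dots> \<le> M1 * \<bar>G y - G z\<bar> + \<bar>F y - F z\<bar> * M2"
        using M1 M2 by (intro add_mono mult_mono) auto
      also have "\<dots> < M1 * \<epsilon>' + \<epsilon>' * M2"
        using d M1(1) M2(1) by (intro add_strict_mono mult_strict_left_mono mult_strict_right_mono) auto
      also have "\<dots> = \<epsilon>' * (M1 + M2)" by (simp add: algebra_simps)
      also have "\<dots> = \<epsilon>" using M1(1) M2(1) by (simp add: \<epsilon>'_def)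
      finally show "\<bar>F y * G y - F z * G z\<bar> < \<epsilon>" .
    qed
  qed
qed

lemma pcont_cmult [intro]: "pcont F \<Longrightarrow> pcont (\<lambda>y. c * F y)"
  using pcont_mult[OF pcont_const] .

lemma pcont_uminus [intro]: "pcont F \<Longrightarrow> pcont (\<lambda>y. - F y)"
  using pcont_cmult[of F "-1"] by simp

lemma pcont_diff [intro]: "pcont F \<Longrightarrow> pcont G \<Longrightarrow> pcont (\<lambda>y. F y - G y)"
  using pcont_add[OF _ pcont_uminus, of F G] by simp

lemma pcont_sum [intro]: "(\<And>i. i \<in> I \<Longrightarrow> pcont (F i)) \<Longrightarrow> pcont (\<lambda>y. \<Sum>i\<in>I. F i y)"
  by (induction I rule: infinite_finite_induct) auto

lemma pcont_abs [intro]: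
  assumes "pcont F" shows "pcont (\<lambda>y. \<bar>F y\<bar>)"
proof -
  obtain M where M: "\<And>y. \<bar>F y\<bar> \<le> M" using pcont_bounded[OF assms] by blast
  obtain E where E: "finite E" "\<And>\<epsilon> \<rho>. \<epsilon> > 0 \<Longrightarrow> \<rho> > 0 \<Longrightarrow>
    \<exists>\<eta>>0. \<forall>y z. \<bar>y - z\<bar> < \<eta> \<and> y \<notin> near_pts E \<rho> \<longrightarrow> \<bar>F y - F z\<bar> < \<epsilon>"
    using pcont_osc[OF assms] by blast
  show ?thesis
  proof (rule pcontI[OF _ _ E(1)])
    show "\<bar>F (y + 1)\<bar> = \<bar>F y\<bar>" for y using assms by (simp add: pcont_period)
    show "\<bar>\<bar>F y\<bar>\<bar> \<le> M" for y using M by simp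
    fix \<epsilon> \<rho> :: real assume "\<epsilon> > 0" "\<rho> > 0"
    then obtain \<eta> where \<eta>: "\<eta> > 0" "\<And>y z. \<bar>y - z\<bar> < \<eta> \<Longrightarrow> y \<notin> near_pts E \<rho> \<Longrightarrow> \<bar>F y - F z\<bar> < \<epsilon>"
      using E(2)[of \<epsilon> \<rho>] by auto
    show "\<exists>\<eta>>0. \<forall>y z. \<bar>y - z\<bar> < \<eta> \<and> y \<notin> near_pts E \<rho> \<longrightarrow> \<bar>\<bar>F y\<bar> - \<bar>F z\<bar>\<bar> < \<epsilon>"
    proof (intro exI[of _ \<eta>] conjI allI impI \<eta>(1))
      fix y z assume "\<bar>y - z\<bar> < \<eta> \<and> y \<notin> near_pts E \<rho>"
      then show "\<bar>\<bar>F y\<bar> - \<bar>F z\<bar>\<bar> < \<epsilon>" using \<eta>(2)[of y z] by linarith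
    qed
  qed
qed

lemma pcont_shift [intro]:
  assumes "pcont F" shows "pcont (\<lambda>y. F (y + s))"
proof -
  obtain M where M: "\<And>y. \<bar>F y\<bar> \<le> M" using pcont_bounded[OF assms] by blast
  obtain E where E: "finite E" "\<And>\<epsilon> \<rho>. \<epsilon> > 0 \<Longrightarrow> \<rho> > 0 \<Longrightarrow>
    \<exists>\<eta>>0. \<forall>y z. \<bar>y - z\<bar> < \<eta> \<and> y \<notin> near_pts E \<rho> \<longrightarrow> \<bar>F y - F z\<bar> < \<epsilon>"
    using pcont_osc[OF assms] by blast
  have fin: "finite ((\<lambda>e. e - s) ` E)" using E by simp
  show ?thesis
  proof (rule pcontI[OF _ _ fin])
    show "F (y + 1 + s) = F (y + s)" for y using pcont_period[OF assms, of "y + s"] by (simp add: algebra_simps)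
    show "\<bar>F (y + s)\<bar> \<le> M" for y using M by simp
    fix \<epsilon> \<rho> :: real assume "\<epsilon> > 0" "\<rho> > 0"
    then obtain \<eta> where \<eta>: "\<eta> > 0" "\<And>y z. \<bar>y - z\<bar> < \<eta> \<Longrightarrow> y \<notin> near_pts E \<rho> \<Longrightarrow> \<bar>F y - F z\<bar> < \<epsilon>"
      using E(2)[of \<epsilon> \<rho>] by auto
    show "\<exists>\<eta>>0. \<forall>y z. \<bar>y - z\<bar> < \<eta> \<and> y \<notin> near_pts ((\<lambda>e. e - s) ` E) \<rho> \<longrightarrow> \<bar>F (y + s) - F (z + s)\<bar> < \<epsilon>"
    proof (intro exI[of _ \<eta>] conjI allI impI \<eta>(1))
      fix y z assume a: "\<bar>y - z\<bar> < \<eta> \<and> y \<notin> near_pts ((\<lambda>e. e - s) ` E) \<rho>"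
      then have "y + s \<notin> near_pts E \<rho>" by (auto simp: near_pts_def algebra_simps)
      then show "\<bar>F (y + s) - F (z + s)\<bar> < \<epsilon>" using \<eta>(2)[of "y + s" "z + s"] a by simp
    qed
  qed
qed

lemma pcont_scale:
  assumes "pcont F" "0 < q" shows "pcont (\<lambda>y. F (real q * y))"
proof -
  obtain M where M: "\<And>y. \<bar>F y\<bar> \<le> M" using pcont_bounded[OF assms(1)] by blast
  obtain E where E: "finite E" "\<And>\<epsilon> \<rho>. \<epsilon> > 0 \<Longrightarrow> \<rho> > 0 \<Longrightarrow>
    \<exists>\<eta>>0. \<forall>y z. \<bar>y - z\<bar> < \<eta> \<and> y \<notin> near_pts E \<rho> \<longrightarrow> \<bar>F y - F z\<bar> < \<epsilon>"
    using pcont_osc[OF assms(1)] by blast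
  \<comment> \<open>Modulo 1 each bad point has \<open>q\<close> preimages under multiplication by
    \<open>q\<close>.\<close>
  let ?E = "(\<lambda>(e, k). (e + real k) / real q) ` (E \<times> {..<q})"
  have fin: "finite ?E" using E by simp
  show ?thesis
  proof (rule pcontI[OF _ _ fin])
    show "F (real q * (y + 1)) = F (real q * y)" for y
      using pcont_periodic_int[OF assms(1), of "real q * y" "int q"] by (simp add: algebra_simps)
    show "\<bar>F (real q * y)\<bar> \<le> M" for y using M by simp
    fix \<epsilon> \<rho> :: real assume e: "\<epsilon> > 0" "\<rho> > 0"
    then have "real q * \<rho> > 0" using assms by simp
    with e obtain \<eta> where \<eta>: "\<eta> > 0" "\<And>y z. \<bar>y - z\<bar> < \<eta> \<Longrightarrow> y \<notin> near_pts E (real q * \<rho>) \<Longrightarrow> \<bar>F y - F z\<bar> < \<epsilon>"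
      using E(2)[of \<epsilon> "real q * \<rho>"] by auto
    show "\<exists>\<eta>>0. \<forall>y z. \<bar>y - z\<bar> < \<eta> \<and> y \<notin> near_pts ?E \<rho> \<longrightarrow> \<bar>F (real q * y) - F (real q * z)\<bar> < \<epsilon>"
    proof (intro exI[of _ "\<eta> / real q"] conjI allI impI)
      show "0 < \<eta> / real q" using \<eta> assms by simp
    next
      fix y z assume a: "\<bar>y - z\<bar> < \<eta> / real q \<and> y \<notin> near_pts ?E \<rho>"
      have "real q * y \<notin> near_pts E (real q * \<rho>)"
      proof
        assume "real q * y \<in> near_pts E (real q * \<rho>)"
        then obtain e n where en: "e \<in> E" "\<bar>real q * y - e - of_int n\<bar> < real q * \<rho>"
          by (auto simp: near_pts_def)
        let ?k = "nat (n mod int q)" and ?m = "n div int q"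
        have "real_of_int n = real ?k + real q * real_of_int ?m"
        proof -
          have "n = n mod int q + int q * (n div int q)" by simp
          then have "real_of_int n = real_of_int (n mod int q) + real q * real_of_int ?m"
            by (metis of_int_add of_int_mult of_int_of_nat_eq)
          then show ?thesis using assms(2) by simp
        qed
        then have "real q * y - e - of_int n = real q * (y - (e + real ?k) / real q - of_int ?m)"
          using assms(2) by (simp add: field_simps)
        then have "real q * \<bar>y - (e + real ?k) / real q - of_int ?m\<bar> < real q * \<rho>"
          using en(2) by (simp add: abs_mult)
        then have "\<bar>y - (e + real ?k) / real q - of_int ?m\<bar> < \<rho>" using assms(2) by simp
        moreover have "(e + real ?k) / real q \<in> ?E"
          using en(1) assms(2) by (auto intro!: image_eqI[of _ _ "(e, ?k)"] simp: nat_less_iff)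
        ultimately show False using a by (auto simp: near_pts_def)
      qed
      moreover have "\<bar>real q * y - real q * z\<bar> < \<eta>"
      proof -
        have "\<bar>real q * y - real q * z\<bar> = real q * \<bar>y - z\<bar>"
          by (simp add: abs_mult flip: right_diff_distrib)
        then show ?thesis using a assms(2) by (simp add: pos_less_divide_eq mult.commute)
      qed
      ultimately show "\<bar>F (real q * y) - F (real q * z)\<bar> < \<epsilon>" by (intro \<eta>(2))
    qed
  qed
qed

definition arc :: "real \<Rightarrow> real \<Rightarrow> real \<Rightarrow> real" where
  "arc u v y = of_bool (u \<le> frac y \<and> frac y < v)"

lemma arc_simps: "arc u v (y + 1) = arc u v y" "\<bar>arc u v y\<bar> \<le> 1" "0 \<le> arc u v y" "arc u v y \<le> 1"
  "arc u v y * arc u v y = arc u v y"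
  by (auto simp: arc_def frac_1_eq)

lemma arc_iff_int:
  assumes "0 \<le> u" "v \<le> 1"
  shows "u \<le> frac y \<and> frac y < v \<longleftrightarrow> (\<exists>n::int. of_int n + u \<le> y \<and> y < of_int n + v)"
proof
  assume "u \<le> frac y \<and> frac y < v"
  then show "\<exists>n::int. of_int n + u \<le> y \<and> y < of_int n + v"
    by (intro exI[of _ "\<lfloor>y\<rfloor>"]) (auto simp: frac_def)
next
  assume "\<exists>n::int. of_int n + u \<le> y \<and> y < of_int n + v"
  then obtain n where n: "of_int n + u \<le> y" "y < of_int n + v" by blast
  then have "\<lfloor>y\<rfloor> = n" using assms by (intro floor_unique) auto
  then show "u \<le> frac y \<and> frac y < v" using n by (auto simp: frac_def)
qed

lemma arc_same_side:
  assumes "\<bar>y - z\<bar> < \<rho>" "y \<notin> near_pts {u, v} \<rho>"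
  shows "(of_int n + u \<le> y \<and> y < of_int n + v) \<longleftrightarrow> (of_int n + u \<le> z \<and> z < of_int n + v)"
proof -
  have "\<bar>y - u - of_int n\<bar> \<ge> \<rho>" "\<bar>y - v - of_int n\<bar> \<ge> \<rho>"
    using assms(2) by (auto simp: near_pts_def not_less)
  then show ?thesis using assms(1) by linarith
qed

lemma pcont_arc [intro]:
  assumes "0 \<le> u" "v \<le> 1" shows "pcont (arc u v)"
proof (rule pcontI[of _ 1 "{u, v}"])
  fix \<epsilon> \<rho> :: real assume e: "\<epsilon> > 0" "\<rho> > 0"
  show "\<exists>\<eta>>0. \<forall>y z. \<bar>y - z\<bar> < \<eta> \<and> y \<notin> near_pts {u, v} \<rho> \<longrightarrow> \<bar>arc u v y - arc u v z\<bar> < \<epsilon>"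
  proof (intro exI[of _ \<rho>] conjI allI impI e(2))
    fix y z assume "\<bar>y - z\<bar> < \<rho> \<and> y \<notin> near_pts {u, v} \<rho>"
    then have "arc u v y = arc u v z"
      unfolding arc_def arc_iff_int[OF assms] using arc_same_side[of y z \<rho> u v] by simp
    then show "\<bar>arc u v y - arc u v z\<bar> < \<epsilon>" using e by simp
  qed
qed (auto simp: arc_simps)

lemma pcont_of_continuous_on:
  assumes "continuous_on {0..b} f" "0 < b" "b \<le> 1"
  shows "pcont (\<lambda>y. arc 0 b y * f (frac y))"
proof -
  have "bounded (f ` {0..b})" using assms by (intro compact_imp_bounded compact_continuous_image) auto
  then obtain M where M: "\<And>x. x \<in> {0..b} \<Longrightarrow> \<bar>f x\<bar> \<le> M" unfolding bounded_iff real_norm_def by blast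
  have uc: "uniformly_continuous_on {0..b} f" using assms by (intro compact_uniformly_continuous) auto
  show ?thesis
  proof (rule pcontI[of _ "max M 0" "{0, b}"])
    show "arc 0 b (y + 1) * f (frac (y + 1)) = arc 0 b y * f (frac y)" for y
      by (simp add: arc_simps frac_1_eq)
    show "\<bar>arc 0 b y * f (frac y)\<bar> \<le> max M 0" for y
      using M[of "frac y"] by (auto simp: arc_def le_max_iff_disj)
    fix \<epsilon> \<rho> :: real assume e: "\<epsilon> > 0" "\<rho> > 0"
    obtain \<eta> where \<eta>: "\<eta> > 0" "\<And>x x'. x \<in> {0..b} \<Longrightarrow> x' \<in> {0..b} \<Longrightarrow> \<bar>x' - x\<bar> < \<eta> \<Longrightarrow> \<bar>f x' - f x\<bar> < \<epsilon>"
      using uc e unfolding uniformly_continuous_on_def dist_real_def by (auto simp: abs_minus_commute)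
    show "\<exists>\<eta>>0. \<forall>y z. \<bar>y - z\<bar> < \<eta> \<and> y \<notin> near_pts {0, b} \<rho> \<longrightarrow>
       \<bar>arc 0 b y * f (frac y) - arc 0 b z * f (frac z)\<bar> < \<epsilon>"
    proof (intro exI[of _ "min \<eta> \<rho>"] conjI allI impI)
      show "0 < min \<eta> \<rho>" using \<eta> e by simp
    next
      fix y z assume a: "\<bar>y - z\<bar> < min \<eta> \<rho> \<and> y \<notin> near_pts {0, b} \<rho>"
      then have same: "(of_int n \<le> y \<and> y < of_int n + b) \<longleftrightarrow> (of_int n \<le> z \<and> z < of_int n + b)" for n
        using arc_same_side[of y z \<rho> 0 b n] by simp
      show "\<bar>arc 0 b y * f (frac y) - arc 0 b z * f (frac z)\<bar> < \<epsilon>"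
      proof (cases "\<exists>n::int. of_int n \<le> y \<and> y < of_int n + b")
        case True
        then obtain n where n: "of_int n \<le> y" "y < of_int n + b" by blast
        then have n': "of_int n \<le> z" "z < of_int n + b" using same by auto
        have fl: "\<lfloor>y\<rfloor> = n" "\<lfloor>z\<rfloor> = n" using n n' assms by (auto intro!: floor_unique)
        have "arc 0 b y = 1" "arc 0 b z = 1" using fl n n' by (auto simp: arc_def frac_def)
        moreover have "\<bar>f (frac y) - f (frac z)\<bar> < \<epsilon>"
          using a n n' fl by (intro \<eta>(2)) (auto simp: frac_def)
        ultimately show ?thesis by simp
      next
        case False
        then have "\<not> (\<exists>n::int. of_int n \<le> z \<and> z < of_int n + b)" using same by blast
        with False have "arc 0 b y = 0" "arc 0 b z = 0"
          using arc_iff_int[of 0 b y] arc_iff_int[of 0 b z] assms by (auto simp: arc_def)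
        then show ?thesis using e by simp
      qed
    qed
  qed simp
qed

text \<open>Uniformity in \<open>y\<close> is unique ergodicity for the functions concerned; it lets
  the final statement hold at every starting point.\<close>

definition has_mean :: "real \<Rightarrow> (real \<Rightarrow> real) \<Rightarrow> real \<Rightarrow> bool" where
  "has_mean a F m \<longleftrightarrow> (\<forall>\<epsilon>>0. \<exists>N0. \<forall>N\<ge>N0. \<forall>y. \<bar>orbit_avg a F N y - m\<bar> < \<epsilon>)"

lemma has_mean_tendsto: "has_mean a F m \<Longrightarrow> (\<lambda>N. orbit_avg a F N y) \<longlonglongrightarrow> m"
  unfolding has_mean_def LIMSEQ_iff by (simp add: dist_real_def) blast

lemma has_mean_unique: "has_mean a F m \<Longrightarrow> has_mean a F m' \<Longrightarrow> m = m'"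
  using has_mean_tendsto LIMSEQ_unique by metis

lemma has_mean_add:
  assumes "has_mean a F m" "has_mean a G k" shows "has_mean a (\<lambda>y. F y + G y) (m + k)"
  unfolding has_mean_def
proof (intro allI impI)
  fix \<epsilon> :: real assume "\<epsilon> > 0"
  then have e: "\<epsilon>/2 > 0" by simp
  obtain N1 where N1: "\<And>N y. N \<ge> N1 \<Longrightarrow> \<bar>orbit_avg a F N y - m\<bar> < \<epsilon>/2" using assms(1) e unfolding has_mean_def by blast
  obtain N2 where N2: "\<And>N y. N \<ge> N2 \<Longrightarrow> \<bar>orbit_avg a G N y - k\<bar> < \<epsilon>/2" using assms(2) e unfolding has_mean_def by blast
  show "\<exists>N0. \<forall>N\<ge>N0. \<forall>y. \<bar>orbit_avg a (\<lambda>y. F y + G y) N y - (m + k)\<bar> < \<epsilon>"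
  proof (intro exI[of _ "max N1 N2"] allI impI)
    fix N y assume "N \<ge> max N1 N2"
    then have "\<bar>orbit_avg a F N y - m\<bar> < \<epsilon>/2" "\<bar>orbit_avg a G N y - k\<bar> < \<epsilon>/2" using N1 N2 by auto
    moreover have "orbit_avg a (\<lambda>y. F y + G y) N y = orbit_avg a F N y + orbit_avg a G N y"
      by (simp add: orbit_avg_def sum.distrib add_divide_distrib)
    ultimately show "\<bar>orbit_avg a (\<lambda>y. F y + G y) N y - (m + k)\<bar> < \<epsilon>" by linarith
  qed
qed

lemma has_mean_const: "has_mean a (\<lambda>_. c) c"
  unfolding has_mean_def by (intro allI impI exI[of _ 1]) (simp add: orbit_avg_def)

lemma has_mean_cmult:
  assumes "has_mean a F m" shows "has_mean a (\<lambda>y. c * F y) (c * m)"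
  unfolding has_mean_def
proof (intro allI impI)
  fix \<epsilon> :: real assume "\<epsilon> > 0"
  then have e: "\<epsilon> / (\<bar>c\<bar> + 1) > 0" by simp
  obtain N1 where N1: "\<And>N y. N \<ge> N1 \<Longrightarrow> \<bar>orbit_avg a F N y - m\<bar> < \<epsilon> / (\<bar>c\<bar> + 1)" using assms e unfolding has_mean_def by blast
  show "\<exists>N0. \<forall>N\<ge>N0. \<forall>y. \<bar>orbit_avg a (\<lambda>y. c * F y) N y - c * m\<bar> < \<epsilon>"
  proof (intro exI[of _ N1] allI impI)
    fix N y assume N: "N \<ge> N1"
    have "orbit_avg a (\<lambda>y. c * F y) N y - c * m = c * (orbit_avg a F N y - m)"
      by (simp add: orbit_avg_def right_diff_distrib flip: sum_distrib_left)
    then have "\<bar>orbit_avg a (\<lambda>y. c * F y) N y - c * m\<bar> = \<bar>c\<bar> * \<bar>orbit_avg a F N y - m\<bar>"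
      by (simp add: abs_mult)
    also have "\<dots> \<le> (\<bar>c\<bar> + 1) * \<bar>orbit_avg a F N y - m\<bar>" by (intro mult_right_mono) auto
    also have "\<dots> < (\<bar>c\<bar> + 1) * (\<epsilon> / (\<bar>c\<bar> + 1))" by (intro mult_strict_left_mono N1 N) auto
    also have "\<dots> = \<epsilon>" by (simp add: field_simps)
    finally show "\<bar>orbit_avg a (\<lambda>y. c * F y) N y - c * m\<bar> < \<epsilon>" .
  qed
qed

lemma has_mean_le:
  assumes "has_mean a F m" "has_mean a G k" "\<And>y. F y \<le> G y" shows "m \<le> k"
proof (rule LIMSEQ_le[OF has_mean_tendsto[OF assms(1), of 0] has_mean_tendsto[OF assms(2), of 0]])
  show "\<exists>N. \<forall>n\<ge>N. orbit_avg a F n 0 \<le> orbit_avg a G n 0"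
    by (auto simp: orbit_avg_def intro!: divide_right_mono sum_mono assms)
qed

lemma has_mean_shift: "has_mean a F m \<Longrightarrow> has_mean a (\<lambda>y. F (y + s)) m"
proof -
  have *: "orbit_avg a (\<lambda>y. F (y + s)) N y = orbit_avg a F N (y + s)" for N y
    by (simp add: orbit_avg_def add_ac)
  show "has_mean a F m \<Longrightarrow> has_mean a (\<lambda>y. F (y + s)) m"
    unfolding has_mean_def * by blast
qed

lemma orbit_sum_blocks:
  assumes "\<And>y. \<bar>orbit_avg a F q y - c\<bar> \<le> \<epsilon>" "0 < q"
  shows "\<bar>(\<Sum>i<k * q. F (y + real i * a)) - real (k * q) * c\<bar> \<le> real (k * q) * \<epsilon>"
proof (induction k)
  case (Suc k)
  let ?z = "y + real (k * q) * a"
  have "(\<Sum>i<k * q + n. F (y + real i * a)) = (\<Sum>i<k * q. F (y + real i * a)) + (\<Sum>i<n. F (y + real (k * q + i) * a))" for n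
    by (induction n) auto
  from this[of q] have "(\<Sum>i<Suc k * q. F (y + real i * a)) = (\<Sum>i<k * q. F (y + real i * a)) + (\<Sum>i<q. F (y + real (k * q + i) * a))"
    by (simp only: mult_Suc add.commute)
  also have "(\<Sum>i<q. F (y + real (k * q + i) * a)) = (\<Sum>i<q. F (?z + real i * a))"
    by (intro sum.cong) (auto simp: algebra_simps)
  also have "\<dots> = real q * orbit_avg a F q ?z" using assms(2) by (simp add: orbit_avg_def)
  finally have 1: "(\<Sum>i<Suc k * q. F (y + real i * a)) = (\<Sum>i<k * q. F (y + real i * a)) + real q * orbit_avg a F q ?z" .
  have "\<bar>real q * orbit_avg a F q ?z - real q * c\<bar> = real q * \<bar>orbit_avg a F q ?z - c\<bar>"
    by (simp add: abs_mult flip: right_diff_distrib)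
  also have "\<dots> \<le> real q * \<epsilon>" by (intro mult_left_mono assms) auto
  finally have 2: "\<bar>real q * orbit_avg a F q ?z - real q * c\<bar> \<le> real q * \<epsilon>" .
  have 3: "real (Suc k * q) * x = real (k * q) * x + real q * x" for x by (simp add: algebra_simps)
  show ?case unfolding 1 3 using Suc 2 by linarith
qed simp

text \<open>A single good block length suffices: long sums are cut into blocks of length
  \<open>q\<close>, each estimated from its own starting point, and the incomplete last block has
  bounded size.\<close>

lemma orbit_avg_all_of_block:
  assumes avg: "\<And>y. \<bar>orbit_avg a F q y - c\<bar> \<le> \<epsilon>" and q: "0 < q" and "\<epsilon> > 0" and M: "\<And>y. \<bar>F y\<bar> \<le> M"
  shows "\<exists>N0. \<forall>N\<ge>N0. \<forall>y. \<bar>orbit_avg a F N y - c\<bar> \<le> 2 * \<epsilon>"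
proof -
  have M0: "M \<ge> 0" using M[of 0] by linarith
  define N0 where "N0 = nat \<lceil>real q * (M + \<bar>c\<bar>) / \<epsilon>\<rceil> + 1"
  show ?thesis
  proof (intro exI[of _ N0] allI impI)
    fix N y assume N: "N \<ge> N0"
    have Npos: "N > 0" using N by (simp add: N0_def)
    have "real q * (M + \<bar>c\<bar>) / \<epsilon> \<le> real N0" unfolding N0_def by linarith
    then have "real q * (M + \<bar>c\<bar>) / \<epsilon> \<le> real N" using N by linarith
    then have Ne: "real q * (M + \<bar>c\<bar>) \<le> real N * \<epsilon>" using \<open>\<epsilon> > 0\<close> by (simp add: pos_divide_le_eq)
    let ?k = "N div q" and ?r = "N mod q"
    have Neq: "N = ?k * q + ?r" by simp
    let ?S = "\<lambda>n. \<Sum>i<n. F (y + real i * a)"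
    have "?S (?k * q + n) - ?S (?k * q) = (\<Sum>i<n. F (y + real (?k * q + i) * a))" for n
      by (induction n) auto
    from this[of ?r] have split: "?S N - ?S (?k * q) = (\<Sum>i<?r. F (y + real (?k * q + i) * a))"
      using Neq by simp
    have "\<bar>(\<Sum>i<?r. F (y + real (?k * q + i) * a))\<bar> \<le> (\<Sum>i<?r. M)"
      by (rule order_trans[OF sum_abs sum_mono]) (rule M)
    also have "\<dots> \<le> real q * M" using q M0 by (simp add: mult_right_mono less_imp_le)
    finally have 1: "\<bar>?S N - ?S (?k * q)\<bar> \<le> real q * M" using split by simp
    have 2: "\<bar>?S (?k * q) - real (?k * q) * c\<bar> \<le> real (?k * q) * \<epsilon>"
      by (rule orbit_sum_blocks[OF avg q])
    have Nr: "real N = real (?k * q) + real ?r" using Neq by (metis of_nat_add)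
    have "\<bar>real ?r * c\<bar> \<le> real q * \<bar>c\<bar>" using q by (simp add: abs_mult mult_right_mono less_imp_le)
    moreover have "real N * c = real (?k * q) * c + real ?r * c" unfolding Nr by (simp add: algebra_simps)
    moreover have "real (?k * q) * \<epsilon> \<le> real N * \<epsilon>" using \<open>\<epsilon> > 0\<close> Nr by (intro mult_right_mono) auto
    moreover have "real q * (M + \<bar>c\<bar>) = real q * M + real q * \<bar>c\<bar>" by (simp add: algebra_simps)
    ultimately have "\<bar>?S N - real N * c\<bar> \<le> 2 * (real N * \<epsilon>)" using 1 2 Ne by linarith
    moreover have "orbit_avg a F N y - c = (?S N - real N * c) / real N"
      using Npos by (simp add: orbit_avg_def diff_divide_distrib)
    ultimately show "\<bar>orbit_avg a F N y - c\<bar> \<le> 2 * \<epsilon>"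
      using Npos by (simp only: abs_divide) (simp add: pos_divide_le_eq algebra_simps)
  qed
qed

lemma has_mean_exists:
  assumes cauchy: "\<And>\<epsilon>. \<epsilon> > 0 \<Longrightarrow> \<exists>c N0. \<forall>N\<ge>N0. \<forall>y. \<bar>orbit_avg a F N y - c\<bar> \<le> \<epsilon>"
  shows "\<exists>m. has_mean a F m"
proof -
  have "Cauchy (\<lambda>N. orbit_avg a F N 0)"
  proof (rule metric_CauchyI)
    fix e :: real assume "e > 0"
    then obtain c N0 where c: "\<And>N y. N \<ge> N0 \<Longrightarrow> \<bar>orbit_avg a F N y - c\<bar> \<le> e/3" using cauchy[of "e/3"] by auto
    have "dist (orbit_avg a F m 0) (orbit_avg a F n 0) < e" if "m \<ge> N0" "n \<ge> N0" for m n
      using c[OF that(1), of 0] c[OF that(2), of 0] \<open>e > 0\<close> unfolding dist_real_def by linarith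
    then show "\<exists>M. \<forall>m\<ge>M. \<forall>n\<ge>M. dist (orbit_avg a F m 0) (orbit_avg a F n 0) < e" by blast
  qed
  then obtain m where m: "(\<lambda>N. orbit_avg a F N 0) \<longlonglongrightarrow> m" using Cauchy_convergent convergent_def by blast
  have "has_mean a F m" unfolding has_mean_def
  proof (intro allI impI)
    fix e :: real assume e: "e > 0"
    then obtain c N0 where c: "\<And>N y. N \<ge> N0 \<Longrightarrow> \<bar>orbit_avg a F N y - c\<bar> \<le> e/3" using cauchy[of "e/3"] by auto
    have mc: "0 \<le> e/3 - \<bar>m - c\<bar>"
    proof (rule Lim_bounded2)
      show "(\<lambda>N. e/3 - \<bar>orbit_avg a F N 0 - c\<bar>) \<longlonglongrightarrow> e/3 - \<bar>m - c\<bar>" by (intro tendsto_intros m)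
      show "\<forall>n\<ge>N0. 0 \<le> e / 3 - \<bar>orbit_avg a F n 0 - c\<bar>" using c by auto
    qed
    show "\<exists>N0. \<forall>N\<ge>N0. \<forall>y. \<bar>orbit_avg a F N y - m\<bar> < e"
    proof (intro exI[of _ N0] allI impI)
      fix N y assume "N \<ge> N0"
      then show "\<bar>orbit_avg a F N y - m\<bar> < e" using c[of N y] mc e by linarith
    qed
  qed
  then show ?thesis by blast
qed

text \<open>By Dirichlet's theorem this amounts to the irrationality of \<open>a\<close>.\<close>

locale rotation =
  fixes a :: real
  assumes approximable: "\<And>Q0. \<exists>q P. Q0 \<le> q \<and> good_approx a q P"
begin

lemma pcont_has_mean:
  assumes F: "pcont F" shows "\<exists>m. has_mean a F m"
proof (rule has_mean_exists)
  fix \<epsilon> :: real assume "\<epsilon> > 0"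
  then have e: "\<epsilon>/2 > 0" by simp
  obtain Q0 where Q0: "\<And>a q P y y'. \<lbrakk>q \<ge> Q0; good_approx a q P\<rbrakk> \<Longrightarrow>
      \<bar>orbit_avg a F q y - (\<Sum>j<q. F (y' + real j / real q)) / real q\<bar> < \<epsilon>/2"
    using orbit_avg_near_lattice_avg[OF F e] by blast
  obtain q P where q: "Q0 \<le> q" "good_approx a q P" using approximable by blast
  obtain M where M: "\<And>y. \<bar>F y\<bar> \<le> M" using pcont_bounded[OF F] by blast
  have "\<exists>N0. \<forall>N\<ge>N0. \<forall>y. \<bar>orbit_avg a F N y - (\<Sum>j<q. F (0 + real j / real q)) / real q\<bar> \<le> 2 * (\<epsilon>/2)"
  proof (rule orbit_avg_all_of_block[OF _ _ e M])
    show "\<bar>orbit_avg a F q y - (\<Sum>j<q. F (0 + real j / real q)) / real q\<bar> \<le> \<epsilon>/2" for y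
      using Q0[OF q] less_imp_le by blast
    show "0 < q" using q by (simp add: good_approx_def)
  qed
  then show "\<exists>c N0. \<forall>N\<ge>N0. \<forall>y. \<bar>orbit_avg a F N y - c\<bar> \<le> \<epsilon>" by auto
qed

text \<open>Plays the part of the integral over the circle; the choice is meaningful for
  \<open>pcont\<close> functions, whose mean exists and is unique.\<close>

definition mean :: "(real \<Rightarrow> real) \<Rightarrow> real" where
  "mean F = (SOME m. has_mean a F m)"

lemma has_mean_mean: "pcont F \<Longrightarrow> has_mean a F (mean F)"
  unfolding mean_def by (rule someI_ex[OF pcont_has_mean])

lemma mean_eqI: "has_mean a F m \<Longrightarrow> mean F = m"
  unfolding mean_def by (rule some_equality) (auto intro: has_mean_unique)

lemma mean_const [simp]: "mean (\<lambda>_. c) = c"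
  by (intro mean_eqI has_mean_const)

lemma mean_add: "pcont F \<Longrightarrow> pcont G \<Longrightarrow> mean (\<lambda>y. F y + G y) = mean F + mean G"
  by (intro mean_eqI has_mean_add has_mean_mean)

lemma mean_cmult: "pcont F \<Longrightarrow> mean (\<lambda>y. c * F y) = c * mean F"
  by (intro mean_eqI has_mean_cmult has_mean_mean)

lemma mean_diff: "pcont F \<Longrightarrow> pcont G \<Longrightarrow> mean (\<lambda>y. F y - G y) = mean F - mean G"
  using mean_add[of F "\<lambda>y. -1 * G y"] mean_cmult[of G "-1"] pcont_cmult[of G "-1"] by simp

lemma mean_sum: "(\<And>i. i \<in> I \<Longrightarrow> pcont (F i)) \<Longrightarrow> mean (\<lambda>y. \<Sum>i\<in>I. F i y) = (\<Sum>i\<in>I. mean (F i))"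
proof (induction I rule: infinite_finite_induct)
  case (insert x I)
  then show ?case by (simp add: mean_add pcont_sum)
qed auto

lemma mean_mono: "pcont F \<Longrightarrow> pcont G \<Longrightarrow> (\<And>y. F y \<le> G y) \<Longrightarrow> mean F \<le> mean G"
  by (rule has_mean_le[OF has_mean_mean has_mean_mean])

lemma mean_shift: "pcont F \<Longrightarrow> mean (\<lambda>y. F (y + s)) = mean F"
  by (intro mean_eqI has_mean_shift has_mean_mean)

lemma mean_nonneg: "pcont F \<Longrightarrow> (\<And>y. 0 \<le> F y) \<Longrightarrow> 0 \<le> mean F"
  using mean_mono[of "\<lambda>_. 0" F] by simp

lemma mean_abs_le: "pcont F \<Longrightarrow> \<bar>mean F\<bar> \<le> mean (\<lambda>y. \<bar>F y\<bar>)"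
  using mean_mono[of F "\<lambda>y. \<bar>F y\<bar>"] mean_mono[of "\<lambda>y. - 1 * F y" "\<lambda>y. \<bar>F y\<bar>"] mean_cmult[of F "-1"]
  by (force simp: abs_le_iff pcont_abs intro!: pcont_cmult)

text \<open>For suitable large \<open>q\<close> the lattice average and the mean are both close to
  the same orbit average, so estimates on the lattices of step \<open>1 / q\<close> pass to the
  mean.\<close>

lemma mean_le_of_lattice:
  assumes F: "pcont F" and le: "\<And>q. 0 < q \<Longrightarrow> (\<Sum>j<q. F (real j / real q)) / real q \<le> c + C / real q"
  shows "mean F \<le> c"
proof (rule field_le_epsilon)
  fix \<epsilon> :: real assume e: "\<epsilon> > 0"
  then have e3: "\<epsilon>/3 > 0" by simp
  obtain Q0 where Q0: "\<And>a q P y y'. \<lbrakk>q \<ge> Q0; good_approx a q P\<rbrakk> \<Longrightarrow>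
      \<bar>orbit_avg a F q y - (\<Sum>j<q. F (y' + real j / real q)) / real q\<bar> < \<epsilon>/3"
    using orbit_avg_near_lattice_avg[OF F e3] by blast
  obtain N0 where N0: "\<And>N y. N \<ge> N0 \<Longrightarrow> \<bar>orbit_avg a F N y - mean F\<bar> < \<epsilon>/3"
    using has_mean_mean[OF F] e3 unfolding has_mean_def by blast
  obtain q P where q: "max Q0 (max N0 (nat \<lceil>3 * \<bar>C\<bar> / \<epsilon>\<rceil>)) \<le> q" "good_approx a q P" using approximable by blast
  have q0: "0 < q" using q by (simp add: good_approx_def)
  have "3 * \<bar>C\<bar> / \<epsilon> \<le> real q" using q(1) by linarith
  then have "C / real q \<le> \<epsilon>/3" using e q0 by (simp add: field_simps)
  moreover have "\<bar>orbit_avg a F q 0 - (\<Sum>j<q. F (real j / real q)) / real q\<bar> < \<epsilon>/3"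
    using Q0[OF _ q(2), of 0 0] q(1) by simp
  moreover have "\<bar>orbit_avg a F q 0 - mean F\<bar> < \<epsilon>/3" using q by (intro N0) simp
  ultimately show "mean F \<le> c + \<epsilon>" using le[OF q0] by linarith
qed

text \<open>Checked on lattices: off a neighbourhood of the bad points the difference is uniformly
  small, and only a small proportion of lattice points lies in the neighbourhood.\<close>

lemma mean_translation_continuous:
  assumes F: "pcont F" and "\<epsilon> > 0"
  shows "\<exists>\<eta>>0. \<forall>s. \<bar>s\<bar> < \<eta> \<longrightarrow> mean (\<lambda>y. \<bar>F (y + s) - F y\<bar>) \<le> \<epsilon>"
proof -
  obtain M where M: "M > 0" "\<And>y. \<bar>F y\<bar> \<le> M" using pcont_bounded[OF F] by blast
  obtain E where E: "finite E" "\<And>\<epsilon> \<rho>. \<epsilon> > 0 \<Longrightarrow> \<rho> > 0 \<Longrightarrow>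
    \<exists>\<eta>>0. \<forall>y z. \<bar>y - z\<bar> < \<eta> \<and> y \<notin> near_pts E \<rho> \<longrightarrow> \<bar>F y - F z\<bar> < \<epsilon>"
    using pcont_osc[OF F] by blast
  define K where "K = 2 * M * real (card E) + 1"
  have K: "K > 0" "2 * M * real (card E) \<le> K" using M(1) by (auto simp: K_def add_nonneg_pos)
  define \<rho> where "\<rho> = \<epsilon> / (4 * K)"
  have \<rho>: "\<rho> > 0" using K \<open>0 < \<epsilon>\<close> by (simp add: \<rho>_def)
  obtain \<eta> where \<eta>: "\<eta> > 0" "\<And>y z. \<bar>y - z\<bar> < \<eta> \<Longrightarrow> y \<notin> near_pts E \<rho> \<Longrightarrow> \<bar>F y - F z\<bar> < \<epsilon>/2"
    using E(2)[of "\<epsilon>/2" \<rho>] \<rho> \<open>\<epsilon> > 0\<close> by auto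
  show ?thesis
  proof (intro exI[of _ \<eta>] conjI allI impI \<eta>(1))
    fix s assume s: "\<bar>s\<bar> < \<eta>"
    show "mean (\<lambda>y. \<bar>F (y + s) - F y\<bar>) \<le> \<epsilon>"
    proof (rule mean_le_of_lattice)
      show "pcont (\<lambda>y. \<bar>F (y + s) - F y\<bar>)" by (intro pcont_abs pcont_diff pcont_shift F)
      fix q :: nat assume q: "0 < q"
      let ?X = "{j. j < q \<and> 0 + real j / real q \<in> near_pts E \<rho>}"
      have pt: "\<bar>F (real j / real q + s) - F (real j / real q)\<bar> \<le> \<epsilon>/2 + 2 * M * of_bool (j \<in> ?X)" if "j < q" for j
      proof (cases "j \<in> ?X")
        case True
        then have "2 * M * of_bool (j \<in> ?X) = 2 * M" by (simp only: of_bool_eq mult_1_right)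
        then show ?thesis using M(2)[of "real j / real q + s"] M(2)[of "real j / real q"] \<open>\<epsilon> > 0\<close> by linarith
      next
        case False
        then have "real j / real q \<notin> near_pts E \<rho>" using that by simp
        then have "\<bar>F (real j / real q) - F (real j / real q + s)\<bar> < \<epsilon>/2" using s by (intro \<eta>(2)) auto
        moreover have "2 * M * of_bool (j \<in> ?X) = 0" using False by (simp only: of_bool_eq mult_zero_right)
        ultimately show ?thesis by linarith
      qed
      have "(\<Sum>j<q. \<bar>F (real j / real q + s) - F (real j / real q)\<bar>) \<le> (\<Sum>j<q. \<epsilon>/2 + 2 * M * of_bool (j \<in> ?X))"
        by (intro sum_mono pt) simp
      also have "\<dots> = real q * (\<epsilon>/2) + 2 * M * (\<Sum>j<q. of_bool (j \<in> ?X))"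
        by (simp add: sum.distrib sum_distrib_left)
      also have "(\<Sum>j<q. of_bool (j \<in> ?X)) = real (card ?X)"
        by (subst sum_of_bool_eq) (auto intro!: arg_cong[where f = card])
      also have "real q * (\<epsilon>/2) + 2 * M * real (card ?X) \<le> real q * (\<epsilon>/2) + 2 * M * (real (card E) * (2 * \<rho> * real q + 1))"
        using card_lattice_near[OF q _ E(1), of \<rho> 0] \<rho> M(1)
        by (intro add_left_mono mult_left_mono) auto
      also have "\<dots> = real q * (\<epsilon>/2) + (2 * M * real (card E)) * (2 * \<rho> * real q + 1)" by simp
      also have "\<dots> \<le> real q * (\<epsilon>/2) + K * (2 * \<rho> * real q + 1)"
        using K \<rho> by (intro add_left_mono mult_right_mono) auto
      also have "\<dots> = real q * \<epsilon> + K" using K by (simp add: \<rho>_def field_simps)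
      finally show "(\<Sum>j<q. \<bar>F (real j / real q + s) - F (real j / real q)\<bar>) / real q \<le> \<epsilon> + K / real q"
        using q by (simp add: field_simps)
    qed
  qed
qed

end

lemma lattice_arc_count_le:
  assumes "0 < K" "0 \<le> u" "u \<le> v" "v \<le> 1"
  shows "(\<Sum>k<K. arc u v (w + real k / real K)) \<le> real K * (v - u) + 3"
proof -
  let ?r = "(v - u) / 2 + 1 / real K"
  let ?X = "{k. k < K \<and> w + real k / real K \<in> near_pts {(u + v) / 2} ?r}"
  have r: "?r \<ge> 0" "1 / real K > 0" using assms by auto
  have "arc u v (w + real k / real K) \<le> of_bool (k \<in> ?X)" if "k < K" for k
  proof (cases "u \<le> frac (w + real k / real K) \<and> frac (w + real k / real K) < v")
    case True
    then obtain n :: int where n: "of_int n + u \<le> w + real k / real K" "w + real k / real K < of_int n + v"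
      using arc_iff_int assms by blast
    have "\<bar>w + real k / real K - (u + v) / 2 - of_int n\<bar> < ?r"
      using n r(2) by (simp add: field_simps abs_less_iff)
    then have "k \<in> ?X" using that by (auto simp: near_pts_def)
    then show ?thesis by (simp only: of_bool_eq arc_simps)
  next
    case False
    then have "arc u v (w + real k / real K) = 0" by (simp only: arc_def of_bool_eq)
    then show ?thesis by (simp only: of_bool_def) simp
  qed
  then have "(\<Sum>k<K. arc u v (w + real k / real K)) \<le> (\<Sum>k<K. of_bool (k \<in> ?X))" by (intro sum_mono) auto
  also have "\<dots> = real (card ?X)"
    by (subst sum_of_bool_eq) (auto intro!: arg_cong[where f = card])
  also have "\<dots> \<le> 2 * ?r * real K + 1" by (intro card_lattice_near_point assms r)
  also have "\<dots> = real K * (v - u) + 3" using assms(1) by (simp add: field_simps)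
  finally show ?thesis .
qed

text \<open>The upper bounds for the two complementary arcs give the lower bound, because the three
  counts add up to \<open>K\<close>; hence the constant \<open>6 = 3 + 3\<close>.\<close>

lemma lattice_arc_count:
  assumes "0 < K" "0 \<le> u" "u \<le> v" "v \<le> 1"
  shows "\<bar>(\<Sum>k<K. arc u v (w + real k / real K)) - real K * (v - u)\<bar> \<le> 6"
proof -
  have "arc 0 u y + arc u v y + arc v 1 y = 1" for y
    using assms frac_ge_0[of y] frac_lt_1[of y] by (auto simp: arc_def)
  then have "(\<Sum>k<K. arc 0 u (w + real k / real K) + arc u v (w + real k / real K) + arc v 1 (w + real k / real K)) = (\<Sum>k<K. 1)"
    by simp
  then have 1: "(\<Sum>k<K. arc 0 u (w + real k / real K)) + (\<Sum>k<K. arc u v (w + real k / real K))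
      + (\<Sum>k<K. arc v 1 (w + real k / real K)) = real K"
    by (simp add: sum.distrib)
  have 2: "(\<Sum>k<K. arc 0 u (w + real k / real K)) \<le> real K * (u - 0) + 3"
    "(\<Sum>k<K. arc v 1 (w + real k / real K)) \<le> real K * (1 - v) + 3"
    "(\<Sum>k<K. arc u v (w + real k / real K)) \<le> real K * (v - u) + 3"
    using assms by (intro lattice_arc_count_le; simp)+
  have 3: "real K * (u - 0) + real K * (v - u) + real K * (1 - v) = real K" by (simp add: algebra_simps)
  show ?thesis using 1 2 3 by linarith
qed

context rotation
begin

lemma mean_abs_diff_le:
  assumes "pcont F" "pcont G" "pcont H" "\<And>y. \<bar>F y - G y\<bar> \<le> H y"
  shows "\<bar>mean F - mean G\<bar> \<le> mean H"
proof -
  have "\<bar>mean F - mean G\<bar> = \<bar>mean (\<lambda>y. F y - G y)\<bar>" using assms by (simp add: mean_diff)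
  also have "\<dots> \<le> mean (\<lambda>y. \<bar>F y - G y\<bar>)" using assms by (intro mean_abs_le pcont_diff)
  also have "\<dots> \<le> mean H" using assms by (intro mean_mono pcont_abs pcont_diff)
  finally show ?thesis .
qed

lemma mean_abs_diff_le_const:
  assumes "pcont F" "pcont G" "\<And>y. \<bar>F y - G y\<bar> \<le> c"
  shows "\<bar>mean F - mean G\<bar> \<le> c"
  using mean_abs_diff_le[OF assms(1,2) pcont_const assms(3)] by simp

lemma pcont_arc_scaled:
  assumes "0 \<le> u" "v \<le> 1" "0 < q" shows "pcont (\<lambda>y. arc u v (real q * y))"
  by (intro pcont_scale pcont_arc assms)

text \<open>An indicator of period \<open>1 / q\<close> decorrelates from \<open>G\<close>.
  Translation by the \<open>K\<close> multiples of \<open>1 / (K * q)\<close> below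
  \<open>1 / q\<close> hardly changes \<open>G\<close>, while the translates of the indicator add up
  to \<open>K * (v - u)\<close> at every point, with an error of at most 6.\<close>

lemma mean_arc_scaled_times:
  assumes G: "pcont G" and M: "\<And>y. \<bar>G y\<bar> \<le> M" and q: "0 < q" and K: "0 < K" and uv: "0 \<le> u" "u \<le> v" "v \<le> 1"
    and tr: "\<And>s. \<bar>s\<bar> < 1 / real q \<Longrightarrow> mean (\<lambda>y. \<bar>G (y + s) - G y\<bar>) \<le> e"
  shows "\<bar>mean (\<lambda>y. arc u v (real q * y) * G y) - (v - u) * mean G\<bar> \<le> e + 6 * M / real K"
proof -
  have M0: "M \<ge> 0" using M[of 0] by linarith
  let ?A = "\<lambda>y. arc u v (real q * y)"
  define s where "s k = real k / (real K * real q)" for k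
  have pA: "pcont ?A" using uv q by (intro pcont_arc_scaled) auto
  have pAs: "pcont (\<lambda>y. ?A (y + s k))" for k by (rule pcont_shift[OF pA])
  let ?mA = "mean (\<lambda>y. ?A y * G y)"
  have near: "\<bar>?mA - mean (\<lambda>y. ?A (y + s k) * G y)\<bar> \<le> e" if k: "k < K" for k
  proof -
    have "?mA = mean (\<lambda>y. ?A (y + s k) * G (y + s k))"
      using mean_shift[OF pcont_mult[OF pA G], of "s k"] by simp
    also have "\<bar>\<dots> - mean (\<lambda>y. ?A (y + s k) * G y)\<bar> \<le> mean (\<lambda>y. \<bar>G (y + s k) - G y\<bar>)"
    proof (rule mean_abs_diff_le)
      fix y
      have "\<bar>?A (y + s k) * G (y + s k) - ?A (y + s k) * G y\<bar> = \<bar>?A (y + s k)\<bar> * \<bar>G (y + s k) - G y\<bar>"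
        by (simp add: abs_mult flip: right_diff_distrib)
      also have "\<dots> \<le> 1 * \<bar>G (y + s k) - G y\<bar>" by (intro mult_right_mono arc_simps) auto
      finally show "\<bar>?A (y + s k) * G (y + s k) - ?A (y + s k) * G y\<bar> \<le> \<bar>G (y + s k) - G y\<bar>" by simp
    qed (intro pcont_mult pcont_shift G pcont_abs pcont_diff pAs)+
    also have "\<dots> \<le> e"
    proof (rule tr)
      have "s k < 1 / real q" "s k \<ge> 0" using k q K by (auto simp: s_def field_simps)
      then show "\<bar>s k\<bar> < 1 / real q" by simp
    qed
    finally show ?thesis .
  qed
  have "\<bar>real K * ?mA - (\<Sum>k<K. mean (\<lambda>y. ?A (y + s k) * G y))\<bar> = \<bar>\<Sum>k<K. ?mA - mean (\<lambda>y. ?A (y + s k) * G y)\<bar>"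
    by (simp add: sum_subtractf)
  also have "\<dots> \<le> (\<Sum>k<K. e)" by (rule order_trans[OF sum_abs sum_mono]) (use near in auto)
  finally have 1: "\<bar>real K * ?mA - (\<Sum>k<K. mean (\<lambda>y. ?A (y + s k) * G y))\<bar> \<le> real K * e" by simp
  have 2: "(\<Sum>k<K. mean (\<lambda>y. ?A (y + s k) * G y)) = mean (\<lambda>y. (\<Sum>k<K. ?A (y + s k)) * G y)"
    using mean_sum[of "{..<K}" "\<lambda>k y. ?A (y + s k) * G y"] pcont_mult[OF pAs G] by (simp add: sum_distrib_right)
  have 3: "real K * ((v - u) * mean G) = mean (\<lambda>y. (real K * (v - u)) * G y)"
    by (simp add: mean_cmult[OF G])
  have 4: "\<bar>mean (\<lambda>y. (\<Sum>k<K. ?A (y + s k)) * G y) - mean (\<lambda>y. (real K * (v - u)) * G y)\<bar> \<le> 6 * M"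
  proof (rule mean_abs_diff_le_const)
    show "pcont (\<lambda>y. (\<Sum>k<K. ?A (y + s k)) * G y)" by (intro pcont_mult pcont_sum pAs G)
    show "pcont (\<lambda>y. (real K * (v - u)) * G y)" by (intro pcont_cmult G)
    fix y
    have "real q * (y + s k) = real q * y + real k / real K" for k
      using q K by (simp add: s_def field_simps)
    then have "?A (y + s k) = arc u v (real q * y + real k / real K)" for k by simp
    then have "\<bar>(\<Sum>k<K. ?A (y + s k)) - real K * (v - u)\<bar> \<le> 6"
      using lattice_arc_count[OF K uv, of "real q * y"] by simp
    then have "\<bar>(\<Sum>k<K. ?A (y + s k)) - real K * (v - u)\<bar> * \<bar>G y\<bar> \<le> 6 * M"
      using M[of y] by (intro mult_mono) auto
    then show "\<bar>(\<Sum>k<K. ?A (y + s k)) * G y - (real K * (v - u)) * G y\<bar> \<le> 6 * M"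
      by (simp add: abs_mult flip: left_diff_distrib)
  qed
  have "real K * \<bar>?mA - (v - u) * mean G\<bar> = \<bar>real K * ?mA - real K * ((v - u) * mean G)\<bar>"
    by (simp add: abs_mult flip: right_diff_distrib)
  also have "\<dots> \<le> real K * e + 6 * M" using 1 2 3 4 by linarith
  finally show ?thesis using K by (simp add: field_simps)
qed

lemma mean_arc_scaled:
  assumes "0 < q" "0 \<le> u" "u \<le> v" "v \<le> 1"
  shows "mean (\<lambda>y. arc u v (real q * y)) = v - u"
proof -
  have "\<bar>mean (\<lambda>y. arc u v (real q * y)) - (v - u)\<bar> \<le> 0"
  proof (rule field_le_epsilon)
    fix e :: real assume e: "e > 0"
    define K where "K = nat \<lceil>6 / e\<rceil> + 1"
    have K: "0 < K" "6 / e \<le> real K" unfolding K_def by linarith+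
    have "6 / real K \<le> e" using K e by (simp add: field_simps)
    then show "\<bar>mean (\<lambda>y. arc u v (real q * y)) - (v - u)\<bar> \<le> 0 + e"
      using mean_arc_scaled_times[of "\<lambda>_. 1" 1 q K u v 0] assms K by simp
  qed
  then show ?thesis by simp
qed

text \<open>The threshold is uniform in \<open>u\<close> and \<open>v\<close> because the arcs to
  which it is applied vary with the scale.\<close>

lemma mean_arc_scaled_times_tendsto:
  assumes G: "pcont G" and "e > 0"
  shows "\<exists>Q0. \<forall>q\<ge>Q0. \<forall>u v. 0 \<le> u \<and> u \<le> v \<and> v \<le> 1 \<longrightarrow>
    \<bar>mean (\<lambda>y. arc u v (real q * y) * G y) - (v - u) * mean G\<bar> \<le> e"
proof -
  obtain M where M: "M > 0" "\<And>y. \<bar>G y\<bar> \<le> M" using pcont_bounded[OF G] by blast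
  obtain \<eta> where \<eta>: "\<eta> > 0" "\<And>s. \<bar>s\<bar> < \<eta> \<Longrightarrow> mean (\<lambda>y. \<bar>G (y + s) - G y\<bar>) \<le> e/2"
    using mean_translation_continuous[OF G, of "e/2"] \<open>e > 0\<close> by auto
  define K where "K = nat \<lceil>12 * M / e\<rceil> + 1"
  have K: "0 < K" "12 * M / e \<le> real K" unfolding K_def by linarith+
  have Ke: "6 * M / real K \<le> e/2" using K \<open>e > 0\<close> by (simp add: field_simps)
  show ?thesis
  proof (intro exI[of _ "nat \<lceil>1/\<eta>\<rceil> + 1"] allI impI)
    fix q u v assume q: "nat \<lceil>1/\<eta>\<rceil> + 1 \<le> q" and uv: "0 \<le> u \<and> u \<le> v \<and> v \<le> (1::real)"
    have "1/\<eta> < real q" using q by linarith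
    then have q\<eta>: "1 / real q < \<eta>" "0 < q" using \<eta>(1) q by (auto simp: field_simps)
    have "\<bar>mean (\<lambda>y. arc u v (real q * y) * G y) - (v - u) * mean G\<bar> \<le> e/2 + 6 * M / real K"
      using uv q\<eta> by (intro mean_arc_scaled_times[OF G M(2) _ K(1)] \<eta>(2)) auto
    then show "\<bar>mean (\<lambda>y. arc u v (real q * y) * G y) - (v - u) * mean G\<bar> \<le> e" using Ke by linarith
  qed
qed

end

section \<open>Visits to an arc during one near-period\<close>

definition visits :: "real \<Rightarrow> real \<Rightarrow> nat \<Rightarrow> real \<Rightarrow> nat" where
  "visits a b m y = (\<Sum>i<m. of_bool (frac (y + real i * a) < b))"

lemma visits_add: "visits a b (m + n) y = visits a b m y + visits a b n (y + real m * a)"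
  by (induction n) (auto simp: visits_def algebra_simps)

text \<open>\<open>q * (y + i * a)\<close> is an integer plus
  \<open>frac (q * y) + i * d / q\<close>, and modulo \<open>q\<close> the integers form a
  permutation. So each cell of width \<open>1 / q\<close> is assigned one orbit point, at a relative
  position that drifts by less than \<open>d\<close> during the block.\<close>

lemma orbit_frac_form:
  fixes a y :: real
  assumes q: "0 < q" and co: "coprime P (int q)" and d: "d = real q * (real q * a - of_int P)"
  obtains p :: "nat \<Rightarrow> nat" where "bij_betw p {..<q} {..<q}"
    "\<And>i. frac (y + real i * a) = frac ((real (p i) + frac (real q * y) + real i * d / real q) / real q)"
proof
  let ?p = "\<lambda>i. nat ((\<lfloor>real q * y\<rfloor> + int i * P) mod int q)"
  let ?n = "\<lambda>i. (\<lfloor>real q * y\<rfloor> + int i * P) div int q"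
  show "bij_betw ?p {..<q} {..<q}" by (rule bij_betw_affine_mod[OF q co])
  fix i
  have "real_of_int (\<lfloor>real q * y\<rfloor> + int i * P) = real_of_int ((\<lfloor>real q * y\<rfloor> + int i * P) mod int q) + real q * real_of_int (?n i)"
    by (metis add.commute mult_div_mod_eq of_int_add of_int_mult of_int_of_nat_eq)
  then have 1: "of_int \<lfloor>real q * y\<rfloor> + real i * of_int P = real (?p i) + real q * of_int (?n i)"
    using q by simp
  have "real q * (y + real i * a) = (of_int \<lfloor>real q * y\<rfloor> + real i * of_int P) + frac (real q * y) + real i * d / real q"
    using q by (simp add: d frac_def field_simps)
  also have "\<dots> = real (?p i) + frac (real q * y) + real i * d / real q + real q * of_int (?n i)"
    unfolding 1 by simp
  finally have "y + real i * a = (real (?p i) + frac (real q * y) + real i * d / real q) / real q + of_int (?n i)"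
    using q by (simp add: field_simps)
  then show "frac (y + real i * a) = frac ((real (?p i) + frac (real q * y) + real i * d / real q) / real q)"
    by simp
qed

lemma card_lessThan_pred: "(\<Sum>j<q. of_bool (j < B)) = B" if "B \<le> q" for B q :: nat
proof -
  have "{..<q} \<inter> {j. j < B} = {..<B}" using that by auto
  then show ?thesis by (subst sum_of_bool_eq) auto
qed

lemma div_less_arc_iff:
  fixes q :: nat
  assumes "0 < q" "0 \<le> x" "x < real q" shows "frac (x / real q) < b \<longleftrightarrow> x < real q * b"
proof -
  have "frac (x / real q) = x / real q" using assms by (intro frac_eq[THEN iffD2]) auto
  then show ?thesis using assms by (simp add: field_simps)
qed

text \<open>The arc \<open>[0, b)\<close> consists of \<open>B\<close> full cells of width
  \<open>1 / q\<close> and the portion \<theta> of the next one. Each cell has one orbit point, at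
  relative position between \<open>u\<close> and \<open>u + d\<close>. If all positions lie in
  \<open>[\<theta>, 1)\<close>, the partial cell is missed; if all are below \<theta>, it is hit.
  The last two bounds cover the other cases, where points may spill over into the following
  cell.\<close>

lemma visits_block:
  fixes a b y :: real
  assumes q: "0 < q" and co: "coprime P (int q)" and d: "d = real q * (real q * a - of_int P)" "0 < d" "d \<le> 1"
    and b: "0 < b" "b < 1"
  defines "B \<equiv> nat \<lfloor>real q * b\<rfloor>" and "\<theta> \<equiv> frac (real q * b)" and "u \<equiv> frac (real q * y)"
  shows visits_block_out: "\<theta> \<le> u \<Longrightarrow> u + d \<le> 1 \<Longrightarrow> visits a b q y = B"
    and visits_block_in: "u + d \<le> \<theta> \<Longrightarrow> visits a b q y = B + 1"
    and visits_block_bounds: "B \<le> visits a b q y + 1" "visits a b q y \<le> B + 2"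
proof -
  obtain p where p: "bij_betw p {..<q} {..<q}"
    and pf: "\<And>i. frac (y + real i * a) = frac ((real (p i) + u + real i * d / real q) / real q)"
    unfolding u_def using orbit_frac_form[OF q co d(1), of y] by metis
  have pq: "p i < q" if "i < q" for i using p that by (auto simp: bij_betw_def)
  define v where "v i = u + real i * d / real q" for i
  have u: "0 \<le> u" "u < 1" by (auto simp: u_def frac_lt_1)
  have \<theta>: "0 \<le> \<theta>" "\<theta> < 1" by (auto simp: \<theta>_def frac_lt_1)
  have "0 \<le> \<lfloor>real q * b\<rfloor>" using b q by simp
  then have qb: "real q * b = real B + \<theta>" by (simp add: B_def \<theta>_def frac_def)
  have "real B < real q"
  proof -
    have "real B \<le> real q * b" using qb \<theta> by simp
    also have "\<dots> < real q * 1" using b q by (intro mult_strict_left_mono) auto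
    finally show ?thesis by simp
  qed
  then have Bq: "B < q" by simp
  have v: "u \<le> v i" "v i \<le> u + d" if "i < q" for i
  proof -
    have "real i * d / real q \<le> real q * d / real q" using that d by (intro divide_right_mono mult_right_mono) auto
    then show "v i \<le> u + d" using q by (simp add: v_def)
    have "0 \<le> real i * d / real q" using d(2) by (intro divide_nonneg_nonneg mult_nonneg_nonneg) auto
    then show "u \<le> v i" by (simp add: v_def)
  qed
  have v': "v i < u + d" if "i < q" for i
  proof -
    have "real i * d / real q < real q * d / real q" using that q d by (intro divide_strict_right_mono mult_strict_right_mono) auto
    then show "v i < u + d" using q by (simp add: v_def)
  qed
  have V: "visits a b q y = (\<Sum>i<q. of_bool (frac ((real (p i) + v i) / real q) < b))"
    by (simp add: visits_def pf v_def add.assoc)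
  have mem: "frac ((real (p i) + v i) / real q) < b \<longleftrightarrow> real (p i) + v i < real B + \<theta>"
    if "i < q" "real (p i) + v i < real q" for i
    using div_less_arc_iff[OF q _ that(2), of b] v(1)[OF that(1)] u qb by simp
  have reidx: "(\<Sum>i<q. of_bool (p i < C)) = (C :: nat)" if "C \<le> q" for C
    by (rule trans[OF sum.reindex_bij_betw[OF p, of "\<lambda>j. of_bool (j < C)"] card_lessThan_pred[OF that]])
  {
    assume out: "\<theta> \<le> u" "u + d \<le> 1"
    have "frac ((real (p i) + v i) / real q) < b \<longleftrightarrow> p i < B" if i: "i < q" for i
    proof -
      have vi: "\<theta> \<le> v i" "v i < 1" using v[OF i] v'[OF i] out u d by linarith+
      have pi: "real (p i) + 1 \<le> real q" using pq[OF i] by linarith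
      have "p i < B \<Longrightarrow> real (p i) + 1 \<le> real B" "\<not> p i < B \<Longrightarrow> real B \<le> real (p i)" by linarith+
      then have "real (p i) + v i < real B + \<theta> \<longleftrightarrow> p i < B" using vi \<theta> by (cases "p i < B") linarith+
      then show ?thesis using mem[OF i] vi pi by simp
    qed
    then have "visits a b q y = (\<Sum>i<q. of_bool (p i < B))" unfolding V by (intro sum.cong) auto
    then show "visits a b q y = B" using reidx[of B] Bq by simp
  }
  {
    assume inn: "u + d \<le> \<theta>"
    have "frac ((real (p i) + v i) / real q) < b \<longleftrightarrow> p i < B + 1" if i: "i < q" for i
    proof -
      have "v i < \<theta>" using v'[OF i] inn d by linarith
      then have vi: "0 \<le> v i" "v i < \<theta>" using v[OF i] u by auto
      have pi: "real (p i) + 1 \<le> real q" using pq[OF i] by linarith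
      have "p i < B + 1 \<Longrightarrow> real (p i) \<le> real B" "\<not> p i < B + 1 \<Longrightarrow> real B + 1 \<le> real (p i)" by linarith+
      then have "real (p i) + v i < real B + \<theta> \<longleftrightarrow> p i < B + 1" using vi \<theta> by (cases "p i < B + 1") linarith+
      then show ?thesis using mem[OF i] vi \<theta> pi by simp
    qed
    then have "visits a b q y = (\<Sum>i<q. of_bool (p i < B + 1))" unfolding V by (intro sum.cong) auto
    then show "visits a b q y = B + 1" using reidx[of "B + 1"] Bq by simp
  }
  \<comment> \<open>Relative positions are below 2, so the points assigned to the first
    \<open>B - 1\<close> cells cannot pass the end of the arc.\<close>
  have "(\<Sum>i<q. of_bool (p i < B - 1)) \<le> visits a b q y" unfolding V
  proof (intro sum_mono)
    fix i assume "i \<in> {..<q}"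
    then have i: "i < q" by simp
    show "of_bool (p i < B - 1) \<le> (of_bool (frac ((real (p i) + v i) / real q) < b) :: nat)"
    proof (cases "p i < B - 1")
      case True
      then have "real (p i) + 2 \<le> real B" by linarith
      moreover have "v i < 2" using v[OF i] u d by linarith
      ultimately have "real (p i) + v i < real B + \<theta>" "real (p i) + v i < real q" using \<theta> Bq by linarith+
      then show ?thesis using mem[OF i] by simp
    qed simp
  qed
  then show "B \<le> visits a b q y + 1" using reidx[of "B - 1"] Bq by simp
  \<comment> \<open>Beyond cell \<open>B\<close> only the point assigned to the last cell can be
    counted, by wrapping around to 0.\<close>
  have "visits a b q y \<le> (\<Sum>i<q. of_bool (p i < B + 1) + of_bool (\<not> p i < q - 1))" unfolding V
  proof (intro sum_mono)
    fix i assume "i \<in> {..<q}"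
    then have i: "i < q" by simp
    show "(of_bool (frac ((real (p i) + v i) / real q) < b) :: nat) \<le> of_bool (p i < B + 1) + of_bool (\<not> p i < q - 1)"
    proof (cases "p i < B + 1 \<or> \<not> p i < q - 1")
      case False
      then have "real (p i) + 2 \<le> real q" "real B + 1 \<le> real (p i)" by linarith+
      moreover have "v i < 2" "0 \<le> v i" using v[OF i] u d by linarith+
      ultimately have "real (p i) + v i < real q" "\<not> real (p i) + v i < real B + \<theta>" using \<theta> by linarith+
      then show ?thesis using mem[OF i] by simp
    qed auto
  qed
  also have "\<dots> = (\<Sum>i<q. of_bool (p i < B + 1)) + (\<Sum>i<q. of_bool (\<not> p i < q - 1))" by (simp only: sum.distrib)
  also have "(\<Sum>i<q. of_bool (p i < B + 1)) = B + 1" using reidx[of "B + 1"] Bq by simp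
  also have "(\<Sum>i<q. of_bool (\<not> p i < q - 1)) = (1::nat)"
  proof -
    have "(\<Sum>i<q. of_bool (p i < q - 1)) + (\<Sum>i<q. of_bool (\<not> p i < q - 1)) = (\<Sum>i<q. 1::nat)"
      unfolding sum.distrib[symmetric] by (intro sum.cong) auto
    then show ?thesis using reidx[of "q - 1"] q by simp
  qed
  finally show "visits a b q y \<le> B + 2" by simp
qed

section \<open>The induced rotation and its weak limits\<close>

text \<open>The bounds on \<open>a\<close> send every point outside the arc into it by one step
  forward and by one step backward, so that return times are 1 or 2.\<close>

locale induced_rotation = rotation +
  fixes b :: real
  assumes b1: "b < 1" and ab: "1 - b < a" "a < b"
begin

definition J :: "real set" where "J = {y. frac y < b}"

lemma b0: "0 < b" using ab b1 by linarith

lemma J_shift_int [simp]: "y + of_int n \<in> J \<longleftrightarrow> y \<in> J"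
  by (simp add: J_def)

lemma J_after:
  assumes "y \<notin> J" shows "y + a \<in> J"
proof -
  have "\<lfloor>y + a\<rfloor> = \<lfloor>y\<rfloor> + 1"
    using assms ab b1 frac_lt_1[of y] by (intro floor_unique) (auto simp: J_def frac_def)
  then show ?thesis using ab frac_lt_1[of y] by (simp add: J_def frac_def)
qed

lemma J_before:
  assumes "y \<notin> J" shows "y - a \<in> J"
proof -
  have "\<lfloor>y - a\<rfloor> = \<lfloor>y\<rfloor>"
    using assms ab b1 frac_lt_1[of y] by (intro floor_unique) (auto simp: J_def frac_def)
  then show ?thesis using ab frac_lt_1[of y] by (simp add: J_def frac_def)
qed

text \<open>The first return map, lifted to the reals: nothing is reduced modulo 1, so orbit points
  keep the form \<open>y + m * a\<close>.\<close>

definition T :: "real \<Rightarrow> real" where "T y = (if y + a \<in> J then y + a else y + 2 * a)"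

definition Tinv :: "real \<Rightarrow> real" where "Tinv y = (if y - a \<in> J then y - a else y - 2 * a)"

definition Tz :: "int \<Rightarrow> real \<Rightarrow> real" where
  "Tz k y = (if 0 \<le> k then (T ^^ nat k) y else (Tinv ^^ nat (- k)) y)"

lemma T_in: "T y \<in> J"
  using J_after[of "y + a"] by (simp add: T_def algebra_simps)

lemma Tinv_in: "Tinv y \<in> J"
  using J_before[of "y - a"] by (simp add: Tinv_def algebra_simps)

lemma Tinv_T: "y \<in> J \<Longrightarrow> Tinv (T y) = y"
  by (simp add: T_def Tinv_def algebra_simps)

lemma T_Tinv: "y \<in> J \<Longrightarrow> T (Tinv y) = y"
  by (simp add: T_def Tinv_def algebra_simps)

lemma Tz_0 [simp]: "Tz 0 y = y" by (simp add: Tz_def)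

lemma Tz_in: "y \<in> J \<Longrightarrow> Tz k y \<in> J"
proof -
  assume y: "y \<in> J"
  have "(T ^^ n) y \<in> J" "(Tinv ^^ n) y \<in> J" for n using y T_in Tinv_in by (induction n) auto
  then show ?thesis by (simp add: Tz_def)
qed

lemma Tz_Suc: "y \<in> J \<Longrightarrow> Tz (k + 1) y = T (Tz k y)"
proof (cases "0 \<le> k")
  case True
  then have "nat (k + 1) = Suc (nat k)" by simp
  then show ?thesis using True by (simp add: Tz_def)
next
  case False
  assume y: "y \<in> J"
  define n where "n = nat (- k) - 1"
  have k: "k = - int (Suc n)" using False by (simp add: n_def)
  have "(Tinv ^^ n) y \<in> J" using y Tinv_in by (induction n) auto
  then have "T (Tz k y) = (Tinv ^^ n) y" unfolding k Tz_def by (simp add: T_Tinv nat_add_distrib)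
  then show ?thesis unfolding k Tz_def by simp
qed

lemma Tz_pred: "y \<in> J \<Longrightarrow> Tz (k - 1) y = Tinv (Tz k y)"
  using Tz_Suc[of y "k - 1"] Tz_in[of y "k - 1"] by (simp add: Tinv_T)

lemma Tz_add:
  assumes "y \<in> J" shows "Tz (i + j) y = Tz i (Tz j y)"
proof (induction i rule: int_induct[of _ 0])
  case (step1 i)
  have "Tz (i + 1 + j) y = T (Tz (i + j) y)" using Tz_Suc[OF assms, of "i + j"] by (simp add: add_ac)
  also have "\<dots> = Tz (i + 1) (Tz j y)" using step1 Tz_Suc[OF Tz_in[OF assms], of i j] by simp
  finally show ?case .
next
  case (step2 i)
  have "Tz (i - 1 + j) y = Tinv (Tz (i + j) y)" using Tz_pred[OF assms, of "i + j"] by (simp add: algebra_simps)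
  also have "\<dots> = Tz (i - 1) (Tz j y)" using step2 Tz_pred[OF Tz_in[OF assms], of i j] by simp
  finally show ?case .
qed simp

lemma Tz_of_nat: "Tz (int n) y = (T ^^ n) y"
  by (simp add: Tz_def)

text \<open>The Koopman operator of the \<open>k\<close>-th power. Extension by 0 outside
  \<open>J\<close> turns functions on the arc into functions on the circle, to which
  \<open>mean\<close> applies.\<close>

definition tr :: "(real \<Rightarrow> real) \<Rightarrow> int \<Rightarrow> real \<Rightarrow> real" where
  "tr f k y = (if y \<in> J then f (Tz k y) else 0)"

definition supp :: "(real \<Rightarrow> real) \<Rightarrow> bool" where
  "supp f \<longleftrightarrow> (\<forall>y. y \<notin> J \<longrightarrow> f y = 0)"

lemma supp_tr [simp, intro]: "supp (tr f k)" by (simp add: supp_def tr_def)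

lemma supp_outside: "supp f \<Longrightarrow> y \<notin> J \<Longrightarrow> f y = 0" by (simp add: supp_def)

lemma tr_0 [simp]: "supp f \<Longrightarrow> tr f 0 = f" by (auto simp: supp_def tr_def)

lemma tr_tr: "tr (tr f i) j = tr f (i + j)"
  by (auto simp: tr_def Tz_in Tz_add fun_eq_iff)

abbreviation chi :: "real \<Rightarrow> real" where "chi \<equiv> arc 0 b"

lemma chi_eq: "chi y = of_bool (y \<in> J)"
  by (simp add: arc_def J_def)

lemma pcont_chi: "pcont chi" using b0 b1 by (intro pcont_arc) auto

lemma tr_1_eq: "tr f 1 = (\<lambda>y. chi y * (chi (y + a) * f (y + a) + (1 - chi (y + a)) * f (y + 2 * a)))"
  by (auto simp: tr_def chi_eq T_def Tz_def fun_eq_iff)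

lemma tr_m1_eq: "tr f (- 1) = (\<lambda>y. chi y * (chi (y - a) * f (y - a) + (1 - chi (y - a)) * f (y - 2 * a)))"
  by (auto simp: tr_def chi_eq Tinv_def Tz_def fun_eq_iff)

lemma pcont_tr_1: "pcont f \<Longrightarrow> pcont (tr f 1)"
  unfolding tr_1_eq by (intro pcont_mult pcont_add pcont_diff pcont_const pcont_shift pcont_chi)

lemma pcont_tr_m1: "pcont f \<Longrightarrow> pcont (tr f (- 1))"
  unfolding tr_m1_eq using pcont_shift[of f "-a"] pcont_shift[of f "-2*a"] pcont_shift[OF pcont_chi, of "-a"]
  by (intro pcont_mult pcont_add pcont_diff pcont_const pcont_chi) auto

lemma pcont_tr_0: "pcont f \<Longrightarrow> pcont (tr f 0)"
proof -
  have "tr f 0 = (\<lambda>y. chi y * f y)" by (auto simp: tr_def chi_eq fun_eq_iff)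
  then show "pcont f \<Longrightarrow> pcont (tr f 0)" using pcont_mult[OF pcont_chi] by simp
qed

lemma pcont_tr [intro]: "pcont f \<Longrightarrow> pcont (tr f k)"
proof (induction k rule: int_induct[of _ 0])
  case base then show ?case by (rule pcont_tr_0)
next
  case (step1 i) then show ?case using pcont_tr_1[of "tr f i"] by (simp add: tr_tr)
next
  case (step2 i) then show ?case using pcont_tr_m1[of "tr f i"] by (simp add: tr_tr)
qed

text \<open>Split by return time and translate each piece back. A point \<open>y\<close> of
  \<open>J\<close> is reached from \<open>y - a\<close> if that lies in \<open>J\<close>, and from
  \<open>y - 2 * a\<close> otherwise, so the two pieces reassemble to \<open>f\<close>.\<close>

lemma mean_tr_1:
  assumes f: "pcont f" "supp f" shows "mean (tr f 1) = mean f"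
proof -
  let ?F = "\<lambda>y. chi y * f (y + a)" and ?G = "\<lambda>y. chi y * ((1 - chi (y + a)) * f (y + 2 * a))"
  have p: "pcont ?F" "pcont ?G" "pcont (\<lambda>y. chi (y - a) * f y)" "pcont (\<lambda>y. chi (y - 2 * a) * ((1 - chi (y - a)) * f y))"
    using f pcont_shift[OF pcont_chi, of "-a"] pcont_shift[OF pcont_chi, of "-2*a"]
    by (auto intro!: pcont_mult pcont_shift pcont_diff pcont_chi pcont_const)
  have "tr f 1 = (\<lambda>y. ?F y + ?G y)"
    using f(2) by (auto simp: tr_1_eq fun_eq_iff chi_eq supp_outside)
  then have "mean (tr f 1) = mean ?F + mean ?G" using mean_add[OF p(1,2)] by simp
  also have "mean ?F = mean (\<lambda>y. chi (y - a) * f y)"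
    using mean_shift[OF p(3), of a] by simp
  also have "mean ?G = mean (\<lambda>y. chi (y - 2 * a) * ((1 - chi (y - a)) * f y))"
    using mean_shift[OF p(4), of "2 * a"] by (simp add: algebra_simps)
  also have "mean (\<lambda>y. chi (y - a) * f y) + mean (\<lambda>y. chi (y - 2 * a) * ((1 - chi (y - a)) * f y)) = mean f"
  proof -
    have "(\<lambda>y. chi (y - a) * f y + chi (y - 2 * a) * ((1 - chi (y - a)) * f y)) = f"
    proof
      fix y
      have "y - a \<notin> J \<Longrightarrow> y - 2 * a \<in> J" using J_before[of "y - a"] by (simp add: algebra_simps)
      then show "chi (y - a) * f y + chi (y - 2 * a) * ((1 - chi (y - a)) * f y) = f y" by (auto simp: chi_eq)
    qed
    then show ?thesis using mean_add[OF p(3,4)] by simp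
  qed
  finally show ?thesis .
qed

lemma mean_tr: "pcont f \<Longrightarrow> supp f \<Longrightarrow> mean (tr f k) = mean f"
proof (induction k rule: int_induct[of _ 0])
  case (step1 i)
  then show ?case using mean_tr_1[of "tr f i"] by (simp add: tr_tr pcont_tr)
next
  case (step2 i)
  then show ?case using mean_tr_1[of "tr f (i - 1)"] by (simp add: tr_tr pcont_tr)
qed simp

lemma tr_mult: "tr (\<lambda>y. f y * g y) k = (\<lambda>y. tr f k y * tr g k y)"
  by (auto simp: tr_def fun_eq_iff)

lemma supp_mult: "supp f \<Longrightarrow> supp (\<lambda>y. f y * g y)"
  by (simp add: supp_def)

lemma mean_tr_adjoint:
  assumes "pcont f" "pcont g" "supp f"
  shows "mean (\<lambda>y. tr f k y * g y) = mean (\<lambda>y. f y * tr g (- k) y)"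
proof -
  have "mean (\<lambda>y. tr f k y * g y) = mean (tr (\<lambda>y. tr f k y * g y) (- k))"
    using assms by (intro mean_tr[symmetric] pcont_mult pcont_tr supp_mult supp_tr)
  also have "\<dots> = mean (\<lambda>y. f y * tr g (- k) y)"
    using assms by (simp add: tr_mult tr_tr)
  finally show ?thesis .
qed

text \<open>\<open>visits\<close> counts the starting point, which lies in \<open>J\<close>, but not
  the end point, so it is the number of returns that lead from \<open>y\<close> to
  \<open>y + m * a\<close>.\<close>

lemma Tz_visits:
  assumes y: "y \<in> J" and "y + real m * a \<in> J"
  shows "Tz (int (visits a b m y)) y = y + real m * a"
  using assms(2)
proof (induction m rule: less_induct)
  case (less m)
  show ?case
  proof (cases m)
    case 0 then show ?thesis by (simp add: visits_def)
  next
    case m: (Suc k)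
    have vS: "visits a b (Suc i) y = visits a b i y + of_bool (y + real i * a \<in> J)" for i
      by (simp add: visits_def J_def)
    show ?thesis
    proof (cases "y + real k * a \<in> J")
      case True
      then have "Tz (int (visits a b m y)) y = T (y + real k * a)"
        using less.IH[of k] m Tz_Suc[OF y, of "int (visits a b k y)"] by (simp add: vS add.commute)
      then show ?thesis using less.prems m by (simp add: T_def algebra_simps)
    next
      case False
      then obtain l where l: "k = Suc l" using y by (cases k) auto
      have "y + real l * a \<in> J" using J_before[OF False] l by (simp add: algebra_simps)
      then have "Tz (int (visits a b m y)) y = T (y + real l * a)"
        using less.IH[of l] m l False Tz_Suc[OF y, of "int (visits a b l y)"] by (simp add: vS add.commute)
      moreover have "y + real l * a + a \<notin> J" using False l by (simp add: algebra_simps)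
      ultimately show ?thesis using m l by (simp add: T_def algebra_simps)
    qed
  qed
qed

text \<open>The rotation steps that the induced map skips end outside \<open>J\<close>, where
  \<open>f\<close> vanishes, and no two consecutive ones are skipped.\<close>

lemma induced_sum_eq_rotation_sum:
  assumes z: "z \<in> J"
  obtains M where "I \<le> M" "M \<le> 2 * I" "Tz (int I) z = z + real M * a"
    "\<And>f. supp f \<Longrightarrow> (\<Sum>i<I. f (Tz (int i) z)) = (\<Sum>m<M. f (z + real m * a))"
proof -
  have "\<exists>M. I \<le> M \<and> M \<le> 2 * I \<and> Tz (int I) z = z + real M * a \<and>
    (\<forall>f. supp f \<longrightarrow> (\<Sum>i<I. f (Tz (int i) z)) = (\<Sum>m<M. f (z + real m * a)))"
  proof (induction I)
    case (Suc I)
    then obtain M where M: "I \<le> M" "M \<le> 2 * I" "Tz (int I) z = z + real M * a"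
      "\<And>f. supp f \<Longrightarrow> (\<Sum>i<I. f (Tz (int i) z)) = (\<Sum>m<M. f (z + real m * a))" by blast
    have next_eq: "Tz (int (Suc I)) z = T (z + real M * a)"
      using Tz_Suc[OF z, of "int I"] M(3) by (simp add: add.commute)
    show ?case
    proof (cases "z + real M * a + a \<in> J")
      case True
      then show ?thesis using M next_eq
        by (intro exI[of _ "Suc M"]) (auto simp: T_def algebra_simps)
    next
      case False
      then have "f (z + real (Suc M) * a) = 0" if "supp f" for f
        using that by (intro supp_outside) (auto simp: algebra_simps)
      then show ?thesis using M next_eq False
        by (intro exI[of _ "Suc (Suc M)"]) (auto simp: T_def algebra_simps)
    qed
  qed (auto intro!: exI[of _ 0])
  then show thesis using that by blast
qed

lemma induced_birkhoff_zero:
  assumes f: "pcont f" "supp f" "mean f = 0" and "\<epsilon> > 0"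
  obtains I0 where "\<And>I z. I \<ge> I0 \<Longrightarrow> z \<in> J \<Longrightarrow> \<bar>\<Sum>i<I. f (Tz (int i) z)\<bar> \<le> \<epsilon> * real I"
proof -
  have "\<epsilon>/2 > 0" using \<open>\<epsilon> > 0\<close> by simp
  moreover have "has_mean a f 0" using has_mean_mean[OF f(1)] f(3) by simp
  ultimately obtain N0 where N0: "\<And>N y. N \<ge> N0 \<Longrightarrow> \<bar>orbit_avg a f N y\<bar> < \<epsilon>/2"
    unfolding has_mean_def diff_zero by blast
  show thesis
  proof (rule that[of "max N0 1"])
    fix I z assume I: "I \<ge> max N0 1" and z: "z \<in> J"
    obtain M where M: "I \<le> M" "M \<le> 2 * I" "(\<Sum>i<I. f (Tz (int i) z)) = (\<Sum>m<M. f (z + real m * a))"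
      using induced_sum_eq_rotation_sum[OF z, of I] f(2) by metis
    have "(\<Sum>m<M. f (z + real m * a)) = real M * orbit_avg a f M z"
      using M(1) I by (simp add: orbit_avg_def)
    then have "\<bar>\<Sum>m<M. f (z + real m * a)\<bar> = real M * \<bar>orbit_avg a f M z\<bar>" by (simp add: abs_mult)
    also have "\<dots> \<le> real M * (\<epsilon>/2)" using N0[of M z] I M(1) by (intro mult_left_mono) auto
    also have "\<dots> \<le> (2 * real I) * (\<epsilon>/2)" using M(2) \<open>\<epsilon> > 0\<close> by (intro mult_right_mono) auto
    finally show "\<bar>\<Sum>i<I. f (Tz (int i) z)\<bar> \<le> \<epsilon> * real I" using M(3) by (simp add: mult.commute)
  qed
qed

lemma induced_birkhoff_zero_signed:
  assumes f: "pcont f" "supp f" "mean f = 0" and "\<epsilon> > 0"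
  obtains I0 where "\<And>I z e \<sigma>. I \<ge> I0 \<Longrightarrow> z \<in> J \<Longrightarrow> \<sigma> = 1 \<or> \<sigma> = - 1 \<Longrightarrow>
    \<bar>\<Sum>i<I. f (Tz (\<sigma> * int i + e) z)\<bar> \<le> \<epsilon> * real I"
proof -
  obtain I0 where I0: "\<And>I z. I \<ge> I0 \<Longrightarrow> z \<in> J \<Longrightarrow> \<bar>\<Sum>i<I. f (Tz (int i) z)\<bar> \<le> \<epsilon> * real I"
    using induced_birkhoff_zero[OF assms] by blast
  show thesis
  proof (rule that[of I0])
    fix I z e and \<sigma> :: int assume I: "I \<ge> I0" and z: "z \<in> J" and \<sigma>: "\<sigma> = 1 \<or> \<sigma> = - 1"
    show "\<bar>\<Sum>i<I. f (Tz (\<sigma> * int i + e) z)\<bar> \<le> \<epsilon> * real I"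
    proof (cases "\<sigma> = 1")
      case True
      then show ?thesis using I0[OF I Tz_in[OF z], of e] by (simp add: Tz_add[OF z])
    next
      case False
      then have s: "\<sigma> = - 1" using \<sigma> by simp
      \<comment> \<open>A backward orbit segment is a forward one read from its other end.\<close>
      let ?w = "Tz (e - (int I - 1)) z"
      have "(\<Sum>i<I. f (Tz (\<sigma> * int i + e) z)) = (\<Sum>i<I. f (Tz (\<sigma> * int (I - Suc i) + e) z))"
        by (rule sum.nat_diff_reindex[symmetric])
      also have "\<dots> = (\<Sum>i<I. f (Tz (int i) ?w))"
      proof (intro sum.cong refl)
        fix i assume "i \<in> {..<I}"
        then have eq: "\<sigma> * int (I - Suc i) + e = int i + (e - (int I - 1))" by (simp add: s of_nat_diff)
        show "f (Tz (\<sigma> * int (I - Suc i) + e) z) = f (Tz (int i) ?w)"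
          unfolding eq Tz_add[OF z, of "int i"] ..
      qed
      finally show ?thesis using I0[OF I Tz_in[OF z]] by simp
    qed
  qed
qed

text \<open>The factor 2 is the bound for the ratio of rotation time to induced time.\<close>

lemma induced_birkhoff_upper:
  assumes f: "pcont f" "supp f" "\<And>y. 0 \<le> f y" and "\<epsilon> > 0"
  obtains N0 where "\<And>N z. N \<ge> N0 \<Longrightarrow> z \<in> J \<Longrightarrow> (\<Sum>i<N. f (Tz (int i) z)) \<le> 2 * real N * (mean f + \<epsilon>)"
proof -
  obtain N0 where N0: "\<And>N y. N \<ge> N0 \<Longrightarrow> \<bar>orbit_avg a f N y - mean f\<bar> < \<epsilon>"
    using has_mean_mean[OF f(1)] \<open>\<epsilon> > 0\<close> unfolding has_mean_def by blast
  have m0: "mean f \<ge> 0" using mean_nonneg[OF f(1,3)] .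
  show thesis
  proof (rule that[of "max N0 1"])
    fix N z assume I: "N \<ge> max N0 1" and z: "z \<in> J"
    obtain M where M: "N \<le> M" "M \<le> 2 * N" "(\<Sum>i<N. f (Tz (int i) z)) = (\<Sum>m<M. f (z + real m * a))"
      using induced_sum_eq_rotation_sum[OF z, of N] f(2) by metis
    have "(\<Sum>m<M. f (z + real m * a)) = real M * orbit_avg a f M z"
      using M(1) I by (simp add: orbit_avg_def)
    also have "\<dots> \<le> real M * (mean f + \<epsilon>)" using N0[of M z] I M(1) by (intro mult_left_mono) auto
    also have "\<dots> \<le> (2 * real N) * (mean f + \<epsilon>)" using M(2) m0 \<open>\<epsilon> > 0\<close> by (intro mult_right_mono) auto
    finally show "(\<Sum>i<N. f (Tz (int i) z)) \<le> 2 * real N * (mean f + \<epsilon>)" using M(3) by simp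
  qed
qed

lemma mean_chi_pos: "mean chi \<ge> 1/2"
proof -
  have "1 \<le> chi y + chi (y + a)" for y
    using J_after[of y] by (cases "y \<in> J") (simp_all add: chi_eq)
  then have "mean (\<lambda>y. 1) \<le> mean (\<lambda>y. chi y + chi (y + a))"
    by (rule mean_mono[OF pcont_const pcont_add[OF pcont_chi pcont_shift[OF pcont_chi]]])
  also have "\<dots> = mean chi + mean chi"
    using mean_add[OF pcont_chi pcont_shift[OF pcont_chi, of a]] mean_shift[OF pcont_chi, of a] by (simp only:)
  finally show ?thesis by simp
qed

end

text \<open>One fixed scale, with all errors kept explicit.\<close>

locale near_period = induced_rotation +
  fixes q :: nat and P :: int
  assumes q0: "0 < q" and co: "coprime P (int q)"
    and d_bounds: "0 < real q * (real q * a - of_int P)" "real q * (real q * a - of_int P) \<le> 1"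
begin

definition d :: real where "d = real q * (real q * a - of_int P)"
definition \<theta> :: real where "\<theta> = frac (real q * b)"
definition B :: nat where "B = nat \<lfloor>real q * b\<rfloor>"

text \<open>The displacement, modulo 1, by \<open>m\<close> blocks of \<open>q\<close> rotation
  steps.\<close>

definition sh :: "nat \<Rightarrow> real" where "sh m = real m * d / real q"

lemma d0: "0 < d" "d \<le> 1" using d_bounds by (simp_all add: d_def)

lemma block_shift: "y + real (m * q) * a = y + sh m + of_int (int m * P)"
  using q0 by (simp add: sh_def d_def field_simps)

lemma sh_add: "sh (m + n) = sh m + sh n"
  by (simp add: sh_def add_divide_distrib algebra_simps)

lemma pcont_block_shift: "pcont F \<Longrightarrow> F (y + real (m * q) * a) = F (y + sh m)"
  unfolding block_shift by (rule pcont_periodic_int)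

lemma J_block_shift: "y + real (m * q) * a \<in> J \<longleftrightarrow> y + sh m \<in> J"
  unfolding block_shift by (rule J_shift_int)

lemma frac_block: "frac (real q * (y + real (m * q) * a)) = frac (frac (real q * y) + real m * d)"
proof -
  have "real q * (y + real (m * q) * a) = frac (real q * y) + real m * d + of_int (\<lfloor>real q * y\<rfloor> + int q * (int m * P))"
    using q0 unfolding block_shift by (simp add: sh_def frac_def field_simps)
  then show ?thesis by (simp only: frac_add_of_int_right)
qed

lemma frac_shift: "frac (real q * (y + sh m)) = frac (frac (real q * y) + real m * d)"
proof -
  have "real q * (y + sh m) = frac (real q * y) + real m * d + of_int \<lfloor>real q * y\<rfloor>"
    using q0 by (simp add: sh_def frac_def field_simps)
  then show ?thesis by (simp only: frac_add_of_int_right)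
qed

lemma visits_one:
  shows visits_one_out: "\<theta> \<le> frac (real q * y) \<Longrightarrow> frac (real q * y) + d \<le> 1 \<Longrightarrow> visits a b q y = B"
    and visits_one_in: "frac (real q * y) + d \<le> \<theta> \<Longrightarrow> visits a b q y = B + 1"
    and visits_one_bounds: "B \<le> visits a b q y + 1" "visits a b q y \<le> B + 2"
  using visits_block[OF q0 co d_def d0 b0 b1] unfolding \<theta>_def B_def by auto

text \<open>Each block moves the relative position \<open>frac (q * y)\<close> by \<open>d\<close>,
  so the count for one block applies again as long as the position has not reached 1.\<close>

lemma visits_out:
  assumes "\<theta> \<le> frac (real q * y)" "frac (real q * y) + real m * d \<le> 1"
  shows "visits a b (m * q) y = m * B"
  using assms(2)
proof (induction m)
  case (Suc m)
  have le: "frac (real q * y) + real m * d + d \<le> 1" using Suc.prems by (simp add: algebra_simps)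
  have IH: "visits a b (m * q) y = m * B" using le d0 by (intro Suc.IH) linarith
  have fr: "frac (real q * (y + real (m * q) * a)) = frac (real q * y) + real m * d"
    unfolding frac_block using le d0 by (intro frac_eq[THEN iffD2]) (auto intro!: add_nonneg_nonneg)
  have "0 \<le> real m * d" using d0 by simp
  then have "visits a b q (y + real (m * q) * a) = B"
    using le assms(1) by (intro visits_one_out) (auto simp only: fr)
  then show ?case using visits_add[of a b "m * q" q y] IH by (simp add: add.commute)
qed (simp add: visits_def)

lemma visits_in:
  assumes "frac (real q * y) + real m * d \<le> \<theta>"
  shows "visits a b (m * q) y = m * (B + 1)"
  using assms
proof (induction m)
  case (Suc m)
  have le: "frac (real q * y) + real m * d + d \<le> \<theta>" using Suc.prems by (simp add: algebra_simps)
  have IH: "visits a b (m * q) y = m * (B + 1)" using le d0 by (intro Suc.IH) linarith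
  have "\<theta> < 1" by (simp add: \<theta>_def frac_lt_1)
  then have fr: "frac (real q * (y + real (m * q) * a)) = frac (real q * y) + real m * d"
    unfolding frac_block using le d0 by (intro frac_eq[THEN iffD2]) (auto intro!: add_nonneg_nonneg)
  have "visits a b q (y + real (m * q) * a) = B + 1"
    using le by (intro visits_one_in) (auto simp only: fr)
  then show ?case using visits_add[of a b "m * q" q y] IH by (simp add: add.commute)
qed (simp add: visits_def)

lemma visits_bounds:
  "\<bar>int (visits a b (m * q) y) - int (m * B)\<bar> \<le> 2 * int m"
proof (induction m)
  case (Suc m)
  then show ?case using visits_one_bounds[of "y + real (m * q) * a"] visits_add[of a b "m * q" q y]
    by (simp add: add.commute)
qed (simp add: visits_def)

lemma Tz_block:
  assumes "y \<in> J" "y + sh m \<in> J"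
  shows "Tz (int (visits a b (m * q) y)) y = y + real (m * q) * a"
  using assms by (intro Tz_visits) (simp_all only: J_block_shift)

lemma tr_block_out:
  assumes f: "pcont f" and y: "y \<in> J" "y + sh m \<in> J"
    and u: "\<theta> \<le> frac (real q * y)" "frac (real q * y) + real m * d \<le> 1"
  shows "tr f (int (m * B)) y = f (y + sh m)"
proof -
  have "Tz (int (m * B)) y = y + real (m * q) * a" using Tz_block[OF y] visits_out[OF u] by simp
  then have "tr f (int (m * B)) y = f (y + real (m * q) * a)" using y by (simp only: tr_def if_True)
  then show ?thesis by (simp only: pcont_block_shift[OF f])
qed

text \<open>Here \<open>m\<close> blocks make \<open>m * (B + 1)\<close> returns, which is
  \<open>m\<close> more than \<open>m * B\<close>; the surplus appears as the power
  \<open>- m\<close>.\<close>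

lemma tr_block_in:
  assumes f: "pcont f" and y: "y \<in> J" "y + sh m \<in> J"
    and u: "frac (real q * y) + real m * d \<le> \<theta>"
  shows "tr f (int (m * B)) y = tr f (- int m) (y + sh m)"
proof -
  have 1: "Tz (int (m * (B + 1))) y = y + real (m * q) * a" using Tz_block[OF y] visits_in[OF u] by simp
  have "Tz (int (m * B)) y = Tz (- int m + int (m * (B + 1))) y" by (simp add: algebra_simps)
  also have "\<dots> = Tz (- int m) (y + real (m * q) * a)" unfolding Tz_add[OF y(1), of "- int m"] 1 ..
  finally have "tr f (int (m * B)) y = tr f (- int m) (y + real (m * q) * a)"
    using y J_block_shift[of y m] by (simp only: tr_def if_True)
  then show ?thesis by (simp only: pcont_block_shift[OF pcont_tr[OF f]])
qed

text \<open>The two ways round a rectangle: \<open>i\<close> blocks before the \<open>m\<close>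
  blocks or after them. A boundary crossed by the \<open>m\<close> blocks makes the numbers of
  returns \<open>B + t1\<close> and \<open>B + t2\<close> differ, so the exponent on the right
  changes by \<open>t1 - t2\<close> when \<open>i\<close> grows by one. With \<open>t1 - t2\<close>
  equal to 1 or -1, consecutive \<open>i\<close> see consecutive powers of \<open>T\<close>.\<close>

lemma tr_block_crossing:
  assumes f: "pcont f" and J: "y \<in> J" "y + sh m \<in> J" "y + sh i \<in> J" "y + sh (m + i) \<in> J"
    and v1: "visits a b (i * q) y = i * (B + t1)"
    and v2: "visits a b (i * q) (y + real (m * q) * a) = i * (B + t2)"
  defines "e \<equiv> int (visits a b (m * q) y) - int (m * B)"
  shows "tr f (int (m * B)) (y + sh i) = tr f (int i * (int t1 - int t2) - e) (y + sh (m + i))"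
proof -
  let ?w = "y + real (m * q) * a" and ?yi = "y + real (i * q) * a"
  have w: "?w \<in> J" using J by (simp only: J_block_shift)
  have wi: "?w + real (i * q) * a = y + real ((m + i) * q) * a" by (simp add: algebra_simps)
  have "?w + sh i = y + sh (m + i) + of_int (int m * P)"
    unfolding block_shift sh_add by simp
  then have wiJ: "?w + sh i \<in> J" using J(4) by (simp only: J_shift_int)
  have 1: "Tz (int (m * B) + e) y = ?w" using Tz_block[OF J(1,2)] by (simp add: e_def)
  have 2: "Tz (int (i * (B + t1))) y = ?yi" using Tz_block[OF J(1,3)] v1 by simp
  have 3: "Tz (int (i * (B + t2))) ?w = y + real ((m + i) * q) * a" using Tz_block[OF w wiJ] v2 wi by simp
  have "Tz (int (m * B)) ?yi = Tz (int (m * B) + int (i * (B + t1))) y"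
    unfolding Tz_add[OF J(1), of "int (m * B)"] 2 ..
  also have "int (m * B) + int (i * (B + t1)) = (int i * (int t1 - int t2) - e) + int (i * (B + t2)) + (int (m * B) + e)"
    by (simp add: algebra_simps)
  also have "Tz \<dots> y = Tz ((int i * (int t1 - int t2) - e) + int (i * (B + t2))) ?w"
    unfolding Tz_add[OF J(1), of "(int i * (int t1 - int t2) - e) + int (i * (B + t2))"] 1 ..
  also have "\<dots> = Tz (int i * (int t1 - int t2) - e) (y + real ((m + i) * q) * a)"
    unfolding Tz_add[OF w] 3 ..
  finally have "tr f (int (m * B)) ?yi = tr f (int i * (int t1 - int t2) - e) (y + real ((m + i) * q) * a)"
    using J(3,4) by (simp only: tr_def J_block_shift if_True)
  then show ?thesis by (simp only: pcont_block_shift[OF pcont_tr[OF f]])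
qed

text \<open>An upper bound for all errors made by moving \<open>y\<close> by at most \<open>sh R\<close>.\<close>

definition err :: "(real \<Rightarrow> real) \<Rightarrow> (real \<Rightarrow> real) \<Rightarrow> nat \<Rightarrow> real \<Rightarrow> real" where
  "err f g R y = (\<Sum>j\<le>R. \<bar>chi (y + sh j) - chi y\<bar> + \<bar>g (y + sh j) - g y\<bar> +
     (\<Sum>k\<in>{- int R..int R}. \<bar>tr f k (y + sh j) - tr f k y\<bar>))"

lemma pcont_err: "pcont f \<Longrightarrow> pcont g \<Longrightarrow> pcont (err f g R)"
  unfolding err_def by (intro pcont_sum pcont_add pcont_abs pcont_diff pcont_shift pcont_chi pcont_tr)

lemma err_nonneg: "0 \<le> err f g R y"
  unfolding err_def by (intro sum_nonneg add_nonneg_nonneg) auto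

lemma err_term:
  assumes "j \<le> R"
  shows "\<bar>chi (y + sh j) - chi y\<bar> + \<bar>g (y + sh j) - g y\<bar> + (\<Sum>k\<in>{- int R..int R}. \<bar>tr f k (y + sh j) - tr f k y\<bar>) \<le> err f g R y"
  unfolding err_def using assms
  by (intro member_le_sum) (auto intro!: add_nonneg_nonneg sum_nonneg)

lemma err_sum_nonneg: "0 \<le> (\<Sum>k\<in>{- int R..int R}. \<bar>tr f k (y + sh j) - tr f k y\<bar>)"
  by (intro sum_nonneg) auto

lemma err_chi: "j \<le> R \<Longrightarrow> \<bar>chi (y + sh j) - chi y\<bar> \<le> err f g R y"
  using err_term[of j R y g f] err_sum_nonneg[where f = f and R = R and y = y and j = j] by linarith

lemma err_g: "j \<le> R \<Longrightarrow> \<bar>g (y + sh j) - g y\<bar> \<le> err f g R y"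
  using err_term[of j R y g f] err_sum_nonneg[where f = f and R = R and y = y and j = j] by linarith

lemma err_tr: "j \<le> R \<Longrightarrow> \<bar>k\<bar> \<le> int R \<Longrightarrow> \<bar>tr f k (y + sh j) - tr f k y\<bar> \<le> err f g R y"
proof -
  assume j: "j \<le> R" and k: "\<bar>k\<bar> \<le> int R"
  have "\<bar>tr f k (y + sh j) - tr f k y\<bar> \<le> (\<Sum>k\<in>{- int R..int R}. \<bar>tr f k (y + sh j) - tr f k y\<bar>)"
    using k by (intro member_le_sum) auto
  then show ?thesis using err_term[OF j, of y g f] by linarith
qed

lemma err_ge_1:
  assumes "y \<in> J" "y + sh j \<notin> J" "j \<le> R" shows "1 \<le> err f g R y"
  using err_chi[OF assms(3), of y f g] assms(1,2) by (simp add: chi_eq)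

end

lemma abs_mult_diff_le:
  fixes x y u v :: real
  assumes "\<bar>x\<bar> \<le> M" "\<bar>v\<bar> \<le> M"
  shows "\<bar>x * y - u * v\<bar> \<le> M * \<bar>y - v\<bar> + \<bar>x - u\<bar> * M"
proof -
  have "x * y - u * v = x * (y - v) + (x - u) * v" by (simp add: algebra_simps)
  then have "\<bar>x * y - u * v\<bar> \<le> \<bar>x\<bar> * \<bar>y - v\<bar> + \<bar>x - u\<bar> * \<bar>v\<bar>"
    by (simp only: abs_mult[symmetric] abs_triangle_ineq)
  also have "\<dots> \<le> M * \<bar>y - v\<bar> + \<bar>x - u\<bar> * M"
    using assms by (intro add_mono mult_mono) auto
  finally show ?thesis .
qed

context induced_rotation
begin

lemma tr_bounded: "(\<And>y. \<bar>f y\<bar> \<le> M) \<Longrightarrow> 0 \<le> M \<Longrightarrow> \<bar>tr f k y\<bar> \<le> M"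
  by (simp add: tr_def)

end

context near_period
begin

text \<open>Over \<open>I\<close> consecutive block translates the powers of \<open>T\<close> run
  through consecutive integers, up to the errors collected in \<open>err\<close>. The small Birkhoff
  sums of \<open>f\<close> then make the total small against \<open>I\<close>.\<close>

lemma crossing_pointwise:
  assumes f: "pcont f" "supp f" "\<And>y. \<bar>f y\<bar> \<le> M" and g: "supp g" "\<And>y. \<bar>g y\<bar> \<le> M" and M: "1 \<le> M"
    and birk: "\<And>z e \<sigma>. z \<in> J \<Longrightarrow> \<sigma> = 1 \<or> \<sigma> = - 1 \<Longrightarrow> \<bar>\<Sum>i<I. f (Tz (\<sigma> * int i + e) z)\<bar> \<le> \<epsilon> * real I"
    and \<epsilon>: "0 \<le> \<epsilon>" and R: "2 * m + I \<le> R"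
    and t: "t1 = 0 \<and> t2 = 1 \<or> t1 = 1 \<and> t2 = (0::nat)"
    and v1: "\<And>i. i < I \<Longrightarrow> visits a b (i * q) y = i * (B + t1)"
    and v2: "\<And>i. i < I \<Longrightarrow> visits a b (i * q) (y + real (m * q) * a) = i * (B + t2)"
  shows "\<bar>\<Sum>i<I. tr f (int (m * B)) (y + sh i) * g (y + sh i)\<bar> \<le> real I * (M * \<epsilon> + 2 * M\<^sup>2 * err f g R y)"
proof -
  let ?\<Phi> = "tr f (int (m * B))" and ?H = "err f g R y"
  have MM: "M \<le> M\<^sup>2" using M by (simp add: power2_eq_square)
  have H0: "0 \<le> ?H" by (rule err_nonneg)
  have \<Phi>: "\<bar>?\<Phi> z\<bar> \<le> M" for z using f(3) M by (intro tr_bounded) auto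
  have Me: "0 \<le> M * \<epsilon>" using M \<epsilon> by simp
  have MH: "M * ?H \<le> M\<^sup>2 * ?H" using MM H0 by (rule mult_right_mono)
  have MH0: "0 \<le> M\<^sup>2 * ?H" using H0 by simp
  \<comment> \<open>If \<open>y\<close> is outside \<open>J\<close>, then \<open>g\<close> vanishes
    at \<open>y\<close> and its values at the translates are at most the error. If a translate
    leaves \<open>J\<close>, the error is at least 1 and covers everything. Only the third case uses
    the dynamics.\<close>
  consider (out) "y \<notin> J" | (leave) j where "y \<in> J" "j \<le> R" "y + sh j \<notin> J" | (stay) "y \<in> J" "\<And>j. j \<le> R \<Longrightarrow> y + sh j \<in> J"
    by blast
  then show ?thesis
  proof cases
    case out
    have "\<bar>?\<Phi> (y + sh i) * g (y + sh i)\<bar> \<le> M * \<epsilon> + 2 * M\<^sup>2 * ?H" if i: "i < I" for i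
    proof -
      have "g y = 0" using g(1) out by (rule supp_outside)
      then have "\<bar>g (y + sh i)\<bar> \<le> ?H" using err_g[of i R g y f] i R by simp
      then have "\<bar>?\<Phi> (y + sh i) * g (y + sh i)\<bar> \<le> M * ?H" unfolding abs_mult using M by (intro mult_mono \<Phi>) auto
      then show ?thesis using Me MH MH0 by linarith
    qed
    then have "(\<Sum>i<I. \<bar>?\<Phi> (y + sh i) * g (y + sh i)\<bar>) \<le> (\<Sum>i<I. M * \<epsilon> + 2 * M\<^sup>2 * ?H)" by (intro sum_mono) auto
    then show ?thesis by (intro order_trans[OF sum_abs]) simp
  next
    case leave
    have H1: "1 \<le> ?H" using err_ge_1[OF leave(1,3,2)] .
    have "\<bar>?\<Phi> (y + sh i) * g (y + sh i)\<bar> \<le> M * \<epsilon> + 2 * M\<^sup>2 * ?H" for i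
    proof -
      have "\<bar>?\<Phi> (y + sh i) * g (y + sh i)\<bar> \<le> M * M" unfolding abs_mult using M by (intro mult_mono \<Phi> g) auto
      also have "\<dots> \<le> M\<^sup>2 * ?H" using H1 mult_left_mono[OF H1, of "M\<^sup>2"] by (simp add: power2_eq_square)
      finally show ?thesis using Me MH0 by linarith
    qed
    then have "(\<Sum>i<I. \<bar>?\<Phi> (y + sh i) * g (y + sh i)\<bar>) \<le> (\<Sum>i<I. M * \<epsilon> + 2 * M\<^sup>2 * ?H)" by (intro sum_mono) auto
    then show ?thesis by (intro order_trans[OF sum_abs]) simp
  next
    case stay
    define e where "e = int (visits a b (m * q) y) - int (m * B)"
    define \<sigma> where "\<sigma> = int t1 - int t2"
    have \<sigma>: "\<sigma> = 1 \<or> \<sigma> = - 1" using t by (auto simp: \<sigma>_def)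
    have e: "\<bar>e\<bar> \<le> 2 * int m" unfolding e_def by (rule visits_bounds)
    have diff: "\<bar>?\<Phi> (y + sh i) * g (y + sh i) - tr f (\<sigma> * int i - e) y * g y\<bar> \<le> 2 * M\<^sup>2 * ?H" if i: "i < I" for i
    proof -
      have k: "\<bar>\<sigma> * int i - e\<bar> \<le> int R"
      proof -
        have "\<bar>\<sigma> * int i\<bar> \<le> int I" using \<sigma> i by (auto simp: abs_mult)
        then show ?thesis using e R by linarith
      qed
      have "?\<Phi> (y + sh i) = tr f (int i * (int t1 - int t2) - e) (y + sh (m + i))"
        unfolding e_def using stay i R by (intro tr_block_crossing[OF f(1) _ _ _ _ v1[OF i] v2[OF i]]) auto
      then have eq: "?\<Phi> (y + sh i) = tr f (\<sigma> * int i - e) (y + sh (m + i))" by (simp add: \<sigma>_def mult.commute)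
      have d1: "\<bar>tr f (\<sigma> * int i - e) (y + sh (m + i)) - tr f (\<sigma> * int i - e) y\<bar> \<le> ?H"
        using i R by (intro err_tr k) auto
      have d2: "\<bar>g (y + sh i) - g y\<bar> \<le> ?H" using i R by (intro err_g) auto
      have "\<bar>?\<Phi> (y + sh i) * g (y + sh i) - tr f (\<sigma> * int i - e) y * g y\<bar> \<le>
        M * \<bar>g (y + sh i) - g y\<bar> + \<bar>?\<Phi> (y + sh i) - tr f (\<sigma> * int i - e) y\<bar> * M"
        by (rule abs_mult_diff_le[OF \<Phi> g(2)])
      also have "\<dots> \<le> M * ?H + ?H * M"
        using d1 d2 M unfolding eq by (intro add_mono mult_left_mono mult_right_mono) auto
      also have "\<dots> \<le> 2 * M\<^sup>2 * ?H" using MH by (simp add: mult.commute)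
      finally show ?thesis .
    qed
    have main: "\<bar>\<Sum>i<I. tr f (\<sigma> * int i - e) y * g y\<bar> \<le> real I * (M * \<epsilon>)"
    proof -
      have "(\<Sum>i<I. tr f (\<sigma> * int i - e) y * g y) = (\<Sum>i<I. f (Tz (\<sigma> * int i + (- e)) y)) * g y"
        using stay by (simp add: tr_def sum_distrib_right)
      then have "\<bar>\<Sum>i<I. tr f (\<sigma> * int i - e) y * g y\<bar> = \<bar>\<Sum>i<I. f (Tz (\<sigma> * int i + (- e)) y)\<bar> * \<bar>g y\<bar>"
        by (simp only: abs_mult)
      also have "\<dots> \<le> (\<epsilon> * real I) * M" using birk[OF stay(1) \<sigma>, of "- e"] g(2) \<epsilon> by (intro mult_mono) auto
      finally show ?thesis by (simp add: mult_ac)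
    qed
    have "\<bar>(\<Sum>i<I. ?\<Phi> (y + sh i) * g (y + sh i)) - (\<Sum>i<I. tr f (\<sigma> * int i - e) y * g y)\<bar> \<le>
      (\<Sum>i<I. \<bar>?\<Phi> (y + sh i) * g (y + sh i) - tr f (\<sigma> * int i - e) y * g y\<bar>)"
      unfolding sum_subtractf[symmetric] by (rule sum_abs)
    also have "\<dots> \<le> (\<Sum>i<I. 2 * M\<^sup>2 * ?H)" using diff by (intro sum_mono) auto
    finally have "\<bar>(\<Sum>i<I. ?\<Phi> (y + sh i) * g (y + sh i)) - (\<Sum>i<I. tr f (\<sigma> * int i - e) y * g y)\<bar> \<le> real I * (2 * M\<^sup>2 * ?H)"
      by simp
    then show ?thesis using main by (simp add: distrib_left)
  qed
qed

text \<open>The mean over the arc equals the average of the means over its \<open>I\<close>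
  translates by \<open>sh i\<close>. Shortening the arc by \<open>I * d\<close> keeps all translates
  of a point inside it; this costs \<open>M\<^sup>2 * (I * d)\<close>, and on the shortened arc the
  pointwise bound applies.\<close>

lemma crossing_mean:
  assumes f: "pcont f" "supp f" "\<And>y. \<bar>f y\<bar> \<le> M" and g: "pcont g" "supp g" "\<And>y. \<bar>g y\<bar> \<le> M" and M: "1 \<le> M"
    and birk: "\<And>z e \<sigma>. z \<in> J \<Longrightarrow> \<sigma> = 1 \<or> \<sigma> = - 1 \<Longrightarrow> \<bar>\<Sum>i<I. f (Tz (\<sigma> * int i + e) z)\<bar> \<le> \<epsilon> * real I"
    and \<epsilon>: "0 \<le> \<epsilon>" and R: "2 * m + I \<le> R" and I: "0 < I"
    and t: "t1 = 0 \<and> t2 = 1 \<or> t1 = 1 \<and> t2 = (0::nat)"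
    and lh: "0 \<le> lo" "lo \<le> hi - real I * d" "hi \<le> 1"
    and v1: "\<And>i y. i < I \<Longrightarrow> lo \<le> frac (real q * y) \<Longrightarrow> frac (real q * y) < hi - real I * d \<Longrightarrow> visits a b (i * q) y = i * (B + t1)"
    and v2: "\<And>i y. i < I \<Longrightarrow> lo \<le> frac (real q * y) \<Longrightarrow> frac (real q * y) < hi - real I * d \<Longrightarrow>
      visits a b (i * q) (y + real (m * q) * a) = i * (B + t2)"
  shows "\<bar>mean (\<lambda>y. arc lo hi (real q * y) * (tr f (int (m * B)) y * g y))\<bar> \<le> M * \<epsilon> + 2 * M\<^sup>2 * mean (err f g R) + M\<^sup>2 * (real I * d)"
proof -
  let ?\<Phi> = "tr f (int (m * B))"
  let ?X = "\<lambda>y. arc lo hi (real q * y)" and ?U = "\<lambda>y. arc lo (hi - real I * d) (real q * y)"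
  let ?Z = "\<lambda>y. ?X y * (?\<Phi> y * g y)"
  have Id: "0 < real I * d" using I d0 by simp
  have pX: "pcont ?X" and pU: "pcont ?U" using lh Id q0 by (auto intro!: pcont_arc_scaled)
  have p\<Phi>: "pcont ?\<Phi>" using f(1) by (rule pcont_tr)
  have pZ: "pcont ?Z" by (intro pcont_mult pX p\<Phi> g)
  have pE: "pcont (err f g R)" using f g by (intro pcont_err)
  have \<Phi>: "\<bar>?\<Phi> z\<bar> \<le> M" for z using f(3) M by (intro tr_bounded) auto
  have sub: "?U y \<le> ?X (y + sh i)" if "i < I" for i y
  proof (cases "?U y = 0")
    case False
    then have u: "lo \<le> frac (real q * y)" "frac (real q * y) < hi - real I * d" by (auto simp: arc_def)
    have id: "real i * d \<le> real I * d" "0 \<le> real i * d" using that d0 by (auto intro!: mult_right_mono)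
    then have "frac (frac (real q * y) + real i * d) = frac (real q * y) + real i * d"
      using u lh by (intro frac_eq[THEN iffD2]) (auto intro!: add_nonneg_nonneg)
    then have "lo \<le> frac (real q * (y + sh i))" "frac (real q * (y + sh i)) < hi"
      unfolding frac_shift using u id by linarith+
    then show ?thesis by (simp add: arc_def)
  qed (simp add: arc_simps)
  have pt: "\<bar>\<Sum>i<I. ?Z (y + sh i)\<bar> \<le> real I * (M * \<epsilon>) + real I * (2 * M\<^sup>2) * err f g R y + M\<^sup>2 * (\<Sum>i<I. ?X (y + sh i) - ?U y)" for y
  proof -
    let ?w = "\<lambda>i. ?\<Phi> (y + sh i) * g (y + sh i)"
    have w: "\<bar>?w i\<bar> \<le> M\<^sup>2" for i unfolding abs_mult power2_eq_square using M by (intro mult_mono \<Phi> g) auto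
    let ?D = "\<lambda>i. ?X (y + sh i) - ?U y"
    have split: "(\<Sum>i<I. ?Z (y + sh i)) = ?U y * (\<Sum>i<I. ?w i) + (\<Sum>i<I. ?D i * ?w i)"
      unfolding sum_distrib_left sum.distrib[symmetric] by (intro sum.cong refl) (simp add: algebra_simps)
    have Dw: "\<bar>?D i * ?w i\<bar> \<le> ?D i * M\<^sup>2" if "i < I" for i
    proof -
      have "0 \<le> ?D i" using sub[OF that] by simp
      then show ?thesis unfolding abs_mult[of "?D i"] using w[of i] by (simp only: abs_of_nonneg mult_left_mono)
    qed
    have "\<bar>\<Sum>i<I. ?D i * ?w i\<bar> \<le> (\<Sum>i<I. \<bar>?D i * ?w i\<bar>)" by (rule sum_abs)
    also have "\<dots> \<le> (\<Sum>i<I. ?D i * M\<^sup>2)" using Dw by (intro sum_mono) auto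
    finally have 1: "\<bar>\<Sum>i<I. ?D i * ?w i\<bar> \<le> M\<^sup>2 * (\<Sum>i<I. ?D i)" by (simp only: sum_distrib_left mult.commute)
    have 2: "\<bar>?U y * (\<Sum>i<I. ?w i)\<bar> \<le> real I * (M * \<epsilon> + 2 * M\<^sup>2 * err f g R y)"
    proof (cases "?U y = 0")
      case True
      have "0 \<le> real I * (M * \<epsilon> + 2 * M\<^sup>2 * err f g R y)"
        using M \<epsilon> err_nonneg[of f g R y] by (intro mult_nonneg_nonneg add_nonneg_nonneg) auto
      then show ?thesis unfolding True by simp
    next
      case False
      then have u: "lo \<le> frac (real q * y)" "frac (real q * y) < hi - real I * d" and U1: "?U y = 1" by (auto simp: arc_def)
      have "\<bar>\<Sum>i<I. ?w i\<bar> \<le> real I * (M * \<epsilon> + 2 * M\<^sup>2 * err f g R y)"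
        by (rule crossing_pointwise[OF f g(2,3) M birk \<epsilon> R t v1[OF _ u] v2[OF _ u]])
      then show ?thesis unfolding U1 by simp
    qed
    have 3: "real I * (M * \<epsilon> + 2 * M\<^sup>2 * err f g R y) = real I * (M * \<epsilon>) + real I * (2 * M\<^sup>2) * err f g R y"
      by (simp add: algebra_simps)
    show ?thesis unfolding split using 1 2 3 abs_triangle_ineq[of "?U y * (\<Sum>i<I. ?w i)" "\<Sum>i<I. ?D i * ?w i"] by linarith
  qed
  have mZ: "real I * mean ?Z = mean (\<lambda>y. \<Sum>i<I. ?Z (y + sh i))"
  proof -
    have "mean (\<lambda>y. \<Sum>i<I. ?Z (y + sh i)) = (\<Sum>i<I. mean (\<lambda>y. ?Z (y + sh i)))"
      by (rule mean_sum) (rule pcont_shift[OF pZ])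
    also have "\<dots> = (\<Sum>i<I. mean ?Z)" using mean_shift[OF pZ] by simp
    finally show ?thesis by simp
  qed
  have mU: "mean ?U = hi - real I * d - lo" using lh Id q0 by (intro mean_arc_scaled) auto
  have mX: "mean ?X = hi - lo" using lh Id q0 by (intro mean_arc_scaled) auto
  have mXs: "mean (\<lambda>y. ?X (y + sh i)) = hi - lo" for i using mean_shift[OF pX] mX by simp
  have pXs: "pcont (\<lambda>y. ?X (y + sh i) - ?U y)" for i by (intro pcont_diff pcont_shift[OF pX] pU)
  let ?S = "\<lambda>y. \<Sum>i<I. ?Z (y + sh i)"
  let ?E = "\<lambda>y. real I * (M * \<epsilon>) + real I * (2 * M\<^sup>2) * err f g R y + M\<^sup>2 * (\<Sum>i<I. ?X (y + sh i) - ?U y)"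
  have pS: "pcont ?S" by (rule pcont_sum) (rule pcont_shift[OF pZ])
  have p3: "pcont (\<lambda>y. M\<^sup>2 * (\<Sum>i<I. ?X (y + sh i) - ?U y))" by (intro pcont_cmult pcont_sum pXs)
  have p2: "pcont (\<lambda>y. real I * (M * \<epsilon>) + real I * (2 * M\<^sup>2) * err f g R y)" by (intro pcont_add pcont_cmult pcont_const pE)
  have "real I * \<bar>mean ?Z\<bar> = \<bar>mean ?S\<bar>" unfolding mZ[symmetric] by (simp add: abs_mult)
  also have "\<dots> \<le> mean (\<lambda>y. \<bar>?S y\<bar>)" by (rule mean_abs_le[OF pS])
  also have "\<dots> \<le> mean ?E" using pt by (intro mean_mono pcont_abs[OF pS] pcont_add[OF p2 p3])
  also have "\<dots> = real I * (M * \<epsilon>) + real I * (2 * M\<^sup>2) * mean (err f g R) + M\<^sup>2 * (\<Sum>i<I. mean (\<lambda>y. ?X (y + sh i) - ?U y))"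
    using mean_add[OF p2 p3] mean_add[OF pcont_const pcont_cmult[OF pE]] mean_cmult[OF pE]
      mean_cmult[OF pcont_sum[of "{..<I}", OF pXs]] mean_sum[of "{..<I}", OF pXs] by simp
  also have "(\<Sum>i<I. mean (\<lambda>y. ?X (y + sh i) - ?U y)) = (\<Sum>i<I. real I * d)"
    using mean_diff[OF pcont_shift[OF pX] pU] mXs mU by simp
  finally have "real I * \<bar>mean ?Z\<bar> \<le> real I * (M * \<epsilon> + 2 * M\<^sup>2 * mean (err f g R) + M\<^sup>2 * (real I * d))"
    by (simp add: algebra_simps)
  then show ?thesis using I by simp
qed

end

context near_period
begin

lemma out_pointwise:
  assumes f: "pcont f" "supp f" "\<And>y. \<bar>f y\<bar> \<le> M" and g: "supp g" "\<And>y. \<bar>g y\<bar> \<le> M" and M: "1 \<le> M"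
    and m: "m \<le> R" and u: "\<theta> \<le> frac (real q * y)" "frac (real q * y) + real m * d \<le> 1"
  shows "\<bar>tr f (int (m * B)) y * g y - f y * g y\<bar> \<le> 2 * M\<^sup>2 * err f g R y"
proof -
  let ?\<Phi> = "tr f (int (m * B))" and ?H = "err f g R y"
  have MM: "M \<le> M\<^sup>2" using M by (simp add: power2_eq_square)
  have H0: "0 \<le> ?H" by (rule err_nonneg)
  have MH: "M * ?H \<le> M\<^sup>2 * ?H" using MM H0 by (rule mult_right_mono)
  have \<Phi>: "\<bar>?\<Phi> z\<bar> \<le> M" for z using f(3) M by (intro tr_bounded) auto
  consider "y \<notin> J" | "y \<in> J" "y + sh m \<notin> J" | "y \<in> J" "y + sh m \<in> J" by blast
  then show ?thesis
  proof cases
    case 1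
    then have "g y = 0" using g(1) by (rule supp_outside[rotated])
    then show ?thesis using H0 by simp
  next
    case 2
    then have H1: "1 \<le> ?H" using m by (rule err_ge_1)
    have "\<bar>?\<Phi> y * g y - f y * g y\<bar> \<le> \<bar>?\<Phi> y\<bar> * \<bar>g y\<bar> + \<bar>f y\<bar> * \<bar>g y\<bar>" by (simp add: abs_triangle_ineq4 flip: abs_mult)
    also have "\<dots> \<le> M * M + M * M" using M by (intro add_mono mult_mono \<Phi> f g) auto
    also have "\<dots> \<le> 2 * M\<^sup>2 * ?H" using mult_left_mono[OF H1, of "2 * M\<^sup>2"] by (simp add: power2_eq_square)
    finally show ?thesis .
  next
    case 3
    have "?\<Phi> y = f (y + sh m)" by (rule tr_block_out[OF f(1) 3 u])
    moreover have "\<bar>tr f 0 (y + sh m) - tr f 0 y\<bar> \<le> ?H" using m by (intro err_tr) auto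
    ultimately have "\<bar>?\<Phi> y - f y\<bar> \<le> ?H" using f(2) by simp
    then have "\<bar>?\<Phi> y - f y\<bar> * \<bar>g y\<bar> \<le> ?H * M" using g(2) H0 by (intro mult_mono) auto
    moreover have "\<bar>?\<Phi> y * g y - f y * g y\<bar> = \<bar>?\<Phi> y - f y\<bar> * \<bar>g y\<bar>"
      by (simp only: left_diff_distrib[symmetric] abs_mult)
    moreover have "0 \<le> M\<^sup>2 * ?H" "?H * M = M * ?H" using H0 by simp_all
    ultimately show ?thesis using MH by linarith
  qed
qed

lemma in_pointwise:
  assumes f: "pcont f" "supp f" "\<And>y. \<bar>f y\<bar> \<le> M" and g: "supp g" "\<And>y. \<bar>g y\<bar> \<le> M" and M: "1 \<le> M"
    and m: "m \<le> R" and u: "frac (real q * y) + real m * d \<le> \<theta>"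
  shows "\<bar>tr f (int (m * B)) y * g y - tr f (- int m) y * g y\<bar> \<le> 2 * M\<^sup>2 * err f g R y"
proof -
  let ?\<Phi> = "tr f (int (m * B))" and ?H = "err f g R y"
  have MM: "M \<le> M\<^sup>2" using M by (simp add: power2_eq_square)
  have H0: "0 \<le> ?H" by (rule err_nonneg)
  have MH: "M * ?H \<le> M\<^sup>2 * ?H" using MM H0 by (rule mult_right_mono)
  have \<Phi>: "\<bar>?\<Phi> z\<bar> \<le> M" "\<bar>tr f (- int m) z\<bar> \<le> M" for z using f(3) M by (auto intro!: tr_bounded)
  consider "y \<notin> J" | "y \<in> J" "y + sh m \<notin> J" | "y \<in> J" "y + sh m \<in> J" by blast
  then show ?thesis
  proof cases
    case 1
    then have "g y = 0" using g(1) by (rule supp_outside[rotated])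
    then show ?thesis using H0 by simp
  next
    case 2
    then have H1: "1 \<le> ?H" using m by (rule err_ge_1)
    have "\<bar>?\<Phi> y * g y - tr f (- int m) y * g y\<bar> \<le> \<bar>?\<Phi> y\<bar> * \<bar>g y\<bar> + \<bar>tr f (- int m) y\<bar> * \<bar>g y\<bar>"
      by (simp add: abs_triangle_ineq4 flip: abs_mult)
    also have "\<dots> \<le> M * M + M * M" using M by (intro add_mono mult_mono \<Phi> g) auto
    also have "\<dots> \<le> 2 * M\<^sup>2 * ?H" using mult_left_mono[OF H1, of "2 * M\<^sup>2"] by (simp add: power2_eq_square)
    finally show ?thesis .
  next
    case 3
    have "?\<Phi> y = tr f (- int m) (y + sh m)" by (rule tr_block_in[OF f(1) 3 u])
    moreover have "\<bar>tr f (- int m) (y + sh m) - tr f (- int m) y\<bar> \<le> ?H" using m by (intro err_tr) auto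
    ultimately have "\<bar>?\<Phi> y - tr f (- int m) y\<bar> \<le> ?H" by simp
    then have "\<bar>?\<Phi> y - tr f (- int m) y\<bar> * \<bar>g y\<bar> \<le> ?H * M" using g(2) H0 by (intro mult_mono) auto
    moreover have "\<bar>?\<Phi> y * g y - tr f (- int m) y * g y\<bar> = \<bar>?\<Phi> y - tr f (- int m) y\<bar> * \<bar>g y\<bar>"
      by (simp only: left_diff_distrib[symmetric] abs_mult)
    moreover have "0 \<le> M\<^sup>2 * ?H" "?H * M = M * ?H" using H0 by simp_all
    ultimately show ?thesis using MH by linarith
  qed
qed

lemma mean_err:
  assumes "pcont f" "pcont g"
  shows "mean (err f g R) = (\<Sum>j\<le>R. mean (\<lambda>y. \<bar>chi (y + sh j) - chi y\<bar>) + mean (\<lambda>y. \<bar>g (y + sh j) - g y\<bar>) +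
          (\<Sum>k\<in>{- int R..int R}. mean (\<lambda>y. \<bar>tr f k (y + sh j) - tr f k y\<bar>)))"
proof -
  define D where "D F j y = \<bar>F (y + sh j) - F y\<bar>" for F :: "real \<Rightarrow> real" and j and y :: real
  have pD: "pcont (D F j)" if "pcont F" for F j
    unfolding D_def using that by (intro pcont_abs pcont_diff pcont_shift)
  have p1: "pcont (\<lambda>y. D chi j y + D g j y)" for j using pD[OF pcont_chi] pD[OF assms(2)] by (rule pcont_add)
  have p2: "pcont (\<lambda>y. \<Sum>k\<in>{- int R..int R}. D (tr f k) j y)" for j
    by (rule pcont_sum) (rule pD[OF pcont_tr[OF assms(1)]])
  have "mean (err f g R) = mean (\<lambda>y. \<Sum>j\<le>R. D chi j y + D g j y + (\<Sum>k\<in>{- int R..int R}. D (tr f k) j y))"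
    unfolding err_def D_def ..
  also have "\<dots> = (\<Sum>j\<le>R. mean (\<lambda>y. D chi j y + D g j y + (\<Sum>k\<in>{- int R..int R}. D (tr f k) j y)))"
    by (rule mean_sum) (rule pcont_add[OF p1 p2])
  also have "\<dots> = (\<Sum>j\<le>R. mean (D chi j) + mean (D g j) + (\<Sum>k\<in>{- int R..int R}. mean (D (tr f k) j)))"
    using mean_add[OF p1 p2] mean_add[OF pD[OF pcont_chi] pD[OF assms(2)]]
      mean_sum[of "{- int R..int R}", OF pD[OF pcont_tr[OF assms(1)]]] by simp
  finally show ?thesis unfolding D_def .
qed

text \<open>The four fates of a relative position under a drift by \<open>s\<close>: it stays below
  \<theta>, crosses \<theta>, stays above \<theta>, or passes into the next cell.\<close>

lemma four_arcs:
  assumes "0 \<le> s" "s \<le> \<theta>" "\<theta> \<le> 1 - s"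
  shows "arc 0 (\<theta> - s) y + arc (\<theta> - s) \<theta> y + arc \<theta> (1 - s) y + arc (1 - s) 1 y = 1"
  using assms frac_ge_0[of y] frac_lt_1[of y] by (auto simp: arc_def)

lemma stay_mean:
  assumes p: "pcont F" "pcont G" "pcont H" and uv: "0 \<le> u" "v \<le> 1"
    and H: "\<And>y. 0 \<le> H y" and pt: "\<And>y. u \<le> frac (real q * y) \<Longrightarrow> frac (real q * y) < v \<Longrightarrow> \<bar>F y - G y\<bar> \<le> H y"
  shows "\<bar>mean (\<lambda>y. arc u v (real q * y) * F y) - mean (\<lambda>y. arc u v (real q * y) * G y)\<bar> \<le> mean H"
proof (rule mean_abs_diff_le)
  have pA: "pcont (\<lambda>y. arc u v (real q * y))" using uv q0 by (intro pcont_arc_scaled)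
  show "pcont (\<lambda>y. arc u v (real q * y) * F y)" "pcont (\<lambda>y. arc u v (real q * y) * G y)"
    using pA p by (auto intro: pcont_mult)
  show "\<bar>arc u v (real q * y) * F y - arc u v (real q * y) * G y\<bar> \<le> H y" for y
    using pt[of y] H[of y] by (auto simp: arc_def)
qed (rule p)

text \<open>On the positions that cross nothing, the power \<open>m * B\<close> of \<open>T\<close>
  acts as the power \<open>- m\<close> or as the identity. The two crossing arcs, each of length
  \<open>m * d\<close>, contribute only errors, which is why both weights will lose
  \<open>m * d\<close>.\<close>

lemma weak_limit_bound:
  assumes f: "pcont f" "supp f" "\<And>y. \<bar>f y\<bar> \<le> M" and g: "pcont g" "supp g" "\<And>y. \<bar>g y\<bar> \<le> M" and M: "1 \<le> M"
    and birk: "\<And>z e \<sigma>. z \<in> J \<Longrightarrow> \<sigma> = 1 \<or> \<sigma> = - 1 \<Longrightarrow> \<bar>\<Sum>i<I. f (Tz (\<sigma> * int i + e) z)\<bar> \<le> \<epsilon> * real I"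
    and \<epsilon>: "0 \<le> \<epsilon>" and R: "2 * m + I \<le> R" and I: "0 < I" "I \<le> m"
    and md: "real m * d + real I * d \<le> 1/3" and \<theta>: "1/3 < \<theta>" "\<theta> < 2/3"
  shows "\<bar>mean (\<lambda>y. tr f (int (m * B)) y * g y) - mean (\<lambda>y. arc \<theta> (1 - real m * d) (real q * y) * (f y * g y))
     - mean (\<lambda>y. arc 0 (\<theta> - real m * d) (real q * y) * (tr f (- int m) y * g y))\<bar>
     \<le> 8 * M\<^sup>2 * mean (err f g R) + 2 * M * \<epsilon> + 2 * M\<^sup>2 * (real I * d)"
proof -
  let ?\<Phi> = "tr f (int (m * B))"
  let ?F = "\<lambda>y. ?\<Phi> y * g y"
  let ?s = "real m * d"
  have s: "0 \<le> ?s" "real I * d \<le> ?s" "0 < real I * d" using I d0 by (auto intro!: mult_right_mono)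
  have p\<Phi>: "pcont ?\<Phi>" using f(1) by (rule pcont_tr)
  have pF: "pcont ?F" by (intro pcont_mult p\<Phi> g)
  have pA: "pcont (\<lambda>y. arc u v (real q * y) * ?F y)" if "0 \<le> u" "v \<le> 1" for u v
    using that q0 by (intro pcont_mult[OF pcont_arc_scaled pF])
  have pE: "pcont (err f g R)" using f g by (intro pcont_err)
  have pE2: "pcont (\<lambda>y. 2 * M\<^sup>2 * err f g R y)" by (intro pcont_cmult pE)
  have mE2: "mean (\<lambda>y. 2 * M\<^sup>2 * err f g R y) = 2 * M\<^sup>2 * mean (err f g R)" by (rule mean_cmult[OF pE])
  have E2: "0 \<le> 2 * M\<^sup>2 * err f g R y" for y using err_nonneg[of f g R y] by simp
  let ?A1 = "\<lambda>y. arc 0 (\<theta> - ?s) (real q * y) * ?F y" and ?A2 = "\<lambda>y. arc (\<theta> - ?s) \<theta> (real q * y) * ?F y"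
    and ?A3 = "\<lambda>y. arc \<theta> (1 - ?s) (real q * y) * ?F y" and ?A4 = "\<lambda>y. arc (1 - ?s) 1 (real q * y) * ?F y"
  have pA': "pcont ?A1" "pcont ?A2" "pcont ?A3" "pcont ?A4" using s md \<theta> by - (rule pA; linarith)+
  have "?F y = ?A1 y + ?A2 y + ?A3 y + ?A4 y" for y
    using four_arcs[of ?s "real q * y"] s md \<theta> by (simp flip: distrib_right)
  then have "mean ?F = mean (\<lambda>y. ?A1 y + ?A2 y + ?A3 y + ?A4 y)" by presburger
  also have "\<dots> = mean ?A1 + mean ?A2 + mean ?A3 + mean ?A4"
    using mean_add[OF pcont_add[OF pcont_add[OF pA'(1,2)] pA'(3)] pA'(4)] mean_add[OF pcont_add[OF pA'(1,2)] pA'(3)]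
      mean_add[OF pA'(1,2)] by simp
  finally have total: "mean ?F = mean ?A1 + mean ?A2 + mean ?A3 + mean ?A4" .
  have 1: "\<bar>mean ?A1 - mean (\<lambda>y. arc 0 (\<theta> - ?s) (real q * y) * (tr f (- int m) y * g y))\<bar> \<le> 2 * M\<^sup>2 * mean (err f g R)"
    unfolding mE2[symmetric]
  proof (rule stay_mean[OF pF _ pE2 _ _ E2])
    show "pcont (\<lambda>y. tr f (- int m) y * g y)" by (intro pcont_mult pcont_tr f g)
    fix y assume "frac (real q * y) < \<theta> - ?s"
    then show "\<bar>?F y - tr f (- int m) y * g y\<bar> \<le> 2 * M\<^sup>2 * err f g R y"
      using R by (intro in_pointwise f g M) auto
  qed (use \<theta> s in auto)
  have 3: "\<bar>mean ?A3 - mean (\<lambda>y. arc \<theta> (1 - ?s) (real q * y) * (f y * g y))\<bar> \<le> 2 * M\<^sup>2 * mean (err f g R)"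
    unfolding mE2[symmetric]
  proof (rule stay_mean[OF pF _ pE2 _ _ E2])
    show "pcont (\<lambda>y. f y * g y)" by (intro pcont_mult f g)
    fix y assume "\<theta> \<le> frac (real q * y)" "frac (real q * y) < 1 - ?s"
    then show "\<bar>?F y - f y * g y\<bar> \<le> 2 * M\<^sup>2 * err f g R y"
      using R by (intro out_pointwise f g M) auto
  qed (use \<theta> s in auto)
  have iI: "real i * d \<le> real I * d" "0 \<le> real i * d" if "i < I" for i using that d0 by (auto intro!: mult_right_mono)
  \<comment> \<open>Before crossing \<theta> a block has \<open>B + 1\<close> returns, afterwards
    \<open>B\<close>.\<close>
  have 2: "\<bar>mean ?A2\<bar> \<le> M * \<epsilon> + 2 * M\<^sup>2 * mean (err f g R) + M\<^sup>2 * (real I * d)"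
  proof (rule crossing_mean[OF f g M birk \<epsilon> R I(1), where ?t1.0 = 1 and ?t2.0 = 0])
    fix i y assume i: "i < I" and u: "\<theta> - ?s \<le> frac (real q * y)" "frac (real q * y) < \<theta> - real I * d"
    show "visits a b (i * q) y = i * (B + 1)" using u iI[OF i] by (intro visits_in) linarith
    have fr: "frac (real q * (y + real (m * q) * a)) = frac (real q * y) + ?s"
      unfolding frac_block using u md \<theta> s by (intro frac_eq[THEN iffD2]) auto
    have "visits a b (i * q) (y + real (m * q) * a) = i * B"
      using u md \<theta> s iI[OF i] by (intro visits_out; unfold fr; linarith)
    then show "visits a b (i * q) (y + real (m * q) * a) = i * (B + 0)" by simp
  qed (use s md \<theta> in auto)
  \<comment> \<open>Here the position passes 1 and reappears near 0: \<open>B\<close> returns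
    before, \<open>B + 1\<close> after.\<close>
  have 4: "\<bar>mean ?A4\<bar> \<le> M * \<epsilon> + 2 * M\<^sup>2 * mean (err f g R) + M\<^sup>2 * (real I * d)"
  proof (rule crossing_mean[OF f g M birk \<epsilon> R I(1), where ?t1.0 = 0 and ?t2.0 = 1])
    fix i y assume i: "i < I" and u: "1 - ?s \<le> frac (real q * y)" "frac (real q * y) < 1 - real I * d"
    have "visits a b (i * q) y = i * B" using u iI[OF i] md \<theta> s by (intro visits_out) linarith+
    then show "visits a b (i * q) y = i * (B + 0)" by simp
    have "frac (frac (real q * y) + ?s) = frac (real q * y) + ?s - 1"
    proof -
      have "\<lfloor>frac (real q * y) + ?s\<rfloor> = 1" using u md s by (intro floor_unique) auto
      then show ?thesis unfolding frac_def[of "frac (real q * y) + ?s"] by simp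
    qed
    then have fr: "frac (real q * (y + real (m * q) * a)) = frac (real q * y) + ?s - 1" unfolding frac_block .
    show "visits a b (i * q) (y + real (m * q) * a) = i * (B + 1)"
      using u md \<theta> s iI[OF i] by (intro visits_in) (simp only: fr)
  qed (use s md \<theta> in auto)
  show ?thesis using total 1 2 3 4 by linarith
qed

end

context rotation
begin

lemma eventually_translation_small:
  assumes F: "pcont F" and "e > 0"
  shows "\<forall>\<^sub>F q in sequentially. \<forall>s. \<bar>s\<bar> \<le> C / real q \<longrightarrow> mean (\<lambda>y. \<bar>F (y + s) - F y\<bar>) \<le> e"
proof -
  obtain \<eta> where \<eta>: "\<eta> > 0" "\<And>s. \<bar>s\<bar> < \<eta> \<Longrightarrow> mean (\<lambda>y. \<bar>F (y + s) - F y\<bar>) \<le> e"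
    using mean_translation_continuous[OF assms] by auto
  have "(\<lambda>q. C / real q) \<longlonglongrightarrow> 0" by (rule lim_const_over_n)
  then have "\<forall>\<^sub>F q in sequentially. C / real q < \<eta>" using \<eta>(1) by (rule order_tendstoD)
  then show ?thesis
  proof (rule eventually_mono)
    fix q assume "C / real q < \<eta>"
    then show "\<forall>s. \<bar>s\<bar> \<le> C / real q \<longrightarrow> mean (\<lambda>y. \<bar>F (y + s) - F y\<bar>) \<le> e" using \<eta>(2) by auto
  qed
qed

end

context induced_rotation
begin

definition good_scale :: "nat \<Rightarrow> nat \<Rightarrow> int \<Rightarrow> bool" where
  "good_scale j q P \<longleftrightarrow> 0 < q \<and> coprime P (int q) \<and>
     1 / (2 * real j) < real q * (real q * a - of_int P) \<and> real q * (real q * a - of_int P) < 1 / real j \<and>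
     1/3 < frac (real q * b) \<and> frac (real q * b) < 2/3"

lemma near_period_of_good_scale: "good_scale j q P \<Longrightarrow> near_period a b q P"
proof unfold_locales
  assume g: "good_scale j q P"
  then have "0 \<le> 1 / (2 * real j)" "1 / real j \<le> 1"
    by (cases "j = 0"; simp add: divide_le_eq_1)+
  then show "0 < real q * (real q * a - of_int P)" "real q * (real q * a - of_int P) \<le> 1"
    using g by (auto simp: good_scale_def)
qed (auto simp: good_scale_def)

text \<open>The order of the quantifiers matters. From \<open>\<delta> > 1 / (2 * j)\<close> and
  \<open>m * \<delta> \<le> 1/4\<close> it follows that \<open>2 * m \<le> j\<close>, so for fixed
  \<open>j\<close> only finitely many functions \<open>tr f k\<close> occur, and \<open>q\<close>
  can be taken large for all of them together, although \<open>m\<close> may be as large as a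
  multiple of \<open>1 / \<delta>\<close>.\<close>

theorem weak_limit:
  assumes f: "pcont f" "supp f" "mean f = 0" and g: "pcont g" "supp g" and "\<epsilon> > 0"
  obtains I0 j0 where "\<And>j. j \<ge> j0 \<Longrightarrow> \<exists>Q0. \<forall>q P m \<delta> \<theta>. q \<ge> Q0 \<and> good_scale j q P \<and> I0 \<le> m \<and>
      \<delta> = real q * (real q * a - of_int P) \<and> \<theta> = frac (real q * b) \<and> real m * \<delta> \<le> 1/4 \<longrightarrow>
      \<bar>mean (\<lambda>y. tr f (int (m * nat \<lfloor>real q * b\<rfloor>)) y * g y) - (1 - \<theta> - real m * \<delta>) * mean (\<lambda>y. f y * g y)
        - (\<theta> - real m * \<delta>) * mean (\<lambda>y. tr f (- int m) y * g y)\<bar> \<le> \<epsilon>"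
proof -
  obtain M1 where M1: "M1 > 0" "\<And>y. \<bar>f y\<bar> \<le> M1" using pcont_bounded[OF f(1)] by blast
  obtain M2 where M2: "M2 > 0" "\<And>y. \<bar>g y\<bar> \<le> M2" using pcont_bounded[OF g(1)] by blast
  define M where "M = max 1 (max M1 M2)"
  have M: "1 \<le> M" by (simp add: M_def)
  have Mf: "\<bar>f y\<bar> \<le> M" and Mg: "\<bar>g y\<bar> \<le> M" for y using M1(2)[of y] M2(2)[of y] by (auto simp: M_def)
  have MM: "0 < M\<^sup>2" using M by simp
  define \<epsilon>1 where "\<epsilon>1 = \<epsilon> / (8 * M)"
  have \<epsilon>1: "\<epsilon>1 > 0" using M \<open>\<epsilon> > 0\<close> by (simp add: \<epsilon>1_def)
  obtain I1 where I1: "\<And>I z e \<sigma>. I \<ge> I1 \<Longrightarrow> z \<in> J \<Longrightarrow> \<sigma> = 1 \<or> \<sigma> = - 1 \<Longrightarrow>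
    \<bar>\<Sum>i<I. f (Tz (\<sigma> * int i + e) z)\<bar> \<le> \<epsilon>1 * real I"
    using induced_birkhoff_zero_signed[OF f \<epsilon>1] by blast
  define I where "I = max I1 1"
  have I: "0 < I" "I1 \<le> I" by (auto simp: I_def)
  \<comment> \<open>The first entry makes \<open>I * \<delta>\<close> at most 1/12, so that
    \<open>m * \<delta> + I * \<delta> \<le> 1/3\<close>; the second keeps the loss from shortening
    the crossing arcs below \<open>\<epsilon> / 4\<close>.\<close>
  define j0 where "j0 = max (12 * I) (nat \<lceil>8 * M\<^sup>2 * real I / \<epsilon>\<rceil> + 1)"
  show thesis
  proof (rule that[of j0 I])
    fix j assume j: "j \<ge> j0"
    then have j12: "12 * I \<le> j" by (simp add: j0_def)
    have j1: "j > 0" using j12 I by linarith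
    have "8 * M\<^sup>2 * real I / \<epsilon> \<le> real j" using j unfolding j0_def by linarith
    then have jI: "8 * M\<^sup>2 * real I \<le> \<epsilon> * real j" using \<open>\<epsilon> > 0\<close> by (simp add: pos_divide_le_eq mult.commute)
    define R where "R = j + I"
    \<comment> \<open>The number of translation differences summed in \<open>err\<close>, among
      which the tolerance is divided.\<close>
    define C where "C = real (R + 1) * (2 + real (2 * R + 1))"
    have C: "C > 0" by (simp add: C_def)
    define \<epsilon>3 where "\<epsilon>3 = \<epsilon> / (32 * M\<^sup>2) / C"
    have \<epsilon>3: "\<epsilon>3 > 0" using C MM \<open>\<epsilon> > 0\<close> by (simp add: \<epsilon>3_def)
    let ?sm = "\<lambda>F q. \<forall>s. \<bar>s\<bar> \<le> real R / real q \<longrightarrow> mean (\<lambda>y. \<bar>F (y + s) - F y\<bar>) \<le> \<epsilon>3"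
    let ?eq = "\<lambda>G q. \<forall>u v. 0 \<le> u \<and> u \<le> v \<and> v \<le> 1 \<longrightarrow>
      \<bar>mean (\<lambda>y. arc u v (real q * y) * G y) - (v - u) * mean G\<bar> \<le> \<epsilon>/8"
    have eq: "eventually (?eq G) sequentially" if "pcont G" for G
      using mean_arc_scaled_times_tendsto[OF that, of "\<epsilon>/8"] \<open>\<epsilon> > 0\<close> by (simp add: eventually_sequentially)
    have "\<forall>\<^sub>F q in sequentially. ?sm chi q \<and> ?sm g q \<and> (\<forall>k\<in>{- int R..int R}. ?sm (tr f k) q) \<and>
       ?eq (\<lambda>y. f y * g y) q \<and> (\<forall>k\<in>{- int R..int R}. ?eq (\<lambda>y. tr f k y * g y) q)"
      by (intro eventually_conj eventually_ball_finite ballI eventually_translation_small[OF _ \<epsilon>3] eq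
            pcont_chi g pcont_tr f pcont_mult) auto
    then obtain Q0 where Q0: "\<And>q. q \<ge> Q0 \<Longrightarrow> ?sm chi q \<and> ?sm g q \<and> (\<forall>k\<in>{- int R..int R}. ?sm (tr f k) q) \<and>
       ?eq (\<lambda>y. f y * g y) q \<and> (\<forall>k\<in>{- int R..int R}. ?eq (\<lambda>y. tr f k y * g y) q)"
      unfolding eventually_sequentially by blast
    show "\<exists>Q0. \<forall>q P m \<delta> \<theta>. q \<ge> Q0 \<and> good_scale j q P \<and> I \<le> m \<and>
      \<delta> = real q * (real q * a - of_int P) \<and> \<theta> = frac (real q * b) \<and> real m * \<delta> \<le> 1/4 \<longrightarrow>
      \<bar>mean (\<lambda>y. tr f (int (m * nat \<lfloor>real q * b\<rfloor>)) y * g y) - (1 - \<theta> - real m * \<delta>) * mean (\<lambda>y. f y * g y)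
        - (\<theta> - real m * \<delta>) * mean (\<lambda>y. tr f (- int m) y * g y)\<bar> \<le> \<epsilon>"
    proof (intro exI[of _ Q0] allI impI, elim conjE)
      fix q P m \<delta> \<theta> assume qQ: "q \<ge> Q0" and gs: "good_scale j q P" and mI: "I \<le> m"
        and \<delta>: "\<delta> = real q * (real q * a - of_int P)" and \<theta>: "\<theta> = frac (real q * b)" and m\<delta>: "real m * \<delta> \<le> 1/4"
      interpret S: near_period a b q P by (rule near_period_of_good_scale[OF gs])
      have d: "S.d = \<delta>" by (simp add: S.d_def \<delta>)
      have th: "S.\<theta> = \<theta>" by (simp add: S.\<theta>_def \<theta>)
      have Bq: "S.B = nat \<lfloor>real q * b\<rfloor>" by (simp add: S.B_def)
      have \<delta>j: "1 / (2 * real j) < \<delta>" "\<delta> < 1 / real j" "1/3 < \<theta>" "\<theta> < 2/3" using gs by (auto simp: good_scale_def \<delta> \<theta>)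
      have \<delta>0: "0 < \<delta>" "\<delta> \<le> 1" using S.d0 d by auto
      have mj: "2 * real m \<le> real j"
      proof -
        have "real m * (1 / (2 * real j)) \<le> real m * \<delta>" using \<delta>j by (intro mult_left_mono) auto
        then have "real m * (1 / (2 * real j)) \<le> 1/4" using m\<delta> by linarith
        then show ?thesis using j1 by (simp add: field_simps)
      qed
      have mR: "2 * m + I \<le> R" using mj by (simp add: R_def)
      have I\<delta>: "real I * \<delta> \<le> real I / real j" 
        using mult_left_mono[OF less_imp_le[OF \<delta>j(2)], of "real I"] by simp
      have "real I / real j \<le> 1/12" using j12 j1 by (simp add: field_simps)
      then have md: "real m * S.d + real I * S.d \<le> 1/3" using m\<delta> I\<delta> unfolding d by linarith
      have E: "mean (S.err f g R) \<le> \<epsilon> / (32 * M\<^sup>2)"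
      proof -
        have sh: "\<bar>S.sh i\<bar> \<le> real R / real q" if "i \<le> R" for i
        proof -
          have "real i * \<delta> \<le> real R * 1" using that \<delta>0 by (intro mult_mono) auto
          then show ?thesis using \<delta>0 by (simp add: S.sh_def d divide_right_mono)
        qed
        have "mean (S.err f g R) = (\<Sum>j\<le>R. mean (\<lambda>y. \<bar>chi (y + S.sh j) - chi y\<bar>) + mean (\<lambda>y. \<bar>g (y + S.sh j) - g y\<bar>) +
          (\<Sum>k\<in>{- int R..int R}. mean (\<lambda>y. \<bar>tr f k (y + S.sh j) - tr f k y\<bar>)))"
          by (rule S.mean_err[OF f(1) g(1)])
        also have "\<dots> \<le> (\<Sum>j\<le>R. \<epsilon>3 + \<epsilon>3 + (\<Sum>k\<in>{- int R..int R}. \<epsilon>3))"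
          using Q0[OF qQ] sh by (intro sum_mono add_mono) auto
        also have "\<dots> = C * \<epsilon>3" by (simp add: C_def algebra_simps)
        also have "\<dots> = \<epsilon> / (32 * M\<^sup>2)" using C by (simp add: \<epsilon>3_def)
        finally show ?thesis .
      qed
      have h1: "\<bar>mean (\<lambda>y. tr f (int (m * S.B)) y * g y) - mean (\<lambda>y. arc S.\<theta> (1 - real m * S.d) (real q * y) * (f y * g y))
         - mean (\<lambda>y. arc 0 (S.\<theta> - real m * S.d) (real q * y) * (tr f (- int m) y * g y))\<bar>
         \<le> 8 * M\<^sup>2 * mean (S.err f g R) + 2 * M * \<epsilon>1 + 2 * M\<^sup>2 * (real I * S.d)"
        using \<delta>j \<epsilon>1 by (intro S.weak_limit_bound[OF f(1,2) Mf g Mg M I1[OF I(2)] _ mR I(1) mI md]) (auto simp: th)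
      have h2: "8 * M\<^sup>2 * mean (S.err f g R) \<le> \<epsilon>/4"
        using mult_left_mono[OF E, of "8 * M\<^sup>2"] MM by simp
      have h3: "2 * M * \<epsilon>1 = \<epsilon>/4" using M by (simp add: \<epsilon>1_def)
      have h4: "2 * M\<^sup>2 * (real I * S.d) \<le> \<epsilon>/4"
      proof -
        have "2 * M\<^sup>2 * (real I * S.d) \<le> 2 * M\<^sup>2 * (real I / real j)" using I\<delta> MM unfolding d by (intro mult_left_mono) auto
        also have "\<dots> \<le> \<epsilon>/4" using jI j1 by (simp add: field_simps)
        finally show ?thesis .
      qed
      have h5: "\<bar>mean (\<lambda>y. arc \<theta> (1 - real m * \<delta>) (real q * y) * (f y * g y)) - ((1 - real m * \<delta>) - \<theta>) * mean (\<lambda>y. f y * g y)\<bar> \<le> \<epsilon>/8"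
        using Q0[OF qQ] m\<delta> \<delta>0 \<delta>j by simp
      have h6: "\<bar>mean (\<lambda>y. arc 0 (\<theta> - real m * \<delta>) (real q * y) * (tr f (- int m) y * g y)) - ((\<theta> - real m * \<delta>) - 0) * mean (\<lambda>y. tr f (- int m) y * g y)\<bar> \<le> \<epsilon>/8"
      proof -
        have "- int m \<in> {- int R..int R}" using mR by simp
        then have eq: "?eq (\<lambda>y. tr f (- int m) y * g y) q" using Q0[OF qQ] by blast
        have "0 \<le> real m * \<delta>" using \<delta>0 by simp
        then have "0 \<le> (0::real) \<and> 0 \<le> \<theta> - real m * \<delta> \<and> \<theta> - real m * \<delta> \<le> 1" using m\<delta> \<delta>j by linarith
        then show ?thesis by (rule eq[rule_format])
      qed
      have h7: "1 - \<theta> - real m * \<delta> = (1 - real m * \<delta>) - \<theta>" by simp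
      have h8: "\<bar>F - X' - Y'\<bar> \<le> \<epsilon>"
        if "\<bar>F - X - Y\<bar> \<le> p1 + p2 + p3" "p1 \<le> \<epsilon>/4" "p2 = \<epsilon>/4" "p3 \<le> \<epsilon>/4" "\<bar>X - X'\<bar> \<le> \<epsilon>/8" "\<bar>Y - Y'\<bar> \<le> \<epsilon>/8"
        for F X X' Y Y' p1 p2 p3 :: real using that by linarith
      show "\<bar>mean (\<lambda>y. tr f (int (m * nat \<lfloor>real q * b\<rfloor>)) y * g y) - (1 - \<theta> - real m * \<delta>) * mean (\<lambda>y. f y * g y)
        - (\<theta> - real m * \<delta>) * mean (\<lambda>y. tr f (- int m) y * g y)\<bar> \<le> \<epsilon>"
        unfolding h7 by (rule h8[OF h1[unfolded d th Bq] h2 h3 h4[unfolded d] h5 h6[unfolded diff_0_right]])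
    qed
  qed
qed

end

section \<open>The limit along good scales\<close>

locale well_approximable = induced_rotation +
  assumes good_scales: "\<And>j Q0. 1 \<le> j \<Longrightarrow> \<exists>q P. Q0 \<le> q \<and> good_scale j q P"
begin

text \<open>The iterated limit: first \<open>j \<rightarrow> \<infinity>\<close> (so that the drift \<open>\<delta>\<close> tends to \<open>0\<close>), and for each \<open>j\<close> the period \<open>q \<rightarrow> \<infinity>\<close>.\<close>

definition scales :: "(nat \<times> int) filter" where
  "scales = Abs_filter (\<lambda>X. \<exists>j0. \<forall>j\<ge>j0. \<exists>Q0. \<forall>q P. q \<ge> Q0 \<and> good_scale j q P \<longrightarrow> X (q, P))"

lemma eventually_scales:
  "eventually X scales \<longleftrightarrow> (\<exists>j0. \<forall>j\<ge>j0. \<exists>Q0. \<forall>q P. q \<ge> Q0 \<and> good_scale j q P \<longrightarrow> X (q, P))"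
  unfolding scales_def
proof (rule eventually_Abs_filter, rule is_filter.intro)
  show "\<exists>j0. \<forall>j\<ge>j0. \<exists>Q0. \<forall>q P. q \<ge> Q0 \<and> good_scale j q P \<longrightarrow> True" by simp
next
  fix X Y :: "nat \<times> int \<Rightarrow> bool"
  assume "\<exists>j0. \<forall>j\<ge>j0. \<exists>Q0. \<forall>q P. q \<ge> Q0 \<and> good_scale j q P \<longrightarrow> X (q, P)"
    and "\<exists>j0. \<forall>j\<ge>j0. \<exists>Q0. \<forall>q P. q \<ge> Q0 \<and> good_scale j q P \<longrightarrow> Y (q, P)"
  then obtain j1 j2 where 1: "\<And>j. j \<ge> j1 \<Longrightarrow> \<exists>Q0. \<forall>q P. q \<ge> Q0 \<and> good_scale j q P \<longrightarrow> X (q, P)"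
    and 2: "\<And>j. j \<ge> j2 \<Longrightarrow> \<exists>Q0. \<forall>q P. q \<ge> Q0 \<and> good_scale j q P \<longrightarrow> Y (q, P)" by blast
  show "\<exists>j0. \<forall>j\<ge>j0. \<exists>Q0. \<forall>q P. q \<ge> Q0 \<and> good_scale j q P \<longrightarrow> X (q, P) \<and> Y (q, P)"
  proof (rule exI[of _ "max j1 j2"], intro allI impI)
    fix j assume "j \<ge> max j1 j2"
    then have "j \<ge> j1" "j \<ge> j2" by auto
    then obtain Q1 Q2 where "\<forall>q P. q \<ge> Q1 \<and> good_scale j q P \<longrightarrow> X (q, P)" "\<forall>q P. q \<ge> Q2 \<and> good_scale j q P \<longrightarrow> Y (q, P)"
      using 1 2 by meson
    then show "\<exists>Q0. \<forall>q P. q \<ge> Q0 \<and> good_scale j q P \<longrightarrow> X (q, P) \<and> Y (q, P)"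
      by (intro exI[of _ "max Q1 Q2"]) simp
  qed
next
  fix X Y :: "nat \<times> int \<Rightarrow> bool"
  assume "\<forall>x. X x \<longrightarrow> Y x" "\<exists>j0. \<forall>j\<ge>j0. \<exists>Q0. \<forall>q P. q \<ge> Q0 \<and> good_scale j q P \<longrightarrow> X (q, P)"
  then show "\<exists>j0. \<forall>j\<ge>j0. \<exists>Q0. \<forall>q P. q \<ge> Q0 \<and> good_scale j q P \<longrightarrow> Y (q, P)" by meson
qed

lemma scales_neq_bot: "scales \<noteq> bot"
proof
  assume "scales = bot"
  then have "eventually (\<lambda>_. False) scales" by simp
  then obtain j0 where "\<forall>j\<ge>j0. \<exists>Q0. \<forall>q P. \<not> (q \<ge> Q0 \<and> good_scale j q P)" unfolding eventually_scales by auto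
  then obtain Q0 where "\<forall>q P. \<not> (q \<ge> Q0 \<and> good_scale (max j0 1) q P)" by (meson max.cobounded1)
  then show False using good_scales[of "max j0 1" Q0] by auto
qed

definition drift :: "nat \<times> int \<Rightarrow> real" where
  "drift s = real (fst s) * (real (fst s) * a - of_int (snd s))"

definition theta :: "nat \<times> int \<Rightarrow> real" where "theta s = frac (real (fst s) * b)"

definition period :: "nat \<times> int \<Rightarrow> nat" where "period s = nat \<lfloor>real (fst s) * b\<rfloor>"

lemma eventually_drift_pos: "\<forall>\<^sub>F s in scales. 0 < drift s"
  unfolding eventually_scales
proof (intro exI allI impI)
  fix j q P assume "0 \<le> q \<and> good_scale j q P"
  then have "1 / (2 * real j) < drift (q, P)" by (simp add: good_scale_def drift_def)
  moreover have "0 \<le> 1 / (2 * real j)" by simp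
  ultimately show "0 < drift (q, P)" by linarith
qed

lemma drift_tendsto: "(drift \<longlongrightarrow> 0) scales"
proof (rule tendstoI)
  fix e :: real assume e: "e > 0"
  have "\<forall>\<^sub>F s in scales. drift s < e" unfolding eventually_scales
  proof (intro exI allI impI)
    fix j q P assume j: "nat \<lceil>1/e\<rceil> + 1 \<le> j" and "0 \<le> q \<and> good_scale j q P"
    then have "drift (q, P) < 1 / real j" by (simp add: good_scale_def drift_def)
    also have "1 / real j \<le> e"
    proof -
      have "1/e \<le> real j" using j by linarith
      moreover have "0 < real j" using j by simp
      ultimately show ?thesis using e by (simp add: field_simps)
    qed
    finally show "drift (q, P) < e" .
  qed
  then show "\<forall>\<^sub>F s in scales. dist (drift s) 0 < e" using eventually_drift_pos
    by eventually_elim simp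
qed

text \<open>The number of returns after which the drift has added up to about \<open>\<tau>\<close>.\<close>

definition steps :: "real \<Rightarrow> nat \<Rightarrow> nat \<times> int \<Rightarrow> nat" where
  "steps \<tau> \<kappa> s = nat \<lfloor>\<tau> / drift s\<rfloor> + \<kappa>"

lemma steps_drift_bounds:
  assumes "0 < \<tau>" "0 < drift s"
  shows "\<tau> - drift s \<le> real (steps \<tau> \<kappa> s) * drift s" "real (steps \<tau> \<kappa> s) * drift s \<le> \<tau> + real \<kappa> * drift s"
proof -
  have "0 \<le> \<tau> / drift s" using assms by simp
  then have n: "real (nat \<lfloor>\<tau> / drift s\<rfloor>) \<le> \<tau> / drift s" "\<tau> / drift s - 1 \<le> real (nat \<lfloor>\<tau> / drift s\<rfloor>)" by linarith+
  have "real (nat \<lfloor>\<tau> / drift s\<rfloor>) * drift s \<le> \<tau>" "\<tau> - drift s \<le> real (nat \<lfloor>\<tau> / drift s\<rfloor>) * drift s"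
    using mult_right_mono[OF n(1), of "drift s"] mult_right_mono[OF n(2), of "drift s"] assms by (auto simp: left_diff_distrib)
  moreover have "0 \<le> real \<kappa> * drift s" using assms by simp
  ultimately show "\<tau> - drift s \<le> real (steps \<tau> \<kappa> s) * drift s" "real (steps \<tau> \<kappa> s) * drift s \<le> \<tau> + real \<kappa> * drift s"
    unfolding steps_def of_nat_add distrib_right by linarith+
qed

lemma steps_drift_tendsto:
  assumes "0 < \<tau>" shows "((\<lambda>s. real (steps \<tau> \<kappa> s) * drift s) \<longlongrightarrow> \<tau>) scales"
proof (rule tendsto_sandwich)
  show "\<forall>\<^sub>F s in scales. \<tau> - drift s \<le> real (steps \<tau> \<kappa> s) * drift s"
    using eventually_drift_pos by eventually_elim (rule steps_drift_bounds(1)[OF assms])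
  show "\<forall>\<^sub>F s in scales. real (steps \<tau> \<kappa> s) * drift s \<le> \<tau> + real \<kappa> * drift s"
    using eventually_drift_pos by eventually_elim (rule steps_drift_bounds(2)[OF assms])
  show "((\<lambda>s. \<tau> - drift s) \<longlongrightarrow> \<tau>) scales" by (auto intro!: tendsto_eq_intros drift_tendsto)
  show "((\<lambda>s. \<tau> + real \<kappa> * drift s) \<longlongrightarrow> \<tau>) scales" by (auto intro!: tendsto_eq_intros drift_tendsto)
qed

lemma eventually_steps_ge:
  assumes "0 < \<tau>" shows "\<forall>\<^sub>F s in scales. I0 \<le> steps \<tau> \<kappa> s"
proof -
  have "0 < \<tau> / (2 * (real I0 + 1))" using assms by simp
  then have "\<forall>\<^sub>F s in scales. drift s < \<tau> / (2 * (real I0 + 1))" by (rule order_tendstoD(2)[OF drift_tendsto])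
  with eventually_drift_pos show ?thesis
  proof eventually_elim
    case (elim s)
    have "real I0 * drift s \<le> (real I0 + 1) * drift s" using elim by (intro mult_right_mono) auto
    also have "\<dots> \<le> \<tau>"
    proof -
      have "drift s * (2 * (real I0 + 1)) < \<tau>" using elim by (subst (asm) pos_less_divide_eq) auto
      moreover have "0 \<le> (real I0 + 1) * drift s" using elim by simp
      moreover have "drift s * (2 * (real I0 + 1)) = 2 * ((real I0 + 1) * drift s)" by simp
      ultimately show ?thesis by linarith
    qed
    finally have "real I0 \<le> \<tau> / drift s" using elim by (simp add: pos_le_divide_eq)
    then show ?case unfolding steps_def by linarith
  qed
qed

lemma theta_bounds: "\<forall>\<^sub>F s in scales. 1/3 < theta s \<and> theta s < 2/3"
  unfolding eventually_scales theta_def good_scale_def by auto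

lemma weak_limit_scales:
  assumes f: "pcont f" "supp f" "mean f = 0" and g: "pcont g" "supp g" and c: "0 < c" and \<tau>: "0 < \<tau>" "real c * \<tau> \<le> 1/8"
  shows "((\<lambda>s. let m = c * steps \<tau> \<kappa> s in
      mean (\<lambda>y. tr f (int (m * period s)) y * g y) - (1 - theta s - real m * drift s) * mean (\<lambda>y. f y * g y)
        - (theta s - real m * drift s) * mean (\<lambda>y. tr f (- int m) y * g y)) \<longlongrightarrow> 0) scales"
proof (rule tendstoI)
  fix e :: real assume e: "e > 0"
  then have "e/2 > 0" by simp
  obtain I0 j0 where W: "\<And>j. j \<ge> j0 \<Longrightarrow> \<exists>Q0. \<forall>q P m \<delta> \<theta>. q \<ge> Q0 \<and> good_scale j q P \<and> I0 \<le> m \<and>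
      \<delta> = real q * (real q * a - of_int P) \<and> \<theta> = frac (real q * b) \<and> real m * \<delta> \<le> 1/4 \<longrightarrow>
      \<bar>mean (\<lambda>y. tr f (int (m * nat \<lfloor>real q * b\<rfloor>)) y * g y) - (1 - \<theta> - real m * \<delta>) * mean (\<lambda>y. f y * g y)
        - (\<theta> - real m * \<delta>) * mean (\<lambda>y. tr f (- int m) y * g y)\<bar> \<le> e/2"
    by (rule weak_limit[OF f g \<open>e/2 > 0\<close>]) (rule that, assumption)
  have 1: "\<forall>\<^sub>F s in scales. \<forall>m. I0 \<le> m \<and> real m * drift s \<le> 1/4 \<longrightarrow>
      \<bar>mean (\<lambda>y. tr f (int (m * period s)) y * g y) - (1 - theta s - real m * drift s) * mean (\<lambda>y. f y * g y)
        - (theta s - real m * drift s) * mean (\<lambda>y. tr f (- int m) y * g y)\<bar> \<le> e/2"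
    unfolding eventually_scales
  proof (rule exI[of _ j0], intro allI impI)
    fix j assume "j0 \<le> j"
    from W[OF this] obtain Q0 where Q0: "\<And>q P m \<delta> \<theta>. q \<ge> Q0 \<and> good_scale j q P \<and> I0 \<le> m \<and>
      \<delta> = real q * (real q * a - of_int P) \<and> \<theta> = frac (real q * b) \<and> real m * \<delta> \<le> 1/4 \<Longrightarrow>
      \<bar>mean (\<lambda>y. tr f (int (m * nat \<lfloor>real q * b\<rfloor>)) y * g y) - (1 - \<theta> - real m * \<delta>) * mean (\<lambda>y. f y * g y)
        - (\<theta> - real m * \<delta>) * mean (\<lambda>y. tr f (- int m) y * g y)\<bar> \<le> e/2" by blast
    show "\<exists>Q0. \<forall>q P. Q0 \<le> q \<and> good_scale j q P \<longrightarrow> (\<forall>m. I0 \<le> m \<and> real m * drift (q, P) \<le> 1/4 \<longrightarrow>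
      \<bar>mean (\<lambda>y. tr f (int (m * period (q, P))) y * g y) - (1 - theta (q, P) - real m * drift (q, P)) * mean (\<lambda>y. f y * g y)
        - (theta (q, P) - real m * drift (q, P)) * mean (\<lambda>y. tr f (- int m) y * g y)\<bar> \<le> e/2)"
    proof (intro exI[of _ Q0] allI impI)
      fix q P m assume "Q0 \<le> q \<and> good_scale j q P" "I0 \<le> m \<and> real m * drift (q, P) \<le> 1/4"
      then show "\<bar>mean (\<lambda>y. tr f (int (m * period (q, P))) y * g y) - (1 - theta (q, P) - real m * drift (q, P)) * mean (\<lambda>y. f y * g y)
        - (theta (q, P) - real m * drift (q, P)) * mean (\<lambda>y. tr f (- int m) y * g y)\<bar> \<le> e/2"
        unfolding period_def theta_def fst_conv by (intro Q0[of q P]) (simp add: drift_def)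
    qed
  qed
  have "((\<lambda>s. real c * (real (steps \<tau> \<kappa> s) * drift s)) \<longlongrightarrow> real c * \<tau>) scales"
    by (intro tendsto_intros steps_drift_tendsto \<tau>)
  then have "\<forall>\<^sub>F s in scales. real c * (real (steps \<tau> \<kappa> s) * drift s) < 1/4"
    by (rule order_tendstoD(2)) (use \<tau> in linarith)
  with 1 eventually_steps_ge[OF \<tau>(1), of I0 \<kappa>]
  show "\<forall>\<^sub>F s in scales. dist (let m = c * steps \<tau> \<kappa> s in
      mean (\<lambda>y. tr f (int (m * period s)) y * g y) - (1 - theta s - real m * drift s) * mean (\<lambda>y. f y * g y)
        - (theta s - real m * drift s) * mean (\<lambda>y. tr f (- int m) y * g y)) 0 < e"
  proof eventually_elim
    case (elim s)
    let ?m = "c * steps \<tau> \<kappa> s"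
    have "1 * steps \<tau> \<kappa> s \<le> ?m" using c by (intro mult_right_mono) auto
    then have "I0 \<le> ?m" using elim(2) by linarith
    moreover have "real ?m * drift s \<le> 1/4" using elim(3) by (simp add: mult.assoc)
    ultimately have "\<bar>mean (\<lambda>y. tr f (int (?m * period s)) y * g y) - (1 - theta s - real ?m * drift s) * mean (\<lambda>y. f y * g y)
        - (theta s - real ?m * drift s) * mean (\<lambda>y. tr f (- int ?m) y * g y)\<bar> \<le> e/2" using elim(1) by blast
    then show ?case unfolding Let_def dist_real_def diff_0_right using e by linarith
  qed
qed

text \<open>The deviation from the expected weak limit, kept as a function so that functionals other
  than the mean can be applied to it.\<close>

definition fwd :: "(real \<Rightarrow> real) \<Rightarrow> nat \<Rightarrow> nat \<times> int \<Rightarrow> real \<Rightarrow> real" where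
  "fwd f m s y = tr f (int (m * period s)) y - (1 - theta s - real m * drift s) * f y
     - (theta s - real m * drift s) * tr f (- int m) y"

definition bwd :: "(real \<Rightarrow> real) \<Rightarrow> nat \<Rightarrow> nat \<times> int \<Rightarrow> real \<Rightarrow> real" where
  "bwd f m s y = tr f (- int (m * period s)) y - (1 - theta s - real m * drift s) * f y
     - (theta s - real m * drift s) * tr f (int m) y"

lemma pcont_fwd: "pcont f \<Longrightarrow> pcont (fwd f m s)"
  unfolding fwd_def by (intro pcont_diff pcont_cmult pcont_tr)

lemma pcont_bwd: "pcont f \<Longrightarrow> pcont (bwd f m s)"
  unfolding bwd_def by (intro pcont_diff pcont_cmult pcont_tr)

lemma supp_fwd: "supp f \<Longrightarrow> supp (fwd f m s)" and supp_bwd: "supp f \<Longrightarrow> supp (bwd f m s)"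
  by (auto simp: supp_def fwd_def bwd_def tr_def)

lemma mean_three_terms:
  assumes "pcont u" "pcont v" "pcont w" "pcont g"
  shows "mean (\<lambda>y. (u y - \<alpha> * v y - \<beta> * w y) * g y) = mean (\<lambda>y. u y * g y) - \<alpha> * mean (\<lambda>y. v y * g y) - \<beta> * mean (\<lambda>y. w y * g y)"
proof -
  have p: "pcont (\<lambda>y. u y * g y)" "pcont (\<lambda>y. v y * g y)" "pcont (\<lambda>y. w y * g y)" using assms by (auto intro: pcont_mult)
  have "mean (\<lambda>y. (u y - \<alpha> * v y - \<beta> * w y) * g y) = mean (\<lambda>y. u y * g y - \<alpha> * (v y * g y) - \<beta> * (w y * g y))"
    by (simp add: algebra_simps)
  also have "\<dots> = mean (\<lambda>y. u y * g y) - \<alpha> * mean (\<lambda>y. v y * g y) - \<beta> * mean (\<lambda>y. w y * g y)"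
    using mean_diff[OF pcont_diff[OF p(1) pcont_cmult[OF p(2), of \<alpha>]] pcont_cmult[OF p(3), of \<beta>]]
      mean_diff[OF p(1) pcont_cmult[OF p(2), of \<alpha>]] mean_cmult[OF p(2)] mean_cmult[OF p(3)] by simp
  finally show ?thesis .
qed

lemma supp_chi: "supp chi" by (simp add: supp_def chi_eq)

lemma mean_supp_chi:
  assumes "supp u" shows "mean (\<lambda>y. u y * g y) = mean (\<lambda>y. u y * (chi y * g y))"
proof -
  have "(\<lambda>y. u y * g y) = (\<lambda>y. u y * (chi y * g y))" using assms by (auto simp: supp_def chi_eq fun_eq_iff)
  then show ?thesis by simp
qed

lemma fwd_weakly_null:
  assumes f: "pcont f" "supp f" "mean f = 0" and c: "0 < c" and \<tau>: "0 < \<tau>" "real c * \<tau> \<le> 1/8" and g: "pcont g"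
  shows "((\<lambda>s. mean (\<lambda>y. fwd f (c * steps \<tau> \<kappa> s) s y * g y)) \<longlongrightarrow> 0) scales"
proof -
  let ?g = "\<lambda>y. chi y * g y"
  have g': "pcont ?g" "supp ?g" using g by (auto intro: pcont_mult pcont_chi supp_mult supp_chi)
  have "mean (\<lambda>y. fwd f (c * steps \<tau> \<kappa> s) s y * g y) = (let m = c * steps \<tau> \<kappa> s in
      mean (\<lambda>y. tr f (int (m * period s)) y * ?g y) - (1 - theta s - real m * drift s) * mean (\<lambda>y. f y * ?g y)
        - (theta s - real m * drift s) * mean (\<lambda>y. tr f (- int m) y * ?g y))" for s
    unfolding mean_supp_chi[OF supp_fwd[OF f(2)], of _ _ g] Let_def unfolding fwd_def
    by (rule mean_three_terms[OF pcont_tr[OF f(1)] f(1) pcont_tr[OF f(1)] g'(1)])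
  then show ?thesis using weak_limit_scales[OF f g' c \<tau>, of \<kappa>] by (simp only:)
qed

lemma tr_chi: "tr chi k = chi"
  by (auto simp: tr_def chi_eq Tz_in fun_eq_iff)

lemma tr_lin: "tr (\<lambda>y. u y - \<alpha> * v y) k = (\<lambda>y. tr u k y - \<alpha> * tr v k y)"
  by (auto simp: tr_def fun_eq_iff)

text \<open>By the invariance of the mean, the backward powers are the adjoints of the forward ones.\<close>

lemma bwd_weakly_null:
  assumes f: "pcont f" "supp f" "mean f = 0" and c: "0 < c" and \<tau>: "0 < \<tau>" "real c * \<tau> \<le> 1/8" and g: "pcont g"
  shows "((\<lambda>s. mean (\<lambda>y. bwd f (c * steps \<tau> \<kappa> s) s y * g y)) \<longlongrightarrow> 0) scales"
proof -
  let ?g = "\<lambda>y. chi y * g y"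
  have g': "pcont ?g" "supp ?g" using g by (auto intro: pcont_mult pcont_chi supp_mult supp_chi)
  \<comment> \<open>Passing to the adjoint puts \<open>g\<close> in the place of the function of
    mean 0. Subtracting \<open>\<alpha> * chi\<close> gives it that mean, and the subtracted part
    pairs to 0 because \<open>chi\<close> is invariant and \<open>mean f = 0\<close>.\<close>
  define \<alpha> where "\<alpha> = mean ?g / mean chi"
  define g0 where "g0 = (\<lambda>y. ?g y - \<alpha> * chi y)"
  have g0: "pcont g0" "supp g0" "mean g0 = 0"
  proof -
    show "pcont g0" unfolding g0_def by (intro pcont_diff pcont_cmult pcont_chi g')
    show "supp g0" by (simp add: g0_def supp_def chi_eq)
    have "mean g0 = mean ?g - \<alpha> * mean chi"
      unfolding g0_def using mean_diff[OF g'(1) pcont_cmult[OF pcont_chi]] mean_cmult[OF pcont_chi] by simp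
    then show "mean g0 = 0" using mean_chi_pos by (simp add: \<alpha>_def)
  qed
  have pair: "mean (\<lambda>y. tr f k y * ?g y) = mean (\<lambda>y. tr g0 (- k) y * f y)" for k
  proof -
    have "mean (\<lambda>y. tr f k y * ?g y) = mean (\<lambda>y. f y * tr ?g (- k) y)" by (rule mean_tr_adjoint[OF f(1) g'(1) f(2)])
    also have "\<dots> = mean (\<lambda>y. tr ?g (- k) y * f y - \<alpha> * f y) "
      using mean_diff[OF pcont_mult[OF pcont_tr[OF g'(1)] f(1)] pcont_cmult[OF f(1)]] mean_cmult[OF f(1)] f(3)
      by (simp add: mult.commute)
    also have "\<dots> = mean (\<lambda>y. tr g0 (- k) y * f y)"
    proof -
      have "(\<lambda>y. tr ?g (- k) y * f y - \<alpha> * f y) = (\<lambda>y. tr g0 (- k) y * f y)"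
        using f(2) unfolding g0_def tr_lin tr_chi by (auto simp: fun_eq_iff supp_def chi_eq left_diff_distrib)
      then show ?thesis by simp
    qed
    finally show ?thesis .
  qed
  have pair0: "mean (\<lambda>y. f y * ?g y) = mean (\<lambda>y. g0 y * f y)" using pair[of 0] f(2) g0(2) by simp
  have "mean (\<lambda>y. bwd f (c * steps \<tau> \<kappa> s) s y * g y) = (let m = c * steps \<tau> \<kappa> s in
      mean (\<lambda>y. tr g0 (int (m * period s)) y * f y) - (1 - theta s - real m * drift s) * mean (\<lambda>y. g0 y * f y)
        - (theta s - real m * drift s) * mean (\<lambda>y. tr g0 (- int m) y * f y))" for s
  proof -
    have "mean (\<lambda>y. bwd f (c * steps \<tau> \<kappa> s) s y * g y) = (let m = c * steps \<tau> \<kappa> s in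
      mean (\<lambda>y. tr f (- int (m * period s)) y * ?g y) - (1 - theta s - real m * drift s) * mean (\<lambda>y. f y * ?g y)
        - (theta s - real m * drift s) * mean (\<lambda>y. tr f (int m) y * ?g y))"
      unfolding mean_supp_chi[OF supp_bwd[OF f(2)], of _ _ g] Let_def unfolding bwd_def
      by (rule mean_three_terms[OF pcont_tr[OF f(1)] f(1) pcont_tr[OF f(1)] g'(1)])
    then show ?thesis unfolding Let_def pair pair0 minus_minus .
  qed
  then show ?thesis using weak_limit_scales[OF g0 f(1,2) c \<tau>, of \<kappa>] by (simp only:)
qed

lemma tr_abs_le: "(\<And>y. \<bar>f y\<bar> \<le> M) \<Longrightarrow> \<bar>tr f k y\<bar> \<le> M"
  using tr_bounded[of f M k y] by (meson abs_ge_zero order_trans)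

lemma three_terms_abs_le:
  fixes u v w :: real
  assumes "\<bar>u\<bar> \<le> M" "\<bar>v\<bar> \<le> M" "\<bar>w\<bar> \<le> M" "\<bar>\<alpha>\<bar> \<le> 1" "\<bar>\<beta>\<bar> \<le> 1"
  shows "\<bar>u - \<alpha> * v - \<beta> * w\<bar> \<le> 3 * M"
proof -
  have "\<bar>\<alpha> * v\<bar> \<le> 1 * M" "\<bar>\<beta> * w\<bar> \<le> 1 * M" unfolding abs_mult using assms by (intro mult_mono; simp)+
  then show ?thesis using assms(1) by linarith
qed

lemma eventually_coefficients:
  assumes c: "real c * \<tau> \<le> 1/8" "0 < \<tau>"
  shows "\<forall>\<^sub>F s in scales. \<bar>1 - theta s - real (c * steps \<tau> \<kappa> s) * drift s\<bar> \<le> 1 \<and> \<bar>theta s - real (c * steps \<tau> \<kappa> s) * drift s\<bar> \<le> 1"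
proof -
  have "((\<lambda>s. real c * (real (steps \<tau> \<kappa> s) * drift s)) \<longlongrightarrow> real c * \<tau>) scales"
    by (intro tendsto_intros steps_drift_tendsto c)
  then have "\<forall>\<^sub>F s in scales. real c * (real (steps \<tau> \<kappa> s) * drift s) < 1/4"
    by (rule order_tendstoD(2)) (use c in linarith)
  with theta_bounds eventually_drift_pos show ?thesis
  proof eventually_elim
    case (elim s)
    have "0 \<le> real (c * steps \<tau> \<kappa> s) * drift s" using elim(2) by simp
    moreover have "real (c * steps \<tau> \<kappa> s) * drift s < 1/4" using elim(3) by (simp add: mult.assoc)
    ultimately show ?case using elim(1) by linarith
  qed
qed

end

context well_approximable
begin

section \<open>Vanishing correlations\<close>

text \<open>A linear functional of \<open>v\<close>: the limit of its averages along the orbit in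
  steps of \<open>p\<close>, weighted by \<open>w\<close>, along the subsequence \<open>N\<close>.
  It is a relation because the limit need not exist for every \<open>v\<close>.\<close>

definition conv :: "real \<Rightarrow> nat \<Rightarrow> (nat \<Rightarrow> real) \<Rightarrow> (nat \<Rightarrow> nat) \<Rightarrow> (real \<Rightarrow> real) \<Rightarrow> real \<Rightarrow> bool" where
  "conv x p w N v l \<longleftrightarrow> (\<lambda>j. (\<Sum>n<N j. v (Tz (int p * int n) x) * w n) / real (N j)) \<longlonglongrightarrow> l"

lemma conv_add_scaled:
  assumes "conv x p w N u k" "conv x p w N v l"
  shows "conv x p w N (\<lambda>y. u y + c * v y) (k + c * l)"
proof -
  have "(\<Sum>n<M. (u (Tz (int p * int n) x) + c * v (Tz (int p * int n) x)) * w n) / real M =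
    (\<Sum>n<M. u (Tz (int p * int n) x) * w n) / real M + c * ((\<Sum>n<M. v (Tz (int p * int n) x) * w n) / real M)" for M
    by (simp add: distrib_right sum.distrib add_divide_distrib sum_distrib_left mult.assoc)
  moreover have "(\<lambda>j. (\<Sum>n<N j. u (Tz (int p * int n) x) * w n) / real (N j)
      + c * ((\<Sum>n<N j. v (Tz (int p * int n) x) * w n) / real (N j))) \<longlonglongrightarrow> k + c * l"
    using assms unfolding conv_def by (intro tendsto_intros)
  ultimately show ?thesis unfolding conv_def by (simp only:)
qed

text \<open>Boundedness in mean square. Cauchy-Schwarz separates \<open>w\<close> from
  \<open>v\<close>, and the squares of \<open>v\<close> at the times \<open>p * n\<close> are part
  of the full Birkhoff sum up to \<open>p * M\<close>, whence the factor \<open>p\<close>.\<close>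

lemma conv_bound:
  assumes x: "x \<in> J" and v: "pcont v" "supp v" and p: "0 < p" and w: "\<And>n. \<bar>w n\<bar> \<le> W"
    and N: "filterlim N at_top sequentially" and l: "conv x p w N v l"
  shows "l\<^sup>2 \<le> W\<^sup>2 * (2 * real p * mean (\<lambda>y. v y * v y))"
proof -
  let ?v2 = "\<lambda>y. v y * v y"
  have pv: "pcont ?v2" "supp ?v2" using v by (auto intro: pcont_mult supp_mult)
  have *: "l\<^sup>2 \<le> W\<^sup>2 * (2 * real p * (mean ?v2 + \<epsilon>))" if "\<epsilon> > 0" for \<epsilon>
  proof -
    obtain N0 where N0: "\<And>N z. N \<ge> N0 \<Longrightarrow> z \<in> J \<Longrightarrow> (\<Sum>i<N. ?v2 (Tz (int i) z)) \<le> 2 * real N * (mean ?v2 + \<epsilon>)"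
      using induced_birkhoff_upper[OF pv zero_le_square \<open>\<epsilon> > 0\<close>] by blast
    have bound: "((\<Sum>n<M. v (Tz (int p * int n) x) * w n) / real M)\<^sup>2 \<le> W\<^sup>2 * (2 * real p * (mean ?v2 + \<epsilon>))" if M: "M \<ge> max N0 1" for M
    proof -
      have M0: "real M > 0" using M by simp
      have "(\<Sum>n<M. v (Tz (int p * int n) x) * w n)\<^sup>2 \<le> (\<Sum>n<M. (v (Tz (int p * int n) x))\<^sup>2) * (\<Sum>n<M. (w n)\<^sup>2)"
        by (rule Cauchy_Schwarz_ineq_sum)
      also have "\<dots> \<le> (2 * real (p * M) * (mean ?v2 + \<epsilon>)) * (real M * W\<^sup>2)"
      proof (rule mult_mono)
        have "(\<Sum>n<M. (v (Tz (int p * int n) x))\<^sup>2) = (\<Sum>n<M. ?v2 (Tz (int (p * n)) x))"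
          by (simp add: power2_eq_square)
        also have "\<dots> = (\<Sum>k\<in>(\<lambda>n. p * n) ` {..<M}. ?v2 (Tz (int k) x))"
          using p by (subst sum.reindex) (auto simp: inj_on_def o_def)
        also have "\<dots> \<le> (\<Sum>k<p * M. ?v2 (Tz (int k) x))"
          using p by (intro sum_mono2) auto
        also have "\<dots> \<le> 2 * real (p * M) * (mean ?v2 + \<epsilon>)"
        proof (rule N0[OF _ x])
          have "1 * M \<le> p * M" using p by (intro mult_right_mono) auto
          then show "N0 \<le> p * M" using M by linarith
        qed
        finally show 1: "(\<Sum>n<M. (v (Tz (int p * int n) x))\<^sup>2) \<le> 2 * real (p * M) * (mean ?v2 + \<epsilon>)" .
        show "0 \<le> 2 * real (p * M) * (mean ?v2 + \<epsilon>)"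
          by (rule order_trans[OF _ 1]) (intro sum_nonneg, simp)
        have "(w n)\<^sup>2 \<le> W\<^sup>2" for n using w[of n] by (simp add: abs_le_square_iff[symmetric])
        then have "(\<Sum>n<M. (w n)\<^sup>2) \<le> (\<Sum>n<M. W\<^sup>2)" by (intro sum_mono) auto
        then show "(\<Sum>n<M. (w n)\<^sup>2) \<le> real M * W\<^sup>2" by simp
        show "0 \<le> (\<Sum>n<M. (w n)\<^sup>2)" by (intro sum_nonneg) simp
      qed
      also have "\<dots> = (W\<^sup>2 * (2 * real p * (mean ?v2 + \<epsilon>))) * (real M)\<^sup>2" by (simp add: power2_eq_square)
      finally show ?thesis using M0 by (simp add: power_divide pos_divide_le_eq)
    qed
    have "\<forall>\<^sub>F j in sequentially. N j \<ge> max N0 1" using N by (simp only: filterlim_at_top)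
    then have "\<forall>\<^sub>F j in sequentially. ((\<Sum>n<N j. v (Tz (int p * int n) x) * w n) / real (N j))\<^sup>2 \<le> W\<^sup>2 * (2 * real p * (mean ?v2 + \<epsilon>))"
      by (rule eventually_mono) (rule bound)
    moreover have "(\<lambda>j. ((\<Sum>n<N j. v (Tz (int p * int n) x) * w n) / real (N j))\<^sup>2) \<longlonglongrightarrow> l\<^sup>2"
      using l unfolding conv_def by (rule tendsto_power)
    ultimately show ?thesis by (intro tendsto_upperbound[of _ "l\<^sup>2"]) auto
  qed
  have "(\<lambda>n. W\<^sup>2 * (2 * real p * (mean ?v2 + 1 / real (Suc n)))) \<longlonglongrightarrow> W\<^sup>2 * (2 * real p * (mean ?v2 + 0))"
    by (intro tendsto_intros LIMSEQ_Suc[OF lim_1_over_n])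
  then have "l\<^sup>2 \<le> W\<^sup>2 * (2 * real p * (mean ?v2 + 0))"
    by (rule LIMSEQ_le_const) (auto intro!: exI[of _ 0] *)
  then show ?thesis by simp
qed

text \<open>Bessel's inequality in disguise: if the values did not tend to \<open>0\<close>, one could add up \<open>K\<close> almost orthogonal
  functions, with signs, whose sum has functional value of order \<open>K\<close> but norm of order \<open>sqrt K\<close>.\<close>

lemma weakly_null_imp_functional_tendsto_0:
  fixes F :: "'s filter"
  assumes x: "x \<in> J" and p: "0 < p" and w: "\<And>n. \<bar>w n\<bar> \<le> W" and N: "filterlim N at_top sequentially"
    and D: "\<And>s. pcont (D s)" "\<And>s. supp (D s)" and bd: "\<forall>\<^sub>F s in F. \<forall>y. \<bar>D s y\<bar> \<le> C"
    and weak: "\<And>g. pcont g \<Longrightarrow> ((\<lambda>s. mean (\<lambda>y. D s y * g y)) \<longlongrightarrow> 0) F"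
    and l: "\<And>s. conv x p w N (D s) (l s)"
  shows "(l \<longlongrightarrow> 0) F"
proof (rule ccontr)
  assume "\<not> (l \<longlongrightarrow> 0) F"
  then obtain \<eta> where \<eta>: "\<eta> > 0" and "\<not> (\<forall>\<^sub>F s in F. \<bar>l s\<bar> < \<eta>)"
    unfolding tendsto_iff by auto
  then have fr: "\<exists>\<^sub>F s in F. \<eta> \<le> \<bar>l s\<bar>" by (simp add: frequently_def not_le)
  have ex: "\<exists>v k. pcont v \<and> supp v \<and> conv x p w N v k \<and> real K * \<eta> \<le> k \<and> mean (\<lambda>y. v y * v y) \<le> real K * (C\<^sup>2 + 1)" for K
  proof (induction K)
    case 0
    show ?case by (intro exI[of _ "\<lambda>_. 0"] exI[of _ "0::real"]) (auto simp: supp_def conv_def)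
  next
    case (Suc K)
    then obtain v k where v: "pcont v" "supp v" "conv x p w N v k" "real K * \<eta> \<le> k" "mean (\<lambda>y. v y * v y) \<le> real K * (C\<^sup>2 + 1)"
      by blast
    have "\<forall>\<^sub>F s in F. \<bar>mean (\<lambda>y. D s y * v y)\<bar> < 1/2"
      using weak[OF v(1)] unfolding tendsto_iff by (auto dest!: spec[of _ "1/2"])
    with bd have "\<forall>\<^sub>F s in F. \<bar>mean (\<lambda>y. D s y * v y)\<bar> < 1/2 \<and> (\<forall>y. \<bar>D s y\<bar> \<le> C)"
      by eventually_elim simp
    then obtain s where s: "\<eta> \<le> \<bar>l s\<bar>" "\<bar>mean (\<lambda>y. D s y * v y)\<bar> < 1/2" "\<And>y. \<bar>D s y\<bar> \<le> C"
      using frequently_ex[OF frequently_eventually_frequently[OF fr]] by blast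
    \<comment> \<open>The sign makes the functional values add up, while the cross term, with a mean
      below 1/2, adds at most 1 to the mean square.\<close>
    define c where "c = sgn (l s)"
    have c: "c = 1 \<or> c = - 1" "c * l s = \<bar>l s\<bar>"
      using s(1) \<eta> by (auto simp: c_def sgn_if)
    let ?v = "\<lambda>y. v y + c * D s y"
    have "pcont ?v" using v D by (intro pcont_add pcont_cmult)
    moreover have "supp ?v" using v D by (simp add: supp_def)
    moreover have "conv x p w N ?v (k + c * l s)" by (rule conv_add_scaled[OF v(3) l])
    moreover have "real (Suc K) * \<eta> \<le> k + c * l s" using v(4) s(1) c(2) by (simp add: algebra_simps)
    moreover have "mean (\<lambda>y. ?v y * ?v y) \<le> real (Suc K) * (C\<^sup>2 + 1)"
    proof -
      have pp: "pcont (\<lambda>y. v y * v y)" "pcont (\<lambda>y. D s y * v y)" "pcont (\<lambda>y. D s y * D s y)"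
        using v D by (auto intro: pcont_mult)
      have cc: "c * c = 1" using c(1) by auto
      have "?v y * ?v y = v y * v y + (2 * c) * (D s y * v y) + D s y * D s y" for y
      proof -
        have "?v y * ?v y = v y * v y + (2 * c) * (D s y * v y) + (c * c) * (D s y * D s y)" by (simp add: algebra_simps)
        then show ?thesis using cc by simp
      qed
      then have "mean (\<lambda>y. ?v y * ?v y) = mean (\<lambda>y. v y * v y + (2 * c) * (D s y * v y) + D s y * D s y)" by presburger
      also have "\<dots> = mean (\<lambda>y. v y * v y) + (2 * c) * mean (\<lambda>y. D s y * v y) + mean (\<lambda>y. D s y * D s y)"
        using mean_add[OF pcont_add[OF pp(1) pcont_cmult[OF pp(2)]] pp(3)] mean_add[OF pp(1) pcont_cmult[OF pp(2)]] mean_cmult[OF pp(2)] by simp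
      also have "mean (\<lambda>y. D s y * D s y) \<le> mean (\<lambda>_. C\<^sup>2)"
      proof (rule mean_mono[OF pp(3) pcont_const])
        fix y
        have "\<bar>D s y\<bar> * \<bar>D s y\<bar> \<le> C * C" using s(3)[of y] by (intro mult_mono) auto
        then show "D s y * D s y \<le> C\<^sup>2" by (simp add: power2_eq_square)
      qed
      also have "(2 * c) * mean (\<lambda>y. D s y * v y) \<le> 1" using s(2) c(1) by auto
      finally show ?thesis using v(5) by (simp add: algebra_simps)
    qed
    ultimately show ?case by blast
  qed
  have *: "(real K * \<eta>)\<^sup>2 \<le> W\<^sup>2 * (2 * real p * (real K * (C\<^sup>2 + 1)))" for K
  proof -
    obtain v k where v: "pcont v" "supp v" "conv x p w N v k" "real K * \<eta> \<le> k" "mean (\<lambda>y. v y * v y) \<le> real K * (C\<^sup>2 + 1)"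
      using ex[of K] by blast
    have "(real K * \<eta>)\<^sup>2 \<le> k\<^sup>2" using v(4) \<eta> by (intro power_mono) auto
    also have "\<dots> \<le> W\<^sup>2 * (2 * real p * mean (\<lambda>y. v y * v y))" by (rule conv_bound[OF x v(1,2) p w N v(3)])
    also have "\<dots> \<le> W\<^sup>2 * (2 * real p * (real K * (C\<^sup>2 + 1)))" by (intro mult_left_mono v(5)) auto
    finally show ?thesis .
  qed
  define A where "A = W\<^sup>2 * (2 * real p * (C\<^sup>2 + 1))"
  define K where "K = nat \<lceil>A / \<eta>\<^sup>2\<rceil> + 1"
  have K: "real K > 0" "A / \<eta>\<^sup>2 < real K" unfolding K_def by linarith+
  have "real K * (real K * \<eta>\<^sup>2) \<le> real K * A" using *[of K] by (simp add: A_def power2_eq_square mult_ac)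
  then have "real K * \<eta>\<^sup>2 \<le> A" using K(1) by simp
  then show False using K(2) \<eta> by (simp add: pos_divide_less_eq)
qed

end

lemma shifted_average_tendsto:
  fixes u :: "int \<Rightarrow> real"
  assumes W: "\<And>k. \<bar>u k\<bar> \<le> W"
  shows "(\<lambda>N. (\<Sum>n<N. u (int n + t)) / real N - (\<Sum>n<N. u (int n)) / real N) \<longlonglongrightarrow> 0"
proof -
  have nat: "\<bar>(\<Sum>n<N. u (int n + t + int k)) - (\<Sum>n<N. u (int n + t))\<bar> \<le> 2 * W * real k" for N k t
  proof (induction k)
    case (Suc k)
    have "(\<Sum>n<N. u (int n + t + int (Suc k))) - (\<Sum>n<N. u (int n + t + int k)) = u (int N + t + int k) - u (t + int k)"
      by (induction N) (auto simp: algebra_simps)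
    then have "\<bar>(\<Sum>n<N. u (int n + t + int (Suc k))) - (\<Sum>n<N. u (int n + t + int k))\<bar> \<le> 2 * W"
      using W[of "int N + t + int k"] W[of "t + int k"] by linarith
    moreover have "2 * W * real (Suc k) = 2 * W * real k + 2 * W" by (simp add: algebra_simps)
    ultimately show ?case using Suc by linarith
  qed simp
  have bd: "\<bar>(\<Sum>n<N. u (int n + t)) - (\<Sum>n<N. u (int n))\<bar> \<le> 2 * W * real (nat \<bar>t\<bar>)" for N
  proof (cases "0 \<le> t")
    case True
    then show ?thesis using nat[where N = N and k = "nat t" and t = 0] by simp
  next
    case False
    then show ?thesis using nat[where N = N and k = "nat (- t)" and t = t] by (simp add: abs_minus_commute)
  qed
  have "(\<lambda>N. 2 * W * real (nat \<bar>t\<bar>) / real N) \<longlonglongrightarrow> 0" by (rule lim_const_over_n)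
  then show ?thesis
  proof (rule Lim_null_comparison[rotated])
    show "\<forall>\<^sub>F N in sequentially. norm ((\<Sum>n<N. u (int n + t)) / real N - (\<Sum>n<N. u (int n)) / real N) \<le> 2 * W * real (nat \<bar>t\<bar>) / real N"
    proof (intro always_eventually allI)
      fix N
      have "norm ((\<Sum>n<N. u (int n + t)) / real N - (\<Sum>n<N. u (int n)) / real N) =
        \<bar>(\<Sum>n<N. u (int n + t)) - (\<Sum>n<N. u (int n))\<bar> / real N"
        by (simp add: abs_divide flip: diff_divide_distrib)
      also have "\<dots> \<le> 2 * W * real (nat \<bar>t\<bar>) / real N" by (intro divide_right_mono bd) simp
      finally show "norm ((\<Sum>n<N. u (int n + t)) / real N - (\<Sum>n<N. u (int n)) / real N) \<le> 2 * W * real (nat \<bar>t\<bar>) / real N" .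
    qed
  qed
qed

text \<open>A diagonal sequence over all integer shifts, which \<open>int_decode\<close>
  numbers.\<close>

lemma common_convergent_subsequence:
  fixes A :: "int \<Rightarrow> nat \<Rightarrow> real"
  assumes "\<And>b N. \<bar>A b N\<bar> \<le> C"
  obtains \<sigma> :: "nat \<Rightarrow> nat" where "strict_mono \<sigma>" "\<forall>b. convergent (\<lambda>j. A b (\<sigma> j))"
proof -
  interpret subseqs "\<lambda>n s. convergent (\<lambda>j. A (int_decode n) (s j))"
  proof
    fix n and s :: "nat \<Rightarrow> nat"
    have "bounded (range (\<lambda>j. A (int_decode n) (s j)))"
      using assms by (auto intro!: boundedI[of _ C])
    then obtain l r where "strict_mono r" "((\<lambda>j. A (int_decode n) (s j)) \<circ> r) \<longlonglongrightarrow> l"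
      using bounded_imp_convergent_subsequence by blast
    then show "\<exists>r. strict_mono r \<and> convergent (\<lambda>j. A (int_decode n) ((s \<circ> r) j))"
      by (auto simp: convergent_def o_def)
  qed
  show thesis
  proof (rule that[OF subseq_diagseq], rule allI)
    fix b
    have "convergent (\<lambda>j. A (int_decode (int_encode b)) ((diagseq \<circ> (+) (Suc (int_encode b))) j))"
    proof (rule diagseq_holds)
      fix r s :: "nat \<Rightarrow> nat" and n assume "strict_mono r" "convergent (\<lambda>j. A (int_decode n) (s j))"
      then show "convergent (\<lambda>j. A (int_decode n) ((s \<circ> r) j))"
        using convergent_subseq_convergent[of "\<lambda>j. A (int_decode n) (s j)" r] by (simp add: o_def)
    qed
    then have "convergent (\<lambda>j. (\<lambda>j. A b (diagseq j)) (j + Suc (int_encode b)))" by (simp add: o_def add.commute)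
    then show "convergent (\<lambda>j. A b (diagseq j))" by (rule convergent_ignore_initial_segment[THEN iffD1])
  qed
qed

lemma not_tendsto_0_subsequence:
  fixes X :: "nat \<Rightarrow> real"
  assumes "\<not> X \<longlonglongrightarrow> 0"
  obtains \<epsilon> and \<sigma> :: "nat \<Rightarrow> nat" where "\<epsilon> > 0" "strict_mono \<sigma>" "\<forall>j. \<epsilon> \<le> \<bar>X (\<sigma> j)\<bar>"
proof -
  from assms obtain \<epsilon> where e: "\<epsilon> > 0" and ne: "\<not> (\<forall>\<^sub>F n in sequentially. \<bar>X n\<bar> < \<epsilon>)"
    unfolding tendsto_iff by auto
  define S where "S = {n. \<epsilon> \<le> \<bar>X n\<bar>}"
  have inf: "infinite S"
    using ne unfolding S_def eventually_sequentially infinite_nat_iff_unbounded_le by (auto simp: not_less)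
  show thesis
  proof (rule that[OF e strict_mono_enumerate[OF inf]])
    show "\<forall>j. \<epsilon> \<le> \<bar>X (enumerate S j)\<bar>" using enumerate_in_set[OF inf] by (simp add: S_def)
  qed
qed

context well_approximable
begin

theorem correlations_vanish:
  assumes f: "pcont f" "supp f" "mean f = 0" and x: "x \<in> J" and rs: "0 < r" "r < (s :: nat)"
  shows "(\<lambda>N. (\<Sum>n<N. f (Tz (int r * int n) x) * f (Tz (int s * int n) x)) / real N) \<longlonglongrightarrow> 0"
proof (rule ccontr)
  obtain M where M: "M > 0" "\<And>y. \<bar>f y\<bar> \<le> M" using pcont_bounded[OF f(1)] by blast
  \<comment> \<open>The shift \<open>b\<close> is counted in units of \<open>n\<close>: it moves the
    first factor by \<open>r * b\<close>, which by re-indexing is the same as moving the second by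
    \<open>- s * b\<close>.\<close>
  define A where "A b N = (\<Sum>n<N. f (Tz (int r * (int n + b)) x) * f (Tz (int s * int n) x)) / real N" for b and N :: nat
  have ff: "\<bar>f y * f z\<bar> \<le> M * M" for y z unfolding abs_mult using M by (intro mult_mono) auto
  have A_bound: "\<bar>A b N\<bar> \<le> M * M" for b N
  proof (cases "N = 0")
    case False
    have "\<bar>\<Sum>n<N. f (Tz (int r * (int n + b)) x) * f (Tz (int s * int n) x)\<bar> \<le> (\<Sum>n<N. M * M)"
      by (rule order_trans[OF sum_abs sum_mono]) (rule ff)
    then show ?thesis using False by (simp add: A_def abs_divide pos_divide_le_eq mult.commute)
  qed (simp add: A_def)
  assume "\<not> (\<lambda>N. (\<Sum>n<N. f (Tz (int r * int n) x) * f (Tz (int s * int n) x)) / real N) \<longlonglongrightarrow> 0"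
  moreover have "A 0 = (\<lambda>N. (\<Sum>n<N. f (Tz (int r * int n) x) * f (Tz (int s * int n) x)) / real N)"
    unfolding A_def by simp
  ultimately have "\<not> A 0 \<longlonglongrightarrow> 0" by metis
  then obtain \<epsilon> and \<sigma> :: "nat \<Rightarrow> nat" where e: "\<epsilon> > 0" and \<sigma>: "strict_mono \<sigma>" "\<forall>j. \<epsilon> \<le> \<bar>A 0 (\<sigma> j)\<bar>"
    using not_tendsto_0_subsequence by blast
  obtain \<sigma>' :: "nat \<Rightarrow> nat" where \<sigma>': "strict_mono \<sigma>'" "\<forall>b. convergent (\<lambda>j. A b (\<sigma> (\<sigma>' j)))"
    using common_convergent_subsequence[of "\<lambda>b j. A b (\<sigma> j)" "M * M", OF A_bound] by blast
  define N where "N j = \<sigma> (\<sigma>' j)" for j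
  have "strict_mono N" unfolding N_def[abs_def] using strict_mono_o[OF \<sigma>(1) \<sigma>'(1)] by (simp add: o_def)
  then have N: "filterlim N at_top sequentially" by (rule filterlim_subseq)
  define a' where "a' b = lim (\<lambda>j. A b (N j))" for b
  have lim: "(\<lambda>j. A b (N j)) \<longlonglongrightarrow> a' b" for b
    using \<sigma>'(2) unfolding a'_def N_def by (simp add: convergent_LIMSEQ_iff)
  \<comment> \<open>Small enough for \<open>r * \<tau>\<close> and \<open>s * \<tau>\<close> both to
    stay within the bound 1/8 under which the weak limits are available.\<close>
  define \<tau> where "\<tau> = 1 / (8 * real s)"
  have \<tau>: "\<tau> > 0" "real s * \<tau> \<le> 1/8" "real r * \<tau> \<le> 1/8" using rs by (auto simp: \<tau>_def field_simps)
  let ?n = "\<lambda>\<kappa> sc. steps \<tau> \<kappa> sc"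
  let ?\<delta>n = "\<lambda>\<kappa> sc. real (?n \<kappa> sc) * drift sc"
  have forward: "((\<lambda>sc. a' (b' + int (?n \<kappa> sc * period sc)) - (1 - theta sc - real (r * ?n \<kappa> sc) * drift sc) * a' b'
      - (theta sc - real (r * ?n \<kappa> sc) * drift sc) * a' (b' - int (?n \<kappa> sc))) \<longlongrightarrow> 0) scales" for b' \<kappa>
  proof -
    \<comment> \<open>The shift by \<open>b'\<close> is absorbed into the function, which keeps mean
      0 by invariance.\<close>
    let ?f = "tr f (int r * b')"
    have f': "pcont ?f" "supp ?f" "mean ?f = 0" using f mean_tr by auto
    show ?thesis
    proof (rule weakly_null_imp_functional_tendsto_0[OF x rs(1) _ N, where D = "\<lambda>sc. fwd ?f (r * ?n \<kappa> sc) sc"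
          and w = "\<lambda>n. f (Tz (int s * int n) x)" and W = M and C = "3 * M"])
      show "\<bar>f (Tz (int s * int n) x)\<bar> \<le> M" for n by (rule M)
      show "pcont (fwd ?f (r * ?n \<kappa> sc) sc)" "supp (fwd ?f (r * ?n \<kappa> sc) sc)" for sc
        by (rule pcont_fwd[OF f'(1)], rule supp_fwd[OF f'(2)])
      show "\<forall>\<^sub>F sc in scales. \<forall>y. \<bar>fwd ?f (r * ?n \<kappa> sc) sc y\<bar> \<le> 3 * M"
        using eventually_coefficients[OF \<tau>(3,1), of \<kappa>]
      proof eventually_elim
        case (elim sc)
        then show ?case unfolding fwd_def by (intro allI three_terms_abs_le tr_abs_le M) auto
      qed
      show "((\<lambda>sc. mean (\<lambda>y. fwd ?f (r * ?n \<kappa> sc) sc y * g y)) \<longlongrightarrow> 0) scales" if "pcont g" for g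
        by (rule fwd_weakly_null[OF f' rs(1) \<tau>(1,3) that])
      fix sc
      let ?\<alpha> = "1 - theta sc - real (r * ?n \<kappa> sc) * drift sc" and ?\<beta> = "theta sc - real (r * ?n \<kappa> sc) * drift sc"
      have tr_at: "tr ?f k (Tz (int r * int n) x) = f (Tz (int r * (int n + b') + k) x)" for k n
        using Tz_in[OF x] Tz_add[OF x] by (simp add: tr_tr tr_def algebra_simps flip: Tz_add[OF x])
      have "fwd ?f (r * ?n \<kappa> sc) sc (Tz (int r * int n) x) =
         f (Tz (int r * (int n + (b' + int (?n \<kappa> sc * period sc)))) x) - ?\<alpha> * f (Tz (int r * (int n + b')) x)
         - ?\<beta> * f (Tz (int r * (int n + (b' - int (?n \<kappa> sc)))) x)" for n
        using tr_at[of 0 n] tr_at[of _ n] tr_0[OF f'(2)] by (simp add: fwd_def algebra_simps)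
      then have "(\<Sum>n<K. fwd ?f (r * ?n \<kappa> sc) sc (Tz (int r * int n) x) * f (Tz (int s * int n) x)) / real K =
         A (b' + int (?n \<kappa> sc * period sc)) K - ?\<alpha> * A b' K - ?\<beta> * A (b' - int (?n \<kappa> sc)) K" for K
        by (simp only: A_def left_diff_distrib sum_subtractf diff_divide_distrib sum_distrib_left[symmetric] mult.assoc times_divide_eq_right)
      then show "conv x r (\<lambda>n. f (Tz (int s * int n) x)) N (fwd ?f (r * ?n \<kappa> sc) sc)
         (a' (b' + int (?n \<kappa> sc * period sc)) - ?\<alpha> * a' b' - ?\<beta> * a' (b' - int (?n \<kappa> sc)))"
        unfolding conv_def by (simp only:) (intro tendsto_intros lim)
    qed
  qed
  have backward: "((\<lambda>sc. a' (b' + int (?n \<kappa> sc * period sc)) - (1 - theta sc - real (s * ?n \<kappa> sc) * drift sc) * a' b'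
      - (theta sc - real (s * ?n \<kappa> sc) * drift sc) * a' (b' - int (?n \<kappa> sc))) \<longlongrightarrow> 0) scales" for b' \<kappa>
  proof -
    have s0: "0 < s" using rs by simp
    let ?w = "\<lambda>n. f (Tz (int r * (int n + b')) x)"
    \<comment> \<open>The second factor shifted by \<open>t\<close> against a fixed first one.
      Re-indexing by \<open>t\<close> changes the sum only by boundary terms, so the limit is
      \<open>a' (b' - t)\<close>.\<close>
    define G where "G t K = (\<Sum>n<K. f (Tz (int s * (int n + t)) x) * ?w n) / real K" for t K
    have G_lim: "(\<lambda>j. G t (N j)) \<longlonglongrightarrow> a' (b' - t)" for t
    proof -
      let ?u = "\<lambda>k. f (Tz (int s * k) x) * f (Tz (int r * (k + (b' - t))) x)"
      have "(\<lambda>K. (\<Sum>n<K. ?u (int n + t)) / real K - (\<Sum>n<K. ?u (int n)) / real K) \<longlonglongrightarrow> 0"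
        by (rule shifted_average_tendsto) (rule ff)
      moreover have "(\<Sum>n<K. ?u (int n + t)) / real K = G t K" "(\<Sum>n<K. ?u (int n)) / real K = A (b' - t) K" for K
        by (simp_all add: G_def A_def mult.commute)
      ultimately have "(\<lambda>K. G t K - A (b' - t) K) \<longlonglongrightarrow> 0" by (simp only:)
      then have "(\<lambda>j. G t (N j) - A (b' - t) (N j)) \<longlonglongrightarrow> 0" using N by (rule filterlim_compose)
      from tendsto_add[OF this lim[of "b' - t"]] show ?thesis by simp
    qed
    show ?thesis
    proof (rule weakly_null_imp_functional_tendsto_0[OF x s0 _ N, where D = "\<lambda>sc. bwd f (s * ?n \<kappa> sc) sc"
          and w = ?w and W = M and C = "3 * M"])
      show "\<bar>?w n\<bar> \<le> M" for n by (rule M)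
      show "pcont (bwd f (s * ?n \<kappa> sc) sc)" "supp (bwd f (s * ?n \<kappa> sc) sc)" for sc
        by (rule pcont_bwd[OF f(1)], rule supp_bwd[OF f(2)])
      show "\<forall>\<^sub>F sc in scales. \<forall>y. \<bar>bwd f (s * ?n \<kappa> sc) sc y\<bar> \<le> 3 * M"
        using eventually_coefficients[OF \<tau>(2,1), of \<kappa>]
      proof eventually_elim
        case (elim sc)
        then show ?case unfolding bwd_def by (intro allI three_terms_abs_le tr_abs_le M) auto
      qed
      show "((\<lambda>sc. mean (\<lambda>y. bwd f (s * ?n \<kappa> sc) sc y * g y)) \<longlongrightarrow> 0) scales" if "pcont g" for g
        by (rule bwd_weakly_null[OF f s0 \<tau>(1,2) that])
      fix sc
      let ?\<alpha> = "1 - theta sc - real (s * ?n \<kappa> sc) * drift sc" and ?\<beta> = "theta sc - real (s * ?n \<kappa> sc) * drift sc"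
      have tr_at: "tr f k (Tz (int s * int n) x) = f (Tz (int s * int n + k) x)" for k n
        using Tz_in[OF x] Tz_add[OF x, of k "int s * int n"] by (simp add: tr_def add.commute)
      have "bwd f (s * ?n \<kappa> sc) sc (Tz (int s * int n) x) =
         f (Tz (int s * (int n + (- int (?n \<kappa> sc * period sc)))) x) - ?\<alpha> * f (Tz (int s * (int n + 0)) x)
         - ?\<beta> * f (Tz (int s * (int n + int (?n \<kappa> sc))) x)" for n
        unfolding bwd_def tr_at by (simp add: algebra_simps)
      then have "(\<Sum>n<K. bwd f (s * ?n \<kappa> sc) sc (Tz (int s * int n) x) * ?w n) / real K =
         G (- int (?n \<kappa> sc * period sc)) K - ?\<alpha> * G 0 K - ?\<beta> * G (int (?n \<kappa> sc)) K" for K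
        by (simp only: G_def left_diff_distrib sum_subtractf diff_divide_distrib sum_distrib_left[symmetric] mult.assoc times_divide_eq_right)
      moreover have "(\<lambda>j. G (- int (?n \<kappa> sc * period sc)) (N j) - ?\<alpha> * G 0 (N j) - ?\<beta> * G (int (?n \<kappa> sc)) (N j)) \<longlonglongrightarrow>
         a' (b' - (- int (?n \<kappa> sc * period sc))) - ?\<alpha> * a' (b' - 0) - ?\<beta> * a' (b' - int (?n \<kappa> sc))"
        by (intro tendsto_intros G_lim)
      ultimately show "conv x s ?w N (bwd f (s * ?n \<kappa> sc) sc)
         (a' (b' + int (?n \<kappa> sc * period sc)) - ?\<alpha> * a' b' - ?\<beta> * a' (b' - int (?n \<kappa> sc)))"
        unfolding conv_def by (simp only: diff_minus_eq_add diff_0_right)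
    qed
  qed
  \<comment> \<open>Shifting the first factor forward and the second one backward gives the same correlation, but the weak limits
    differ in the coefficients \<open>r \<tau>\<close> and \<open>s \<tau>\<close>.\<close>
  have key: "((\<lambda>sc. a' b' + a' (b' - int (?n \<kappa> sc))) \<longlongrightarrow> 0) scales" for b' \<kappa>
  proof -
    let ?c = "real r - real s"
    \<comment> \<open>In the difference of the two limits everything cancels except the terms with
      \<open>r\<close> or \<open>s\<close>, and these factor. The total drift tends to \<tau>, so
      the first factor stays away from 0 and can be divided out.\<close>
    have "((\<lambda>sc. (?c * ?\<delta>n \<kappa> sc) * (a' b' + a' (b' - int (?n \<kappa> sc)))) \<longlongrightarrow> 0 - 0) scales"
      using tendsto_diff[OF forward[of b' \<kappa>] backward[of b' \<kappa>]] by (simp add: algebra_simps)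
    moreover have dn: "((\<lambda>sc. ?c * ?\<delta>n \<kappa> sc) \<longlongrightarrow> ?c * \<tau>) scales"
      by (intro tendsto_intros steps_drift_tendsto \<tau>)
    moreover have nz: "?c * \<tau> \<noteq> 0" using rs \<tau> by simp
    ultimately have quot: "((\<lambda>sc. (?c * ?\<delta>n \<kappa> sc) * (a' b' + a' (b' - int (?n \<kappa> sc))) / (?c * ?\<delta>n \<kappa> sc)) \<longlongrightarrow> (0 - 0) / (?c * \<tau>)) scales"
      by (rule tendsto_divide)
    have "\<forall>\<^sub>F sc in scales. (?c * ?\<delta>n \<kappa> sc) * (a' b' + a' (b' - int (?n \<kappa> sc))) / (?c * ?\<delta>n \<kappa> sc) = a' b' + a' (b' - int (?n \<kappa> sc))"
      using tendsto_imp_eventually_ne[OF dn nz] by eventually_elim simp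
    from tendsto_cong[OF this, THEN iffD1, OF quot] show ?thesis by (simp only: diff_self div_0)
  qed
  have step: "a' b' = a' (b' - 1)" for b'
  proof -
    \<comment> \<open>Since \<open>steps \<tau> 1\<close> exceeds \<open>steps \<tau> 0\<close> by
      one, both limits contain the same distant value of \<open>a'\<close>, which cancels.\<close>
    have shift: "b' - int (?n 1 sc) = b' - 1 - int (?n 0 sc)" for sc by (simp add: steps_def)
    have "((\<lambda>sc. (a' b' + a' (b' - int (?n 1 sc))) - (a' (b' - 1) + a' (b' - 1 - int (?n 0 sc)))) \<longlongrightarrow> 0 - 0) scales"
      by (intro tendsto_diff key)
    then have "((\<lambda>sc. a' b' - a' (b' - 1)) \<longlongrightarrow> 0) scales"
      unfolding shift by (simp only: add_diff_cancel_right diff_self)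
    then show ?thesis using scales_neq_bot by (simp add: tendsto_const_iff)
  qed
  have const: "a' b' = a' 0" for b'
  proof (induction b' rule: int_induct[of _ 0])
    case (step1 i) then show ?case using step[of "i + 1"] by simp
  next
    case (step2 i) then show ?case using step[of i] by simp
  qed simp
  have "((\<lambda>sc. a' 0 + a' 0) \<longlongrightarrow> 0) scales" using key[of 0 0] unfolding const[of "0 - _"] .
  then have "a' 0 = 0" using scales_neq_bot by (simp add: tendsto_const_iff)
  then have "(\<lambda>j. A 0 (N j)) \<longlonglongrightarrow> 0" using lim[of 0] by simp
  then have "(\<lambda>j. \<bar>A 0 (N j)\<bar>) \<longlonglongrightarrow> 0" by (rule tendsto_rabs_zero)
  moreover have "\<epsilon> \<le> \<bar>A 0 (N j)\<bar>" for j using \<sigma>(2) by (simp add: N_def)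
  ultimately have "\<epsilon> \<le> 0" by (intro LIMSEQ_le_const) auto
  then show False using e by simp
qed

end

context well_approximable
begin

theorem moebius_disjoint:
  assumes F: "pcont F" "supp F" and x: "x \<in> J"
  shows "(\<lambda>N. (\<Sum>n<N. F ((T ^^ n) x) * mu n) / real N) \<longlonglongrightarrow> 0"
proof -
  \<comment> \<open>On \<open>J\<close> this splits \<open>F\<close> into a function of mean 0 and
    the constant \<kappa>, which meets \<open>mu\<close> only through the mean of
    \<open>mu\<close>.\<close>
  define \<kappa> where "\<kappa> = mean F / mean chi"
  let ?G = "\<lambda>y. F y - \<kappa> * chi y"
  have chi0: "mean chi \<noteq> 0" using mean_chi_pos by simp
  have G: "pcont ?G" by (rule pcont_diff[OF F(1) pcont_cmult[OF pcont_chi]])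
  have "mean ?G = mean F - \<kappa> * mean chi" by (simp only: mean_diff[OF F(1) pcont_cmult[OF pcont_chi]] mean_cmult[OF pcont_chi])
  then have G0: "mean ?G = 0" using chi0 by (simp add: \<kappa>_def)
  obtain M0 where M0: "\<And>y. \<bar>?G y\<bar> \<le> M0" using pcont_bounded[OF G] by blast
  define M where "M = \<bar>M0\<bar> + 1"
  have "0 < M" "M0 \<le> M" by (auto simp: M_def)
  then have M: "0 < M" "\<And>y. \<bar>?G y\<bar> \<le> M" using order_trans[OF M0] by blast+
  define f where "f y = 1 / M * ?G y" for y
  have f: "pcont f" "supp f" "mean f = 0"
  proof -
    show "pcont f" unfolding f_def by (rule pcont_cmult[OF G])
    show "supp f" using F(2) by (simp add: supp_def f_def chi_eq)
    show "mean f = 0" unfolding f_def by (simp only: mean_cmult[OF G] G0)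
  qed
  have f1: "\<bar>f y\<bar> \<le> 1" for y using M(1) M(2)[of y] by (simp add: f_def abs_mult)
  have corr: "(\<lambda>N. (\<Sum>n<N. f ((T ^^ (p * n)) x) * f ((T ^^ (q * n)) x)) / real N) \<longlonglongrightarrow> 0" if "0 < p" "p < q" for p q
    using correlations_vanish[OF f x that] by (simp only: Tz_of_nat flip: of_nat_mult)
  have f_mu: "(\<lambda>N. (\<Sum>n<N. f ((T ^^ n) x) * mu n) / real N) \<longlonglongrightarrow> 0"
  proof (rule katai[OF f1 _ sum_prime_reciprocals_unbounded])
    fix p q :: nat assume pq: "prime p" "prime q" "p \<noteq> q"
    show "(\<lambda>N. (\<Sum>n<N. f ((T ^^ (p * n)) x) * f ((T ^^ (q * n)) x)) / real N) \<longlonglongrightarrow> 0"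
    proof (cases "p < q")
      case True then show ?thesis using corr prime_gt_0_nat[OF pq(1)] by blast
    next
      case False
      then have "q < p" using pq(3) by simp
      then show ?thesis using corr[of q p] prime_gt_0_nat[OF pq(2)] by (simp only: mult.commute)
    qed
  qed
  have in_J: "(T ^^ n) x \<in> J" for n using x T_in by (cases n) auto
  have "F ((T ^^ n) x) = M * f ((T ^^ n) x) + \<kappa>" for n
    using M(1) in_J[of n] by (simp add: f_def chi_eq)
  then have "(\<Sum>n<N. F ((T ^^ n) x) * mu n) / real N
      = M * ((\<Sum>n<N. f ((T ^^ n) x) * mu n) / real N) + \<kappa> * ((\<Sum>n<N. mu n) / real N)" for N
    by (simp add: sum.distrib sum_distrib_left ring_distribs add_divide_distrib mult.assoc)
  moreover have "(\<lambda>N. M * ((\<Sum>n<N. f ((T ^^ n) x) * mu n) / real N) + \<kappa> * ((\<Sum>n<N. mu n) / real N)) \<longlonglongrightarrow> M * 0 + \<kappa> * 0"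
    by (intro tendsto_intros f_mu mean_mu_tendsto)
  ultimately show ?thesis by simp
qed

end

section \<open>Exchanges of three intervals\<close>

text \<open>In the three-element index type 3 and 0 are the same element, so
  \<open>l $ of_nat k\<close> runs through the three coordinates for
  \<open>k = 1, 2, 3\<close>.\<close>

definition iet3 :: "real ^ 3 \<Rightarrow> real \<Rightarrow> real" where
  "iet3 l = iet 3 (\<lambda>k. l $ of_nat k) (id(1 := 3, 2 := 2, 3 := 1))"

lemma iet3_eq:
  fixes l :: "real ^ 3"
  assumes pos: "\<And>i. 0 < l $ i" and x: "0 \<le> x" "x < l $ 1 + l $ 2 + l $ 3"
  shows "iet3 l x = (if x < l $ 1 then x + (l $ 2 + l $ 3) else if x < l $ 1 + l $ 2 then x - l $ 1 + l $ 3 else x - (l $ 1 + l $ 2))"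
proof -
  have pos': "0 < l $ 1" "0 < l $ 2" "0 < l $ 3" using pos by auto
  let ?l = "\<lambda>k::nat. l $ of_nat k" and ?p = "id(1 := 3, 2 := 2, 3 := (1::nat))"
  have dom: "j \<in> {1..3} \<longleftrightarrow> j = 1 \<or> j = 2 \<or> j = 3" for j :: nat by auto
  have sums: "(\<Sum>k\<in>{1..<1}. ?l k) = 0" "(\<Sum>k\<in>{1..<2}. ?l k) = l $ 1" "(\<Sum>k\<in>{1..<3}. ?l k) = l $ 1 + l $ 2"
    "(\<Sum>k\<in>{1..1}. ?l k) = l $ 1" "(\<Sum>k\<in>{1..2}. ?l k) = l $ 1 + l $ 2" "(\<Sum>k\<in>{1..3}. ?l k) = l $ 1 + l $ 2 + l $ 3"
    by (simp_all add: numeral_2_eq_2 numeral_3_eq_3)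
  have images: "{k. k \<in> {1..3} \<and> ?p k < ?p 1} = {2, 3}" "{k. k \<in> {1..3} \<and> ?p k < ?p 2} = {3}" "{k. k \<in> {1..3} \<and> ?p k < ?p 3} = {}"
    unfolding dom by auto
  have ints: "x \<in> iet_interval ?l 1 \<longleftrightarrow> 0 \<le> x \<and> x < l $ 1"
    "x \<in> iet_interval ?l 2 \<longleftrightarrow> l $ 1 \<le> x \<and> x < l $ 1 + l $ 2"
    "x \<in> iet_interval ?l 3 \<longleftrightarrow> l $ 1 + l $ 2 \<le> x \<and> x < l $ 1 + l $ 2 + l $ 3"
    unfolding iet_interval_def sums by auto
  have index: "(THE j. j \<in> {1..3} \<and> x \<in> iet_interval ?l j) = (if x < l $ 1 then 1 else if x < l $ 1 + l $ 2 then 2 else 3)"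
    unfolding dom by (rule the_equality) (use x pos' in \<open>auto simp: ints simp del: One_nat_def\<close>)
  have sum_images: "(\<Sum>k | k \<in> {1..3} \<and> ?p k < ?p 1. ?l k) = l $ 2 + l $ 3"
    "(\<Sum>k | k \<in> {1..3} \<and> ?p k < ?p 2. ?l k) = l $ 3" "(\<Sum>k | k \<in> {1..3} \<and> ?p k < ?p 3. ?l k) = 0"
    unfolding images by simp_all
  have eq: "iet3 l x = x - (\<Sum>k\<in>{1..<j}. ?l k) + (\<Sum>k | k \<in> {1..3} \<and> ?p k < ?p j. ?l k)"
    if "(if x < l $ 1 then 1 else if x < l $ 1 + l $ 2 then 2 else 3) = j" for j
    unfolding iet3_def iet_def index that Let_def ..
  consider "x < l $ 1" | "\<not> x < l $ 1" "x < l $ 1 + l $ 2" | "\<not> x < l $ 1" "\<not> x < l $ 1 + l $ 2" by blast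
  then show ?thesis
  proof cases
    case 1 then show ?thesis using eq[of 1, unfolded sums sum_images] by simp
  next
    case 2 then show ?thesis using eq[of 2, unfolded sums sum_images] by simp
  next
    case 3 then show ?thesis using eq[of 3, unfolded sums sum_images] by simp
  qed
qed

lemma frac_add_shift: "frac (y + a) = t" if "0 \<le> t" "t < 1" "frac y + a - t \<in> \<int>" for y a t :: real
proof -
  have "y + a - t = of_int \<lfloor>y\<rfloor> + (frac y + a - t)" by (simp add: frac_def)
  then have "y + a - t \<in> \<int>" using that(3) by (metis Ints_add Ints_of_int)
  then show ?thesis using that by (simp add: frac_unique_iff)
qed

context
  fixes l :: "real ^ 3"
  assumes pos: "\<And>i. 0 < l $ i"
begin

lemma circumference_pos: "0 < circumference l"
  using pos[of 1] pos[of 2] pos[of 3] by (simp add: circumference_def)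

lemma circumference_angle: "circumference l * angle l = l $ 2 + l $ 3"
  and circumference_base: "circumference l * base l = l $ 1 + l $ 2 + l $ 3"
  using circumference_pos by (simp_all add: angle_def base_def)

text \<open>The case \<open>j = 1\<close> already provides the approximations required of a
  rotation. Multiplied by the circumference, the three inequalities between angle, base and 1 say
  that the three lengths are positive.\<close>

lemma well_approximable_of_scales:
  assumes scales: "\<And>j Q0. 1 \<le> j \<Longrightarrow> \<exists>q P. Q0 \<le> q \<and> tight j q P (angle l) \<and> central q (base l)"
  shows "well_approximable (angle l) (base l)"
proof -
  have "\<exists>q P. Q0 \<le> q \<and> good_approx (angle l) q P" for Q0
  proof -
    obtain q P where q: "Q0 \<le> q" "tight 1 q P (angle l)" using scales[of 1 Q0] by auto
    then have q0: "0 < q" and "\<bar>real q * (real q * angle l - of_int P)\<bar> \<le> 1" by (auto simp: tight_def)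
    moreover have "angle l - of_int P / real q = real q * (real q * angle l - of_int P) / (real q)\<^sup>2"
      using q0 by (simp add: power2_eq_square field_simps)
    ultimately have "\<bar>angle l - of_int P / real q\<bar> \<le> 1 / (real q)\<^sup>2"
      by (simp only: abs_divide abs_power2) (simp add: divide_right_mono)
    then show ?thesis using q by (auto simp: good_approx_def tight_def)
  qed
  then interpret rotation "angle l" by unfold_locales
  have "circumference l * base l < circumference l * 1" "circumference l * (1 - base l) < circumference l * angle l"
    "circumference l * angle l < circumference l * base l"
    unfolding right_diff_distrib circumference_angle circumference_base
    using pos[of 1] pos[of 2] pos[of 3] by (simp_all add: circumference_def)
  then interpret induced_rotation "angle l" "base l"
    unfolding mult_less_cancel_left_pos[OF circumference_pos] by unfold_locales
  show ?thesis
  proof unfold_locales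
    fix j Q0 :: nat assume "1 \<le> j"
    then obtain q P where q: "Q0 \<le> q" "tight j q P (angle l)" "central q (base l)" using scales by blast
    then have "good_scale j q P" using frac_of_central[OF q(3)] by (simp add: good_scale_def tight_def)
    then show "\<exists>q P. Q0 \<le> q \<and> good_scale j q P" using q(1) by blast
  qed
qed

text \<open>One rotation step keeps the first interval inside the arc without wrapping, carries the
  second onto the attached interval of length \<open>l $ 2\<close>, and wraps the third around once.
  For the second interval one more step wraps around and gives the translation by
  \<open>l $ 3 - l $ 1\<close>.\<close>

lemma iet3_eq_induced:
  assumes ir: "induced_rotation (angle l) (base l)" and y: "y \<in> induced_rotation.J (base l)"
  shows "circumference l * frac (induced_rotation.T (angle l) (base l) y) = iet3 l (circumference l * frac y)"
proof -
  interpret induced_rotation "angle l" "base l" by (rule ir)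
  let ?c = "circumference l"
  have c: "0 < ?c" by (rule circumference_pos)
  have pos': "0 < l $ 1" "0 < l $ 2" "0 < l $ 3" using pos by auto
  define x where "x = ?c * frac y"
  have yx: "frac y = x / ?c" using c by (simp add: x_def)
  have "?c * frac y < ?c * base l" using y c by (simp add: J_def)
  then have x: "0 \<le> x" "x < l $ 1 + l $ 2 + l $ 3" using c by (auto simp: x_def circumference_base)
  have fr: "frac (y + s) = t / ?c" if "0 \<le> t" "t < ?c" "x + ?c * s = t \<or> x + ?c * s = t + ?c" for s t
  proof (rule frac_add_shift)
    have "?c * (frac y + s - t / ?c) = x + ?c * s - t" using c unfolding yx by (simp add: algebra_simps)
    then have "?c * (frac y + s - t / ?c) = ?c * 0 \<or> ?c * (frac y + s - t / ?c) = ?c * 1" using that(3) by auto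
    then have "frac y + s - t / ?c = 0 \<or> frac y + s - t / ?c = 1" using c by (simp only: mult_cancel_left) auto
    then show "frac y + s - t / ?c \<in> \<int>" by auto
  qed (use that c in auto)
  have inJ: "z \<in> J \<longleftrightarrow> t < l $ 1 + l $ 2 + l $ 3" if "frac z = t / ?c" for z t
    using mult_less_cancel_left_pos[OF c, of "frac z" "base l"] c by (simp add: J_def that circumference_base)
  have c2: "?c * (2 * angle l) = 2 * (l $ 2 + l $ 3)" using circumference_angle by simp
  have c_def: "?c = l $ 1 + 2 * l $ 2 + l $ 3" by (simp add: circumference_def)
  consider "x < l $ 1" | "l $ 1 \<le> x" "x < l $ 1 + l $ 2" | "l $ 1 + l $ 2 \<le> x" by linarith
  then have "?c * frac (T y) = iet3 l x"
  proof cases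
    case 1
    have "frac (y + angle l) = (x + (l $ 2 + l $ 3)) / ?c"
      by (rule fr; use 1 x pos' circumference_angle c_def in linarith)
    moreover from inJ[OF this] have "y + angle l \<in> J" using 1 by simp
    ultimately show ?thesis using 1 x c pos by (simp add: T_def iet3_eq)
  next
    case 2
    have "frac (y + angle l) = (x + (l $ 2 + l $ 3)) / ?c"
      by (rule fr; use 2 x pos' circumference_angle c_def in linarith)
    from inJ[OF this] have "y + angle l \<notin> J" using 2 by simp
    moreover have "x + ?c * (2 * angle l) = x - l $ 1 + l $ 3 + ?c"
      unfolding c2 by (simp add: c_def)
    then have "frac (y + 2 * angle l) = (x - l $ 1 + l $ 3) / ?c"
      by (intro fr disjI2) (use 2 x pos' c_def in linarith)+
    ultimately show ?thesis using 2 x c pos by (simp add: T_def iet3_eq)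
  next
    case 3
    have "frac (y + angle l) = (x - (l $ 1 + l $ 2)) / ?c"
      by (rule fr; use 3 x pos' circumference_angle c_def in linarith)
    moreover from inJ[OF this] have "y + angle l \<in> J" using 3 x pos' by simp
    ultimately show ?thesis using 3 c pos' by (simp add: T_def iet3_eq[OF pos x])
  qed
  then show ?thesis by (simp add: x_def)
qed

lemma iet3_moebius_disjoint:
  assumes wa: "well_approximable (angle l) (base l)"
    and x: "x \<in> {0..<l $ 1 + l $ 2 + l $ 3}" and f: "continuous_on {0..l $ 1 + l $ 2 + l $ 3} f"
  shows "(\<lambda>N. (\<Sum>n<N. f ((iet3 l ^^ n) x) * mu n) / real N) \<longlonglongrightarrow> 0"
proof -
  interpret well_approximable "angle l" "base l" by (rule wa)
  let ?c = "circumference l"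
  have c: "0 < ?c" by (rule circumference_pos)
  have pos': "0 < l $ 1" "0 < l $ 2" "0 < l $ 3" using pos by auto
  define F where "F y = arc 0 (base l) y * f (?c * frac y)" for y
  have F: "pcont F" "supp F"
  proof -
    have "continuous_on {0..base l} (\<lambda>t. f (?c * t))"
    proof (rule continuous_on_compose2[OF f])
      show "(\<lambda>t. ?c * t) ` {0..base l} \<subseteq> {0..l $ 1 + l $ 2 + l $ 3}"
        using c by (auto simp: circumference_base[symmetric])
    qed (intro continuous_intros)
    then show "pcont F" unfolding F_def
      by (rule pcont_of_continuous_on) (use b1 pos' c in \<open>auto simp: base_def\<close>)
    show "supp F" by (simp add: supp_def F_def chi_eq)
  qed
  define y where "y = x / ?c"
  have "frac y = y"
    using x c pos' by (simp add: y_def frac_eq circumference_def)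
  then have y: "?c * frac y = x" using c by (simp add: y_def)
  then have "?c * frac y < ?c * base l" using x by (simp add: circumference_base)
  then have "y \<in> J" using c by (simp add: J_def)
  have orbit: "(T ^^ n) y \<in> J \<and> ?c * frac ((T ^^ n) y) = (iet3 l ^^ n) x" for n
  proof (induction n)
    case (Suc n)
    then show ?case using iet3_eq_induced[OF induced_rotation_axioms, of "(T ^^ n) y"] T_in by simp
  qed (use y \<open>y \<in> J\<close> in simp)
  have "F ((T ^^ n) y) = f ((iet3 l ^^ n) x)" for n
    using orbit[of n] by (simp add: F_def chi_eq)
  then show ?thesis using moebius_disjoint[OF F \<open>y \<in> J\<close>] by simp
qed

end

theorem corollary1p6:
  shows "AE l :: real ^ 3 in lebesgue. (\<forall>i. 0 < l $ i) \<longrightarrow>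
    (let L = (\<Sum>i\<in>UNIV. l $ i);
         T = iet 3 (\<lambda>k. l $ of_nat k) (id(1 := 3, 2 := 2, 3 := 1))
     in \<forall>x\<in>{0..<L}. \<forall>f :: real \<Rightarrow> real. continuous_on {0..L} f \<longrightarrow>
          (\<lambda>N. 1 / real N * (\<Sum>n<N. f ((T ^^ n) x) * real_of_int (moebius_mu n)))
            \<longlonglongrightarrow> 0)"
  using AE_good_scales
proof eventually_elim
  case (elim l)
  show ?case
    unfolding Let_def
  proof (intro impI ballI allI)
    assume "\<forall>i. 0 < l $ i"
    then have pos: "\<And>i. 0 < l $ i" by simp
    have L: "(\<Sum>i\<in>UNIV. l $ i) = l $ 1 + l $ 2 + l $ 3" by (simp add: sum_3)
    fix x and f :: "real \<Rightarrow> real"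
    assume x: "x \<in> {0..<(\<Sum>i\<in>UNIV. l $ i)}" and f: "continuous_on {0..(\<Sum>i\<in>UNIV. l $ i)} f"
    have "well_approximable (angle l) (base l)"
      by (rule well_approximable_of_scales[OF pos]) (use elim circumference_pos[OF pos] in blast)
    from iet3_moebius_disjoint[OF pos this x[unfolded L] f[unfolded L]]
    show "(\<lambda>N. 1 / real N * (\<Sum>n<N. f ((iet 3 (\<lambda>k. l $ of_nat k) (id(1 := 3, 2 := 2, 3 := 1)) ^^ n) x) * mu n)) \<longlonglongrightarrow> 0"
      unfolding iet3_def by simp
  qed
qed

end
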